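(* Let $\mathcal X$ be a quantum set. Then there is a one-to-one correspondence between quantum graph structures $V$ on $\ell^\infty(\mathcal X)$ and binary relations $R$ on $\mathcal X$ (i.e., from $\mathcal X$ to $\mathcal X$) such that (1) $[\![(\forall (x = x_* ) \in \mathcal X \times \mathcal X^* )\, \widehat R(x, x_* ) ]\!] = \top$; (2) $[\![(\forall (x_1 = x_{1*}) \in \mathcal X \times \mathcal X^* )\,(\forall (x_2 = x_{2*}) \in \mathcal X \times \mathcal X^* )\, (\widehat R (x_1, x_{2*}) \to \widehat R(x_2, x_{1*}))]\!] = \top$. The correspondence is given by $R(X_1, X_2) = \mathrm{inc}_{X_2}^\dagger \cdot V \cdot \mathrm{inc}_{X_1}$, for $X_1, X_2 \in \mathrm{At}(\mathcal X)$.
   Context: Operators. Hilbert spaces are complex. $L(H,K)$ is the space of bounded operators $H\to K$, $L(H)=L(H,H)$, $H^*=L(H,\mathbb C)$. For $a\in L(H,K)$: $a^\dagger\in L(K,H)$ is the Hermitian adjoint. Products of subspaces of operators denote linear spans of products. The identifications $X^{**}=X$, $(X\otimes Y)^*=X^*\otimes Y^*$, $\mathbb C^*=\mathbb C$, $X\otimes\mathbb C=X$ are used. Quantum sets. A quantum set $\mathcal X$ is an object uniquely determined by a set $\mathrm{At}(\mathcal X)$ of nonzero finite-dimensional Hilbert spaces, its atoms. $\ell^\infty(\mathcal X)=\bigoplus_{X\in\mathrm{At}(\mathcal X)}L(X)$ is the $\ell^\infty$-direct sum von Neumann algebra, canonically represented on the $\ell^2$-direct sum $\bigoplus\mathrm{At}(\mathcal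 X)$; $\mathrm{inc}_X\in L(X,\bigoplus\mathrm{At}(\mathcal X))$ is the inclusion isometry. $\mathcal X\times\mathcal Y$ has atoms $X\otimes Y$; $\mathcal X^*$ has atoms $X^*$; $\mathbf 1$ (the empty product) has the single atom $\mathbb C$. Quantum graph structures. For a von Neumann algebra $M\subseteq L(H)$ with commutant $M'$, a quantum graph structure on $M$ is an ultraweakly closed subspace $V\subseteq L(H)$ that is an operator system ($1\in V$ and $V^\dagger=V$) such that $m'v\in V$ and $vm'\in V$ for all $m'\in M'$ and $v\in V$. Binary relations. A binary relation $R$ from $\mathcal X$ to $\mathcal Y$ is a choice of subspaces $R(X,Y)\le L(X,Y)$ for all atoms $X,Y$. Order, joins, meets and complement $\neg$ are componentwise (inclusion, span, intersection, orthogonal complement for $\langle a|b\rangle=\mathrm{Tr}(a^\dagger b)$); $\top$ and $\bot$ (or $\top_{\mathcal X}$, $\bot_{\mathcal X}$ for $\mathcal Y=\mathbf 1$) are the largest and smallest. $(S\circ R)(X,Z)=\sum_Y S(Y,Z)\cdot R(X,Y)$; $(R\times S)(X\otimes X',Y\otimes Y')=R(X,Y)\otimes S(X',Y')$; $I_{\mathcal X}(X,X)=\mathbb C1_X$, with other components $0$. A relation of arity $(\mathcal X_1,\dots,\mathcal X_n)$ is a binary relation $R$ from $\mathcal X_1\times\cdots\times\mathcal X_n$ to $\mathbf 1$; write $R(X_1\otimes\cdots\otimes X_n)$ for $R(X_1\otimes\cdots\otimes X_n,\mathbb C)$. The equality relation $E_{\mathcal X}$ of arity $(\mathcal X,\mathcal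 X^* )$ has $E_{\mathcal X}(X\otimes X^* )=\mathbb C\epsilon_X$, with $\epsilon_X:X\otimes X^*\to\mathbb C$ evaluation, and $E_{\mathcal X}(X_1\otimes X_2^* )=0$ for $X_1\ne X_2$. For a binary relation $B$ from $\mathcal X$ to $\mathcal Y$, $\widehat B=E_{\mathcal Y}\circ(B\times I_{\mathcal Y^*})$, a relation of arity $(\mathcal X,\mathcal Y^* )$. Interpretation of formulas. Each quantum set is a sort with infinitely many variables. Formulas are built from atomic formulas $R(x_1,\dots,x_n)$ ($R$ a relation of arity $(\mathcal X_1,\dots,\mathcal X_n)$, $x_i$ distinct variables of sorts $\mathcal X_i$). For distinct variables $x_i$ of sorts $\mathcal X_i$ including the free variables of $\phi$, $[\![\phi]\!]=[\![(x_1,\dots,x_n)\in\mathcal X_1\times\cdots\times\mathcal X_n\,|\,\phi]\!]$ is a relation of arity $(\mathcal X_1,\dots,\mathcal X_n)$ (for a sentence, of arity $()$, so $\top$ or $\bot$), defined recursively. For a permutation $\pi$ of $\{1,\dots,n\}$, $m\le n$ and $R$ of arity $(\mathcal X_{\pi(1)},\dots,\mathcal X_{\pi(m)})$, $[\![R(x_{\pi(1)},\dots,x_{\pi(m)})]\!](X_1\otimes\cdots\otimes X_n)=(R\times\top_{\mathcal X_{\pi(m+1)}}\times\cdots\times\top_{\mathcal X_{\pi(n)}})(X_{\pi(1)}\otimes\cdots\otimes X_{\pi(n)})\cdot u_\pi$, where $u_\pi$ is the unitary permuting tensor factors. $[\![\neg\phi]\!]=\neg[\![\phi]\!]$; $[\![\phi\wedge\psi]\!]=[\![\phi]\!]\wedge[\![\psi]\!]$;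 $[\![(x_1,\dots,x_n)\,|\,(\forall x\in\mathcal X)\,\phi]\!]=\sup\{R \text{ of arity }(\mathcal X_1,\dots,\mathcal X_n): \top_{\mathcal X}\times R\le[\![(x,x_1,\dots,x_n)\,|\,\phi]\!]\}$. Abbreviations: $\phi\vee\psi$ is $\neg(\neg\phi\wedge\neg\psi)$; $\exists$ is $\neg\forall\neg$; $\phi\to\psi$ is $\neg\phi\vee(\phi\wedge\psi)$; $(\forall(x=x_* )\in\mathcal X\times\mathcal X^* )\,\phi$ is $(\forall x_*\in\mathcal X^* )(\forall x\in\mathcal X)(E_{\mathcal X}(x,x_* )\to\phi)$, where $x$ (sort $\mathcal X$) and $x_*$ (sort $\mathcal X^*$) are distinct variables. *)

theory Defs
  imports "HOL-Analysis.Analysis" "HOL-Algebra.Module" "HOL-Combinatorics.Permutations"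
begin

section \<open>Hilbert spaces as records\<close>

text \<open>
  The atoms of a quantum set are different Hilbert spaces that have to live in one type, so a
  Hilbert space is a record: a module over the complex numbers in the sense of HOL-Algebra (whose
  fields \<open>mult\<close> and \<open>one\<close> play no role) with an inner product, linear in its second argument.
\<close>

record 'v hilb = "(complex, 'v) module" +
  ip :: "'v \<Rightarrow> 'v \<Rightarrow> complex"

definition complex_ring :: "complex ring" where
  "complex_ring = \<lparr>carrier = UNIV, mult = (*), one = 1, zero = 0, add = (+)\<rparr>"

definition complex_hilb :: "complex hilb" where
  "complex_hilb = \<lparr>carrier = UNIV, mult = (*), one = 1, zero = 0, add = (+), smult = (*),
     ip = (\<lambda>x y. cnj x * y)\<rparr>"

definition hnorm :: "'v hilb \<Rightarrow> 'v \<Rightarrow> real" where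
  "hnorm X x = sqrt (Re (ip X x x))"

locale inner_product_space = module complex_ring X for X :: "'v hilb" (structure) +
  assumes ip_add_right: "\<lbrakk>x \<in> carrier X; y \<in> carrier X; z \<in> carrier X\<rbrakk>
      \<Longrightarrow> ip X x (y \<oplus> z) = ip X x y + ip X x z"
    and ip_smult_right: "\<lbrakk>x \<in> carrier X; y \<in> carrier X\<rbrakk> \<Longrightarrow> ip X x (c \<odot>\<^bsub>X\<^esub> y) = c * ip X x y"
    and ip_cnj: "\<lbrakk>x \<in> carrier X; y \<in> carrier X\<rbrakk> \<Longrightarrow> ip X y x = cnj (ip X x y)"
    and ip_pos: "\<lbrakk>x \<in> carrier X; x \<noteq> \<zero>\<rbrakk> \<Longrightarrow> Re (ip X x x) > 0"

definition finite_spanning :: "'v hilb \<Rightarrow> 'v set \<Rightarrow> bool" where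
  "finite_spanning X S \<longleftrightarrow> finite S \<and> S \<subseteq> carrier X \<and>
     (\<forall>x\<in>carrier X. \<exists>c. x = (\<Oplus>\<^bsub>X\<^esub>s\<in>S. c s \<odot>\<^bsub>X\<^esub> s))"

text \<open>Completeness is automatic in finite dimension.\<close>

definition fd_hilbert_space :: "'v hilb \<Rightarrow> bool" where
  "fd_hilbert_space X \<longleftrightarrow> inner_product_space X \<and> (\<exists>S. finite_spanning X S)"

definition orthonormal_basis :: "'v hilb \<Rightarrow> 'v set \<Rightarrow> bool" where
  "orthonormal_basis X B \<longleftrightarrow> finite_spanning X B \<and>
     (\<forall>e\<in>B. \<forall>f\<in>B. ip X e f = (if e = f then 1 else 0))"

definition some_onb :: "'v hilb \<Rightarrow> 'v set" where
  "some_onb X = (SOME B. orthonormal_basis X B)"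

text \<open>
  The dual space, with the functional \<open>ip X y\<close> represented by the vector \<open>y\<close> (Riesz); under this
  representation the double dual of \<open>X\<close> is \<open>X\<close> itself, and the value of the functional \<open>y\<close> at \<open>x\<close>
  is \<open>ip X y x\<close>.
\<close>

definition hdual :: "'v hilb \<Rightarrow> 'v hilb" where
  "hdual X = X\<lparr>smult := (\<lambda>c x. smult X (cnj c) x), ip := (\<lambda>x y. ip X y x)\<rparr>"


section \<open>Bounded operators\<close>

text \<open>Operators are extensional functions, so that equality of operators is equality in HOL.\<close>

definition bounded_ops :: "'v hilb \<Rightarrow> 'w hilb \<Rightarrow> ('v \<Rightarrow> 'w) set" where
  "bounded_ops H K = {a \<in> carrier H \<rightarrow>\<^sub>E carrier K.
     (\<forall>x\<in>carrier H. \<forall>y\<in>carrier H. a (x \<oplus>\<^bsub>H\<^esub> y) = a x \<oplus>\<^bsub>K\<^esub> a y) \<and>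
     (\<forall>c. \<forall>x\<in>carrier H. a (c \<odot>\<^bsub>H\<^esub> x) = c \<odot>\<^bsub>K\<^esub> a x) \<and>
     (\<exists>C. \<forall>x\<in>carrier H. hnorm K (a x) \<le> C * hnorm H x)}"

text \<open>Composition and identity are \<open>compose (carrier H)\<close> and \<open>\<lambda>x\<in>carrier H. x\<close>.\<close>

definition op_space :: "'v hilb \<Rightarrow> 'w hilb \<Rightarrow> (complex, 'v \<Rightarrow> 'w) module" where
  "op_space H K = \<lparr>carrier = bounded_ops H K, mult = undefined, one = undefined,
     zero = (\<lambda>x\<in>carrier H. \<zero>\<^bsub>K\<^esub>), add = (\<lambda>a b. \<lambda>x\<in>carrier H. a x \<oplus>\<^bsub>K\<^esub> b x),
     smult = (\<lambda>c a. \<lambda>x\<in>carrier H. c \<odot>\<^bsub>K\<^esub> a x)\<rparr>"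

definition op_subspace :: "'v hilb \<Rightarrow> 'w hilb \<Rightarrow> ('v \<Rightarrow> 'w) set \<Rightarrow> bool" where
  "op_subspace H K W \<longleftrightarrow> submodule W complex_ring (op_space H K)"

definition op_span :: "'v hilb \<Rightarrow> 'w hilb \<Rightarrow> ('v \<Rightarrow> 'w) set \<Rightarrow> ('v \<Rightarrow> 'w) set" where
  "op_span H K S = op_subspace H K hull S"

definition adj :: "'v hilb \<Rightarrow> 'w hilb \<Rightarrow> ('v \<Rightarrow> 'w) \<Rightarrow> 'w \<Rightarrow> 'v" where
  "adj H K a = (THE b. b \<in> bounded_ops K H \<and>
     (\<forall>x\<in>carrier H. \<forall>y\<in>carrier K. ip K y (a x) = ip H (b y) x))"

text \<open>Trace and Hilbert-Schmidt inner product, for finite-dimensional spaces.\<close>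

definition trace_op :: "'v hilb \<Rightarrow> ('v \<Rightarrow> 'v) \<Rightarrow> complex" where
  "trace_op X a = (\<Sum>e\<in>some_onb X. ip X e (a e))"

definition hs_ip :: "'v hilb \<Rightarrow> 'w hilb \<Rightarrow> ('v \<Rightarrow> 'w) \<Rightarrow> ('v \<Rightarrow> 'w) \<Rightarrow> complex" where
  "hs_ip X Y a b = trace_op X (compose (carrier X) (adj X Y a) b)"

definition ortho_compl :: "'v hilb \<Rightarrow> 'w hilb \<Rightarrow> ('v \<Rightarrow> 'w) set \<Rightarrow> ('v \<Rightarrow> 'w) set" where
  "ortho_compl X Y W = {a \<in> bounded_ops X Y. \<forall>b\<in>W. hs_ip X Y b a = 0}"


section \<open>Quantum graph structures\<close>

definition commutant :: "'v hilb \<Rightarrow> ('v \<Rightarrow> 'v) set \<Rightarrow> ('v \<Rightarrow> 'v) set" where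
  "commutant H M = {b \<in> bounded_ops H H.
     \<forall>a\<in>M. compose (carrier H) a b = compose (carrier H) b a}"

definition square_summable :: "'v hilb \<Rightarrow> (nat \<Rightarrow> 'v) \<Rightarrow> bool" where
  "square_summable H \<xi> \<longleftrightarrow> range \<xi> \<subseteq> carrier H \<and> summable (\<lambda>n. (hnorm H (\<xi> n))\<^sup>2)"

text \<open>The coarsest topology making all functionals \<open>a \<mapsto> (\<Sum>n. \<langle>\<eta> n | a (\<xi> n)\<rangle>)\<close> continuous.\<close>

definition ultraweak_topology :: "'v hilb \<Rightarrow> ('v \<Rightarrow> 'v) topology" where
  "ultraweak_topology H = topology_generated_by
     {{a \<in> bounded_ops H H. (\<Sum>n. ip H (\<eta> n) (a (\<xi> n))) \<in> U} | \<xi> \<eta> U.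
        square_summable H \<xi> \<and> square_summable H \<eta> \<and> open U}"

definition quantum_graph_structure :: "'v hilb \<Rightarrow> ('v \<Rightarrow> 'v) set \<Rightarrow> ('v \<Rightarrow> 'v) set \<Rightarrow> bool" where
  "quantum_graph_structure H M V \<longleftrightarrow>
     op_subspace H H V \<and> closedin (ultraweak_topology H) V \<and>
     (\<lambda>x\<in>carrier H. x) \<in> V \<and> adj H H ` V = V \<and>
     (\<forall>m\<in>commutant H M. \<forall>v\<in>V. compose (carrier H) m v \<in> V \<and> compose (carrier H) v m \<in> V)"


section \<open>Quantum sets\<close>

definition quantum_set :: "'v hilb set \<Rightarrow> bool" where
  "quantum_set \<X> \<longleftrightarrow> (\<forall>X\<in>\<X>. fd_hilbert_space X \<and> carrier X \<noteq> {\<zero>\<^bsub>X\<^esub>})"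

definition qdual :: "'v hilb set \<Rightarrow> 'v hilb set" where
  "qdual \<X> = hdual ` \<X>"

definition hilbert_sum :: "'v hilb set \<Rightarrow> ('v hilb \<Rightarrow> 'v) hilb" where
  "hilbert_sum \<X> = \<lparr>
     carrier = {f \<in> \<Pi>\<^sub>E X\<in>\<X>. carrier X. (\<lambda>X. (hnorm X (f X))\<^sup>2) summable_on \<X>},
     mult = undefined, one = undefined,
     zero = (\<lambda>X\<in>\<X>. \<zero>\<^bsub>X\<^esub>), add = (\<lambda>f g. \<lambda>X\<in>\<X>. f X \<oplus>\<^bsub>X\<^esub> g X),
     smult = (\<lambda>c f. \<lambda>X\<in>\<X>. c \<odot>\<^bsub>X\<^esub> f X),
     ip = (\<lambda>f g. \<Sum>\<^sub>\<infinity>X\<in>\<X>. ip X (f X) (g X))\<rparr>"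

definition inc :: "'v hilb set \<Rightarrow> 'v hilb \<Rightarrow> 'v \<Rightarrow> 'v hilb \<Rightarrow> 'v" where
  "inc \<X> X = (\<lambda>x\<in>carrier X. \<lambda>Y\<in>\<X>. if Y = X then x else \<zero>\<^bsub>Y\<^esub>)"

definition ell_infinity :: "'v hilb set \<Rightarrow> (('v hilb \<Rightarrow> 'v) \<Rightarrow> 'v hilb \<Rightarrow> 'v) set" where
  "ell_infinity \<X> = {(\<lambda>f\<in>carrier (hilbert_sum \<X>). \<lambda>X\<in>\<X>. m X (f X)) | m.
     (\<forall>X\<in>\<X>. m X \<in> bounded_ops X X) \<and>
     (\<exists>C. \<forall>X\<in>\<X>. \<forall>x\<in>carrier X. hnorm X (m X x) \<le> C * hnorm X x)}"


section \<open>Tensor products of finite-dimensional Hilbert spaces\<close>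

text \<open>
  The elementary tensor \<open>x\<^sub>1 \<otimes> \<dots> \<otimes> x\<^sub>n\<close> is the conjugate-multilinear form
  \<open>(y\<^sub>1, \<dots>, y\<^sub>n) \<mapsto> \<langle>y\<^sub>1 | x\<^sub>1\<rangle> \<dots> \<langle>y\<^sub>n | x\<^sub>n\<rangle>\<close>, and the tensor product is the linear span of these. Any
  element \<open>t\<close> then satisfies \<open>\<langle>y\<^sub>1 \<otimes> \<dots> \<otimes> y\<^sub>n | t\<rangle> = t [y\<^sub>1, \<dots>, y\<^sub>n]\<close>, so the values of \<open>t\<close> on lists of
  basis vectors are its coordinates in the product basis. The empty product is one-dimensional.
\<close>

abbreviation vec_lists :: "'v hilb list \<Rightarrow> 'v list set" where
  "vec_lists Xs \<equiv> listset (map carrier Xs)"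

definition elem_tensor :: "'v hilb list \<Rightarrow> 'v list \<Rightarrow> 'v list \<Rightarrow> complex" where
  "elem_tensor Xs xs = (\<lambda>ys\<in>vec_lists Xs. \<Prod>i<length Xs. ip (Xs ! i) (ys ! i) (xs ! i))"

definition tensor :: "'v hilb list \<Rightarrow> ('v list \<Rightarrow> complex) hilb" where
  "tensor Xs = \<lparr>
     carrier = {(\<lambda>ys\<in>vec_lists Xs. \<Sum>xs\<in>S. c xs * elem_tensor Xs xs ys) | S c.
       finite S \<and> S \<subseteq> vec_lists Xs},
     mult = undefined, one = undefined,
     zero = (\<lambda>ys\<in>vec_lists Xs. 0), add = (\<lambda>s t. \<lambda>ys\<in>vec_lists Xs. s ys + t ys),
     smult = (\<lambda>c t. \<lambda>ys\<in>vec_lists Xs. c * t ys),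
     ip = (\<lambda>s t. \<Sum>es\<in>listset (map some_onb Xs). cnj (s es) * t es)\<rparr>"

text \<open>
  The operator on a tensor product with values \<open>F xs\<close> on the elementary tensors, for \<open>F\<close> linear in
  each entry of \<open>xs\<close>.
\<close>

definition tensor_lift :: "'v hilb list \<Rightarrow> 'w hilb \<Rightarrow> ('v list \<Rightarrow> 'w) \<Rightarrow> ('v list \<Rightarrow> complex) \<Rightarrow> 'w" where
  "tensor_lift Xs K F = (THE u. u \<in> bounded_ops (tensor Xs) K \<and>
     (\<forall>xs\<in>vec_lists Xs. u (elem_tensor Xs xs) = F xs))"

text \<open>\<open>u\<^sub>\<pi>\<close>, from \<open>X\<^sub>1 \<otimes> \<dots> \<otimes> X\<^sub>n\<close> to \<open>X\<^sub>\<pi>\<^sub>(\<^sub>1\<^sub>) \<otimes> \<dots> \<otimes> X\<^sub>\<pi>\<^sub>(\<^sub>n\<^sub>)\<close>, with positions counted from 0.\<close>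

definition perm_op :: "(nat \<Rightarrow> nat) \<Rightarrow> 'v hilb list \<Rightarrow>
    ('v list \<Rightarrow> complex) \<Rightarrow> 'v list \<Rightarrow> complex" where
  "perm_op \<pi> Xs = tensor_lift Xs (tensor (permute_list \<pi> Xs))
     (\<lambda>xs. elem_tensor (permute_list \<pi> Xs) (permute_list \<pi> xs))"

definition tensor_op2 :: "'v hilb list \<Rightarrow> 'v hilb list \<Rightarrow> ('v \<Rightarrow> 'v) \<Rightarrow> ('v \<Rightarrow> 'v) \<Rightarrow>
    ('v list \<Rightarrow> complex) \<Rightarrow> 'v list \<Rightarrow> complex" where
  "tensor_op2 Xs Ys a b = tensor_lift Xs (tensor Ys) (\<lambda>xs. elem_tensor Ys [a (xs ! 0), b (xs ! 1)])"

text \<open>The product of a functional on \<open>tensor Xs\<close> and one on \<open>tensor Ys\<close>, on \<open>tensor (Xs @ Ys)\<close>.\<close>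

definition tensor_functional :: "'v hilb list \<Rightarrow> 'v hilb list \<Rightarrow>
    (('v list \<Rightarrow> complex) \<Rightarrow> complex) \<Rightarrow> (('v list \<Rightarrow> complex) \<Rightarrow> complex) \<Rightarrow>
    ('v list \<Rightarrow> complex) \<Rightarrow> complex" where
  "tensor_functional Xs Ys r s = tensor_lift (Xs @ Ys) complex_hilb
     (\<lambda>zs. r (elem_tensor Xs (take (length Xs) zs)) * s (elem_tensor Ys (drop (length Xs) zs)))"


section \<open>Relations on quantum sets\<close>

text \<open>Extensional, so that equality of relations is equality in HOL.\<close>

definition binary_relations ::
    "'v hilb set \<Rightarrow> 'v hilb set \<Rightarrow> ('v hilb \<Rightarrow> 'v hilb \<Rightarrow> ('v \<Rightarrow> 'v) set) set" where
  "binary_relations \<X> \<Y> = (\<Pi>\<^sub>E X\<in>\<X>. \<Pi>\<^sub>E Y\<in>\<Y>. {W. op_subspace X Y W})"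

definition id_relation :: "'v hilb set \<Rightarrow> 'v hilb \<Rightarrow> 'v hilb \<Rightarrow> ('v \<Rightarrow> 'v) set" where
  "id_relation \<X> = (\<lambda>X\<in>\<X>. \<lambda>Y\<in>\<X>.
     if X = Y then op_span X Y {\<lambda>x\<in>carrier X. x} else {\<lambda>x\<in>carrier X. \<zero>\<^bsub>Y\<^esub>})"

text \<open>
  The atoms of \<open>\<X>\<^sub>1 \<times> \<dots> \<times> \<X>\<^sub>n\<close> are given by the lists \<open>[X\<^sub>1, \<dots>, X\<^sub>n]\<close> in \<open>listset [\<X>\<^sub>1, \<dots>, \<X>\<^sub>n]\<close>,
  standing for \<open>tensor [X\<^sub>1, \<dots>, X\<^sub>n]\<close>. A relation of arity \<open>[\<X>\<^sub>1, \<dots>, \<X>\<^sub>n]\<close> assigns to each of them a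
  subspace of its space of functionals.
\<close>

type_synonym 'v qrel = "'v hilb list \<Rightarrow> (('v list \<Rightarrow> complex) \<Rightarrow> complex) set"

abbreviation functionals :: "'v hilb list \<Rightarrow> (('v list \<Rightarrow> complex) \<Rightarrow> complex) set" where
  "functionals Xs \<equiv> bounded_ops (tensor Xs) complex_hilb"

abbreviation functional_span :: "'v hilb list \<Rightarrow> (('v list \<Rightarrow> complex) \<Rightarrow> complex) set \<Rightarrow>
    (('v list \<Rightarrow> complex) \<Rightarrow> complex) set" where
  "functional_span Xs \<equiv> op_span (tensor Xs) complex_hilb"

definition relations :: "'v hilb set list \<Rightarrow> 'v qrel set" where
  "relations As = (\<Pi>\<^sub>E Xs\<in>listset As. {W. op_subspace (tensor Xs) complex_hilb W})"

definition rel_le :: "'v hilb set list \<Rightarrow> 'v qrel \<Rightarrow> 'v qrel \<Rightarrow> bool" where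
  "rel_le As R S \<longleftrightarrow> (\<forall>Xs\<in>listset As. R Xs \<subseteq> S Xs)"

definition rel_top :: "'v hilb set list \<Rightarrow> 'v qrel" where
  "rel_top As = (\<lambda>Xs\<in>listset As. functionals Xs)"

definition rel_not :: "'v hilb set list \<Rightarrow> 'v qrel \<Rightarrow> 'v qrel" where
  "rel_not As R = (\<lambda>Xs\<in>listset As. ortho_compl (tensor Xs) complex_hilb (R Xs))"

definition rel_meet :: "'v hilb set list \<Rightarrow> 'v qrel \<Rightarrow> 'v qrel \<Rightarrow> 'v qrel" where
  "rel_meet As R S = (\<lambda>Xs\<in>listset As. R Xs \<inter> S Xs)"

definition rel_Sup :: "'v hilb set list \<Rightarrow> 'v qrel set \<Rightarrow> 'v qrel" where
  "rel_Sup As \<R> = (\<lambda>Xs\<in>listset As. functional_span Xs (\<Union>R\<in>\<R>. R Xs))"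

text \<open>The product of a relation of arity \<open>As\<close> and one of arity \<open>Bs\<close>, of arity \<open>As @ Bs\<close>.\<close>

definition rel_prod :: "'v hilb set list \<Rightarrow> 'v hilb set list \<Rightarrow> 'v qrel \<Rightarrow> 'v qrel \<Rightarrow> 'v qrel" where
  "rel_prod As Bs R S = (\<lambda>Zs\<in>listset (As @ Bs).
     let Xs = take (length As) Zs; Ys = drop (length As) Zs in
     functional_span Zs {tensor_functional Xs Ys r s | r s. r \<in> R Xs \<and> s \<in> S Ys})"

text \<open>\<open>\<epsilon>\<^sub>X\<close>, a functional on \<open>tensor [X, hdual X]\<close>.\<close>

definition evaluation :: "'v hilb \<Rightarrow> ('v list \<Rightarrow> complex) \<Rightarrow> complex" where
  "evaluation X = tensor_lift [X, hdual X] complex_hilb (\<lambda>xs. ip X (xs ! 1) (xs ! 0))"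

definition equality_rel :: "'v hilb set \<Rightarrow> 'v qrel" where
  "equality_rel \<X> = (\<lambda>Xs\<in>listset [\<X>, qdual \<X>]. functional_span Xs
     (if Xs ! 1 = hdual (Xs ! 0) then {evaluation (Xs ! 0)} else {}))"

text \<open>The component of \<open>R \<times> S\<close> from \<open>X \<otimes> X'\<close> to \<open>Y \<otimes> Y'\<close>, for \<open>Xs = [X, X']\<close> and \<open>Ys = [Y, Y']\<close>.\<close>

definition brel_prod :: "('v hilb \<Rightarrow> 'v hilb \<Rightarrow> ('v \<Rightarrow> 'v) set) \<Rightarrow>
    ('v hilb \<Rightarrow> 'v hilb \<Rightarrow> ('v \<Rightarrow> 'v) set) \<Rightarrow> 'v hilb list \<Rightarrow> 'v hilb list \<Rightarrow>
    (('v list \<Rightarrow> complex) \<Rightarrow> 'v list \<Rightarrow> complex) set" where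
  "brel_prod R S Xs Ys = op_span (tensor Xs) (tensor Ys)
     {tensor_op2 Xs Ys a b | a b. a \<in> R (Xs ! 0) (Ys ! 0) \<and> b \<in> S (Xs ! 1) (Ys ! 1)}"

text \<open>\<open>E\<^sub>\<Y> \<circ> (B \<times> I)\<close>, where \<open>I\<close> is the identity relation on the dual of \<open>\<Y>\<close>.\<close>

definition rel_hat :: "'v hilb set \<Rightarrow> 'v hilb set \<Rightarrow> ('v hilb \<Rightarrow> 'v hilb \<Rightarrow> ('v \<Rightarrow> 'v) set) \<Rightarrow> 'v qrel" where
  "rel_hat \<X> \<Y> B = (\<lambda>Xs\<in>listset [\<X>, qdual \<Y>]. functional_span Xs
     (\<Union>Ys\<in>listset [\<Y>, qdual \<Y>]. {compose (carrier (tensor Xs)) e t | e t.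
        e \<in> equality_rel \<Y> Ys \<and> t \<in> brel_prod B (id_relation (qdual \<Y>)) Xs Ys}))"


section \<open>Formulas\<close>

text \<open>A variable is a pair of its sort and an index.\<close>

type_synonym 'v var = "'v hilb set \<times> nat"

datatype 'v formula =
    Atom "'v qrel" "'v var list"
  | Neg "'v formula"
  | Conj "'v formula" "'v formula"
  | Forall "'v var" "'v formula"

definition Disj :: "'v formula \<Rightarrow> 'v formula \<Rightarrow> 'v formula" where
  "Disj \<phi> \<psi> = Neg (Conj (Neg \<phi>) (Neg \<psi>))"

definition Imp :: "'v formula \<Rightarrow> 'v formula \<Rightarrow> 'v formula" where
  "Imp \<phi> \<psi> = Disj (Neg \<phi>) (Conj \<phi> \<psi>)"

text \<open>\<open>(\<forall>(x = x\<^sub>*) \<in> \<X> \<times> \<X>\<^sup>*) \<phi>\<close>, for variables \<open>x = (\<X>, i)\<close> and \<open>x\<^sub>* = (qdual \<X>, j)\<close>.\<close>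

definition Forall_eq :: "'v hilb set \<Rightarrow> nat \<Rightarrow> nat \<Rightarrow> 'v formula \<Rightarrow> 'v formula" where
  "Forall_eq \<X> i j \<phi> = Forall (qdual \<X>, j) (Forall (\<X>, i)
     (Imp (Atom (equality_rel \<X>) [(\<X>, i), (qdual \<X>, j)]) \<phi>))"

text \<open>
  \<open>interp \<phi> \<Gamma>\<close> is the interpretation of \<open>\<phi>\<close> in the context \<open>\<Gamma>\<close>, a list of distinct variables that
  includes the free variables of \<open>\<phi>\<close> and no bound ones. In the atomic case the variables \<open>vs\<close> are
  the first entries of a permutation of \<open>\<Gamma>\<close>; the interpretation does not depend on the order of the
  remaining ones, which here is that of \<open>\<Gamma>\<close>, and this determines \<open>\<pi>\<close>. The product of the top
  relations of the remaining sorts is the top relation.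
\<close>

definition context_perm :: "'v var list \<Rightarrow> 'v var list \<Rightarrow> nat \<Rightarrow> nat" where
  "context_perm \<Gamma> vs = (THE \<pi>. \<pi> permutes {..<length \<Gamma>} \<and>
     permute_list \<pi> \<Gamma> = vs @ filter (\<lambda>v. v \<notin> set vs) \<Gamma>)"

primrec interp :: "'v formula \<Rightarrow> 'v var list \<Rightarrow> 'v qrel" where
  "interp (Atom R vs) \<Gamma> = (\<lambda>Xs\<in>listset (map fst \<Gamma>).
     let \<pi> = context_perm \<Gamma> vs;
         Bs = map fst (filter (\<lambda>v. v \<notin> set vs) \<Gamma>)
     in {compose (carrier (tensor Xs)) r (perm_op \<pi> Xs) | r.
           r \<in> rel_prod (map fst vs) Bs R (rel_top Bs) (permute_list \<pi> Xs)})"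
| "interp (Neg \<phi>) \<Gamma> = rel_not (map fst \<Gamma>) (interp \<phi> \<Gamma>)"
| "interp (Conj \<phi> \<psi>) \<Gamma> = rel_meet (map fst \<Gamma>) (interp \<phi> \<Gamma>) (interp \<psi> \<Gamma>)"
| "interp (Forall x \<phi>) \<Gamma> = rel_Sup (map fst \<Gamma>)
     {R \<in> relations (map fst \<Gamma>).
        rel_le (map fst (x # \<Gamma>)) (rel_prod [fst x] (map fst \<Gamma>) (rel_top [fst x]) R)
          (interp \<phi> (x # \<Gamma>))}"

end

theory Submission
  imports Defs
begin

text \<open>
  The idea is that both sides of the correspondence are determined by compressions to pairs of atoms.

  The commutant of \<open>\<ell>\<^sup>\<infinity>(\<X>)\<close> consists of the operators that act on each atom by a scalar
  (\<open>commutant_scalar\<close>); in particular it contains the projections \<open>p\<^sub>X\<close> to the atoms. So a quantum graph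
  structure \<open>V\<close> contains the block \<open>p\<^sub>Y v p\<^sub>X\<close> of each \<open>v\<close> in \<open>V\<close>. If every compression of a bounded operator \<open>v\<close>
  is the compression of some element of \<open>V\<close>, then the finite sums of blocks of \<open>v\<close> lie in \<open>V\<close>; they
  converge ultraweakly to \<open>v\<close>, and \<open>V\<close> is closed, so \<open>v\<close> lies in \<open>V\<close> (\<open>quantum_graph_structure_contains\<close>).
  Therefore \<open>V\<close> can be recovered from the binary relation \<open>R\<close> of its compressions. Starting from \<open>R\<close>, the
  operators with compressions in \<open>R\<close> form a subspace that is invariant under the commutant and closed, being
  given by equations between finitely many matrix coefficients each. It contains the identity and is
  closed under adjoints if and only if all \<open>R(X, X)\<close> contain the identity and \<open>R(X, Y)\<^sup>\<dagger> \<subseteq> R(Y, X)\<close>. Compressing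
  operators that consist of a single block returns \<open>R\<close>.

  It remains to see that these two conditions are what the formulas express. The quantifier
  \<open>\<forall>(x = x\<^sub>*)\<close> amounts to the insertion of the evaluation \<open>\<epsilon>\<^sub>X\<close>: a functional \<open>f\<close> satisfies
  \<open>\<forall>(x = x\<^sub>*) \<phi>\<close> if and only if \<open>\<epsilon>\<^sub>X \<otimes> f\<close> satisfies \<open>\<phi>\<close> for every atom \<open>X\<close> (\<open>interp_Forall_eq_iff\<close>). The relation
  derived from \<open>R\<close> consists, on \<open>X \<otimes> Y\<^sup>*\<close>, of the functionals \<open>x \<otimes> y \<mapsto> \<langle>y|b x\<rangle>\<close> with \<open>b\<close> in \<open>R(X, Y)\<close>
  (\<open>rel_hat\<close>). The first formula thus says that \<open>\<epsilon>\<^sub>X\<close> is such a functional, with \<open>b\<close> the identity.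
  The second one says that \<open>\<epsilon>\<^sub>X\<^sub>2 \<otimes> \<epsilon>\<^sub>X\<^sub>1\<close> satisfies a Sasaki arrow \<open>A \<rightarrow> B\<close>. Here \<open>A\<close> and \<open>B\<close> are the
  subspaces \<open>R(X\<^sub>1, X\<^sub>2) \<otimes> L(X\<^sub>2, X\<^sub>1)\<close> and \<open>L(X\<^sub>1, X\<^sub>2) \<otimes> R(X\<^sub>2, X\<^sub>1)\<close> of a tensor product of operator spaces, and
  the projection of \<open>\<epsilon>\<^sub>X\<^sub>2 \<otimes> \<epsilon>\<^sub>X\<^sub>1\<close> to \<open>A\<close> is \<open>\<Sum>\<^sub>i r\<^sub>i \<otimes> r\<^sub>i\<^sup>\<dagger>\<close> for an orthonormal basis \<open>(r\<^sub>i)\<close> of \<open>R(X\<^sub>1, X\<^sub>2)\<close>. It lies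
  in \<open>B\<close> if and only if \<open>R(X\<^sub>1, X\<^sub>2)\<^sup>\<dagger> \<subseteq> R(X\<^sub>2, X\<^sub>1)\<close> (\<open>symmetry_criterion\<close>).

  Throughout, vectors are handled by their inner products with other vectors and tensors by the values of
  functionals on elementary tensors, so that the calculations are finite sums of complex numbers.
\<close>

section \<open>Inner product spaces and orthonormal bases\<close>

lemma complex_ring_simps [simp]:
  "carrier complex_ring = UNIV" "\<zero>\<^bsub>complex_ring\<^esub> = 0" "\<one>\<^bsub>complex_ring\<^esub> = 1"
  "x \<oplus>\<^bsub>complex_ring\<^esub> y = x + y" "x \<otimes>\<^bsub>complex_ring\<^esub> y = x * y"
  by (simp_all add: complex_ring_def)

lemma cring_complex_ring: "cring complex_ring"
proof (rule cringI)
  show "abelian_group complex_ring"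
    by (rule abelian_groupI) (auto intro: exI[of _ "- x" for x] simp: add.assoc add.commute)
  show "Group.comm_monoid complex_ring"
    by (rule comm_monoidI) auto
qed (auto simp: algebra_simps)

lemma complex_submodule_iff:
  assumes "module complex_ring M"
  shows "submodule W complex_ring M \<longleftrightarrow> W \<subseteq> carrier M \<and> \<zero>\<^bsub>M\<^esub> \<in> W \<and>
     (\<forall>a\<in>W. \<forall>b\<in>W. a \<oplus>\<^bsub>M\<^esub> b \<in> W) \<and> (\<forall>c. \<forall>a\<in>W. c \<odot>\<^bsub>M\<^esub> a \<in> W)" (is "?L \<longleftrightarrow> ?R")
proof
  interpret M: module complex_ring M by fact
  assume L: ?L
  obtain w where w: "w \<in> W" using M.submoduleE(2)[OF L] by auto
  have "0 \<odot>\<^bsub>M\<^esub> w = \<zero>\<^bsub>M\<^esub>" using M.smult_l_null[of w] w M.submoduleE(1)[OF L] by auto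
  moreover have "0 \<odot>\<^bsub>M\<^esub> w \<in> W" using M.submoduleE(4)[OF L] w by simp
  ultimately have "\<zero>\<^bsub>M\<^esub> \<in> W" by simp
  then show ?R using M.submoduleE[OF L] by auto
next
  interpret M: module complex_ring M by fact
  assume R: ?R
  show ?L
  proof (rule M.submoduleI)
    fix a assume a: "a \<in> W"
    then have ac: "a \<in> carrier M" using R by auto
    have "\<ominus>\<^bsub>M\<^esub> a = (- 1) \<odot>\<^bsub>M\<^esub> a"
    proof (rule M.minus_equality)
      show "(- 1) \<odot>\<^bsub>M\<^esub> a \<oplus>\<^bsub>M\<^esub> a = \<zero>\<^bsub>M\<^esub>"
        using M.smult_l_distr[of "-1" 1 a] M.smult_one[of a] M.smult_l_null[of a] ac by simp
    qed (use ac in auto)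
    then show "\<ominus>\<^bsub>M\<^esub> a \<in> W" using R a by auto
  qed (use R in auto)
qed

context inner_product_space
begin

lemma smult_in [simp, intro]: "x \<in> carrier X \<Longrightarrow> c \<odot>\<^bsub>X\<^esub> x \<in> carrier X"
  by simp

lemma one_smult [simp]: "x \<in> carrier X \<Longrightarrow> 1 \<odot>\<^bsub>X\<^esub> x = x"
  using smult_one by simp

lemma zero_smult [simp]: "x \<in> carrier X \<Longrightarrow> 0 \<odot>\<^bsub>X\<^esub> x = \<zero>\<^bsub>X\<^esub>"
  using smult_l_null by simp

lemma smult_zero [simp]: "c \<odot>\<^bsub>X\<^esub> \<zero>\<^bsub>X\<^esub> = \<zero>\<^bsub>X\<^esub>"
  using smult_r_null by simp

lemma smult_smult: "x \<in> carrier X \<Longrightarrow> c \<odot>\<^bsub>X\<^esub> (d \<odot>\<^bsub>X\<^esub> x) = (c * d) \<odot>\<^bsub>X\<^esub> x"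
  using smult_assoc1[of c d x] by simp

lemma ip_add_left:
  "\<lbrakk>x \<in> carrier X; y \<in> carrier X; z \<in> carrier X\<rbrakk> \<Longrightarrow> ip X (y \<oplus>\<^bsub>X\<^esub> z) x = ip X y x + ip X z x"
  using ip_cnj[of x "y \<oplus>\<^bsub>X\<^esub> z"] ip_cnj[of x y] ip_cnj[of x z] by (simp add: ip_add_right)

lemma ip_smult_left:
  "\<lbrakk>x \<in> carrier X; y \<in> carrier X\<rbrakk> \<Longrightarrow> ip X (c \<odot>\<^bsub>X\<^esub> y) x = cnj c * ip X y x"
  using ip_cnj[of x "c \<odot>\<^bsub>X\<^esub> y"] ip_cnj[of x y] by (simp add: ip_smult_right)

lemma cnj_ip: "\<lbrakk>x \<in> carrier X; y \<in> carrier X\<rbrakk> \<Longrightarrow> cnj (ip X x y) = ip X y x"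
  using ip_cnj[of x y] by simp

lemma ip_zero_right [simp]: "x \<in> carrier X \<Longrightarrow> ip X x \<zero>\<^bsub>X\<^esub> = 0"
  using ip_smult_right[of x "\<zero>\<^bsub>X\<^esub>" 0] by simp

lemma ip_zero_left [simp]: "x \<in> carrier X \<Longrightarrow> ip X \<zero>\<^bsub>X\<^esub> x = 0"
  using ip_smult_left[of x "\<zero>\<^bsub>X\<^esub>" 0] by simp

lemmas ip_simps = ip_add_right ip_add_left ip_smult_right ip_smult_left

lemma Im_ip_self [simp]: "x \<in> carrier X \<Longrightarrow> Im (ip X x x) = 0"
  using ip_cnj[of x x] by (metis add.inverse_neutral cnj.simps(2) complex_cnj_cancel_iff equal_neg_zero)

lemma Re_ip_self_ge_0 [simp]: "x \<in> carrier X \<Longrightarrow> Re (ip X x x) \<ge> 0"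
  using ip_pos[of x] by (cases "x = \<zero>\<^bsub>X\<^esub>") (auto simp: less_imp_le)

lemma ip_self_eq_0: "\<lbrakk>x \<in> carrier X; ip X x x = 0\<rbrakk> \<Longrightarrow> x = \<zero>\<^bsub>X\<^esub>"
  using ip_pos[of x] by (cases "x = \<zero>\<^bsub>X\<^esub>") auto

lemma hnorm_ge_0 [simp]: "x \<in> carrier X \<Longrightarrow> hnorm X x \<ge> 0"
  by (simp add: hnorm_def)

lemma hnorm_zero [simp]: "hnorm X \<zero>\<^bsub>X\<^esub> = 0"
  by (simp add: hnorm_def)

lemma hnorm_power2: "x \<in> carrier X \<Longrightarrow> (hnorm X x)\<^sup>2 = Re (ip X x x)"
  by (simp add: hnorm_def)

lemma ip_self: "x \<in> carrier X \<Longrightarrow> ip X x x = of_real ((hnorm X x)\<^sup>2)"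
  by (simp add: hnorm_power2 complex_eq_iff)

lemma hnorm_eq_0: "\<lbrakk>x \<in> carrier X; hnorm X x = 0\<rbrakk> \<Longrightarrow> x = \<zero>\<^bsub>X\<^esub>"
  using ip_self_eq_0 ip_self by simp

lemma diff_eq_zeroD:
  assumes "x \<in> carrier X" "y \<in> carrier X" "x \<oplus>\<^bsub>X\<^esub> (- 1) \<odot>\<^bsub>X\<^esub> y = \<zero>\<^bsub>X\<^esub>"
  shows "x = y"
proof -
  have "(- 1) \<odot>\<^bsub>X\<^esub> y \<oplus>\<^bsub>X\<^esub> 1 \<odot>\<^bsub>X\<^esub> y = \<zero>\<^bsub>X\<^esub>"
    using smult_l_distr[of "-1" 1 y] assms by simp
  then have "x \<oplus>\<^bsub>X\<^esub> ((- 1) \<odot>\<^bsub>X\<^esub> y \<oplus>\<^bsub>X\<^esub> y) = x" using assms by simp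
  then have "(x \<oplus>\<^bsub>X\<^esub> (- 1) \<odot>\<^bsub>X\<^esub> y) \<oplus>\<^bsub>X\<^esub> y = x" using assms(1,2) by (simp add: M.a_assoc del: assms(3))
  then show ?thesis using assms by simp
qed

text \<open>Vector identities are proved by pairing both sides with an arbitrary vector, which turns them
  into identities of complex numbers.\<close>

lemma ip_ext:
  assumes "x \<in> carrier X" "y \<in> carrier X" "\<And>z. z \<in> carrier X \<Longrightarrow> ip X z x = ip X z y"
  shows "x = y"
proof (rule diff_eq_zeroD[OF assms(1,2)], rule ip_self_eq_0)
  let ?w = "x \<oplus>\<^bsub>X\<^esub> (- 1) \<odot>\<^bsub>X\<^esub> y"
  show w: "?w \<in> carrier X" using assms by simp
  have "ip X ?w ?w = ip X ?w x - ip X ?w y"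
    using w assms(1,2) by (simp add: ip_add_right[OF w] ip_smult_right[OF w])
  then show "ip X ?w ?w = 0" using assms(3)[OF w] by simp
qed

lemma Cauchy_Schwarz:
  assumes "x \<in> carrier X" "y \<in> carrier X"
  shows "cmod (ip X x y) \<le> hnorm X x * hnorm X y"
proof (cases "y = \<zero>\<^bsub>X\<^esub>")
  case False
  define n where "n = (hnorm X y)\<^sup>2"
  have n: "n > 0" using ip_pos[OF assms(2) False] hnorm_power2[OF assms(2)] by (simp add: n_def)
  define c where "c = ip X y x / of_real n"
  let ?z = "x \<oplus>\<^bsub>X\<^esub> (- c) \<odot>\<^bsub>X\<^esub> y"
  have "ip X ?z ?z = ip X x x - c * ip X x y - cnj c * ip X y x + cnj c * c * of_real n"
    using assms ip_self[OF assms(2)] by (simp add: ip_simps algebra_simps n_def)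
  also have "cnj c * c * of_real n = cnj c * ip X y x" using n by (simp add: c_def)
  also have "c * ip X x y = of_real ((cmod (ip X x y))\<^sup>2 / n)"
    using ip_cnj[OF assms] by (simp add: c_def complex_norm_square[symmetric] mult.commute)
  finally have "Re (ip X ?z ?z) = (hnorm X x)\<^sup>2 - (cmod (ip X x y))\<^sup>2 / n"
    using ip_self[OF assms(1)] by simp
  then have "(cmod (ip X x y))\<^sup>2 / n \<le> (hnorm X x)\<^sup>2" using Re_ip_self_ge_0[of ?z] assms by simp
  then have "(cmod (ip X x y))\<^sup>2 \<le> (hnorm X x * hnorm X y)\<^sup>2"
    using n by (simp add: power_mult_distrib n_def divide_simps)
  then show ?thesis by (rule power2_le_imp_le) (use assms in simp)
qed (use assms in simp)

lemma hnorm_add_le: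
  assumes "x \<in> carrier X" "y \<in> carrier X"
  shows "hnorm X (x \<oplus>\<^bsub>X\<^esub> y) \<le> hnorm X x + hnorm X y"
proof (rule power2_le_imp_le)
  have "Re (ip X x y) \<le> hnorm X x * hnorm X y"
    using Cauchy_Schwarz[OF assms] complex_Re_le_cmod order_trans by blast
  moreover have "(hnorm X (x \<oplus>\<^bsub>X\<^esub> y))\<^sup>2 = (hnorm X x)\<^sup>2 + (hnorm X y)\<^sup>2 + 2 * Re (ip X x y)"
    using assms ip_cnj[OF assms] by (simp add: hnorm_power2 ip_simps)
  ultimately show "(hnorm X (x \<oplus>\<^bsub>X\<^esub> y))\<^sup>2 \<le> (hnorm X x + hnorm X y)\<^sup>2"
    by (simp add: power2_sum)
qed (use assms in simp)

lemma hnorm_smult: "x \<in> carrier X \<Longrightarrow> hnorm X (c \<odot>\<^bsub>X\<^esub> x) = cmod c * hnorm X x"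
proof -
  assume x: "x \<in> carrier X"
  have "ip X (c \<odot>\<^bsub>X\<^esub> x) (c \<odot>\<^bsub>X\<^esub> x) = (c * cnj c) * ip X x x"
    using x by (simp add: ip_simps)
  also have "\<dots> = of_real ((cmod c * hnorm X x)\<^sup>2)"
    unfolding complex_norm_square[symmetric] ip_self[OF x] by (simp add: power_mult_distrib)
  finally have "Re (ip X (c \<odot>\<^bsub>X\<^esub> x) (c \<odot>\<^bsub>X\<^esub> x)) = (cmod c * hnorm X x)\<^sup>2"
    by simp
  then show ?thesis using x by (simp add: hnorm_def)
qed

lemma ip_finsum_right:
  assumes "finite S" "y \<in> carrier X" "\<And>s. s \<in> S \<Longrightarrow> f s \<in> carrier X"
  shows "ip X y (\<Oplus>\<^bsub>X\<^esub>s\<in>S. f s) = (\<Sum>s\<in>S. ip X y (f s))"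
  using assms(1,3) by (induction) (auto simp: finsum_insert ip_add_right assms(2) Pi_def finsum_closed)

lemma finsum_mem [simp]: "(\<And>s. s \<in> S \<Longrightarrow> f s \<in> carrier X) \<Longrightarrow> (\<Oplus>\<^bsub>X\<^esub>s\<in>S. f s) \<in> carrier X"
  by (rule finsum_closed) auto

lemma ip_finsum_left:
  assumes "finite S" "y \<in> carrier X" "\<And>s. s \<in> S \<Longrightarrow> f s \<in> carrier X"
  shows "ip X (\<Oplus>\<^bsub>X\<^esub>s\<in>S. f s) y = (\<Sum>s\<in>S. ip X (f s) y)"
proof -
  have "ip X (\<Oplus>\<^bsub>X\<^esub>s\<in>S. f s) y = cnj (\<Sum>s\<in>S. ip X y (f s))"
    using ip_cnj[of y "\<Oplus>\<^bsub>X\<^esub>s\<in>S. f s"] assms by (simp add: ip_finsum_right)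
  also have "\<dots> = (\<Sum>s\<in>S. ip X (f s) y)"
    unfolding cnj_sum by (rule sum.cong) (use assms in \<open>auto simp: cnj_ip\<close>)
  finally show ?thesis .
qed

lemmas subspace_iff = complex_submodule_iff[OF module_axioms]

lemma finsum_in_subspace:
  assumes "submodule W complex_ring X" "finite S" "\<And>s. s \<in> S \<Longrightarrow> f s \<in> W"
  shows "(\<Oplus>\<^bsub>X\<^esub>s\<in>S. f s) \<in> W"
proof -
  have W: "W \<subseteq> carrier X" "\<zero>\<^bsub>X\<^esub> \<in> W" "\<And>a b. a \<in> W \<Longrightarrow> b \<in> W \<Longrightarrow> a \<oplus>\<^bsub>X\<^esub> b \<in> W"
    using assms(1) unfolding subspace_iff by auto
  show ?thesis using assms(2,3)
  proof (induction)
    case (insert s S)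
    then have "f \<in> S \<rightarrow> carrier X" "f s \<in> carrier X" using W(1) by auto
    then show ?case using insert W(3) by (simp add: finsum_insert)
  qed (use W in simp)
qed

end

definition orthonormal :: "'v hilb \<Rightarrow> 'v set \<Rightarrow> bool" where
  "orthonormal X B \<longleftrightarrow> finite B \<and> B \<subseteq> carrier X \<and>
     (\<forall>e\<in>B. \<forall>f\<in>B. ip X e f = (if e = f then 1 else 0))"

text \<open>The weak form of \<open>x = (\<Sum>b\<in>B. \<langle>b|x\<rangle> b)\<close>; it involves sums of complex numbers only.\<close>

definition expands :: "'v hilb \<Rightarrow> 'v set \<Rightarrow> 'v \<Rightarrow> bool" where
  "expands X B x \<longleftrightarrow> (\<forall>y\<in>carrier X. ip X y x = (\<Sum>b\<in>B. ip X y b * ip X b x))"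

context inner_product_space
begin

lemma expandsD: "\<lbrakk>expands X B x; y \<in> carrier X\<rbrakk> \<Longrightarrow> ip X y x = (\<Sum>b\<in>B. ip X y b * ip X b x)"
  by (simp add: expands_def)

lemma expands_finsum:
  assumes "orthonormal X B" "expands X B x" "x \<in> carrier X"
  shows "x = (\<Oplus>\<^bsub>X\<^esub>b\<in>B. ip X b x \<odot>\<^bsub>X\<^esub> b)"
proof (rule ip_ext)
  have B: "finite B" "B \<subseteq> carrier X" using assms(1) by (auto simp: orthonormal_def)
  then have Bc: "\<And>b. b \<in> B \<Longrightarrow> ip X b x \<odot>\<^bsub>X\<^esub> b \<in> carrier X" by auto
  then show "(\<Oplus>\<^bsub>X\<^esub>b\<in>B. ip X b x \<odot>\<^bsub>X\<^esub> b) \<in> carrier X" by (rule finsum_mem)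
  fix z assume z: "z \<in> carrier X"
  have "ip X z (\<Oplus>\<^bsub>X\<^esub>b\<in>B. ip X b x \<odot>\<^bsub>X\<^esub> b) = (\<Sum>b\<in>B. ip X z (ip X b x \<odot>\<^bsub>X\<^esub> b))"
    using ip_finsum_right[OF B(1) z Bc] .
  also have "\<dots> = (\<Sum>b\<in>B. ip X z b * ip X b x)"
    by (rule sum.cong) (use B z in \<open>auto simp: ip_smult_right\<close>)
  finally show "ip X z x = ip X z (\<Oplus>\<^bsub>X\<^esub>b\<in>B. ip X b x \<odot>\<^bsub>X\<^esub> b)"
    using expandsD[OF assms(2) z] by simp
qed (use assms in simp)

text \<open>One step of the Gram-Schmidt process inside a subspace \<open>W\<close>: the difference of \<open>w\<close> and its
  projection to the span of \<open>B\<close> is normalized.\<close>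

lemma orthonormal_extend:
  assumes W: "submodule W complex_ring X" and B: "orthonormal X B" "B \<subseteq> W"
    and w: "w \<in> W" "\<not> expands X B w"
  obtains u where "u \<in> W" "u \<notin> B" "orthonormal X (insert u B)" "expands X (insert u B) w"
proof -
  have Wc: "W \<subseteq> carrier X" "\<And>a b. a \<in> W \<Longrightarrow> b \<in> W \<Longrightarrow> a \<oplus>\<^bsub>X\<^esub> b \<in> W"
     "\<And>a c. a \<in> W \<Longrightarrow> c \<odot>\<^bsub>X\<^esub> a \<in> W"
    using W unfolding subspace_iff by auto
  have fB: "finite B" and on: "\<And>e f. e \<in> B \<Longrightarrow> f \<in> B \<Longrightarrow> ip X e f = (if e = f then 1 else 0)"
    using B(1) by (auto simp: orthonormal_def)
  have Bc: "b \<in> carrier X" if "b \<in> B" for b using that B(2) Wc(1) by auto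
  have wc: "w \<in> carrier X" using w Wc by auto
  define z where "z = (\<Oplus>\<^bsub>X\<^esub>b\<in>B. (- ip X b w) \<odot>\<^bsub>X\<^esub> b)"
  define v where "v = w \<oplus>\<^bsub>X\<^esub> z"
  have zW: "z \<in> W" unfolding z_def
    by (rule finsum_in_subspace[OF W fB]) (use B Wc in auto)
  have vW: "v \<in> W" using zW w Wc by (auto simp: v_def)
  then have vc: "v \<in> carrier X" using Wc by auto
  have zc: "z \<in> carrier X" using zW Wc by auto
  have ipz: "ip X y z = - (\<Sum>b\<in>B. ip X y b * ip X b w)" if y: "y \<in> carrier X" for y
  proof -
    have "ip X y z = (\<Sum>b\<in>B. ip X y ((- ip X b w) \<odot>\<^bsub>X\<^esub> b))"
      unfolding z_def by (rule ip_finsum_right) (use fB y Bc in auto)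
    also have "\<dots> = (\<Sum>b\<in>B. - (ip X y b * ip X b w))"
      by (rule sum.cong) (use Bc y in \<open>auto simp: ip_smult_right\<close>)
    finally show ?thesis by (simp add: sum_negf)
  qed
  have ipv: "ip X y v = ip X y w - (\<Sum>b\<in>B. ip X y b * ip X b w)" if y: "y \<in> carrier X" for y
    using y wc zc by (simp add: v_def ip_add_right ipz)
  have bv: "ip X b v = 0" if b: "b \<in> B" for b
  proof -
    have "(\<Sum>b'\<in>B. ip X b b' * ip X b' w) = (\<Sum>b'\<in>B. if b = b' then ip X b' w else 0)"
      by (rule sum.cong) (use on b in auto)
    also have "\<dots> = ip X b w" using fB b by simp
    finally show ?thesis using ipv[OF Bc[OF b]] by simp
  qed
  then have vb: "ip X v b = 0" if b: "b \<in> B" for b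
    using b ip_cnj[OF Bc[OF b] vc] by simp
  define n where "n = hnorm X v"
  have "v \<noteq> \<zero>\<^bsub>X\<^esub>"
    using w(2) ipv by (fastforce simp: expands_def)
  then have n: "n > 0" using hnorm_eq_0[OF vc] hnorm_ge_0[OF vc] unfolding n_def by (auto simp: less_le)
  define u where "u = complex_of_real (1 / n) \<odot>\<^bsub>X\<^esub> v"
  have uW: "u \<in> W" using vW Wc by (auto simp: u_def)
  then have uc: "u \<in> carrier X" using Wc by auto
  have uu: "ip X u u = 1" using n vc ip_self[OF vc]
    by (simp add: u_def ip_simps n_def[symmetric] power2_eq_square)
  have bu: "ip X b u = 0" "ip X u b = 0" if "b \<in> B" for b
    using that bv vb Bc vc by (auto simp: u_def ip_simps)
  have uB: "u \<notin> B" using bu(1)[of u] uu by auto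
  have on': "orthonormal X (insert u B)"
    unfolding orthonormal_def using fB Bc uc uu bu on uB by (auto simp: subset_iff)
  have vw: "ip X v w = of_real (n\<^sup>2)"
  proof -
    have "ip X v v = ip X v w - (\<Sum>b\<in>B. ip X v b * ip X b w)" by (rule ipv[OF vc])
    also have "(\<Sum>b\<in>B. ip X v b * ip X b w) = 0" using vb by simp
    finally show ?thesis using ip_self[OF vc] by (simp add: n_def)
  qed
  have "expands X (insert u B) w" unfolding expands_def
  proof
    fix y assume y: "y \<in> carrier X"
    have "ip X y u * ip X u w = ip X y v"
      using y vc wc n vw by (simp add: u_def ip_simps power2_eq_square)
    then show "ip X y w = (\<Sum>b\<in>insert u B. ip X y b * ip X b w)"
      using ipv[OF y] fB uB by simp
  qed
  with that uW uB on' show thesis by blast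
qed

lemma expands_insert:
  assumes "orthonormal X (insert u B)" "u \<notin> B" "expands X B x"
  shows "expands X (insert u B) x"
proof -
  have u: "u \<in> carrier X" "finite B" and ub: "\<And>b. b \<in> B \<Longrightarrow> ip X u b = 0"
    using assms(1,2) by (auto simp: orthonormal_def)
  have "ip X u x = 0" using expandsD[OF assms(3) u(1)] ub by simp
  then show ?thesis using assms(2,3) u(2) by (simp add: expands_def)
qed

lemma gram_schmidt:
  assumes "finite S" "S \<subseteq> carrier X"
  obtains B where "orthonormal X B" "\<And>s. s \<in> S \<Longrightarrow> expands X B s"
proof -
  have W: "submodule (carrier X) complex_ring X" by (simp add: subspace_iff)
  have "\<exists>B. orthonormal X B \<and> (\<forall>s\<in>S. expands X B s)"
    using assms
  proof (induction)
    case empty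
    then show ?case by (intro exI[of _ "{}"]) (simp add: orthonormal_def)
  next
    case (insert s S)
    then obtain B where B: "orthonormal X B" "\<forall>s\<in>S. expands X B s" by auto
    show ?case
    proof (cases "expands X B s")
      case False
      have "B \<subseteq> carrier X" using B by (auto simp: orthonormal_def)
      then obtain u where "u \<notin> B" "orthonormal X (insert u B)" "expands X (insert u B) s"
        by (rule orthonormal_extend[OF W B(1) _ _ False]) (use insert.prems in auto)
      then show ?thesis using expands_insert B(2) by blast
    qed (use B in auto)
  qed
  then show thesis using that by blast
qed

text \<open>Pairing a linear combination of an orthonormal set with the elements of that set identifies its
  coefficients.\<close>

lemma orthonormal_basis_iff:
  "orthonormal_basis X B \<longleftrightarrow> orthonormal X B \<and> (\<forall>x\<in>carrier X. expands X B x)"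
proof
  assume L: "orthonormal_basis X B"
  then have B: "orthonormal X B" "finite B" "B \<subseteq> carrier X"
    and sp: "\<And>x. x \<in> carrier X \<Longrightarrow> \<exists>c. x = (\<Oplus>\<^bsub>X\<^esub>s\<in>B. c s \<odot>\<^bsub>X\<^esub> s)"
    and on: "\<And>e f. e \<in> B \<Longrightarrow> f \<in> B \<Longrightarrow> ip X e f = (if e = f then 1 else 0)"
    by (auto simp: orthonormal_basis_def orthonormal_def finite_spanning_def)
  have "expands X B x" if x: "x \<in> carrier X" for x
  proof -
    obtain c where c: "x = (\<Oplus>\<^bsub>X\<^esub>s\<in>B. c s \<odot>\<^bsub>X\<^esub> s)" using sp x by blast
    have *: "ip X y x = (\<Sum>b\<in>B. ip X y b * c b)" if y: "y \<in> carrier X" for y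
    proof -
      have "ip X y x = (\<Sum>b\<in>B. ip X y (c b \<odot>\<^bsub>X\<^esub> b))"
        unfolding c by (rule ip_finsum_right) (use B y in auto)
      also have "\<dots> = (\<Sum>b\<in>B. ip X y b * c b)"
        by (rule sum.cong) (use B y in \<open>auto simp: ip_smult_right\<close>)
      finally show ?thesis .
    qed
    have "ip X e x = c e" if e: "e \<in> B" for e
    proof -
      have "ip X e x = (\<Sum>b\<in>B. ip X e b * c b)" using * e B by auto
      also have "\<dots> = (\<Sum>b\<in>B. if e = b then c b else 0)"
        by (rule sum.cong) (use on e in auto)
      also have "\<dots> = c e" using e B by simp
      finally show ?thesis .
    qed
    then show ?thesis using * by (simp add: expands_def)
  qed
  then show "orthonormal X B \<and> (\<forall>x\<in>carrier X. expands X B x)" using B by blast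
next
  assume R: "orthonormal X B \<and> (\<forall>x\<in>carrier X. expands X B x)"
  then show "orthonormal_basis X B"
    unfolding orthonormal_basis_def finite_spanning_def orthonormal_def
    using expands_finsum[of B] by (auto simp: orthonormal_def intro!: exI[of _ "\<lambda>b. ip X b x" for x])
qed

lemma finite_spanning_basis:
  assumes "finite_spanning X S"
  obtains B where "orthonormal_basis X B"
proof -
  have S: "finite S" "S \<subseteq> carrier X"
    and sp: "\<And>x. x \<in> carrier X \<Longrightarrow> \<exists>c. x = (\<Oplus>\<^bsub>X\<^esub>s\<in>S. c s \<odot>\<^bsub>X\<^esub> s)"
    using assms by (auto simp: finite_spanning_def)
  obtain B where B: "orthonormal X B" "\<And>s. s \<in> S \<Longrightarrow> expands X B s"
    using gram_schmidt[OF S] by blast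
  have Bc: "B \<subseteq> carrier X" "finite B" using B by (auto simp: orthonormal_def)
  have "expands X B x" if x: "x \<in> carrier X" for x
  proof -
    obtain c where c: "x = (\<Oplus>\<^bsub>X\<^esub>s\<in>S. c s \<odot>\<^bsub>X\<^esub> s)" using sp x by blast
    have *: "ip X y x = (\<Sum>s\<in>S. c s * ip X y s)" if y: "y \<in> carrier X" for y
    proof -
      have "ip X y x = (\<Sum>s\<in>S. ip X y (c s \<odot>\<^bsub>X\<^esub> s))"
        unfolding c by (rule ip_finsum_right) (use S y in auto)
      also have "\<dots> = (\<Sum>s\<in>S. c s * ip X y s)"
        by (rule sum.cong) (use S y in \<open>auto simp: ip_smult_right\<close>)
      finally show ?thesis .
    qed
    show ?thesis unfolding expands_def
    proof
      fix y assume y: "y \<in> carrier X"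
      have "ip X y x = (\<Sum>s\<in>S. c s * (\<Sum>b\<in>B. ip X y b * ip X b s))"
        using *[OF y] expandsD[OF B(2) y] by simp
      also have "\<dots> = (\<Sum>b\<in>B. \<Sum>s\<in>S. ip X y b * (c s * ip X b s))"
        by (subst sum.swap) (simp add: sum_distrib_left mult_ac)
      also have "\<dots> = (\<Sum>b\<in>B. ip X y b * ip X b x)"
        using Bc * by (intro sum.cong) (auto simp: sum_distrib_left)
      finally show "ip X y x = (\<Sum>b\<in>B. ip X y b * ip X b x)" .
    qed
  qed
  with B(1) that show thesis by (auto simp: orthonormal_basis_iff)
qed

lemma Bessel:
  assumes B: "orthonormal X B" and x: "x \<in> carrier X"
  shows "(\<Sum>b\<in>B. (cmod (ip X b x))\<^sup>2) \<le> (hnorm X x)\<^sup>2"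
proof -
  have Bc: "B \<subseteq> carrier X" "finite B"
    and on: "\<And>e f. e \<in> B \<Longrightarrow> f \<in> B \<Longrightarrow> ip X e f = (if e = f then 1 else 0)"
    using B by (auto simp: orthonormal_def)
  define p where "p = (\<Oplus>\<^bsub>X\<^esub>b\<in>B. ip X b x \<odot>\<^bsub>X\<^esub> b)"
  define s where "s = (\<Sum>b\<in>B. (cmod (ip X b x))\<^sup>2)"
  have pc: "p \<in> carrier X" unfolding p_def by (rule finsum_mem) (use Bc in auto)
  have yp: "ip X y p = (\<Sum>b\<in>B. ip X b x * ip X y b)" if y: "y \<in> carrier X" for y
  proof -
    have "ip X y p = (\<Sum>b\<in>B. ip X y (ip X b x \<odot>\<^bsub>X\<^esub> b))"
      unfolding p_def by (rule ip_finsum_right) (use Bc y in auto)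
    also have "\<dots> = (\<Sum>b\<in>B. ip X b x * ip X y b)"
      by (rule sum.cong) (use Bc y in \<open>auto simp: ip_smult_right\<close>)
    finally show ?thesis .
  qed
  have bp: "ip X b p = ip X b x" if b: "b \<in> B" for b
  proof -
    have "ip X b p = (\<Sum>b'\<in>B. ip X b' x * ip X b b')" using yp b Bc by auto
    also have "\<dots> = (\<Sum>b'\<in>B. if b = b' then ip X b' x else 0)"
      by (rule sum.cong) (use on b in auto)
    finally show ?thesis using b Bc by simp
  qed
  have xp: "ip X x p = of_real s"
  proof -
    have "ip X x p = (\<Sum>b\<in>B. ip X b x * cnj (ip X b x))"
      unfolding yp[OF x] by (rule sum.cong) (use Bc x in \<open>auto simp: cnj_ip subset_iff\<close>)
    then show ?thesis by (simp add: s_def flip: complex_norm_square)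
  qed
  have pp: "ip X p p = of_real s"
  proof -
    have "ip X p p = (\<Sum>b\<in>B. ip X b x * cnj (ip X b x))"
      unfolding yp[OF pc] by (rule sum.cong) (use Bc pc bp in \<open>auto simp: ip_cnj[of _ p] subset_iff\<close>)
    then show ?thesis by (simp add: s_def flip: complex_norm_square)
  qed
  have px: "ip X p x = of_real s" using ip_cnj[OF x pc] xp by simp
  let ?d = "x \<oplus>\<^bsub>X\<^esub> (- 1) \<odot>\<^bsub>X\<^esub> p"
  have "ip X ?d ?d = of_real ((hnorm X x)\<^sup>2 - s)"
    using x pc ip_self[OF x] by (simp add: ip_simps xp pp px)
  moreover have "Re (ip X ?d ?d) \<ge> 0" using x pc by simp
  ultimately show ?thesis by (simp add: s_def)
qed

text \<open>Sum \<open>\<bar>\<langle>a|b\<rangle>\<bar>\<^sup>2\<close> over both sets. By Parseval for \<open>B\<close> the result is the number of elements of \<open>A\<close>; by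
  Bessel for \<open>A\<close> it is at most the number of elements of \<open>B\<close>.\<close>

lemma card_orthonormal_le:
  assumes "orthonormal_basis X B" "orthonormal X A"
  shows "card A \<le> card B"
proof -
  have B: "orthonormal X B" "B \<subseteq> carrier X" "finite B" "\<And>x. x \<in> carrier X \<Longrightarrow> expands X B x"
    using assms(1) by (auto simp: orthonormal_basis_iff orthonormal_def)
  have A: "A \<subseteq> carrier X" "finite A" "\<And>a. a \<in> A \<Longrightarrow> ip X a a = 1"
    using assms(2) by (auto simp: orthonormal_def)
  have "1 = (\<Sum>b\<in>B. (cmod (ip X a b))\<^sup>2)" if a: "a \<in> A" for a
  proof -
    have ac: "a \<in> carrier X" using a A by auto
    have "ip X a a = (\<Sum>b\<in>B. ip X a b * ip X b a)" using expandsD[OF B(4)] ac by simp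
    also have "\<dots> = (\<Sum>b\<in>B. of_real ((cmod (ip X a b))\<^sup>2))"
      using B ac by (intro sum.cong) (auto simp: ip_cnj[of a] subset_iff simp flip: complex_norm_square)
    finally show ?thesis using A(3)[OF a] by (metis of_real_sum of_real_eq_1_iff)
  qed
  then have "real (card A) = (\<Sum>a\<in>A. \<Sum>b\<in>B. (cmod (ip X a b))\<^sup>2)" by simp
  also have "\<dots> = (\<Sum>b\<in>B. \<Sum>a\<in>A. (cmod (ip X a b))\<^sup>2)" by (rule sum.swap)
  also have "\<dots> \<le> (\<Sum>b\<in>B. 1)"
  proof (rule sum_mono)
    fix b assume b: "b \<in> B"
    then have "ip X b b = 1" "b \<in> carrier X" using B by (auto simp: orthonormal_def)
    then show "(\<Sum>a\<in>A. (cmod (ip X a b))\<^sup>2) \<le> 1"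
      using Bessel[OF assms(2), of b] by (simp add: hnorm_power2)
  qed
  finally show ?thesis by simp
qed

text \<open>Orthonormal sets have bounded size, so there is a largest one inside \<open>W\<close>; a vector of \<open>W\<close> outside its
  span would make it possible to enlarge it.\<close>

lemma subspace_basis:
  assumes X: "finite_spanning X S" and W: "submodule W complex_ring X"
  obtains B where "orthonormal X B" "B \<subseteq> W" "\<And>w. w \<in> W \<Longrightarrow> expands X B w"
proof -
  obtain C where C: "orthonormal_basis X C" using finite_spanning_basis[OF X] .
  let ?P = "\<lambda>n. \<exists>B. orthonormal X B \<and> B \<subseteq> W \<and> card B = n"
  have P0: "?P 0" by (intro exI[of _ "{}"]) (simp add: orthonormal_def)
  have Pb: "\<forall>n. ?P n \<longrightarrow> n < Suc (card C)"
    using card_orthonormal_le[OF C] by (auto simp: less_Suc_eq_le)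
  have "\<exists>m. ?P m \<and> (\<forall>n. ?P n \<longrightarrow> n \<le> m)"
    by (rule ex_has_greatest_nat[of ?P 0 "\<lambda>n. n", OF P0 Pb])
  then obtain B where B: "orthonormal X B" "B \<subseteq> W" and
    max: "\<And>B'. orthonormal X B' \<Longrightarrow> B' \<subseteq> W \<Longrightarrow> card B' \<le> card B" by blast
  have "expands X B w" if w: "w \<in> W" for w
  proof (rule ccontr)
    assume "\<not> expands X B w"
    then obtain u where "u \<in> W" "u \<notin> B" "orthonormal X (insert u B)"
      using orthonormal_extend[OF W B w] by blast
    then show False using max[of "insert u B"] B by (simp add: orthonormal_def)
  qed
  with B that show thesis by blast
qed

lemma projection:
  assumes X: "finite_spanning X S" and W: "submodule W complex_ring X" and x: "x \<in> carrier X"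
  obtains p where "p \<in> W" "\<And>w. w \<in> W \<Longrightarrow> ip X w p = ip X w x"
proof -
  obtain B where B: "orthonormal X B" "B \<subseteq> W" "\<And>w. w \<in> W \<Longrightarrow> expands X B w"
    using subspace_basis[OF X W] by metis
  have Wc: "W \<subseteq> carrier X" "\<And>a c. a \<in> W \<Longrightarrow> c \<odot>\<^bsub>X\<^esub> a \<in> W" using W unfolding subspace_iff by auto
  have fB: "finite B" using B by (simp add: orthonormal_def)
  define p where "p = (\<Oplus>\<^bsub>X\<^esub>b\<in>B. ip X b x \<odot>\<^bsub>X\<^esub> b)"
  have "p \<in> W" unfolding p_def by (rule finsum_in_subspace[OF W fB]) (use B Wc in auto)
  moreover have "ip X w p = ip X w x" if w: "w \<in> W" for w
  proof -
    have wc: "w \<in> carrier X" using w Wc by auto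
    have "ip X w p = (\<Sum>b\<in>B. ip X w (ip X b x \<odot>\<^bsub>X\<^esub> b))"
      unfolding p_def by (rule ip_finsum_right) (use B Wc fB wc in auto)
    also have "\<dots> = (\<Sum>b\<in>B. cnj (ip X x b * ip X b w))"
      by (rule sum.cong) (use B Wc wc x in \<open>auto simp: ip_smult_right cnj_ip subset_iff\<close>)
    also have "\<dots> = cnj (ip X x w)" using expandsD[OF B(3)[OF w] x] by simp
    finally show ?thesis using ip_cnj[OF x wc] by simp
  qed
  ultimately show thesis by (rule that)
qed

text \<open>The difference of \<open>x\<close> and its projection to \<open>W\<close> is orthogonal to \<open>W\<close>, hence to \<open>x\<close>, hence to itself.\<close>

lemma double_orthogonal:
  assumes X: "finite_spanning X S" and W: "submodule W complex_ring X" and x: "x \<in> carrier X"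
    and perp: "\<And>a. \<lbrakk>a \<in> carrier X; \<And>w. w \<in> W \<Longrightarrow> ip X w a = 0\<rbrakk> \<Longrightarrow> ip X a x = 0"
  shows "x \<in> W"
proof -
  obtain p where p: "p \<in> W" "\<And>w. w \<in> W \<Longrightarrow> ip X w p = ip X w x"
    using projection[OF X W x] by metis
  have Wc: "W \<subseteq> carrier X" using W unfolding subspace_iff by auto
  then have pc: "p \<in> carrier X" using p by auto
  let ?d = "x \<oplus>\<^bsub>X\<^esub> (- 1) \<odot>\<^bsub>X\<^esub> p"
  have dc: "?d \<in> carrier X" using x pc by simp
  have wd: "ip X w ?d = 0" if w: "w \<in> W" for w
    using w p(2)[OF w] Wc x pc by (simp add: ip_simps subset_iff)
  have "ip X ?d ?d = ip X ?d x - ip X ?d p"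
    using x pc by (simp add: ip_add_right[OF dc] ip_smult_right[OF dc])
  also have "ip X ?d x = 0" using perp[OF dc wd] .
  also have "ip X ?d p = 0" using wd[OF p(1)] ip_cnj[OF pc dc] by simp
  finally have "?d = \<zero>\<^bsub>X\<^esub>" using ip_self_eq_0[OF dc] by simp
  then show ?thesis using diff_eq_zeroD[OF x pc] p(1) by simp
qed

text \<open>The algebraic content of modus ponens for the Sasaki arrow
  \<open>A \<rightarrow> B = A\<^sup>\<bottom> \<or> (A \<and> B)\<close>: the component of \<open>h\<close> orthogonal to \<open>A \<inter> B\<close> lies in \<open>A\<close>, hence is
  orthogonal to \<open>h\<close>, hence to itself.\<close>

lemma sasaki_modus_ponens:
  assumes X: "finite_spanning X S" and A: "submodule A complex_ring X" and B: "submodule B complex_ring X"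
    and h: "h \<in> A"
    and imp: "\<And>a. \<lbrakk>a \<in> A; \<And>b. b \<in> A \<inter> B \<Longrightarrow> ip X b a = 0\<rbrakk> \<Longrightarrow> ip X a h = 0"
  shows "h \<in> B"
proof -
  have AB: "submodule (A \<inter> B) complex_ring X" and Ac: "A \<subseteq> carrier X"
    and cl: "\<And>a b. a \<in> A \<Longrightarrow> b \<in> A \<Longrightarrow> a \<oplus>\<^bsub>X\<^esub> b \<in> A" "\<And>a c. a \<in> A \<Longrightarrow> c \<odot>\<^bsub>X\<^esub> a \<in> A"
    using A B unfolding subspace_iff by auto
  obtain p where p: "p \<in> A \<inter> B" "\<And>w. w \<in> A \<inter> B \<Longrightarrow> ip X w p = ip X w h"
    using projection[OF X AB] h Ac by (metis subsetD)
  have hc: "h \<in> carrier X" and pc: "p \<in> carrier X" using h p Ac by auto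
  let ?d = "h \<oplus>\<^bsub>X\<^esub> (- 1) \<odot>\<^bsub>X\<^esub> p"
  have d: "?d \<in> A" using h p cl by auto
  have dc: "?d \<in> carrier X" using d Ac by auto
  have wd: "ip X w ?d = 0" if w: "w \<in> A \<inter> B" for w
  proof -
    have "w \<in> carrier X" using w Ac by auto
    then show ?thesis using p(2)[OF w] hc pc by (simp add: ip_simps)
  qed
  have "ip X ?d h = 0" using imp[OF d] wd by blast
  moreover have "ip X ?d p = 0" using wd[OF p(1)] ip_cnj[OF pc dc] by simp
  ultimately have "ip X ?d ?d = 0"
    using hc pc by (simp add: ip_add_right[OF dc] ip_smult_right[OF dc])
  then have "?d = \<zero>\<^bsub>X\<^esub>" using ip_self_eq_0[OF dc] by simp
  then show ?thesis using diff_eq_zeroD[OF hc pc] p(1) by simp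
qed

end

lemma fd_hilbert_spaceD:
  assumes "fd_hilbert_space X"
  shows "inner_product_space X" "\<exists>S. finite_spanning X S" "orthonormal_basis X (some_onb X)"
proof -
  show 1: "inner_product_space X" and 2: "\<exists>S. finite_spanning X S"
    using assms by (auto simp: fd_hilbert_space_def)
  show "orthonormal_basis X (some_onb X)"
    using inner_product_space.finite_spanning_basis[OF 1] 2 unfolding some_onb_def
    by (metis someI_ex)
qed

lemma orthonormal_basisD:
  assumes "inner_product_space X" "orthonormal_basis X B"
  shows "finite B" "\<And>b. b \<in> B \<Longrightarrow> b \<in> carrier X"
    "\<And>e f. e \<in> B \<Longrightarrow> f \<in> B \<Longrightarrow> ip X e f = (if e = f then 1 else 0)"
    "\<And>x y. x \<in> carrier X \<Longrightarrow> y \<in> carrier X \<Longrightarrow> ip X x y = (\<Sum>b\<in>B. ip X x b * ip X b y)"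
  using assms(2) unfolding inner_product_space.orthonormal_basis_iff[OF assms(1)]
  by (auto simp: orthonormal_def expands_def)

section \<open>Operators between inner product spaces\<close>

definition linear_op :: "'v hilb \<Rightarrow> 'w hilb \<Rightarrow> ('v \<Rightarrow> 'w) \<Rightarrow> bool" where
  "linear_op H K a \<longleftrightarrow> a \<in> carrier H \<rightarrow>\<^sub>E carrier K \<and>
     (\<forall>x\<in>carrier H. \<forall>y\<in>carrier H. a (x \<oplus>\<^bsub>H\<^esub> y) = a x \<oplus>\<^bsub>K\<^esub> a y) \<and>
     (\<forall>c. \<forall>x\<in>carrier H. a (c \<odot>\<^bsub>H\<^esub> x) = c \<odot>\<^bsub>K\<^esub> a x)"

lemma linear_opI:
  assumes "\<And>x. x \<in> carrier H \<Longrightarrow> a x \<in> carrier K" "\<And>x. x \<notin> carrier H \<Longrightarrow> a x = undefined"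
    "\<And>x y. x \<in> carrier H \<Longrightarrow> y \<in> carrier H \<Longrightarrow> a (x \<oplus>\<^bsub>H\<^esub> y) = a x \<oplus>\<^bsub>K\<^esub> a y"
    "\<And>c x. x \<in> carrier H \<Longrightarrow> a (c \<odot>\<^bsub>H\<^esub> x) = c \<odot>\<^bsub>K\<^esub> a x"
  shows "linear_op H K a"
  using assms by (auto simp: linear_op_def PiE_def extensional_def)

lemma bounded_ops_iff:
  "a \<in> bounded_ops H K \<longleftrightarrow> linear_op H K a \<and> (\<exists>C. \<forall>x\<in>carrier H. hnorm K (a x) \<le> C * hnorm H x)"
  by (auto simp: bounded_ops_def linear_op_def)

lemma linear_opD:
  assumes "linear_op H K a"
  shows "x \<in> carrier H \<Longrightarrow> a x \<in> carrier K" "x \<notin> carrier H \<Longrightarrow> a x = undefined"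
    "x \<in> carrier H \<Longrightarrow> y \<in> carrier H \<Longrightarrow> a (x \<oplus>\<^bsub>H\<^esub> y) = a x \<oplus>\<^bsub>K\<^esub> a y"
    "x \<in> carrier H \<Longrightarrow> a (c \<odot>\<^bsub>H\<^esub> x) = c \<odot>\<^bsub>K\<^esub> a x"
  using assms by (auto simp: linear_op_def PiE_def extensional_def)

lemma bounded_opsD:
  assumes "a \<in> bounded_ops H K"
  shows "x \<in> carrier H \<Longrightarrow> a x \<in> carrier K" "x \<notin> carrier H \<Longrightarrow> a x = undefined"
    "x \<in> carrier H \<Longrightarrow> y \<in> carrier H \<Longrightarrow> a (x \<oplus>\<^bsub>H\<^esub> y) = a x \<oplus>\<^bsub>K\<^esub> a y"
    "x \<in> carrier H \<Longrightarrow> a (c \<odot>\<^bsub>H\<^esub> x) = c \<odot>\<^bsub>K\<^esub> a x"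
  using assms linear_opD[of H K a] by (auto simp: bounded_ops_iff)

lemma op_ext:
  assumes "a \<in> bounded_ops H K" "b \<in> bounded_ops H K" "\<And>x. x \<in> carrier H \<Longrightarrow> a x = b x"
  shows "a = b"
proof
  fix x show "a x = b x"
    using assms(3)[of x] bounded_opsD(2)[OF assms(1), of x] bounded_opsD(2)[OF assms(2), of x]
    by (cases "x \<in> carrier H") auto
qed

lemma bounded_ops_bound:
  assumes "a \<in> bounded_ops H K" "inner_product_space H"
  obtains C where "C \<ge> 0" "\<And>x. x \<in> carrier H \<Longrightarrow> hnorm K (a x) \<le> C * hnorm H x"
proof -
  obtain C where C: "\<And>x. x \<in> carrier H \<Longrightarrow> hnorm K (a x) \<le> C * hnorm H x"
    using assms(1) by (auto simp: bounded_ops_iff)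
  have "hnorm K (a x) \<le> max C 0 * hnorm H x" if x: "x \<in> carrier H" for x
    using C[OF x] mult_right_mono[OF _ inner_product_space.hnorm_ge_0[OF assms(2) x], of C "max C 0"]
    by simp
  then show thesis by (intro that[of "max C 0"]) auto
qed

lemma linear_op_zero:
  assumes "linear_op H K a" "inner_product_space H" "inner_product_space K"
  shows "a \<zero>\<^bsub>H\<^esub> = \<zero>\<^bsub>K\<^esub>"
proof -
  interpret H: inner_product_space H by fact
  interpret K: inner_product_space K by fact
  have "a (0 \<odot>\<^bsub>H\<^esub> \<zero>\<^bsub>H\<^esub>) = 0 \<odot>\<^bsub>K\<^esub> a \<zero>\<^bsub>H\<^esub>" by (rule linear_opD(4)[OF assms(1)]) simp
  then show ?thesis using linear_opD(1)[OF assms(1), of "\<zero>\<^bsub>H\<^esub>"] by simp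
qed

lemma linear_op_finsum:
  assumes "linear_op H K a" "inner_product_space H" "inner_product_space K"
    and "finite S" "\<And>s. s \<in> S \<Longrightarrow> f s \<in> carrier H" "k \<in> carrier K"
  shows "ip K k (a (\<Oplus>\<^bsub>H\<^esub>s\<in>S. f s)) = (\<Sum>s\<in>S. ip K k (a (f s)))"
proof -
  interpret H: inner_product_space H by fact
  interpret K: inner_product_space K by fact
  note a = linear_opD[OF assms(1)]
  show ?thesis using assms(4,5)
  proof (induction)
    case (insert s S)
    then have "f \<in> S \<rightarrow> carrier H" "f s \<in> carrier H" by auto
    then show ?case using insert assms(6) a(1,3) by (simp add: H.finsum_insert K.ip_add_right)
  qed (use linear_op_zero[OF assms(1-3)] assms(6) in simp)
qed

lemma linear_op_expand:
  assumes a: "linear_op H K a" and H: "inner_product_space H" and K: "inner_product_space K"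
    and B: "orthonormal_basis H B" and x: "x \<in> carrier H" and k: "k \<in> carrier K"
  shows "ip K k (a x) = (\<Sum>b\<in>B. ip H b x * ip K k (a b))"
proof -
  interpret H: inner_product_space H by fact
  interpret K: inner_product_space K by fact
  note aD = linear_opD[OF a]
  note BD = orthonormal_basisD(1-3)[OF H B]
  have "x = (\<Oplus>\<^bsub>H\<^esub>b\<in>B. ip H b x \<odot>\<^bsub>H\<^esub> b)"
    using B x H.expands_finsum[of B x] by (auto simp: H.orthonormal_basis_iff)
  then have "ip K k (a x) = ip K k (a (\<Oplus>\<^bsub>H\<^esub>b\<in>B. ip H b x \<odot>\<^bsub>H\<^esub> b))" by simp
  also have "\<dots> = (\<Sum>b\<in>B. ip K k (a (ip H b x \<odot>\<^bsub>H\<^esub> b)))"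
    by (rule linear_op_finsum[OF a H K]) (use BD(1,2) k in auto)
  also have "\<dots> = (\<Sum>b\<in>B. ip H b x * ip K k (a b))"
    by (rule sum.cong) (use BD(2) k aD(1,4) in \<open>auto simp: K.ip_smult_right\<close>)
  finally show ?thesis .
qed

lemma linear_op_eqI:
  assumes "linear_op H K a" "linear_op H K b" "inner_product_space H" "inner_product_space K"
    "orthonormal_basis H B" "\<And>e. e \<in> B \<Longrightarrow> a e = b e"
  shows "a = b"
proof
  interpret K: inner_product_space K by fact
  note aD = linear_opD[OF assms(1)] and bD = linear_opD[OF assms(2)]
  fix x
  show "a x = b x"
  proof (cases "x \<in> carrier H")
    case True
    show ?thesis
    proof (rule K.ip_ext)
      fix z assume z: "z \<in> carrier K"
      show "ip K z (a x) = ip K z (b x)"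
        using linear_op_expand[OF assms(1,3,4,5) True z] linear_op_expand[OF assms(2,3,4,5) True z]
          assms(6) by simp
    qed (use aD(1) bD(1) True in auto)
  qed (use aD(2) bD(2) in simp)
qed

text \<open>Expand \<open>\<langle>a x|a x\<rangle>\<close> in the values of \<open>a\<close> on an orthonormal basis and estimate each term by
  Cauchy-Schwarz: the sum of the norms of these values bounds \<open>a\<close>.\<close>

lemma linear_op_bounded:
  assumes a: "linear_op H K a" and H: "fd_hilbert_space H" and K: "inner_product_space K"
  shows "a \<in> bounded_ops H K"
proof -
  note Hi = fd_hilbert_spaceD(1)[OF H] and B = fd_hilbert_spaceD(3)[OF H]
  interpret H: inner_product_space H by fact
  interpret K: inner_product_space K by fact
  let ?B = "some_onb H"
  note aD = linear_opD[OF a]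
  note BD = orthonormal_basisD(1-3)[OF Hi B]
  define C where "C = (\<Sum>b\<in>?B. hnorm K (a b))"
  have "hnorm K (a x) \<le> C * hnorm H x" if x: "x \<in> carrier H" for x
  proof (cases "hnorm K (a x) = 0")
    case True
    then show ?thesis using x BD aD by (auto simp: C_def intro!: sum_nonneg mult_nonneg_nonneg)
  next
    case False
    then have pos: "hnorm K (a x) > 0" using K.hnorm_ge_0[OF aD(1)[OF x]] by simp
    have "(hnorm K (a x))\<^sup>2 = cmod (ip K (a x) (a x))"
      unfolding K.ip_self[OF aD(1)[OF x]] by (simp only: norm_of_real) simp
    also have "\<dots> = cmod (\<Sum>b\<in>?B. ip H b x * ip K (a x) (a b))"
      using linear_op_expand[OF a Hi K B x aD(1)[OF x]] by simp
    also have "\<dots> \<le> (\<Sum>b\<in>?B. hnorm H x * (hnorm K (a x) * hnorm K (a b)))"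
    proof (rule sum_norm_le)
      fix b assume b: "b \<in> ?B"
      then have bc: "b \<in> carrier H" and "hnorm H b = 1" using BD(2,3) by (auto simp: hnorm_def)
      then have "cmod (ip H b x) \<le> hnorm H x" using H.Cauchy_Schwarz[of b x] x by simp
      then show "cmod (ip H b x * ip K (a x) (a b)) \<le> hnorm H x * (hnorm K (a x) * hnorm K (a b))"
        unfolding norm_mult
        by (rule mult_mono) (use K.Cauchy_Schwarz aD(1) bc x in auto)
    qed
    also have "\<dots> = hnorm K (a x) * (C * hnorm H x)"
      by (simp add: C_def sum_distrib_left sum_distrib_right mult_ac)
    finally show ?thesis using pos by (simp add: power2_eq_square)
  qed
  then show ?thesis using a by (auto simp: bounded_ops_iff)
qed

lemma bounded_op_expand:
  assumes "a \<in> bounded_ops H K" "inner_product_space H" "inner_product_space K"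
    "orthonormal_basis H B" "x \<in> carrier H" "k \<in> carrier K"
  shows "ip K k (a x) = (\<Sum>b\<in>B. ip H b x * ip K k (a b))"
  using linear_op_expand[of H K a] assms by (simp add: bounded_ops_iff)

lemma compose_bounded_ops:
  assumes a: "a \<in> bounded_ops K L" and b: "b \<in> bounded_ops H K"
    and H: "inner_product_space H" and K: "inner_product_space K"
  shows "compose (carrier H) a b \<in> bounded_ops H L"
proof -
  interpret H: inner_product_space H by fact
  note aD = bounded_opsD[OF a] and bD = bounded_opsD[OF b]
  obtain C where C: "C \<ge> 0" "\<And>x. x \<in> carrier K \<Longrightarrow> hnorm L (a x) \<le> C * hnorm K x"
    using bounded_ops_bound[OF a K] by blast
  obtain D where D: "\<And>x. x \<in> carrier H \<Longrightarrow> hnorm K (b x) \<le> D * hnorm H x"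
    using b by (auto simp: bounded_ops_iff)
  have "linear_op H L (compose (carrier H) a b)"
    by (rule linear_opI) (use aD bD in \<open>auto simp: compose_def\<close>)
  moreover have "hnorm L (compose (carrier H) a b x) \<le> (C * D) * hnorm H x" if x: "x \<in> carrier H" for x
  proof -
    have "hnorm L (a (b x)) \<le> C * hnorm K (b x)" using C(2) bD(1)[OF x] .
    also have "\<dots> \<le> C * (D * hnorm H x)" using C(1) D[OF x] by (rule mult_left_mono[rotated])
    finally show ?thesis using x by (simp add: compose_def)
  qed
  ultimately show ?thesis by (auto simp: bounded_ops_iff)
qed

lemma id_bounded_ops: "inner_product_space H \<Longrightarrow> (\<lambda>x\<in>carrier H. x) \<in> bounded_ops H H"
proof -
  assume "inner_product_space H"
  then interpret inner_product_space H .
  have "linear_op H H (\<lambda>x\<in>carrier H. x)" by (rule linear_opI) auto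
  moreover have "\<forall>x\<in>carrier H. hnorm H ((\<lambda>x\<in>carrier H. x) x) \<le> 1 * hnorm H x" by simp
  ultimately show ?thesis unfolding bounded_ops_iff by blast
qed

subsection \<open>Subspaces of operators\<close>

lemma op_space_simps [simp]:
  "carrier (op_space H K) = bounded_ops H K"
  "zero (op_space H K) = (\<lambda>x\<in>carrier H. \<zero>\<^bsub>K\<^esub>)"
  "add (op_space H K) = (\<lambda>a b. \<lambda>x\<in>carrier H. a x \<oplus>\<^bsub>K\<^esub> b x)"
  "smult (op_space H K) = (\<lambda>c a. \<lambda>x\<in>carrier H. c \<odot>\<^bsub>K\<^esub> a x)"
  by (simp_all add: op_space_def)

lemma module_op_space:
  assumes H: "inner_product_space H" and K: "inner_product_space K"
  shows "module complex_ring (op_space H K)"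
proof -
  interpret H: inner_product_space H by fact
  interpret K: inner_product_space K by fact
  have add: "(\<lambda>x\<in>carrier H. a x \<oplus>\<^bsub>K\<^esub> b x) \<in> bounded_ops H K"
    if a: "a \<in> bounded_ops H K" and b: "b \<in> bounded_ops H K" for a b
  proof -
    note aD = bounded_opsD[OF a] and bD = bounded_opsD[OF b]
    obtain C where C: "\<And>x. x \<in> carrier H \<Longrightarrow> hnorm K (a x) \<le> C * hnorm H x"
      using a by (auto simp: bounded_ops_iff)
    obtain D where D: "\<And>x. x \<in> carrier H \<Longrightarrow> hnorm K (b x) \<le> D * hnorm H x"
      using b by (auto simp: bounded_ops_iff)
    have "linear_op H K (\<lambda>x\<in>carrier H. a x \<oplus>\<^bsub>K\<^esub> b x)"
      by (rule linear_opI) (use aD bD in \<open>auto simp: K.smult_r_distr K.M.a_ac\<close>)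
    moreover have "hnorm K (a x \<oplus>\<^bsub>K\<^esub> b x) \<le> (C + D) * hnorm H x" if x: "x \<in> carrier H" for x
      using C[OF x] D[OF x] K.hnorm_add_le[of "a x" "b x"] aD(1)[OF x] bD(1)[OF x]
      by (simp add: algebra_simps)
    ultimately show ?thesis by (auto simp: bounded_ops_iff)
  qed
  have smult: "(\<lambda>x\<in>carrier H. c \<odot>\<^bsub>K\<^esub> a x) \<in> bounded_ops H K" if a: "a \<in> bounded_ops H K" for c a
  proof -
    note aD = bounded_opsD[OF a]
    obtain C where C: "\<And>x. x \<in> carrier H \<Longrightarrow> hnorm K (a x) \<le> C * hnorm H x"
      using a by (auto simp: bounded_ops_iff)
    have "linear_op H K (\<lambda>x\<in>carrier H. c \<odot>\<^bsub>K\<^esub> a x)"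
      by (rule linear_opI)
        (use aD in \<open>auto simp: K.smult_r_distr K.smult_smult mult.commute\<close>)
    moreover have "hnorm K (c \<odot>\<^bsub>K\<^esub> a x) \<le> (cmod c * C) * hnorm H x" if x: "x \<in> carrier H" for x
      using mult_left_mono[OF C[OF x], of "cmod c"] K.hnorm_smult aD(1)[OF x] by (simp add: mult.assoc)
    ultimately show ?thesis by (auto simp: bounded_ops_iff)
  qed
  have zero: "(\<lambda>x\<in>carrier H. \<zero>\<^bsub>K\<^esub>) \<in> bounded_ops H K"
  proof -
    have "linear_op H K (\<lambda>x\<in>carrier H. \<zero>\<^bsub>K\<^esub>)" by (rule linear_opI) auto
    moreover have "\<forall>x\<in>carrier H. hnorm K ((\<lambda>x\<in>carrier H. \<zero>\<^bsub>K\<^esub>) x) \<le> 0 * hnorm H x" by simp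
    ultimately show ?thesis unfolding bounded_ops_iff by blast
  qed
  show ?thesis
  proof (rule moduleI)
    show "cring complex_ring" by (rule cring_complex_ring)
    show "abelian_group (op_space H K)"
    proof (rule abelian_groupI)
      fix a assume a: "a \<in> carrier (op_space H K)"
      show "\<exists>b\<in>carrier (op_space H K). b \<oplus>\<^bsub>op_space H K\<^esub> a = \<zero>\<^bsub>op_space H K\<^esub>"
      proof (rule bexI[of _ "\<lambda>x\<in>carrier H. (-1) \<odot>\<^bsub>K\<^esub> a x"])
        have "(- 1) \<odot>\<^bsub>K\<^esub> y \<oplus>\<^bsub>K\<^esub> y = \<zero>\<^bsub>K\<^esub>" if "y \<in> carrier K" for y
          using K.smult_l_distr[of "-1" 1 y] that by simp
        then show "(\<lambda>x\<in>carrier H. (-1) \<odot>\<^bsub>K\<^esub> a x) \<oplus>\<^bsub>op_space H K\<^esub> a = \<zero>\<^bsub>op_space H K\<^esub>"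
          using a bounded_opsD(1)[of a] by (auto intro!: restrict_ext)
      qed (use a smult in simp)
    next
      fix a assume a: "a \<in> carrier (op_space H K)"
      note aD = bounded_opsD(1,2)[OF a[simplified]]
      show "\<zero>\<^bsub>op_space H K\<^esub> \<oplus>\<^bsub>op_space H K\<^esub> a = a"
        using aD by (auto intro!: ext)
    qed (use add zero bounded_opsD(1,2)[where H = H and K = K] in
        \<open>auto intro!: restrict_ext ext simp: K.M.a_ac\<close>)
    fix c d a b assume a: "a \<in> carrier (op_space H K)" and b: "b \<in> carrier (op_space H K)"
    note aD = bounded_opsD[OF a[simplified]] and bD = bounded_opsD[OF b[simplified]]
    show "c \<odot>\<^bsub>op_space H K\<^esub> a \<in> carrier (op_space H K)" using a smult by simp
    show "(c \<oplus>\<^bsub>complex_ring\<^esub> d) \<odot>\<^bsub>op_space H K\<^esub> a =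
      c \<odot>\<^bsub>op_space H K\<^esub> a \<oplus>\<^bsub>op_space H K\<^esub> d \<odot>\<^bsub>op_space H K\<^esub> a"
      using aD K.smult_l_distr[of c d] by (auto intro!: restrict_ext)
    show "c \<odot>\<^bsub>op_space H K\<^esub> (a \<oplus>\<^bsub>op_space H K\<^esub> b) =
      c \<odot>\<^bsub>op_space H K\<^esub> a \<oplus>\<^bsub>op_space H K\<^esub> c \<odot>\<^bsub>op_space H K\<^esub> b"
      using aD bD by (auto intro!: restrict_ext simp: K.smult_r_distr)
    show "(c \<otimes>\<^bsub>complex_ring\<^esub> d) \<odot>\<^bsub>op_space H K\<^esub> a = c \<odot>\<^bsub>op_space H K\<^esub> (d \<odot>\<^bsub>op_space H K\<^esub> a)"
      using aD K.smult_assoc1[of c d] by (auto intro!: restrict_ext)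
    show "\<one>\<^bsub>complex_ring\<^esub> \<odot>\<^bsub>op_space H K\<^esub> a = a"
      using aD by (auto intro!: ext)
  qed
qed

lemma op_subspace_iff:
  assumes "inner_product_space H" "inner_product_space K"
  shows "op_subspace H K W \<longleftrightarrow> W \<subseteq> bounded_ops H K \<and> (\<lambda>x\<in>carrier H. \<zero>\<^bsub>K\<^esub>) \<in> W \<and>
     (\<forall>a\<in>W. \<forall>b\<in>W. (\<lambda>x\<in>carrier H. a x \<oplus>\<^bsub>K\<^esub> b x) \<in> W) \<and>
     (\<forall>c. \<forall>a\<in>W. (\<lambda>x\<in>carrier H. c \<odot>\<^bsub>K\<^esub> a x) \<in> W)"
  unfolding op_subspace_def complex_submodule_iff[OF module_op_space[OF assms]] by simp

lemma op_subspace_bounded_ops: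
  assumes "inner_product_space H" "inner_product_space K"
  shows "op_subspace H K (bounded_ops H K)"
  using module.carrier_is_submodule[OF module_op_space[OF assms]] by (simp add: op_subspace_def)

lemma op_span_inc: "a \<in> S \<Longrightarrow> a \<in> op_span H K S"
  unfolding op_span_def by (rule hull_inc)

lemma op_span_minimal: "S \<subseteq> W \<Longrightarrow> op_subspace H K W \<Longrightarrow> op_span H K S \<subseteq> W"
  unfolding op_span_def by (rule hull_minimal)

lemma op_subspace_op_span:
  assumes H: "inner_product_space H" and K: "inner_product_space K" and S: "S \<subseteq> bounded_ops H K"
  shows "op_subspace H K (op_span H K S)"
proof -
  have "op_span H K S \<subseteq> bounded_ops H K"
    by (rule op_span_minimal[OF S op_subspace_bounded_ops[OF H K]])
  then show ?thesis
    unfolding op_subspace_iff[OF H K] unfolding op_span_def hull_def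
    by (auto simp: op_subspace_iff[OF H K])
qed

lemma op_subspace_Int:
  "\<lbrakk>inner_product_space H; inner_product_space K; op_subspace H K V; op_subspace H K W\<rbrakk>
    \<Longrightarrow> op_subspace H K (V \<inter> W)"
  by (auto simp: op_subspace_iff)

subsection \<open>Adjoints\<close>

lemma adj_eqI:
  assumes H: "inner_product_space H" and b: "b \<in> bounded_ops K H"
    and ab: "\<And>x y. x \<in> carrier H \<Longrightarrow> y \<in> carrier K \<Longrightarrow> ip K y (a x) = ip H (b y) x"
  shows "adj H K a = b"
  unfolding adj_def
proof (rule the_equality)
  interpret H: inner_product_space H by fact
  show "b \<in> bounded_ops K H \<and> (\<forall>x\<in>carrier H. \<forall>y\<in>carrier K. ip K y (a x) = ip H (b y) x)"
    using b ab by blast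
  fix b' assume b': "b' \<in> bounded_ops K H \<and> (\<forall>x\<in>carrier H. \<forall>y\<in>carrier K. ip K y (a x) = ip H (b' y) x)"
  show "b' = b"
  proof (rule op_ext[of _ K H])
    fix y assume y: "y \<in> carrier K"
    then have c: "b y \<in> carrier H" "b' y \<in> carrier H" using bounded_opsD(1) b b' by auto
    show "b' y = b y"
    proof (rule H.ip_ext[OF c(2,1)])
      fix z assume z: "z \<in> carrier H"
      have "ip H (b' y) z = ip H (b y) z" using b' ab y z by simp
      then show "ip H z (b' y) = ip H z (b y)" using H.ip_cnj[OF c(1) z] H.ip_cnj[OF c(2) z] by simp
    qed
  qed (use b b' in auto)
qed

text \<open>Linearity follows from the pairing. For the bound, Cauchy-Schwarz is applied to
  \<open>\<langle>b y|b y\<rangle> = \<langle>y|a (b y)\<rangle>\<close>.\<close>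

lemma adjoint_bounded:
  assumes H: "inner_product_space H" and K: "inner_product_space K" and a: "a \<in> bounded_ops H K"
    and b: "\<And>y. y \<in> carrier K \<Longrightarrow> b y \<in> carrier H" "\<And>y. y \<notin> carrier K \<Longrightarrow> b y = undefined"
    and ab: "\<And>x y. x \<in> carrier H \<Longrightarrow> y \<in> carrier K \<Longrightarrow> ip K y (a x) = ip H (b y) x"
  shows "b \<in> bounded_ops K H"
proof -
  interpret H: inner_product_space H by fact
  interpret K: inner_product_space K by fact
  note aD = bounded_opsD[OF a]
  have ba: "ip H x (b y) = ip K (a x) y" if "x \<in> carrier H" "y \<in> carrier K" for x y
    using ab[OF that] that b(1) H.ip_cnj[of "b y" x] K.ip_cnj[of y "a x"] aD(1) by simp
  have "linear_op K H b"
  proof (rule linear_opI)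
    fix x y assume "x \<in> carrier K" "y \<in> carrier K"
    then show "b (x \<oplus>\<^bsub>K\<^esub> y) = b x \<oplus>\<^bsub>H\<^esub> b y"
      using b(1) aD(1) by (intro H.ip_ext) (auto simp: ba H.ip_add_right K.ip_add_right)
  next
    fix c x assume "x \<in> carrier K"
    then show "b (c \<odot>\<^bsub>K\<^esub> x) = c \<odot>\<^bsub>H\<^esub> b x"
      using b(1) aD(1) by (intro H.ip_ext) (auto simp: ba H.ip_smult_right K.ip_smult_right)
  qed (use b in auto)
  moreover obtain C where C: "C \<ge> 0" "\<And>x. x \<in> carrier H \<Longrightarrow> hnorm K (a x) \<le> C * hnorm H x"
    using bounded_ops_bound[OF a H] by blast
  have "hnorm H (b y) \<le> C * hnorm K y" if y: "y \<in> carrier K" for y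
  proof (cases "hnorm H (b y) = 0")
    case True
    then show ?thesis using C(1) y by simp
  next
    case False
    then have pos: "hnorm H (b y) > 0" using H.hnorm_ge_0[OF b(1)[OF y]] by simp
    have "(hnorm H (b y))\<^sup>2 = cmod (ip H (b y) (b y))"
      unfolding H.ip_self[OF b(1)[OF y]] by (simp only: norm_of_real) simp
    also have "\<dots> = cmod (ip K y (a (b y)))" using ab b(1) y by simp
    also have "\<dots> \<le> hnorm K y * hnorm K (a (b y))" by (rule K.Cauchy_Schwarz) (use y b aD in auto)
    also have "\<dots> \<le> hnorm K y * (C * hnorm H (b y))" by (rule mult_left_mono) (use C b y in auto)
    finally have "hnorm H (b y) * hnorm H (b y) \<le> hnorm H (b y) * (C * hnorm K y)"
      by (simp add: power2_eq_square mult_ac)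
    then show ?thesis using pos by simp
  qed
  ultimately show ?thesis by (auto simp: bounded_ops_iff)
qed

lemma adj_fd:
  assumes H: "fd_hilbert_space H" and K: "inner_product_space K" and a: "a \<in> bounded_ops H K"
  shows "adj H K a \<in> bounded_ops K H"
    "x \<in> carrier H \<Longrightarrow> y \<in> carrier K \<Longrightarrow> ip K y (a x) = ip H (adj H K a y) x"
proof -
  note Hi = fd_hilbert_spaceD(1)[OF H] and B = fd_hilbert_spaceD(3)[OF H]
  interpret H: inner_product_space H by fact
  interpret K: inner_product_space K by fact
  let ?B = "some_onb H"
  note aD = bounded_opsD[OF a]
  note BD = orthonormal_basisD(1-3)[OF Hi B]
  define b where "b = (\<lambda>y\<in>carrier K. \<Oplus>\<^bsub>H\<^esub>e\<in>?B. ip K (a e) y \<odot>\<^bsub>H\<^esub> e)"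
  have bc: "b y \<in> carrier H" if "y \<in> carrier K" for y
    using that BD by (auto simp: b_def intro!: H.finsum_mem)
  have ab: "ip K y (a x) = ip H (b y) x" if x: "x \<in> carrier H" and y: "y \<in> carrier K" for x y
  proof -
    have "ip H (b y) x = (\<Sum>e\<in>?B. ip H (ip K (a e) y \<odot>\<^bsub>H\<^esub> e) x)"
      unfolding b_def using x y BD by (simp add: H.ip_finsum_left)
    also have "\<dots> = (\<Sum>e\<in>?B. ip H e x * ip K y (a e))"
      by (rule sum.cong) (use x y BD aD in \<open>auto simp: H.ip_smult_left K.cnj_ip\<close>)
    also have "\<dots> = ip K y (a x)" using bounded_op_expand[OF a Hi K B x y] by simp
    finally show ?thesis by simp
  qed
  have bb: "b \<in> bounded_ops K H"
    by (rule adjoint_bounded[OF Hi K a bc _ ab]) (auto simp: b_def)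
  have "adj H K a = b" by (rule adj_eqI[OF Hi bb ab])
  then show "adj H K a \<in> bounded_ops K H"
    "x \<in> carrier H \<Longrightarrow> y \<in> carrier K \<Longrightarrow> ip K y (a x) = ip H (adj H K a y) x"
    using bb ab by auto
qed

subsection \<open>The Hilbert-Schmidt inner product\<close>

lemma hs_ip_some_onb:
  assumes X: "fd_hilbert_space X" and Y: "inner_product_space Y"
    and a: "a \<in> bounded_ops X Y" and b: "b \<in> bounded_ops X Y"
  shows "hs_ip X Y a b = (\<Sum>e\<in>some_onb X. ip Y (a e) (b e))"
  unfolding hs_ip_def trace_op_def
proof (rule sum.cong)
  fix e assume "e \<in> some_onb X"
  then have e: "e \<in> carrier X"
    using orthonormal_basisD(2)[OF fd_hilbert_spaceD(1,3)[OF X]] by blast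
  interpret X: inner_product_space X by (rule fd_hilbert_spaceD(1)[OF X])
  interpret Y: inner_product_space Y by fact
  note ae = bounded_opsD(1)[OF a e] and be = bounded_opsD(1)[OF b e]
  show "ip X e (compose (carrier X) (adj X Y a) b e) = ip Y (a e) (b e)"
    using adj_fd[OF X Y a] e ae be X.ip_cnj[of "adj X Y a (b e)" e] Y.ip_cnj[of "b e" "a e"]
      bounded_opsD(1)[OF adj_fd(1)[OF X Y a] be]
    by (simp add: compose_def)
qed simp

text \<open>Both sides equal \<open>\<Sum>\<^sub>e \<Sum>\<^sub>f \<langle>f|e\<rangle> \<langle>a e|b f\<rangle>\<close>, by expansion of \<open>b e\<close> in the values \<open>b f\<close> or of \<open>a f\<close> in the
  values \<open>a e\<close>.\<close>

lemma hs_ip_onb: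
  assumes X: "fd_hilbert_space X" and Y: "inner_product_space Y"
    and a: "a \<in> bounded_ops X Y" and b: "b \<in> bounded_ops X Y" and B: "orthonormal_basis X B"
  shows "hs_ip X Y a b = (\<Sum>e\<in>B. ip Y (a e) (b e))"
proof -
  note Xi = fd_hilbert_spaceD(1)[OF X] and E = fd_hilbert_spaceD(3)[OF X]
  interpret X: inner_product_space X by fact
  interpret Y: inner_product_space Y by fact
  note ED = orthonormal_basisD(1-3)[OF Xi E] and BD = orthonormal_basisD(1-3)[OF Xi B]
  note aD = bounded_opsD[OF a] and bD = bounded_opsD[OF b]
  have "hs_ip X Y a b = (\<Sum>e\<in>some_onb X. \<Sum>f\<in>B. ip X f e * ip Y (a e) (b f))"
    unfolding hs_ip_some_onb[OF X Y a b]
    by (rule sum.cong) (use bounded_op_expand[OF b Xi Y B] ED aD in auto)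
  also have "\<dots> = (\<Sum>f\<in>B. \<Sum>e\<in>some_onb X. ip X f e * ip Y (a e) (b f))" by (rule sum.swap)
  also have "\<dots> = (\<Sum>f\<in>B. ip Y (a f) (b f))"
  proof (rule sum.cong)
    fix f assume "f \<in> B"
    then have f: "f \<in> carrier X" using BD by auto
    have "ip Y (b f) (a f) = (\<Sum>e\<in>some_onb X. ip X e f * ip Y (b f) (a e))"
      by (rule bounded_op_expand[OF a Xi Y E]) (use f bD in auto)
    then have "cnj (ip Y (b f) (a f)) = (\<Sum>e\<in>some_onb X. cnj (ip X e f) * cnj (ip Y (b f) (a e)))"
      by simp
    also have "\<dots> = (\<Sum>e\<in>some_onb X. ip X f e * ip Y (a e) (b f))"
      by (rule sum.cong) (use f ED aD bD in \<open>auto simp: X.cnj_ip Y.cnj_ip\<close>)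
    finally show "(\<Sum>e\<in>some_onb X. ip X f e * ip Y (a e) (b f)) = ip Y (a f) (b f)"
      using f aD bD by (simp add: Y.cnj_ip)
  qed simp
  finally show ?thesis .
qed

definition hs_space :: "'v hilb \<Rightarrow> 'w hilb \<Rightarrow> ('v \<Rightarrow> 'w) hilb" where
  "hs_space X Y = \<lparr>carrier = bounded_ops X Y, mult = undefined, one = undefined,
     zero = (\<lambda>x\<in>carrier X. \<zero>\<^bsub>Y\<^esub>), add = (\<lambda>a b. \<lambda>x\<in>carrier X. a x \<oplus>\<^bsub>Y\<^esub> b x),
     smult = (\<lambda>c a. \<lambda>x\<in>carrier X. c \<odot>\<^bsub>Y\<^esub> a x), ip = hs_ip X Y\<rparr>"

lemma hs_space_simps [simp]:
  "carrier (hs_space H K) = bounded_ops H K"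
  "zero (hs_space H K) = (\<lambda>x\<in>carrier H. \<zero>\<^bsub>K\<^esub>)"
  "add (hs_space H K) = (\<lambda>a b. \<lambda>x\<in>carrier H. a x \<oplus>\<^bsub>K\<^esub> b x)"
  "smult (hs_space H K) = (\<lambda>c a. \<lambda>x\<in>carrier H. c \<odot>\<^bsub>K\<^esub> a x)"
  "ip (hs_space H K) = hs_ip H K"
  by (simp_all add: hs_space_def)

lemma module_hs_space:
  assumes "inner_product_space H" "inner_product_space K"
  shows "module complex_ring (hs_space H K)"
proof -
  interpret M: module complex_ring "op_space H K" by (rule module_op_space[OF assms])
  have eq: "carrier (hs_space H K) = carrier (op_space H K)" "zero (hs_space H K) = zero (op_space H K)"
    "add (hs_space H K) = add (op_space H K)" "smult (hs_space H K) = smult (op_space H K)"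
    by simp_all
  show ?thesis
  proof (rule moduleI)
    show "abelian_group (hs_space H K)"
      by (rule abelian_groupI; unfold eq)
        (auto intro: M.M.a_closed M.M.a_assoc M.M.a_comm M.M.l_neg M.M.a_inv_closed
          simp del: op_space_simps)
  qed (unfold eq, auto simp: cring_complex_ring M.smult_r_distr M.smult_l_distr M.smult_assoc1 M.smult_one
      simp del: op_space_simps complex_ring_simps(3-5))
qed

lemma inner_product_hs_space:
  assumes X: "fd_hilbert_space X" and Y: "inner_product_space Y"
  shows "inner_product_space (hs_space X Y)"
proof -
  note Xi = fd_hilbert_spaceD(1)[OF X] and E = fd_hilbert_spaceD(3)[OF X]
  interpret X: inner_product_space X by fact
  interpret Y: inner_product_space Y by fact
  interpret M: module complex_ring "hs_space X Y" by (rule module_hs_space[OF Xi Y])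
  note ED = orthonormal_basisD(1-3)[OF Xi E]
  note hs = hs_ip_some_onb[OF X Y]
  show ?thesis
  proof
    fix a b c assume "a \<in> carrier (hs_space X Y)" "b \<in> carrier (hs_space X Y)" "c \<in> carrier (hs_space X Y)"
    then have abc: "a \<in> bounded_ops X Y" "b \<in> bounded_ops X Y" "c \<in> bounded_ops X Y" by auto
    have "(\<lambda>x\<in>carrier X. b x \<oplus>\<^bsub>Y\<^esub> c x) \<in> bounded_ops X Y"
      using M.M.add.m_closed[of b c] abc by simp
    then show "ip (hs_space X Y) a (b \<oplus>\<^bsub>hs_space X Y\<^esub> c) = ip (hs_space X Y) a b + ip (hs_space X Y) a c"
      using abc ED(2) bounded_opsD(1)[OF abc(1)] bounded_opsD(1)[OF abc(2)] bounded_opsD(1)[OF abc(3)]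
      by (auto simp: hs sum.distrib[symmetric] Y.ip_add_right intro!: sum.cong)
  next
    fix a b c assume "a \<in> carrier (hs_space X Y)" "b \<in> carrier (hs_space X Y)"
    then have abc: "a \<in> bounded_ops X Y" "b \<in> bounded_ops X Y" by auto
    have "(\<lambda>x\<in>carrier X. c \<odot>\<^bsub>Y\<^esub> b x) \<in> bounded_ops X Y"
      using M.smult_closed[of c b] abc by simp
    then show "ip (hs_space X Y) a (c \<odot>\<^bsub>hs_space X Y\<^esub> b) = c * ip (hs_space X Y) a b"
      using abc ED(2) bounded_opsD(1)[OF abc(1)] bounded_opsD(1)[OF abc(2)]
      by (auto simp: hs sum_distrib_left Y.ip_smult_right intro!: sum.cong)
  next
    fix a b assume "a \<in> carrier (hs_space X Y)" "b \<in> carrier (hs_space X Y)"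
    then have abc: "a \<in> bounded_ops X Y" "b \<in> bounded_ops X Y" by auto
    then show "ip (hs_space X Y) b a = cnj (ip (hs_space X Y) a b)"
      using ED(2) bounded_opsD(1)[OF abc(1)] bounded_opsD(1)[OF abc(2)]
      by (auto simp: hs Y.cnj_ip intro!: sum.cong)
  next
    fix a assume a: "a \<in> carrier (hs_space X Y)" and nz: "a \<noteq> \<zero>\<^bsub>hs_space X Y\<^esub>"
    then have ab: "a \<in> bounded_ops X Y" by simp
    have z: "(\<lambda>x\<in>carrier X. \<zero>\<^bsub>Y\<^esub>) \<in> bounded_ops X Y" using M.M.zero_closed by simp
    have "\<exists>e\<in>some_onb X. a e \<noteq> \<zero>\<^bsub>Y\<^esub>"
    proof (rule ccontr)
      assume "\<not> (\<exists>e\<in>some_onb X. a e \<noteq> \<zero>\<^bsub>Y\<^esub>)"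
      then have "a = (\<lambda>x\<in>carrier X. \<zero>\<^bsub>Y\<^esub>)"
        using ab z ED by (intro linear_op_eqI[OF _ _ Xi Y E]) (auto simp: bounded_ops_iff)
      then show False using nz by simp
    qed
    then obtain e where e: "e \<in> some_onb X" "a e \<noteq> \<zero>\<^bsub>Y\<^esub>" by blast
    have "Re (ip (hs_space X Y) a a) = (\<Sum>e\<in>some_onb X. Re (ip Y (a e) (a e)))"
      using ab by (simp add: hs)
    also have "\<dots> > 0"
      by (rule sum_pos2[OF ED(1) e(1)]) (use e ED bounded_opsD(1)[OF ab] Y.ip_pos in auto)
    finally show "Re (ip (hs_space X Y) a a) > 0" .
  qed
qed

text \<open>The rank-one operator \<open>|y\<rangle>\<langle>x|\<close>.\<close>

definition ketbra :: "'v hilb \<Rightarrow> 'w hilb \<Rightarrow> 'w \<Rightarrow> 'v \<Rightarrow> 'v \<Rightarrow> 'w" where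
  "ketbra X Y y x = (\<lambda>z\<in>carrier X. ip X x z \<odot>\<^bsub>Y\<^esub> y)"

lemma ketbra_bounded:
  assumes X: "inner_product_space X" and Y: "inner_product_space Y"
    and y: "y \<in> carrier Y" and x: "x \<in> carrier X"
  shows "ketbra X Y y x \<in> bounded_ops X Y"
proof -
  interpret X: inner_product_space X by fact
  interpret Y: inner_product_space Y by fact
  have "linear_op X Y (ketbra X Y y x)"
  proof (rule linear_opI)
    fix z w assume "z \<in> carrier X" "w \<in> carrier X"
    then show "ketbra X Y y x (z \<oplus>\<^bsub>X\<^esub> w) = ketbra X Y y x z \<oplus>\<^bsub>Y\<^esub> ketbra X Y y x w"
      using x y Y.smult_l_distr[of "ip X x z" "ip X x w" y] by (simp add: ketbra_def X.ip_add_right)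
  next
    fix c z assume "z \<in> carrier X"
    then show "ketbra X Y y x (c \<odot>\<^bsub>X\<^esub> z) = c \<odot>\<^bsub>Y\<^esub> ketbra X Y y x z"
      using x y Y.smult_assoc1[of c "ip X x z" y] by (simp add: ketbra_def X.ip_smult_right)
  qed (use x y in \<open>auto simp: ketbra_def\<close>)
  moreover have "hnorm Y (ketbra X Y y x z) \<le> (hnorm X x * hnorm Y y) * hnorm X z"
    if z: "z \<in> carrier X" for z
    using mult_right_mono[OF X.Cauchy_Schwarz[OF x z], of "hnorm Y y"] z y x
    by (simp add: ketbra_def Y.hnorm_smult mult_ac)
  ultimately show ?thesis by (auto simp: bounded_ops_iff)
qed

text \<open>The rank-one operators between the elements of two orthonormal bases form an orthonormal basis.\<close>

lemma fd_hs_space: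
  assumes X: "fd_hilbert_space X" and Y: "fd_hilbert_space Y"
  shows "fd_hilbert_space (hs_space X Y)"
proof -
  note Xi = fd_hilbert_spaceD(1)[OF X] and E = fd_hilbert_spaceD(3)[OF X]
  note Yi = fd_hilbert_spaceD(1)[OF Y] and F = fd_hilbert_spaceD(3)[OF Y]
  interpret X: inner_product_space X by fact
  interpret Y: inner_product_space Y by fact
  interpret HS: inner_product_space "hs_space X Y" by (rule inner_product_hs_space[OF X Yi])
  note ED = orthonormal_basisD(1-3)[OF Xi E] and FD = orthonormal_basisD(1-3)[OF Yi F]
  let ?E = "some_onb X" and ?F = "some_onb Y"
  define k where "k = (\<lambda>(e, f). ketbra X Y f e)"
  define B where "B = k ` (?E \<times> ?F)"
  have kb: "k p \<in> bounded_ops X Y" if "p \<in> ?E \<times> ?F" for p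
    using that ED FD by (auto simp: k_def intro!: ketbra_bounded[OF Xi Yi])
  have k_ip: "hs_ip X Y (k (e, f)) a = ip Y f (a e)"
    if e: "e \<in> ?E" and f: "f \<in> ?F" and a: "a \<in> bounded_ops X Y" for e f a
  proof -
    have "hs_ip X Y (k (e, f)) a = (\<Sum>e'\<in>?E. if e = e' then ip Y f (a e') else 0)"
      unfolding hs_ip_some_onb[OF X Yi kb a, of "(e, f)", simplified, OF conjI[OF e f]]
      by (rule sum.cong) (use e f ED FD bounded_opsD(1)[OF a] in
          \<open>auto simp: k_def ketbra_def Y.ip_smult_left\<close>)
    then show ?thesis using e ED by simp
  qed
  have k_on: "hs_ip X Y (k p) (k q) = (if p = q then 1 else 0)"
    if pq': "p \<in> ?E \<times> ?F" "q \<in> ?E \<times> ?F" for p q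
  proof -
    obtain e f e' f' where pq: "p = (e, f)" "q = (e', f')" and ef: "e \<in> ?E" "f \<in> ?F" "e' \<in> ?E" "f' \<in> ?F"
      using pq' by (cases p, cases q) auto
    have "hs_ip X Y (k p) (k q) = ip Y f (ip X e' e \<odot>\<^bsub>Y\<^esub> f')"
      using k_ip[OF ef(1,2) kb[OF pq'(2)]] pq ef ED(2) by (simp add: k_def ketbra_def)
    then show ?thesis using pq ef ED(2,3) FD(2,3) by (simp add: Y.ip_smult_right)
  qed
  have inj: "inj_on k (?E \<times> ?F)"
  proof (rule inj_onI)
    fix p q assume pq: "p \<in> ?E \<times> ?F" "q \<in> ?E \<times> ?F" "k p = k q"
    then show "p = q" using k_on[OF pq(1,2)] k_on[OF pq(1,1)] by (simp split: if_splits)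
  qed
  have "orthonormal_basis (hs_space X Y) B"
    unfolding HS.orthonormal_basis_iff
  proof (intro conjI ballI)
    show "orthonormal (hs_space X Y) B"
      unfolding orthonormal_def
    proof (intro conjI ballI)
      show "finite B" using ED(1) FD(1) by (simp add: B_def)
      show "B \<subseteq> carrier (hs_space X Y)" using kb by (auto simp: B_def)
      fix b c assume "b \<in> B" "c \<in> B"
      then obtain p q where "p \<in> ?E \<times> ?F" "b = k p" "q \<in> ?E \<times> ?F" "c = k q"
        unfolding B_def by blast
      then show "ip (hs_space X Y) b c = (if b = c then 1 else 0)"
        using k_on inj_on_eq_iff[OF inj] by simp
    qed
    fix a assume "a \<in> carrier (hs_space X Y)"
    then have a: "a \<in> bounded_ops X Y" by simp
    show "expands (hs_space X Y) B a" unfolding expands_def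
    proof
      fix c assume "c \<in> carrier (hs_space X Y)"
      then have c: "c \<in> bounded_ops X Y" by simp
      have "(\<Sum>b\<in>B. hs_ip X Y c b * hs_ip X Y b a) =
        (\<Sum>e\<in>?E. \<Sum>f\<in>?F. hs_ip X Y c (k (e, f)) * hs_ip X Y (k (e, f)) a)"
        unfolding B_def by (simp add: sum.reindex[OF inj] sum.cartesian_product split_def)
      also have "\<dots> = (\<Sum>e\<in>?E. \<Sum>f\<in>?F. ip Y (c e) f * ip Y f (a e))"
      proof (intro sum.cong refl)
        fix e f assume ef: "e \<in> ?E" "f \<in> ?F"
        have "hs_ip X Y c (k (e, f)) = cnj (hs_ip X Y (k (e, f)) c)"
          using HS.ip_cnj[of "k (e, f)" c] kb[of "(e, f)"] c ef by simp
        also have "\<dots> = ip Y (c e) f" using k_ip[OF ef c] ef ED FD bounded_opsD(1)[OF c] by (simp add: Y.cnj_ip)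
        finally show "hs_ip X Y c (k (e, f)) * hs_ip X Y (k (e, f)) a = ip Y (c e) f * ip Y f (a e)"
          using k_ip[OF ef a] by simp
      qed
      also have "\<dots> = (\<Sum>e\<in>?E. ip Y (c e) (a e))"
        by (rule sum.cong) (use orthonormal_basisD(4)[OF Yi F] ED(2) bounded_opsD(1)[OF a] bounded_opsD(1)[OF c] in auto)
      finally show "ip (hs_space X Y) c a = (\<Sum>b\<in>B. ip (hs_space X Y) c b * ip (hs_space X Y) b a)"
        using hs_ip_some_onb[OF X Yi c a] by simp
    qed
  qed
  then show ?thesis using HS.inner_product_space_axioms
    by (auto simp: fd_hilbert_space_def orthonormal_basis_def)
qed

lemma submodule_hs_space:
  assumes "inner_product_space H" "inner_product_space K"
  shows "submodule W complex_ring (hs_space H K) \<longleftrightarrow> op_subspace H K W"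
  unfolding complex_submodule_iff[OF module_hs_space[OF assms]] op_subspace_iff[OF assms] by simp

lemma op_subspace_ortho_compl:
  assumes X: "fd_hilbert_space X" and Y: "inner_product_space Y" and W: "W \<subseteq> bounded_ops X Y"
  shows "op_subspace X Y (ortho_compl X Y W)"
proof -
  note Xi = fd_hilbert_spaceD(1)[OF X]
  interpret HS: inner_product_space "hs_space X Y" by (rule inner_product_hs_space[OF X Y])
  show ?thesis
    unfolding submodule_hs_space[OF Xi Y, symmetric] HS.subspace_iff
    using HS.ip_simps(1,3) HS.ip_zero_right HS.M.add.m_closed HS.smult_in HS.M.zero_closed W
    by (auto simp: ortho_compl_def subset_iff)
qed

lemma hs_double_orthogonal:
  assumes X: "fd_hilbert_space X" and Y: "fd_hilbert_space Y" and W: "op_subspace X Y W"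
    and a: "a \<in> bounded_ops X Y"
    and perp: "\<And>s. \<lbrakk>s \<in> bounded_ops X Y; \<And>w. w \<in> W \<Longrightarrow> hs_ip X Y w s = 0\<rbrakk> \<Longrightarrow> hs_ip X Y s a = 0"
  shows "a \<in> W"
proof -
  note Xi = fd_hilbert_spaceD(1)[OF X] and Yi = fd_hilbert_spaceD(1)[OF Y]
  obtain S where "finite_spanning (hs_space X Y) S"
    using fd_hilbert_spaceD(2)[OF fd_hs_space[OF X Y]] by blast
  then show ?thesis
    using inner_product_space.double_orthogonal[OF inner_product_hs_space[OF X Yi], of S W a] W a perp
    by (auto simp: submodule_hs_space[OF Xi Yi])
qed

subsection \<open>Scalars and dual spaces\<close>

lemma complex_hilb_simps [simp]:
  "carrier complex_hilb = UNIV" "zero complex_hilb = 0" "add complex_hilb = (+)"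
  "smult complex_hilb = (*)" "ip complex_hilb x y = cnj x * y"
  by (simp_all add: complex_hilb_def)

lemma fd_complex_hilb: "fd_hilbert_space complex_hilb"
proof -
  have "module complex_ring complex_hilb"
  proof (rule moduleI)
    show "abelian_group complex_hilb"
      by (rule abelian_groupI) (auto intro: exI[of _ "- x" for x] simp: add.assoc add.commute)
  qed (auto simp: cring_complex_ring algebra_simps)
  then interpret module complex_ring complex_hilb .
  have 1: "inner_product_space complex_hilb"
  proof
    fix x :: complex assume "x \<noteq> \<zero>\<^bsub>complex_hilb\<^esub>"
    then have "0 < (cmod x)\<^sup>2" by simp
    then show "Re (ip complex_hilb x x) > 0" unfolding cmod_power2 by (simp add: power2_eq_square)
  qed (auto simp: algebra_simps)
  have "finite_spanning complex_hilb {1}"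
    unfolding finite_spanning_def
  proof (intro conjI ballI)
    fix x :: complex
    show "\<exists>c. x = (\<Oplus>\<^bsub>complex_hilb\<^esub>s\<in>{1}. c s \<odot>\<^bsub>complex_hilb\<^esub> s)"
      by (rule exI[of _ "\<lambda>_. x"]) (simp add: M.finsum_insert)
  qed auto
  with 1 show ?thesis by (auto simp: fd_hilbert_space_def)
qed

lemmas ip_complex_hilb = fd_hilbert_spaceD(1)[OF fd_complex_hilb]

lemma hdual_simps [simp]:
  "carrier (hdual X) = carrier X" "zero (hdual X) = zero X" "add (hdual X) = add X"
  "smult (hdual X) = (\<lambda>c x. smult X (cnj c) x)" "ip (hdual X) = (\<lambda>x y. ip X y x)"
  by (simp_all add: hdual_def)

lemma hdual_hdual [simp]: "hdual (hdual X) = X"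
  by (simp add: hdual_def)

lemma hdual_inject [simp]: "hdual X = hdual Y \<longleftrightarrow> X = Y"
  by (metis hdual_hdual)

lemma finsum_hdual: "finsum (hdual X) f S = finsum X f S"
  by (simp add: finsum_def hdual_def)

lemma inner_product_hdual:
  assumes "inner_product_space X" shows "inner_product_space (hdual X)"
proof -
  interpret inner_product_space X by fact
  have "module complex_ring (hdual X)"
  proof (rule moduleI)
    show "abelian_group (hdual X)"
      using M.abelian_group_axioms
      unfolding abelian_group_def abelian_monoid_def abelian_group_axioms_def by (simp add: hdual_def)
  qed (use smult_l_distr smult_assoc1 smult_r_distr in \<open>auto simp: cring_complex_ring\<close>)
  then interpret D: module complex_ring "hdual X" .
  show ?thesis
    by unfold_locales (auto simp: ip_simps cnj_ip ip_pos)
qed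

lemma fd_hdual:
  assumes "fd_hilbert_space X" shows "fd_hilbert_space (hdual X)"
proof -
  obtain S where S: "finite_spanning X S" using assms by (auto simp: fd_hilbert_space_def)
  have "finite_spanning (hdual X) S"
    unfolding finite_spanning_def
  proof (intro conjI ballI)
    fix x assume "x \<in> carrier (hdual X)"
    then obtain c where "x = (\<Oplus>\<^bsub>X\<^esub>s\<in>S. c s \<odot>\<^bsub>X\<^esub> s)" using S by (auto simp: finite_spanning_def)
    then show "\<exists>c. x = (\<Oplus>\<^bsub>hdual X\<^esub>s\<in>S. c s \<odot>\<^bsub>hdual X\<^esub> s)"
      by (intro exI[of _ "\<lambda>s. cnj (c s)"]) (simp add: finsum_hdual)
  qed (use S in \<open>auto simp: finite_spanning_def\<close>)
  then show ?thesis using assms inner_product_hdual by (auto simp: fd_hilbert_space_def)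
qed

lemma orthonormal_basis_hdual:
  assumes "inner_product_space X" "orthonormal_basis X B" shows "orthonormal_basis (hdual X) B"
proof -
  note BD = orthonormal_basisD[OF assms]
  have "orthonormal (hdual X) B" using BD(1-3) by (auto simp: orthonormal_def)
  moreover have "expands (hdual X) B x" if "x \<in> carrier X" for x
    unfolding expands_def by (auto simp: BD(4)[OF that] mult.commute)
  ultimately show ?thesis
    by (simp add: inner_product_space.orthonormal_basis_iff[OF inner_product_hdual[OF assms(1)]])
qed

section \<open>Tensor products\<close>

lemma listset_iff: "xs \<in> listset As \<longleftrightarrow> length xs = length As \<and> (\<forall>i<length As. xs ! i \<in> As ! i)"
proof (induction As arbitrary: xs)
  case (Cons A As)
  show ?case
    by (cases xs) (auto simp: set_Cons_def Cons nth_Cons less_Suc_eq_0_disj split: nat.splits)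
qed simp

lemma listset_Cons_iff: "xs \<in> listset (A # As) \<longleftrightarrow> (\<exists>a as. xs = a # as \<and> a \<in> A \<and> as \<in> listset As)"
  by (simp add: set_Cons_def)

lemma listset_append_iff:
  "zs \<in> listset (As @ Bs) \<longleftrightarrow> (\<exists>xs ys. zs = xs @ ys \<and> xs \<in> listset As \<and> ys \<in> listset Bs)"
proof (induction As arbitrary: zs)
  case (Cons A As)
  show ?case
    unfolding append_Cons listset_Cons_iff Cons.IH by (metis append_Cons)
qed simp

lemma sum_listset_Cons: "(\<Sum>xs\<in>listset (A # As). f xs) = (\<Sum>a\<in>A. \<Sum>as\<in>listset As. f (a # as))"
proof -
  have "listset (A # As) = (\<lambda>(a, as). a # as) ` (A \<times> listset As)"
    by (auto simp: set_Cons_def)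
  moreover have "inj_on (\<lambda>(a, as). a # as) (A \<times> listset As)" by (auto simp: inj_on_def)
  ultimately show ?thesis by (simp add: sum.reindex sum.cartesian_product split_def)
qed

lemma sum_listset_append:
  "(\<Sum>xs\<in>listset (As @ Bs). f xs) = (\<Sum>xs\<in>listset As. \<Sum>ys\<in>listset Bs. f (xs @ ys))"
  by (induction As arbitrary: f) (simp_all add: sum_listset_Cons del: listset.simps(2))

lemma finite_listset: "(\<And>A. A \<in> set As \<Longrightarrow> finite A) \<Longrightarrow> finite (listset As)"
proof (induction As)
  case (Cons A As)
  have "listset (A # As) = (\<lambda>(a, as). a # as) ` (A \<times> listset As)"
    by (auto simp: set_Cons_def)
  then show ?case using Cons by simp
qed simp

text \<open>The inner product of two elementary tensors, as a function of lists of any kind.\<close>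

definition tensor_ip :: "'v hilb list \<Rightarrow> 'v list \<Rightarrow> 'v list \<Rightarrow> complex" where
  "tensor_ip Xs ys xs = (\<Prod>i<length Xs. ip (Xs ! i) (ys ! i) (xs ! i))"

lemma tensor_ip_simps [simp]:
  "tensor_ip [] ys xs = 1"
  "tensor_ip (X # Xs) (y # ys) (x # xs) = ip X y x * tensor_ip Xs ys xs"
  by (simp_all add: tensor_ip_def prod.lessThan_Suc_shift del: prod.lessThan_Suc)

lemma tensor_ip_append:
  "\<lbrakk>length xs = length Xs; length ys = length Xs\<rbrakk>
    \<Longrightarrow> tensor_ip (Xs @ Zs) (ys @ vs) (xs @ us) = tensor_ip Xs ys xs * tensor_ip Zs vs us"
proof (induction Xs arbitrary: xs ys)
  case (Cons X Xs)
  then obtain x xs' y ys' where "xs = x # xs'" "ys = y # ys'" by (metis length_Suc_conv)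
  then show ?case using Cons by simp
qed simp

lemma tensor_ip_permute:
  assumes "\<pi> permutes {..<length Xs}" "length xs = length Xs" "length ys = length Xs"
  shows "tensor_ip (permute_list \<pi> Xs) (permute_list \<pi> ys) (permute_list \<pi> xs) = tensor_ip Xs ys xs"
proof -
  have "tensor_ip (permute_list \<pi> Xs) (permute_list \<pi> ys) (permute_list \<pi> xs) =
    (\<Prod>i<length Xs. ip (Xs ! \<pi> i) (ys ! \<pi> i) (xs ! \<pi> i))"
    unfolding tensor_ip_def
    by (rule prod.cong) (use assms in \<open>auto simp: permute_list_nth\<close>)
  also have "\<dots> = tensor_ip Xs ys xs"
    unfolding tensor_ip_def
    using prod.permute[OF assms(1), of "\<lambda>i. ip (Xs ! i) (ys ! i) (xs ! i)"] by (simp add: comp_def)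
  finally show ?thesis .
qed

lemma elem_tensor_apply: "ys \<in> vec_lists Xs \<Longrightarrow> elem_tensor Xs xs ys = tensor_ip Xs ys xs"
  by (simp add: elem_tensor_def tensor_ip_def)

definition fd_list :: "'v hilb list \<Rightarrow> bool" where
  "fd_list Xs \<longleftrightarrow> (\<forall>X\<in>set Xs. fd_hilbert_space X)"

lemma fd_list_simps [simp]:
  "fd_list []" "fd_list (X # Xs) \<longleftrightarrow> fd_hilbert_space X \<and> fd_list Xs"
  "fd_list (Xs @ Ys) \<longleftrightarrow> fd_list Xs \<and> fd_list Ys"
  by (auto simp: fd_list_def)

abbreviation onb_list :: "'v hilb list \<Rightarrow> 'v set list \<Rightarrow> bool" where
  "onb_list \<equiv> list_all2 orthonormal_basis"

lemma onb_list_some: "fd_list Xs \<Longrightarrow> onb_list Xs (map some_onb Xs)"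
  by (auto simp: list_all2_conv_all_nth fd_list_def intro!: fd_hilbert_spaceD(3))

lemma onb_list_finite: "onb_list Xs Bs \<Longrightarrow> finite (listset Bs)"
  by (rule finite_listset)
    (auto simp: in_set_conv_nth list_all2_conv_all_nth orthonormal_basis_def finite_spanning_def)

lemma onb_list_subset: "onb_list Xs Bs \<Longrightarrow> es \<in> listset Bs \<Longrightarrow> es \<in> vec_lists Xs"
  by (fastforce simp: listset_iff list_all2_conv_all_nth orthonormal_basis_def finite_spanning_def)

lemma tensor_ip_onb:
  assumes "onb_list Xs Bs" "es \<in> listset Bs" "fs \<in> listset Bs"
  shows "tensor_ip Xs es fs = (if es = fs then 1 else 0)"
  using assms
proof (induction arbitrary: es fs rule: list_all2_induct)
  case (Cons X Xs B Bs)
  then obtain e es' f fs' where ef: "es = e # es'" "fs = f # fs'" "e \<in> B" "f \<in> B"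
    "es' \<in> listset Bs" "fs' \<in> listset Bs"
    by (auto simp: set_Cons_def)
  have "ip X e f = (if e = f then 1 else 0)"
    using Cons.hyps(1) ef by (simp add: orthonormal_basis_def)
  then show ?case using ef Cons.IH[OF ef(5,6)] by simp
qed simp

lemma cnj_tensor_ip:
  assumes "fd_list Xs" "xs \<in> vec_lists Xs" "ys \<in> vec_lists Xs"
  shows "cnj (tensor_ip Xs xs ys) = tensor_ip Xs ys xs"
  using assms
  by (induction Xs arbitrary: xs ys)
    (auto simp: set_Cons_def inner_product_space.cnj_ip[OF fd_hilbert_spaceD(1)])

lemma tensor_ip_expand:
  assumes "onb_list Xs Bs" "fd_list Xs" "xs \<in> vec_lists Xs" "ys \<in> vec_lists Xs"
  shows "tensor_ip Xs ys xs = (\<Sum>es\<in>listset Bs. tensor_ip Xs ys es * tensor_ip Xs es xs)"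
  using assms
proof (induction arbitrary: xs ys rule: list_all2_induct)
  case (Cons X Xs B Bs)
  obtain x xs' y ys' where x: "xs = x # xs'" "x \<in> carrier X" "xs' \<in> vec_lists Xs"
    and y: "ys = y # ys'" "y \<in> carrier X" "ys' \<in> vec_lists Xs"
    using Cons.prems by (auto simp: set_Cons_def)
  have "tensor_ip (X # Xs) ys xs = (\<Sum>e\<in>B. ip X y e * ip X e x) *
    (\<Sum>es\<in>listset Bs. tensor_ip Xs ys' es * tensor_ip Xs es xs')"
    using Cons x y orthonormal_basisD(4)[OF fd_hilbert_spaceD(1), of X B y x] by simp
  also have "\<dots> = (\<Sum>es\<in>listset (B # Bs). tensor_ip (X # Xs) ys es * tensor_ip (X # Xs) es xs)"
    unfolding sum_product by (simp add: sum_listset_Cons x y mult_ac del: listset.simps(2))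
  finally show ?case .
qed simp

lemma tensor_simps [simp]:
  "zero (tensor Xs) = (\<lambda>ys\<in>vec_lists Xs. 0)"
  "add (tensor Xs) = (\<lambda>s t. \<lambda>ys\<in>vec_lists Xs. s ys + t ys)"
  "smult (tensor Xs) = (\<lambda>c t. \<lambda>ys\<in>vec_lists Xs. c * t ys)"
  "ip (tensor Xs) = (\<lambda>s t. \<Sum>es\<in>listset (map some_onb Xs). cnj (s es) * t es)"
  by (simp_all add: tensor_def)

text \<open>By linearity it is enough to consider elementary tensors, for which this is the product of the
  Parseval identities of the factors.\<close>

lemma tensor_expand:
  assumes "onb_list Xs Bs" "fd_list Xs" "t \<in> carrier (tensor Xs)" "ys \<in> vec_lists Xs"
  shows "t ys = (\<Sum>es\<in>listset Bs. tensor_ip Xs ys es * t es)"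
proof -
  obtain S c where t: "t = (\<lambda>ys\<in>vec_lists Xs. \<Sum>xs\<in>S. c xs * elem_tensor Xs xs ys)"
    and S: "finite S" "S \<subseteq> vec_lists Xs"
    using assms(3) by (auto simp: tensor_def)
  have tv: "t zs = (\<Sum>xs\<in>S. c xs * tensor_ip Xs zs xs)" if "zs \<in> vec_lists Xs" for zs
    using that by (simp add: t elem_tensor_apply)
  have "t ys = (\<Sum>xs\<in>S. \<Sum>es\<in>listset Bs. tensor_ip Xs ys es * (c xs * tensor_ip Xs es xs))"
    unfolding tv[OF assms(4)]
  proof (rule sum.cong)
    fix xs assume "xs \<in> S"
    then have "xs \<in> vec_lists Xs" using S by auto
    then show "c xs * tensor_ip Xs ys xs = (\<Sum>es\<in>listset Bs. tensor_ip Xs ys es * (c xs * tensor_ip Xs es xs))"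
      using tensor_ip_expand[OF assms(1,2) _ assms(4)] by (simp add: sum_distrib_left mult_ac)
  qed simp
  also have "\<dots> = (\<Sum>es\<in>listset Bs. \<Sum>xs\<in>S. tensor_ip Xs ys es * (c xs * tensor_ip Xs es xs))"
    by (rule sum.swap)
  also have "\<dots> = (\<Sum>es\<in>listset Bs. tensor_ip Xs ys es * t es)"
    by (rule sum.cong) (use onb_list_subset[OF assms(1)] tv in \<open>auto simp: sum_distrib_left\<close>)
  finally show ?thesis .
qed

text \<open>Tensors are described by their coordinates in one product basis. This makes it evident that they are
  closed under sums and multiples, which is not visible from representations as sums of elementary
  tensors.\<close>

lemma tensor_carrier_iff:
  assumes "fd_list Xs"
  shows "t \<in> carrier (tensor Xs) \<longleftrightarrow> t \<in> extensional (vec_lists Xs) \<and>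
    (\<forall>ys\<in>vec_lists Xs. t ys = (\<Sum>es\<in>listset (map some_onb Xs). tensor_ip Xs ys es * t es))"
proof
  assume "t \<in> carrier (tensor Xs)"
  then show "t \<in> extensional (vec_lists Xs) \<and>
    (\<forall>ys\<in>vec_lists Xs. t ys = (\<Sum>es\<in>listset (map some_onb Xs). tensor_ip Xs ys es * t es))"
    using tensor_expand[OF onb_list_some[OF assms] assms] by (auto simp: tensor_def)
next
  let ?B = "listset (map some_onb Xs)"
  assume R: "t \<in> extensional (vec_lists Xs) \<and>
    (\<forall>ys\<in>vec_lists Xs. t ys = (\<Sum>es\<in>?B. tensor_ip Xs ys es * t es))"
  then have "t = (\<lambda>ys\<in>vec_lists Xs. \<Sum>es\<in>?B. t es * elem_tensor Xs es ys)"
    by (intro extensionalityI[of _ "vec_lists Xs"]) (auto simp: elem_tensor_apply mult.commute)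
  moreover have "finite ?B" "?B \<subseteq> vec_lists Xs"
    using onb_list_finite[OF onb_list_some[OF assms]] onb_list_subset[OF onb_list_some[OF assms]] by auto
  ultimately show "t \<in> carrier (tensor Xs)" unfolding tensor_def by auto
qed

lemma elem_tensor_carrier: "fd_list Xs \<Longrightarrow> xs \<in> vec_lists Xs \<Longrightarrow> elem_tensor Xs xs \<in> carrier (tensor Xs)"
  unfolding tensor_def
  by (auto simp: elem_tensor_def intro!: exI[of _ "{xs}"] exI[of _ "\<lambda>_. 1"])

lemma inner_product_tensor:
  assumes fd: "fd_list Xs"
  shows "inner_product_space (tensor Xs)"
proof -
  let ?B = "listset (map some_onb Xs)"
  have Bv: "es \<in> vec_lists Xs" if "es \<in> ?B" for es
    using onb_list_subset[OF onb_list_some[OF fd] that] .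
  have Bf: "finite ?B" by (rule onb_list_finite[OF onb_list_some[OF fd]])
  note iff = tensor_carrier_iff[OF fd]
  have ext: "s = t" if "s \<in> carrier (tensor Xs)" "t \<in> carrier (tensor Xs)" "\<And>es. es \<in> ?B \<Longrightarrow> s es = t es" for s t
    using that by (intro extensionalityI[of _ "vec_lists Xs"]) (auto simp: iff)
  have add: "(\<lambda>ys\<in>vec_lists Xs. s ys + t ys) \<in> carrier (tensor Xs)"
    if "s \<in> carrier (tensor Xs)" "t \<in> carrier (tensor Xs)" for s t
    unfolding iff
  proof (intro conjI ballI)
    fix ys assume ys: "ys \<in> vec_lists Xs"
    have "s ys + t ys = (\<Sum>es\<in>?B. tensor_ip Xs ys es * s es) + (\<Sum>es\<in>?B. tensor_ip Xs ys es * t es)"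
      using that ys unfolding iff by metis
    also have "\<dots> = (\<Sum>es\<in>?B. tensor_ip Xs ys es * (s es + t es))"
      by (simp add: sum.distrib distrib_left)
    finally show "(\<lambda>ys\<in>vec_lists Xs. s ys + t ys) ys =
        (\<Sum>es\<in>?B. tensor_ip Xs ys es * (\<lambda>ys\<in>vec_lists Xs. s ys + t ys) es)"
      using ys Bv by simp
  qed simp
  have smult: "(\<lambda>ys\<in>vec_lists Xs. c * t ys) \<in> carrier (tensor Xs)" if "t \<in> carrier (tensor Xs)" for c t
    unfolding iff
  proof (intro conjI ballI)
    fix ys assume ys: "ys \<in> vec_lists Xs"
    have "c * t ys = c * (\<Sum>es\<in>?B. tensor_ip Xs ys es * t es)"
      using that ys unfolding iff by metis
    also have "\<dots> = (\<Sum>es\<in>?B. tensor_ip Xs ys es * (c * t es))"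
      by (simp add: sum_distrib_left mult_ac)
    finally show "(\<lambda>ys\<in>vec_lists Xs. c * t ys) ys =
        (\<Sum>es\<in>?B. tensor_ip Xs ys es * (\<lambda>ys\<in>vec_lists Xs. c * t ys) es)"
      using ys Bv by simp
  qed simp
  have zero: "(\<lambda>ys\<in>vec_lists Xs. 0) \<in> carrier (tensor Xs)" using Bv unfolding iff by auto
  have eqI: "(\<lambda>ys\<in>vec_lists Xs. f ys) = t" if "t \<in> carrier (tensor Xs)" "\<And>ys. ys \<in> vec_lists Xs \<Longrightarrow> f ys = t ys" for t f
    using that by (intro extensionalityI[of _ "vec_lists Xs"]) (auto simp: iff)
  have "module complex_ring (tensor Xs)"
  proof (rule moduleI)
    show "abelian_group (tensor Xs)"
    proof (rule abelian_groupI)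
      fix s t u assume s: "s \<in> carrier (tensor Xs)" and t: "t \<in> carrier (tensor Xs)" and u: "u \<in> carrier (tensor Xs)"
      show "s \<oplus>\<^bsub>tensor Xs\<^esub> t \<in> carrier (tensor Xs)" using add[OF s t] by simp
      show "s \<oplus>\<^bsub>tensor Xs\<^esub> t \<oplus>\<^bsub>tensor Xs\<^esub> u = s \<oplus>\<^bsub>tensor Xs\<^esub> (t \<oplus>\<^bsub>tensor Xs\<^esub> u)"
        by (auto intro!: restrict_ext)
      show "s \<oplus>\<^bsub>tensor Xs\<^esub> t = t \<oplus>\<^bsub>tensor Xs\<^esub> s" by (auto intro!: restrict_ext)
      show "\<zero>\<^bsub>tensor Xs\<^esub> \<oplus>\<^bsub>tensor Xs\<^esub> s = s" using s by (auto intro!: eqI)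
      show "\<exists>r\<in>carrier (tensor Xs). r \<oplus>\<^bsub>tensor Xs\<^esub> s = \<zero>\<^bsub>tensor Xs\<^esub>"
        by (rule bexI[of _ "\<lambda>ys\<in>vec_lists Xs. (-1) * s ys"]) (use smult[OF s, of "-1"] in \<open>auto intro!: restrict_ext\<close>)
    qed (use zero in simp)
  qed (use smult in \<open>auto intro!: restrict_ext eqI simp: cring_complex_ring algebra_simps\<close>)
  then interpret module complex_ring "tensor Xs" .
  show ?thesis
  proof
    fix t assume t: "t \<in> carrier (tensor Xs)" and nz: "t \<noteq> \<zero>\<^bsub>tensor Xs\<^esub>"
    obtain es where es: "es \<in> ?B" "t es \<noteq> 0"
      using ext[OF t zero] nz Bv by fastforce
    have "Re (ip (tensor Xs) t t) = (\<Sum>es\<in>?B. (cmod (t es))\<^sup>2)"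
      unfolding cmod_power2 by (simp add: power2_eq_square)
    also have "\<dots> > 0" by (rule sum_pos2[OF Bf es(1)]) (use es in auto)
    finally show "Re (ip (tensor Xs) t t) > 0" .
  qed (use Bv in \<open>auto simp: sum.distrib[symmetric] sum_distrib_left algebra_simps intro!: sum.cong\<close>)
qed

lemma tensor_ip_onb_list:
  assumes B: "onb_list Xs Bs" and fd: "fd_list Xs" and s: "s \<in> carrier (tensor Xs)" and t: "t \<in> carrier (tensor Xs)"
  shows "ip (tensor Xs) s t = (\<Sum>es\<in>listset Bs. cnj (s es) * t es)"
proof -
  let ?E = "listset (map some_onb Xs)"
  note E = onb_list_some[OF fd]
  have "ip (tensor Xs) s t = (\<Sum>es\<in>?E. \<Sum>fs\<in>listset Bs. cnj (s es) * (tensor_ip Xs es fs * t fs))"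
    using tensor_expand[OF B fd t] onb_list_subset[OF E] by (simp add: sum_distrib_left)
  also have "\<dots> = (\<Sum>fs\<in>listset Bs. \<Sum>es\<in>?E. cnj (s es) * (tensor_ip Xs es fs * t fs))"
    by (rule sum.swap)
  also have "\<dots> = (\<Sum>fs\<in>listset Bs. cnj (s fs) * t fs)"
  proof (rule sum.cong)
    fix fs assume fs: "fs \<in> listset Bs"
    have "cnj (s fs) = (\<Sum>es\<in>?E. cnj (tensor_ip Xs fs es) * cnj (s es))"
      using tensor_expand[OF E fd s onb_list_subset[OF B fs]] by simp
    also have "\<dots> = (\<Sum>es\<in>?E. cnj (s es) * tensor_ip Xs es fs)"
      by (rule sum.cong) (use cnj_tensor_ip[OF fd] onb_list_subset[OF B fs] onb_list_subset[OF E] in auto)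
    finally show "(\<Sum>es\<in>?E. cnj (s es) * (tensor_ip Xs es fs * t fs)) = cnj (s fs) * t fs"
      by (simp add: sum_distrib_right mult.assoc)
  qed simp
  finally show ?thesis .
qed

lemma ip_elem_tensor:
  assumes fd: "fd_list Xs" and t: "t \<in> carrier (tensor Xs)" and ys: "ys \<in> vec_lists Xs"
  shows "ip (tensor Xs) (elem_tensor Xs ys) t = t ys"
proof -
  note E = onb_list_some[OF fd]
  have "ip (tensor Xs) (elem_tensor Xs ys) t = (\<Sum>es\<in>listset (map some_onb Xs). tensor_ip Xs ys es * t es)"
    unfolding tensor_simps
    by (rule sum.cong) (use onb_list_subset[OF E] ys cnj_tensor_ip[OF fd] in \<open>auto simp: elem_tensor_apply\<close>)
  then show ?thesis using tensor_expand[OF E fd t ys] by simp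
qed

lemma tensor_onb:
  assumes B: "onb_list Xs Bs" and fd: "fd_list Xs"
  shows "orthonormal_basis (tensor Xs) (elem_tensor Xs ` listset Bs)" "inj_on (elem_tensor Xs) (listset Bs)"
proof -
  interpret T: inner_product_space "tensor Xs" by (rule inner_product_tensor[OF fd])
  have Bv: "es \<in> vec_lists Xs" if "es \<in> listset Bs" for es using onb_list_subset[OF B that] .
  have on: "ip (tensor Xs) (elem_tensor Xs es) (elem_tensor Xs fs) = (if es = fs then 1 else 0)"
    if "es \<in> listset Bs" "fs \<in> listset Bs" for es fs
    using ip_elem_tensor[OF fd elem_tensor_carrier[OF fd]] tensor_ip_onb[OF B that] that Bv
    by (simp add: elem_tensor_apply del: tensor_simps)
  show inj: "inj_on (elem_tensor Xs) (listset Bs)"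
  proof (rule inj_onI)
    fix es fs assume "es \<in> listset Bs" "fs \<in> listset Bs" "elem_tensor Xs es = elem_tensor Xs fs"
    then show "es = fs" using on[of es fs] on[of es es] by (simp split: if_splits del: tensor_simps)
  qed
  show "orthonormal_basis (tensor Xs) (elem_tensor Xs ` listset Bs)"
    unfolding T.orthonormal_basis_iff
  proof (intro conjI ballI)
    show "orthonormal (tensor Xs) (elem_tensor Xs ` listset Bs)"
      unfolding orthonormal_def
    proof (intro conjI ballI)
      fix e f assume "e \<in> elem_tensor Xs ` listset Bs" "f \<in> elem_tensor Xs ` listset Bs"
      then obtain es fs where "es \<in> listset Bs" "e = elem_tensor Xs es" "fs \<in> listset Bs" "f = elem_tensor Xs fs"
        by blast
      then show "ip (tensor Xs) e f = (if e = f then 1 else 0)"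
        using on inj_on_eq_iff[OF inj] by (simp del: tensor_simps)
    qed (use onb_list_finite[OF B] elem_tensor_carrier[OF fd] Bv in auto)
    fix t assume t: "t \<in> carrier (tensor Xs)"
    show "expands (tensor Xs) (elem_tensor Xs ` listset Bs) t"
      unfolding expands_def
    proof
      fix s assume s: "s \<in> carrier (tensor Xs)"
      have "ip (tensor Xs) s t = (\<Sum>es\<in>listset Bs. ip (tensor Xs) s (elem_tensor Xs es) * ip (tensor Xs) (elem_tensor Xs es) t)"
        unfolding tensor_ip_onb_list[OF B fd s t]
      proof (rule sum.cong)
        fix es assume "es \<in> listset Bs"
        then have es: "es \<in> vec_lists Xs" by (rule Bv)
        have "ip (tensor Xs) s (elem_tensor Xs es) = cnj (ip (tensor Xs) (elem_tensor Xs es) s)"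
          by (rule T.ip_cnj) (use s es elem_tensor_carrier[OF fd] in auto)
        then show "cnj (s es) * t es = ip (tensor Xs) s (elem_tensor Xs es) * ip (tensor Xs) (elem_tensor Xs es) t"
          using ip_elem_tensor[OF fd t es] ip_elem_tensor[OF fd s es] by (simp del: tensor_simps)
      qed simp
      then show "ip (tensor Xs) s t = (\<Sum>b\<in>elem_tensor Xs ` listset Bs. ip (tensor Xs) s b * ip (tensor Xs) b t)"
        by (simp add: sum.reindex[OF inj] del: tensor_simps)
    qed
  qed
qed

lemma fd_tensor: "fd_list Xs \<Longrightarrow> fd_hilbert_space (tensor Xs)"
  using tensor_onb(1)[OF onb_list_some, of Xs] inner_product_tensor[of Xs]
  by (auto simp: fd_hilbert_space_def orthonormal_basis_def)

lemma tensor_op_eqI: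
  assumes fd: "fd_list Xs" and K: "inner_product_space K" and B: "onb_list Xs Bs"
    and "a \<in> bounded_ops (tensor Xs) K" "b \<in> bounded_ops (tensor Xs) K"
    and "\<And>es. es \<in> listset Bs \<Longrightarrow> a (elem_tensor Xs es) = b (elem_tensor Xs es)"
  shows "a = b"
  by (rule linear_op_eqI[OF _ _ inner_product_tensor[OF fd] K tensor_onb(1)[OF B fd]])
    (use assms in \<open>auto simp: bounded_ops_iff\<close>)

lemma tensor_op_expand:
  assumes fd: "fd_list Xs" and K: "inner_product_space K" and B: "onb_list Xs Bs"
    and a: "a \<in> bounded_ops (tensor Xs) K" and xs: "xs \<in> vec_lists Xs" and k: "k \<in> carrier K"
  shows "ip K k (a (elem_tensor Xs xs)) = (\<Sum>es\<in>listset Bs. tensor_ip Xs es xs * ip K k (a (elem_tensor Xs es)))"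
proof -
  have "ip K k (a (elem_tensor Xs xs)) = (\<Sum>es\<in>listset Bs.
      ip (tensor Xs) (elem_tensor Xs es) (elem_tensor Xs xs) * ip K k (a (elem_tensor Xs es)))"
    using bounded_op_expand[OF a inner_product_tensor[OF fd] K tensor_onb(1)[OF B fd] elem_tensor_carrier[OF fd xs] k]
    by (simp add: sum.reindex[OF tensor_onb(2)[OF B fd]] del: tensor_simps)
  also have "\<dots> = (\<Sum>es\<in>listset Bs. tensor_ip Xs es xs * ip K k (a (elem_tensor Xs es)))"
    using ip_elem_tensor[OF fd elem_tensor_carrier[OF fd xs]] onb_list_subset[OF B]
    by (simp add: elem_tensor_apply del: tensor_simps)
  finally show ?thesis .
qed

lemma functional_expand:
  assumes "fd_list Xs" "onb_list Xs Bs" "r \<in> functionals Xs" "xs \<in> vec_lists Xs"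
  shows "r (elem_tensor Xs xs) = (\<Sum>es\<in>listset Bs. tensor_ip Xs es xs * r (elem_tensor Xs es))"
  using tensor_op_expand[OF assms(1) ip_complex_hilb assms(2,3,4), of 1] by simp

lemma functional_eqI:
  assumes "fd_list Xs" "r \<in> functionals Xs" "s \<in> functionals Xs"
    and "\<And>xs. xs \<in> vec_lists Xs \<Longrightarrow> r (elem_tensor Xs xs) = s (elem_tensor Xs xs)"
  shows "r = s"
  using tensor_op_eqI[OF assms(1) ip_complex_hilb onb_list_some[OF assms(1)] assms(2,3)] assms(4)
    onb_list_subset[OF onb_list_some[OF assms(1)]] by blast

lemma hs_ip_functionals:
  assumes fd: "fd_list Xs" and B: "onb_list Xs Bs" and r: "r \<in> functionals Xs" and s: "s \<in> functionals Xs"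
  shows "hs_ip (tensor Xs) complex_hilb r s =
    (\<Sum>es\<in>listset Bs. cnj (r (elem_tensor Xs es)) * s (elem_tensor Xs es))"
  unfolding hs_ip_onb[OF fd_tensor[OF fd] ip_complex_hilb r s tensor_onb(1)[OF B fd]]
  by (simp add: sum.reindex[OF tensor_onb(2)[OF B fd]])

text \<open>The operator sends \<open>t\<close> to the sum of the vectors \<open>t es \<odot> F es\<close> over a product basis. The last
  hypothesis is the part of multilinearity that this uses, namely that \<open>F\<close> is determined by its values
  on basis vectors in the same way as elementary tensors are.\<close>

lemma tensor_lift:
  assumes fd: "fd_list Xs" and K: "inner_product_space K"
    and F: "\<And>xs. xs \<in> vec_lists Xs \<Longrightarrow> F xs \<in> carrier K"
    and exp: "\<And>xs k. \<lbrakk>xs \<in> vec_lists Xs; k \<in> carrier K\<rbrakk> \<Longrightarrow>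
      ip K k (F xs) = (\<Sum>es\<in>listset (map some_onb Xs). tensor_ip Xs es xs * ip K k (F es))"
  shows "tensor_lift Xs K F \<in> bounded_ops (tensor Xs) K"
    and "xs \<in> vec_lists Xs \<Longrightarrow> tensor_lift Xs K F (elem_tensor Xs xs) = F xs"
proof -
  interpret T: inner_product_space "tensor Xs" by (rule inner_product_tensor[OF fd])
  interpret K: inner_product_space K by fact
  let ?B = "listset (map some_onb Xs)"
  note B = onb_list_some[OF fd]
  note Bv = onb_list_subset[OF B]
  have FB: "F es \<in> carrier K" if "es \<in> ?B" for es using F Bv that by blast
  define u where "u = (\<lambda>t\<in>carrier (tensor Xs). \<Oplus>\<^bsub>K\<^esub>es\<in>?B. t es \<odot>\<^bsub>K\<^esub> F es)"
  have uc: "u t \<in> carrier K" if "t \<in> carrier (tensor Xs)" for t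
    using that FB by (auto simp: u_def intro!: K.finsum_mem)
  have ipu: "ip K k (u t) = (\<Sum>es\<in>?B. t es * ip K k (F es))"
    if t: "t \<in> carrier (tensor Xs)" and k: "k \<in> carrier K" for k t
  proof -
    have "ip K k (u t) = (\<Sum>es\<in>?B. ip K k (t es \<odot>\<^bsub>K\<^esub> F es))"
      using t k FB onb_list_finite[OF B] by (simp add: u_def K.ip_finsum_right del: tensor_simps)
    also have "\<dots> = (\<Sum>es\<in>?B. t es * ip K k (F es))"
      by (rule sum.cong) (use k FB in \<open>auto simp: K.ip_smult_right\<close>)
    finally show ?thesis .
  qed
  have "linear_op (tensor Xs) K u"
  proof (rule linear_opI)
    fix s t assume st: "s \<in> carrier (tensor Xs)" "t \<in> carrier (tensor Xs)"
    have "s \<oplus>\<^bsub>tensor Xs\<^esub> t \<in> carrier (tensor Xs)" using st by (rule T.M.a_closed)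
    then show "u (s \<oplus>\<^bsub>tensor Xs\<^esub> t) = u s \<oplus>\<^bsub>K\<^esub> u t"
      using st uc
      by (intro K.ip_ext) (auto simp: ipu K.ip_add_right Bv sum.distrib[symmetric] distrib_right intro!: sum.cong
          simp del: tensor_simps(1,3,4))
  next
    fix c t assume t: "t \<in> carrier (tensor Xs)"
    have "c \<odot>\<^bsub>tensor Xs\<^esub> t \<in> carrier (tensor Xs)" using t by (rule T.smult_in)
    then show "u (c \<odot>\<^bsub>tensor Xs\<^esub> t) = c \<odot>\<^bsub>K\<^esub> u t"
      using t uc
      by (intro K.ip_ext) (auto simp: ipu K.ip_smult_right Bv sum_distrib_left mult.assoc intro!: sum.cong
          simp del: tensor_simps(1,2,4))
  qed (use uc in \<open>auto simp: u_def\<close>)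
  then have u: "u \<in> bounded_ops (tensor Xs) K" by (rule linear_op_bounded[OF _ fd_tensor[OF fd] K])
  have uF: "u (elem_tensor Xs xs) = F xs" if xs: "xs \<in> vec_lists Xs" for xs
  proof (rule K.ip_ext)
    fix k assume k: "k \<in> carrier K"
    show "ip K k (u (elem_tensor Xs xs)) = ip K k (F xs)"
      unfolding ipu[OF elem_tensor_carrier[OF fd xs] k] exp[OF xs k]
      by (rule sum.cong) (use Bv in \<open>auto simp: elem_tensor_apply\<close>)
  qed (use uc F elem_tensor_carrier[OF fd xs] xs in auto)
  have "tensor_lift Xs K F = u"
    unfolding tensor_lift_def
  proof (rule the_equality)
    fix v assume "v \<in> bounded_ops (tensor Xs) K \<and> (\<forall>xs\<in>vec_lists Xs. v (elem_tensor Xs xs) = F xs)"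
    then show "v = u" using u uF Bv by (intro tensor_op_eqI[OF fd K B]) auto
  qed (use u uF in auto)
  then show "tensor_lift Xs K F \<in> bounded_ops (tensor Xs) K"
    "xs \<in> vec_lists Xs \<Longrightarrow> tensor_lift Xs K F (elem_tensor Xs xs) = F xs"
    using u uF by auto
qed

text \<open>The recursion on the list of spaces makes linearity in each entry available to induction, and reduces
  to one linearity condition per entry for lists that are given explicitly.\<close>

primrec multilinear :: "'v hilb list \<Rightarrow> ('v list \<Rightarrow> complex) \<Rightarrow> bool" where
  "multilinear [] F \<longleftrightarrow> True"
| "multilinear (X # Xs) F \<longleftrightarrow>
     (\<forall>xs\<in>vec_lists Xs. linear_op X complex_hilb (\<lambda>x\<in>carrier X. F (x # xs))) \<and>
     (\<forall>x\<in>carrier X. multilinear Xs (\<lambda>xs. F (x # xs)))"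

text \<open>The entries are expanded in their bases one at a time.\<close>

lemma multilinear_expand:
  assumes "fd_list Xs" "multilinear Xs F" "onb_list Xs Bs" "xs \<in> vec_lists Xs"
  shows "F xs = (\<Sum>es\<in>listset Bs. tensor_ip Xs es xs * F es)"
  using assms
proof (induction Xs arbitrary: F xs Bs)
  case (Cons X Xs)
  obtain B Bs' where B: "Bs = B # Bs'" "orthonormal_basis X B" "onb_list Xs Bs'"
    using Cons.prems by (auto simp: list_all2_Cons1)
  obtain x xs' where x: "xs = x # xs'" "x \<in> carrier X" "xs' \<in> vec_lists Xs"
    using Cons.prems by (auto simp: set_Cons_def)
  have X: "inner_product_space X" using Cons.prems fd_hilbert_spaceD(1) by auto
  note BD = orthonormal_basisD(2)[OF X B(2)]
  have lin: "linear_op X complex_hilb (\<lambda>x\<in>carrier X. F (x # xs'))"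
    using Cons.prems x by simp
  have "F (x # xs') = (\<Sum>e\<in>B. ip X e x * F (e # xs'))"
    using linear_op_expand[OF lin X ip_complex_hilb B(2) x(2), of 1] x BD by simp
  also have "\<dots> = (\<Sum>e\<in>B. ip X e x * (\<Sum>es\<in>listset Bs'. tensor_ip Xs es xs' * F (e # es)))"
  proof (rule sum.cong)
    fix e assume "e \<in> B"
    then show "ip X e x * F (e # xs') = ip X e x * (\<Sum>es\<in>listset Bs'. tensor_ip Xs es xs' * F (e # es))"
      using Cons.IH[of "\<lambda>xs. F (e # xs)" Bs' xs'] Cons.prems BD B x by simp
  qed simp
  finally show ?case
    by (simp add: x B sum_listset_Cons sum_distrib_left mult.assoc del: listset.simps(2))
qed simp

text \<open>The universal property of the tensor product, for forms with complex values.\<close>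

lemma functional_lift:
  assumes "fd_list Xs" "multilinear Xs F"
  shows "tensor_lift Xs complex_hilb F \<in> functionals Xs"
    and "xs \<in> vec_lists Xs \<Longrightarrow> tensor_lift Xs complex_hilb F (elem_tensor Xs xs) = F xs"
proof -
  have "F xs = (\<Sum>es\<in>listset (map some_onb Xs). tensor_ip Xs es xs * F es)" if "xs \<in> vec_lists Xs" for xs
    by (rule multilinear_expand[OF assms onb_list_some[OF assms(1)] that])
  then have *: "ip complex_hilb k (F xs) = (\<Sum>es\<in>listset (map some_onb Xs). tensor_ip Xs es xs * ip complex_hilb k (F es))"
    if "xs \<in> vec_lists Xs" for xs k
    using that by (auto simp: sum_distrib_left mult_ac)
  show "tensor_lift Xs complex_hilb F \<in> functionals Xs"
    by (rule tensor_lift[OF assms(1) ip_complex_hilb]) (use * in auto)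
  show "xs \<in> vec_lists Xs \<Longrightarrow> tensor_lift Xs complex_hilb F (elem_tensor Xs xs) = F xs"
    by (rule tensor_lift[OF assms(1) ip_complex_hilb]) (use * in auto)
qed

lemma tensor_functional:
  assumes fd: "fd_list Xs" "fd_list Ys" and r: "r \<in> functionals Xs" and s: "s \<in> functionals Ys"
  shows "tensor_functional Xs Ys r s \<in> functionals (Xs @ Ys)"
    and "\<lbrakk>xs \<in> vec_lists Xs; ys \<in> vec_lists Ys\<rbrakk> \<Longrightarrow>
      tensor_functional Xs Ys r s (elem_tensor (Xs @ Ys) (xs @ ys)) = r (elem_tensor Xs xs) * s (elem_tensor Ys ys)"
proof -
  define F where "F = (\<lambda>zs. r (elem_tensor Xs (take (length Xs) zs)) * s (elem_tensor Ys (drop (length Xs) zs)))"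
  have eq: "tensor_functional Xs Ys r s = tensor_lift (Xs @ Ys) complex_hilb F"
    by (simp add: tensor_functional_def F_def)
  note BX = onb_list_some[OF fd(1)] and BY = onb_list_some[OF fd(2)]
  have F: "F (xs @ ys) = r (elem_tensor Xs xs) * s (elem_tensor Ys ys)" if "xs \<in> vec_lists Xs" for xs ys
    using that by (simp add: F_def listset_iff)
  have exp: "F zs = (\<Sum>es\<in>listset (map some_onb (Xs @ Ys)). tensor_ip (Xs @ Ys) es zs * F es)"
    if zs: "zs \<in> vec_lists (Xs @ Ys)" for zs
  proof -
    obtain xs ys where z: "zs = xs @ ys" "xs \<in> vec_lists Xs" "ys \<in> vec_lists Ys"
      using zs by (auto simp: listset_append_iff)
    have "(\<Sum>es\<in>listset (map some_onb (Xs @ Ys)). tensor_ip (Xs @ Ys) es zs * F es) =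
      (\<Sum>es\<in>listset (map some_onb Xs). \<Sum>fs\<in>listset (map some_onb Ys).
        (tensor_ip Xs es xs * r (elem_tensor Xs es)) * (tensor_ip Ys fs ys * s (elem_tensor Ys fs)))"
      unfolding map_append sum_listset_append
    proof (intro sum.cong refl)
      fix es fs assume "es \<in> listset (map some_onb Xs)" "fs \<in> listset (map some_onb Ys)"
      then have "es \<in> vec_lists Xs" using onb_list_subset[OF BX] by blast
      moreover from this have "length es = length Xs" "length xs = length Xs" using z by (auto simp: listset_iff)
      ultimately show "tensor_ip (Xs @ Ys) (es @ fs) zs * F (es @ fs) =
        (tensor_ip Xs es xs * r (elem_tensor Xs es)) * (tensor_ip Ys fs ys * s (elem_tensor Ys fs))"
        using F by (simp add: z tensor_ip_append mult_ac)
    qed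
    also have "\<dots> = F zs"
      unfolding sum_product[symmetric] z F[OF z(2)]
      using functional_expand[OF fd(1) BX r z(2)] functional_expand[OF fd(2) BY s z(3)] by simp
    finally show ?thesis by simp
  qed
  then have *: "ip complex_hilb k (F xs) =
      (\<Sum>es\<in>listset (map some_onb (Xs @ Ys)). tensor_ip (Xs @ Ys) es xs * ip complex_hilb k (F es))"
    if "xs \<in> vec_lists (Xs @ Ys)" for xs k
    using that by (auto simp: sum_distrib_left mult_ac)
  have fd': "fd_list (Xs @ Ys)" using fd by simp
  show "tensor_functional Xs Ys r s \<in> functionals (Xs @ Ys)"
    unfolding eq by (rule tensor_lift[OF fd' ip_complex_hilb]) (use * in auto)
  assume xy: "xs \<in> vec_lists Xs" "ys \<in> vec_lists Ys"
  then have "xs @ ys \<in> vec_lists (Xs @ Ys)" by (auto simp: listset_append_iff)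
  then have "tensor_functional Xs Ys r s (elem_tensor (Xs @ Ys) (xs @ ys)) = F (xs @ ys)"
    unfolding eq by (intro tensor_lift[OF fd' ip_complex_hilb]) (use * in auto)
  then show "tensor_functional Xs Ys r s (elem_tensor (Xs @ Ys) (xs @ ys)) = r (elem_tensor Xs xs) * s (elem_tensor Ys ys)"
    using F[OF xy(1)] by simp
qed

lemma permute_vec_lists:
  assumes "\<pi> permutes {..<length As}" "xs \<in> listset As"
  shows "permute_list \<pi> xs \<in> listset (permute_list \<pi> As)"
proof -
  have "\<pi> permutes {..<length xs}" using assms by (simp add: listset_iff)
  then show ?thesis
    using assms permutes_in_image[OF assms(1)] by (auto simp: listset_iff permute_list_nth)
qed

text \<open>A permutation of the factors maps product bases to product bases and preserves the inner products of
  elementary tensors, so it is compatible with the expansion in a product basis.\<close>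

lemma perm_op:
  assumes fd: "fd_list Xs" and \<pi>: "\<pi> permutes {..<length Xs}"
  shows "perm_op \<pi> Xs \<in> bounded_ops (tensor Xs) (tensor (permute_list \<pi> Xs))"
    and "xs \<in> vec_lists Xs \<Longrightarrow> perm_op \<pi> Xs (elem_tensor Xs xs) = elem_tensor (permute_list \<pi> Xs) (permute_list \<pi> xs)"
proof -
  let ?Y = "permute_list \<pi> Xs"
  have fdY: "fd_list ?Y" using fd \<pi> by (simp add: fd_list_def)
  interpret T: inner_product_space "tensor ?Y" by (rule inner_product_tensor[OF fdY])
  have perm: "permute_list \<pi> xs \<in> vec_lists ?Y" if "xs \<in> vec_lists Xs" for xs
    using permute_vec_lists[of \<pi> "map carrier Xs" xs] \<pi> that by (simp add: permute_list_map)
  define F where "F = (\<lambda>xs. elem_tensor ?Y (permute_list \<pi> xs))"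
  have Fc: "F xs \<in> carrier (tensor ?Y)" if "xs \<in> vec_lists Xs" for xs
    using elem_tensor_carrier[OF fdY perm[OF that]] by (simp add: F_def)
  note B = onb_list_some[OF fd]
  have exp: "ip (tensor ?Y) k (F xs) = (\<Sum>es\<in>listset (map some_onb Xs). tensor_ip Xs es xs * ip (tensor ?Y) k (F es))"
    if xs: "xs \<in> vec_lists Xs" and k: "k \<in> carrier (tensor ?Y)" for xs k
  proof -
    have ipF: "ip (tensor ?Y) k (F zs) = cnj (k (permute_list \<pi> zs))" if zs: "zs \<in> vec_lists Xs" for zs
      using T.ip_cnj[OF Fc[OF zs] k] ip_elem_tensor[OF fdY k perm[OF zs]]
      by (simp add: F_def del: tensor_simps)
    have C: "onb_list ?Y (permute_list \<pi> (map some_onb Xs))"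
    proof -
      have "permute_list \<pi> (map some_onb Xs) = map some_onb ?Y"
        using \<pi> by (simp add: permute_list_map)
      then show ?thesis using onb_list_some[OF fdY] by simp
    qed
    have surj: "listset (permute_list \<pi> (map some_onb Xs)) = permute_list \<pi> ` listset (map some_onb Xs)"
    proof
      show "permute_list \<pi> ` listset (map some_onb Xs) \<subseteq> listset (permute_list \<pi> (map some_onb Xs))"
        using permute_vec_lists[of \<pi> "map some_onb Xs"] \<pi> by auto
      show "listset (permute_list \<pi> (map some_onb Xs)) \<subseteq> permute_list \<pi> ` listset (map some_onb Xs)"
      proof
        fix es assume es: "es \<in> listset (permute_list \<pi> (map some_onb Xs))"
        let ?\<rho> = "inv_into UNIV \<pi>"
        have \<rho>: "?\<rho> permutes {..<length Xs}" by (rule permutes_inv[OF \<pi>])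
        have len: "length es = length Xs" using es by (simp add: listset_iff)
        have "permute_list ?\<rho> es \<in> listset (permute_list ?\<rho> (permute_list \<pi> (map some_onb Xs)))"
          by (rule permute_vec_lists[OF _ es]) (use \<rho> in simp)
        also have "permute_list ?\<rho> (permute_list \<pi> (map some_onb Xs)) = map some_onb Xs"
          using \<rho> \<pi> by (simp add: permute_list_compose[symmetric] permutes_inv_o)
        finally have 1: "permute_list ?\<rho> es \<in> listset (map some_onb Xs)" .
        have "permute_list \<pi> (permute_list ?\<rho> es) = es"
          using \<rho> \<pi> len by (simp add: permute_list_compose[symmetric] permutes_inv_o)
        then show "es \<in> permute_list \<pi> ` listset (map some_onb Xs)" using 1 by force
      qed
    qed
    have inj: "inj_on (permute_list \<pi>) (listset (map some_onb Xs))"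
    proof (rule inj_onI)
      fix es fs assume ef: "es \<in> listset (map some_onb Xs)" "fs \<in> listset (map some_onb Xs)"
        and eq: "permute_list \<pi> es = permute_list \<pi> fs"
      have len: "length es = length Xs" "length fs = length Xs" using ef by (auto simp: listset_iff)
      have "permute_list (inv_into UNIV \<pi>) (permute_list \<pi> es) = permute_list (inv_into UNIV \<pi>) (permute_list \<pi> fs)" using eq by simp
      then show "es = fs"
        using permutes_inv[OF \<pi>] \<pi> len by (simp add: permute_list_compose[symmetric] permutes_inv_o)
    qed
    have "cnj (k (permute_list \<pi> xs)) =
      cnj (\<Sum>es\<in>listset (permute_list \<pi> (map some_onb Xs)). tensor_ip ?Y (permute_list \<pi> xs) es * k es)"
      using tensor_expand[OF C fdY k perm[OF xs]] by simp
    also have "\<dots> = (\<Sum>es\<in>listset (map some_onb Xs).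
        cnj (tensor_ip ?Y (permute_list \<pi> xs) (permute_list \<pi> es)) * cnj (k (permute_list \<pi> es)))"
      unfolding surj by (simp add: sum.reindex[OF inj])
    also have "\<dots> = (\<Sum>es\<in>listset (map some_onb Xs). tensor_ip Xs es xs * cnj (k (permute_list \<pi> es)))"
    proof (rule sum.cong)
      fix es assume "es \<in> listset (map some_onb Xs)"
      then have es: "es \<in> vec_lists Xs" by (rule onb_list_subset[OF B])
      have "tensor_ip ?Y (permute_list \<pi> xs) (permute_list \<pi> es) = tensor_ip Xs xs es"
        by (rule tensor_ip_permute[OF \<pi>]) (use xs es in \<open>auto simp: listset_iff\<close>)
      then show "cnj (tensor_ip ?Y (permute_list \<pi> xs) (permute_list \<pi> es)) * cnj (k (permute_list \<pi> es)) =
        tensor_ip Xs es xs * cnj (k (permute_list \<pi> es))"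
        using cnj_tensor_ip[OF fd xs es] by simp
    qed simp
    finally show ?thesis using ipF xs onb_list_subset[OF B] by (simp del: tensor_simps)
  qed
  have eq: "perm_op \<pi> Xs = tensor_lift Xs (tensor ?Y) F" by (simp add: perm_op_def F_def)
  show "perm_op \<pi> Xs \<in> bounded_ops (tensor Xs) (tensor ?Y)"
    unfolding eq by (rule tensor_lift[OF fd T.inner_product_space_axioms Fc exp])
  show "xs \<in> vec_lists Xs \<Longrightarrow> perm_op \<pi> Xs (elem_tensor Xs xs) = elem_tensor ?Y (permute_list \<pi> xs)"
    unfolding eq using tensor_lift(2)[OF fd T.inner_product_space_axioms Fc exp] by (simp add: F_def)
qed

section \<open>Relations and the interpretation of formulas\<close>

subsection \<open>Multilinear forms and functionals\<close>

lemma linear_op_cong: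
  "linear_op X complex_hilb (\<lambda>x\<in>carrier X. f x) \<Longrightarrow> (\<And>x. x \<in> carrier X \<Longrightarrow> f x = g x)
    \<Longrightarrow> linear_op X complex_hilb (\<lambda>x\<in>carrier X. g x)"
  by (metis (mono_tags, lifting) restrict_ext)

lemma linear_functionalI:
  assumes "inner_product_space X"
    and "\<And>x y. x \<in> carrier X \<Longrightarrow> y \<in> carrier X \<Longrightarrow> f (x \<oplus>\<^bsub>X\<^esub> y) = f x + f y"
    and "\<And>c x. x \<in> carrier X \<Longrightarrow> f (c \<odot>\<^bsub>X\<^esub> x) = c * f x"
  shows "linear_op X complex_hilb (\<lambda>x\<in>carrier X. f x)"
proof -
  interpret inner_product_space X by fact
  show ?thesis by (rule linear_opI) (use assms(2,3) in auto)
qed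

lemma linear_functionalD:
  assumes "inner_product_space X" "linear_op X complex_hilb (\<lambda>x\<in>carrier X. f x)"
  shows "\<And>x y. x \<in> carrier X \<Longrightarrow> y \<in> carrier X \<Longrightarrow> f (x \<oplus>\<^bsub>X\<^esub> y) = f x + f y"
    "\<And>c x. x \<in> carrier X \<Longrightarrow> f (c \<odot>\<^bsub>X\<^esub> x) = c * f x"
proof -
  interpret inner_product_space X by fact
  show "f (x \<oplus>\<^bsub>X\<^esub> y) = f x + f y" if "x \<in> carrier X" "y \<in> carrier X" for x y
    using linear_opD(3)[OF assms(2) that] that by simp
  show "f (c \<odot>\<^bsub>X\<^esub> x) = c * f x" if "x \<in> carrier X" for c x
    using linear_opD(4)[OF assms(2) that, of c] that by simp
qed

lemma multilinear_cong:
  assumes "multilinear Xs F" "\<And>xs. xs \<in> vec_lists Xs \<Longrightarrow> F xs = G xs"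
  shows "multilinear Xs G"
  using assms
proof (induction Xs arbitrary: F G)
  case (Cons X Xs)
  have eq: "F (x # xs) = G (x # xs)" if "x \<in> carrier X" "xs \<in> vec_lists Xs" for x xs
    using Cons.prems(2)[of "x # xs"] that by (simp add: set_Cons_def)
  have "linear_op X complex_hilb (\<lambda>x\<in>carrier X. G (x # xs))" if "xs \<in> vec_lists Xs" for xs
  proof (rule linear_op_cong)
    show "linear_op X complex_hilb (\<lambda>x\<in>carrier X. F (x # xs))" using Cons.prems(1) that by simp
  qed (rule eq[OF _ that])
  moreover have "multilinear Xs (\<lambda>xs. G (x # xs))" if "x \<in> carrier X" for x
  proof (rule Cons.IH)
    show "multilinear Xs (\<lambda>xs. F (x # xs))" using Cons.prems(1) that by simp
  qed (rule eq[OF that])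
  ultimately show ?case by simp
qed simp

lemma multilinear_sum:
  assumes "fd_list Xs" "\<And>i. i \<in> I \<Longrightarrow> multilinear Xs (F i)"
  shows "multilinear Xs (\<lambda>xs. \<Sum>i\<in>I. c i * F i xs)"
  using assms
proof (induction Xs arbitrary: F)
  case (Cons X Xs)
  have X: "inner_product_space X" using Cons.prems fd_hilbert_spaceD(1) by auto
  have "linear_op X complex_hilb (\<lambda>x\<in>carrier X. \<Sum>i\<in>I. c i * F i (x # xs))" if xs: "xs \<in> vec_lists Xs" for xs
  proof -
    have l: "linear_op X complex_hilb (\<lambda>x\<in>carrier X. F i (x # xs))" if "i \<in> I" for i
      using Cons.prems(2)[OF that] xs by simp
    show ?thesis
      by (rule linear_functionalI[OF X])
        (auto simp: linear_functionalD[OF X l] sum.distrib[symmetric] sum_distrib_left algebra_simps intro!: sum.cong)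
  qed
  moreover have "multilinear Xs (\<lambda>xs. \<Sum>i\<in>I. c i * F i (x # xs))" if "x \<in> carrier X" for x
    using Cons.prems that by (intro Cons.IH[of "\<lambda>i xs. F i (x # xs)"]) auto
  ultimately show ?case by simp
qed simp

lemma multilinear_scale:
  assumes "fd_list Xs" "multilinear Xs F" shows "multilinear Xs (\<lambda>xs. c * F xs)"
  using multilinear_sum[OF assms(1), of "{()}" "\<lambda>_. F" "\<lambda>_. c"] assms(2) by simp

lemma multilinear_tensor_ip:
  assumes "fd_list Xs" "ys \<in> vec_lists Xs" shows "multilinear Xs (tensor_ip Xs ys)"
  using assms
proof (induction Xs arbitrary: ys)
  case (Cons X Xs)
  obtain y ys' where y: "ys = y # ys'" "y \<in> carrier X" "ys' \<in> vec_lists Xs"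
    using Cons.prems by (auto simp: set_Cons_def)
  have X: "inner_product_space X" using Cons.prems fd_hilbert_spaceD(1) by auto
  have "linear_op X complex_hilb (\<lambda>x\<in>carrier X. ip X y x * tensor_ip Xs ys' xs)" for xs
    by (rule linear_functionalI[OF X])
      (use y X in \<open>auto simp: inner_product_space.ip_simps algebra_simps\<close>)
  then show ?case using Cons y by (simp add: multilinear_scale)
qed simp

lemma multilinear_functional:
  assumes fd: "fd_list Xs" and r: "r \<in> functionals Xs"
  shows "multilinear Xs (\<lambda>xs. r (elem_tensor Xs xs))"
proof (rule multilinear_cong)
  note B = onb_list_some[OF fd]
  show "multilinear Xs (\<lambda>xs. \<Sum>es\<in>listset (map some_onb Xs). r (elem_tensor Xs es) * tensor_ip Xs es xs)"
    by (rule multilinear_sum[OF fd]) (use multilinear_tensor_ip[OF fd] onb_list_subset[OF B] in auto)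
  fix xs assume "xs \<in> vec_lists Xs"
  then show "(\<Sum>es\<in>listset (map some_onb Xs). r (elem_tensor Xs es) * tensor_ip Xs es xs) = r (elem_tensor Xs xs)"
    using functional_expand[OF fd B r] by (simp add: mult.commute)
qed

lemma multilinear_append_right:
  "\<lbrakk>multilinear (Xs @ Ys) F; xs \<in> vec_lists Xs\<rbrakk> \<Longrightarrow> multilinear Ys (\<lambda>ys. F (xs @ ys))"
proof (induction Xs arbitrary: F xs)
  case (Cons X Xs)
  obtain x xs' where x: "xs = x # xs'" "x \<in> carrier X" "xs' \<in> vec_lists Xs"
    using Cons.prems by (auto simp: set_Cons_def)
  then show ?case using Cons.prems Cons.IH[of "\<lambda>xs. F (x # xs)" xs'] by simp
qed simp

abbreviation functional_subspace :: "'v hilb list \<Rightarrow> (('v list \<Rightarrow> complex) \<Rightarrow> complex) set \<Rightarrow> bool" where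
  "functional_subspace Xs \<equiv> op_subspace (tensor Xs) complex_hilb"

lemma functional_subspace_iff:
  assumes "fd_list Xs"
  shows "functional_subspace Xs W \<longleftrightarrow> W \<subseteq> functionals Xs \<and> (\<lambda>t\<in>carrier (tensor Xs). 0) \<in> W \<and>
     (\<forall>a\<in>W. \<forall>b\<in>W. (\<lambda>t\<in>carrier (tensor Xs). a t + b t) \<in> W) \<and>
     (\<forall>c. \<forall>a\<in>W. (\<lambda>t\<in>carrier (tensor Xs). c * a t) \<in> W)"
  using op_subspace_iff[OF inner_product_tensor[OF assms] ip_complex_hilb, of W] by simp

lemma functional_subspaceD:
  assumes "functional_subspace Xs W" "fd_list Xs"
  shows "a \<in> W \<Longrightarrow> a \<in> functionals Xs" "(\<lambda>t\<in>carrier (tensor Xs). 0) \<in> W"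
    "a \<in> W \<Longrightarrow> b \<in> W \<Longrightarrow> (\<lambda>t\<in>carrier (tensor Xs). a t + b t) \<in> W"
    "a \<in> W \<Longrightarrow> (\<lambda>t\<in>carrier (tensor Xs). c * a t) \<in> W"
  using assms by (auto simp: functional_subspace_iff)

lemma functional_subspace_functionals: "fd_list Xs \<Longrightarrow> functional_subspace Xs (functionals Xs)"
  by (rule op_subspace_bounded_ops[OF inner_product_tensor ip_complex_hilb])

lemmas functionals_closed = functional_subspaceD[OF functional_subspace_functionals]

text \<open>Elementary tensors determine a functional, so it is enough to recognize \<open>g\<close> as a linear combination
  there.\<close>

lemma functional_subspace_lincomb:
  assumes W: "functional_subspace Xs W" and fd: "fd_list Xs" and I: "finite I"
    and f: "\<And>i. i \<in> I \<Longrightarrow> f i \<in> W" and g: "g \<in> functionals Xs"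
    and eq: "\<And>xs. xs \<in> vec_lists Xs \<Longrightarrow> g (elem_tensor Xs xs) = (\<Sum>i\<in>I. c i * f i (elem_tensor Xs xs))"
  shows "g \<in> W"
proof -
  note WD = functional_subspaceD[OF W fd]
  have 1: "(\<lambda>t\<in>carrier (tensor Xs). \<Sum>i\<in>I. c i * f i t) \<in> W"
    using I f
  proof (induction)
    case (insert i I)
    have "(\<lambda>t\<in>carrier (tensor Xs). (\<lambda>t\<in>carrier (tensor Xs). c i * f i t) t +
       (\<lambda>t\<in>carrier (tensor Xs). \<Sum>i\<in>I. c i * f i t) t) \<in> W"
      by (rule WD(3)[OF WD(4)]) (use insert in auto)
    also have "(\<lambda>t\<in>carrier (tensor Xs). (\<lambda>t\<in>carrier (tensor Xs). c i * f i t) t +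
       (\<lambda>t\<in>carrier (tensor Xs). \<Sum>i\<in>I. c i * f i t) t) =
       (\<lambda>t\<in>carrier (tensor Xs). \<Sum>i\<in>insert i I. c i * f i t)"
      by (rule restrict_ext) (use insert in simp)
    finally show ?case .
  qed (use WD(2) in simp)
  have "g = (\<lambda>t\<in>carrier (tensor Xs). \<Sum>i\<in>I. c i * f i t)"
    by (rule functional_eqI[OF fd g WD(1)[OF 1]]) (use eq elem_tensor_carrier[OF fd] in auto)
  then show ?thesis using 1 by simp
qed

subsection \<open>Relations\<close>

definition quantum_sets :: "'v hilb set list \<Rightarrow> bool" where
  "quantum_sets As \<longleftrightarrow> (\<forall>\<X>\<in>set As. quantum_set \<X>)"

lemma quantum_sets_simps [simp]:
  "quantum_sets []" "quantum_sets (\<X> # As) \<longleftrightarrow> quantum_set \<X> \<and> quantum_sets As"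
  "quantum_sets (As @ Bs) \<longleftrightarrow> quantum_sets As \<and> quantum_sets Bs"
  by (auto simp: quantum_sets_def)

lemma quantum_setD: "quantum_set \<X> \<Longrightarrow> X \<in> \<X> \<Longrightarrow> fd_hilbert_space X"
  by (simp add: quantum_set_def)

lemma quantum_sets_fd_list: "quantum_sets As \<Longrightarrow> Xs \<in> listset As \<Longrightarrow> fd_list Xs"
proof (induction As arbitrary: Xs)
  case (Cons \<X> As)
  then show ?case by (auto simp: set_Cons_def quantum_setD)
qed simp

lemma quantum_set_qdual: "quantum_set \<X> \<Longrightarrow> quantum_set (qdual \<X>)"
  by (auto simp: quantum_set_def qdual_def fd_hdual)

lemma relationsD: "R \<in> relations As \<Longrightarrow> Xs \<in> listset As \<Longrightarrow> functional_subspace Xs (R Xs)"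
  by (auto simp: relations_def)

lemma functional_subspace_slices:
  assumes fd: "fd_list Xs" "fd_list Ys" and W: "functional_subspace Xs W"
  shows "functional_subspace (Xs @ Ys) {h \<in> functionals (Xs @ Ys). \<forall>ys\<in>vec_lists Ys. \<exists>r\<in>W. \<forall>xs\<in>vec_lists Xs.
     r (elem_tensor Xs xs) = h (elem_tensor (Xs @ Ys) (xs @ ys))}" (is "functional_subspace _ ?S")
proof -
  have fd': "fd_list (Xs @ Ys)" using fd by simp
  note WD = functional_subspaceD[OF W fd(1)] and FD = functionals_closed[OF fd' fd']
  have et: "elem_tensor (Xs @ Ys) (xs @ ys) \<in> carrier (tensor (Xs @ Ys))"
    if "xs \<in> vec_lists Xs" "ys \<in> vec_lists Ys" for xs ys
    using that by (intro elem_tensor_carrier[OF fd']) (auto simp: listset_append_iff)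
  note et1 = elem_tensor_carrier[OF fd(1)]
  show ?thesis
    unfolding functional_subspace_iff[OF fd']
  proof (intro conjI ballI allI)
    show "(\<lambda>t\<in>carrier (tensor (Xs @ Ys)). 0) \<in> ?S"
      using FD(2) et et1 WD(2) by (auto intro!: bexI[of _ "\<lambda>t\<in>carrier (tensor Xs). 0"])
  next
    fix a b assume a: "a \<in> ?S" and b: "b \<in> ?S"
    have "\<exists>r\<in>W. \<forall>xs\<in>vec_lists Xs. r (elem_tensor Xs xs) =
      a (elem_tensor (Xs @ Ys) (xs @ ys)) + b (elem_tensor (Xs @ Ys) (xs @ ys))" if ys: "ys \<in> vec_lists Ys" for ys
    proof -
      obtain r s where "r \<in> W" "\<forall>xs\<in>vec_lists Xs. r (elem_tensor Xs xs) = a (elem_tensor (Xs @ Ys) (xs @ ys))"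
        "s \<in> W" "\<forall>xs\<in>vec_lists Xs. s (elem_tensor Xs xs) = b (elem_tensor (Xs @ Ys) (xs @ ys))"
        using a b ys by blast
      then show ?thesis using WD(3)[of r s] et1
        by (intro bexI[of _ "\<lambda>t\<in>carrier (tensor Xs). r t + s t"]) auto
    qed
    then show "(\<lambda>t\<in>carrier (tensor (Xs @ Ys)). a t + b t) \<in> ?S"
      using FD(3)[of a b] a b et by auto
  next
    fix c a assume a: "a \<in> ?S"
    have "\<exists>r\<in>W. \<forall>xs\<in>vec_lists Xs. r (elem_tensor Xs xs) = c * a (elem_tensor (Xs @ Ys) (xs @ ys))"
      if ys: "ys \<in> vec_lists Ys" for ys
    proof -
      obtain r where "r \<in> W" "\<forall>xs\<in>vec_lists Xs. r (elem_tensor Xs xs) = a (elem_tensor (Xs @ Ys) (xs @ ys))"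
        using a ys by blast
      then show ?thesis using WD(4)[of r c] et1
        by (intro bexI[of _ "\<lambda>t\<in>carrier (tensor Xs). c * r t"]) auto
    qed
    then show "(\<lambda>t\<in>carrier (tensor (Xs @ Ys)). c * a t) \<in> ?S"
      using FD(4)[of a c] a et by auto
  qed auto
qed

text \<open>Every functional on a tensor product is the sum of its slices at the basis vectors of the last factors,
  each multiplied by an element of the dual basis. Hence the condition that all slices lie in \<open>R\<close>
  characterizes the product of \<open>R\<close> with the full relation.\<close>

lemma rel_prod_top:
  assumes As: "quantum_sets As" and Bs: "quantum_sets Bs" and Xs: "Xs \<in> listset As" and Ys: "Ys \<in> listset Bs"
    and R: "functional_subspace Xs (R Xs)"
  shows "rel_prod As Bs R (rel_top Bs) (Xs @ Ys) =
    {h \<in> functionals (Xs @ Ys). \<forall>ys\<in>vec_lists Ys. \<exists>r\<in>R Xs. \<forall>xs\<in>vec_lists Xs.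
       r (elem_tensor Xs xs) = h (elem_tensor (Xs @ Ys) (xs @ ys))}" (is "?L = ?S")
proof -
  have fd: "fd_list Xs" "fd_list Ys" "fd_list (Xs @ Ys)"
    using quantum_sets_fd_list[OF As Xs] quantum_sets_fd_list[OF Bs Ys] by auto
  have len: "length Xs = length As" using Xs by (simp add: listset_iff)
  have mem: "Xs @ Ys \<in> listset (As @ Bs)" using Xs Ys by (auto simp: listset_append_iff)
  note RD = functional_subspaceD[OF R fd(1)]
  let ?G = "{tensor_functional Xs Ys r s | r s. r \<in> R Xs \<and> s \<in> functionals Ys}"
  have L: "?L = functional_span (Xs @ Ys) ?G"
    using mem Ys by (simp add: rel_prod_def rel_top_def len[symmetric] del: listset.simps)
  have S: "functional_subspace (Xs @ Ys) ?S" by (rule functional_subspace_slices[OF fd(1,2) R])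
  have G: "?G \<subseteq> functionals (Xs @ Ys)" using tensor_functional(1)[OF fd(1,2) RD(1)] by auto
  show ?thesis
  proof
    have "?G \<subseteq> ?S"
    proof
      fix h assume "h \<in> ?G"
      then obtain r s where h: "h = tensor_functional Xs Ys r s" and r: "r \<in> R Xs" and s: "s \<in> functionals Ys"
        by blast
      note h' = tensor_functional[OF fd(1,2) RD(1)[OF r] s]
      have "\<exists>r'\<in>R Xs. \<forall>xs\<in>vec_lists Xs. r' (elem_tensor Xs xs) = h (elem_tensor (Xs @ Ys) (xs @ ys))"
        if "ys \<in> vec_lists Ys" for ys
        using RD(4)[OF r, of "s (elem_tensor Ys ys)"] h'(2) that elem_tensor_carrier[OF fd(1)] h
        by (intro bexI[of _ "\<lambda>t\<in>carrier (tensor Xs). s (elem_tensor Ys ys) * r t"]) auto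
      then show "h \<in> ?S" using h'(1) h by auto
    qed
    then show "?L \<subseteq> ?S" unfolding L using S by (rule op_span_minimal)
    show "?S \<subseteq> ?L"
    proof
      fix h assume h: "h \<in> ?S"
      let ?B = "listset (map some_onb Ys)"
      note B = onb_list_some[OF fd(2)]
      have "\<forall>fs\<in>?B. \<exists>r. r \<in> R Xs \<and> (\<forall>xs\<in>vec_lists Xs. r (elem_tensor Xs xs) = h (elem_tensor (Xs @ Ys) (xs @ fs)))"
        using h onb_list_subset[OF B] by blast
      then obtain r where r: "\<And>fs. fs \<in> ?B \<Longrightarrow> r fs \<in> R Xs"
        "\<And>fs xs. fs \<in> ?B \<Longrightarrow> xs \<in> vec_lists Xs \<Longrightarrow> r fs (elem_tensor Xs xs) = h (elem_tensor (Xs @ Ys) (xs @ fs))"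
        by metis
      define d where "d = (\<lambda>fs. tensor_lift Ys complex_hilb (tensor_ip Ys fs))"
      have d: "d fs \<in> functionals Ys" "ys \<in> vec_lists Ys \<Longrightarrow> d fs (elem_tensor Ys ys) = tensor_ip Ys fs ys"
        if "fs \<in> ?B" for fs ys
        using functional_lift[OF fd(2) multilinear_tensor_ip[OF fd(2) onb_list_subset[OF B that]]] by (auto simp: d_def)
      have "functional_subspace (Xs @ Ys) (functional_span (Xs @ Ys) ?G)"
        by (rule op_subspace_op_span[OF inner_product_tensor[OF fd(3)] ip_complex_hilb G])
      then have "h \<in> functional_span (Xs @ Ys) ?G"
      proof (rule functional_subspace_lincomb[OF _ fd(3)])
        show "finite ?B" by (rule onb_list_finite[OF B])
        show "tensor_functional Xs Ys (r fs) (d fs) \<in> functional_span (Xs @ Ys) ?G" if "fs \<in> ?B" for fs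
          by (rule op_span_inc) (use r(1) d(1) that in blast)
        show "h \<in> functionals (Xs @ Ys)" using h by blast
        fix zs assume "zs \<in> vec_lists (Xs @ Ys)"
        then obtain xs ys where z: "zs = xs @ ys" "xs \<in> vec_lists Xs" "ys \<in> vec_lists Ys"
          by (auto simp: listset_append_iff)
        have "multilinear (Xs @ Ys) (\<lambda>zs. h (elem_tensor (Xs @ Ys) zs))"
          by (rule multilinear_functional[OF fd(3)]) (use h in blast)
        then have "multilinear Ys (\<lambda>ys. h (elem_tensor (Xs @ Ys) (xs @ ys)))"
          using z(2) by (rule multilinear_append_right)
        then have "h (elem_tensor (Xs @ Ys) (xs @ ys)) =
            (\<Sum>fs\<in>?B. tensor_ip Ys fs ys * h (elem_tensor (Xs @ Ys) (xs @ fs)))"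
          by (rule multilinear_expand[OF fd(2) _ B z(3)])
        also have "\<dots> = (\<Sum>fs\<in>?B. 1 * tensor_functional Xs Ys (r fs) (d fs) (elem_tensor (Xs @ Ys) (xs @ ys)))"
        proof (rule sum.cong)
          fix fs assume fs: "fs \<in> ?B"
          show "tensor_ip Ys fs ys * h (elem_tensor (Xs @ Ys) (xs @ fs)) =
              1 * tensor_functional Xs Ys (r fs) (d fs) (elem_tensor (Xs @ Ys) (xs @ ys))"
            using tensor_functional(2)[OF fd(1,2) RD(1)[OF r(1)[OF fs]] d(1)[OF fs] z(2,3)] r(2)[OF fs z(2)] d(2)[OF fs z(3)]
            by simp
        qed simp
        finally show "h (elem_tensor (Xs @ Ys) zs) =
          (\<Sum>fs\<in>?B. 1 * tensor_functional Xs Ys (r fs) (d fs) (elem_tensor (Xs @ Ys) zs))" using z(1) by simp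
      qed
      then show "h \<in> ?L" unfolding L .
    qed
  qed
qed

subsection \<open>Atomic formulas\<close>

lemma context_perm_eqI:
  assumes "distinct \<Gamma>" "\<pi> permutes {..<length \<Gamma>}" "permute_list \<pi> \<Gamma> = vs @ filter (\<lambda>v. v \<notin> set vs) \<Gamma>"
  shows "context_perm \<Gamma> vs = \<pi>"
  unfolding context_perm_def
proof (rule the_equality)
  fix \<rho> assume \<rho>: "\<rho> permutes {..<length \<Gamma>} \<and> permute_list \<rho> \<Gamma> = vs @ filter (\<lambda>v. v \<notin> set vs) \<Gamma>"
  show "\<rho> = \<pi>"
  proof
    fix i
    show "\<rho> i = \<pi> i"
    proof (cases "i < length \<Gamma>")
      case True
      have "permute_list \<rho> \<Gamma> ! i = permute_list \<pi> \<Gamma> ! i" using assms(3) \<rho> by simp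
      then have "\<Gamma> ! \<rho> i = \<Gamma> ! \<pi> i"
        using permute_list_nth[of \<rho> \<Gamma> i] permute_list_nth[of \<pi> \<Gamma> i] True \<rho> assms(2) by simp
      moreover have "\<rho> i < length \<Gamma>" "\<pi> i < length \<Gamma>"
        using permutes_in_image[of \<rho> "{..<length \<Gamma>}" i] permutes_in_image[OF assms(2), of i] \<rho> True by auto
      ultimately show ?thesis using assms(1) nth_eq_iff_index_eq by metis
    next
      case False
      then show ?thesis using \<rho> assms(2) by (simp add: permutes_def)
    qed
  qed
qed (use assms in simp)

text \<open>Composition with \<open>u\<^sub>\<pi>\<close> is invertible, so \<open>f\<close> belongs to the interpretation exactly if \<open>f \<circ> u\<^sub>\<pi>\<^sup>-\<^sup>1\<close> has
  its slices in \<open>R\<close>. The inverse permutation is hidden in the choice of the lists \<open>xs\<close> that \<open>\<pi>\<close> turns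
  into \<open>ys @ zs\<close>.\<close>

lemma interp_Atom:
  assumes \<Gamma>: "distinct \<Gamma>" "quantum_sets (map fst \<Gamma>)" "Xs \<in> listset (map fst \<Gamma>)"
    and \<pi>: "\<pi> permutes {..<length \<Gamma>}" "permute_list \<pi> \<Gamma> = vs @ filter (\<lambda>v. v \<notin> set vs) \<Gamma>"
    and YZ: "permute_list \<pi> Xs = Ys @ Zs" "length Ys = length vs"
    and R: "R \<in> relations (map fst vs)"
  shows "interp (Atom R vs) \<Gamma> Xs = {f \<in> functionals Xs. \<forall>zs\<in>vec_lists Zs. \<exists>r\<in>R Ys.
      \<forall>ys\<in>vec_lists Ys. \<forall>xs\<in>vec_lists Xs. permute_list \<pi> xs = ys @ zs \<longrightarrow>
        r (elem_tensor Ys ys) = f (elem_tensor Xs xs)}" (is "_ = ?S")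
    and "functional_subspace Xs (interp (Atom R vs) \<Gamma> Xs)"
proof -
  let ?rest = "filter (\<lambda>v. v \<notin> set vs) \<Gamma>"
  have len: "length Xs = length \<Gamma>" using \<Gamma>(3) by (simp add: listset_iff)
  have \<pi>X: "\<pi> permutes {..<length Xs}" using \<pi>(1) len by simp
  let ?\<rho> = "inv_into UNIV \<pi>"
  have \<rho>: "?\<rho> permutes {..<length Xs}" by (rule permutes_inv[OF \<pi>X])
  have cp: "context_perm \<Gamma> vs = \<pi>" by (rule context_perm_eqI[OF \<Gamma>(1) \<pi>])
  have "permute_list \<pi> Xs \<in> listset (permute_list \<pi> (map fst \<Gamma>))"
    by (rule permute_vec_lists) (use \<pi> \<Gamma> in auto)
  then have "Ys @ Zs \<in> listset (map fst vs @ map fst ?rest)"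
    using \<pi> YZ by (simp add: permute_list_map)
  then obtain Ys' Zs' where "Ys @ Zs = Ys' @ Zs'" "Ys' \<in> listset (map fst vs)" "Zs' \<in> listset (map fst ?rest)"
    unfolding listset_append_iff by blast
  moreover from this have "length Ys' = length Ys" using YZ(2) by (simp add: listset_iff)
  ultimately have Ys: "Ys \<in> listset (map fst vs)" and Zs: "Zs \<in> listset (map fst ?rest)"
    by simp_all
  have q: "quantum_sets (map fst vs @ map fst ?rest)"
  proof -
    have "set (vs @ ?rest) = set \<Gamma>" using \<pi> set_permute_list[OF \<pi>(1)] by metis
    then have "set (map fst vs @ map fst ?rest) = set (map fst \<Gamma>)"
      unfolding map_append[symmetric] set_map by simp
    then show ?thesis using \<Gamma>(2) unfolding quantum_sets_def by simp
  qed
  then have q1: "quantum_sets (map fst vs)" and q2: "quantum_sets (map fst ?rest)" by auto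
  have fdX: "fd_list Xs" using quantum_sets_fd_list \<Gamma> by blast
  have fd: "fd_list Ys" "fd_list Zs" "fd_list (Ys @ Zs)"
    using quantum_sets_fd_list[OF q1 Ys] quantum_sets_fd_list[OF q2 Zs] by auto
  note RY = relationsD[OF R Ys]
  let ?P = "{h \<in> functionals (Ys @ Zs). \<forall>zs\<in>vec_lists Zs. \<exists>r\<in>R Ys. \<forall>ys\<in>vec_lists Ys.
       r (elem_tensor Ys ys) = h (elem_tensor (Ys @ Zs) (ys @ zs))}"
  have I: "interp (Atom R vs) \<Gamma> Xs = {compose (carrier (tensor Xs)) r (perm_op \<pi> Xs) | r. r \<in> ?P}"
    using \<Gamma>(3) by (simp add: cp YZ(1) rel_prod_top[where R = R, OF q1 q2 Ys Zs RY, symmetric] Let_def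
        del: listset.simps)
  note u = perm_op[OF fdX \<pi>X, unfolded YZ(1)]
  have perm: "permute_list \<pi> xs \<in> vec_lists (Ys @ Zs)" if "xs \<in> vec_lists Xs" for xs
    using permute_vec_lists[of \<pi> "map carrier Xs" xs] \<pi>X that YZ(1)
    by (simp add: permute_list_map)
  have inv1: "permute_list ?\<rho> (permute_list \<pi> xs) = xs" if "length xs = length Xs" for xs :: "'c list"
    using that \<rho> \<pi>X by (simp add: permute_list_compose[symmetric] permutes_inv_o)
  have inv2: "permute_list \<pi> (permute_list ?\<rho> xs) = xs" if "length xs = length Xs" for xs :: "'c list"
    using that \<rho> \<pi>X by (simp add: permute_list_compose[symmetric] permutes_inv_o)
  have ru: "compose (carrier (tensor Xs)) r (perm_op \<pi> Xs) \<in> functionals Xs"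
    "xs \<in> vec_lists Xs \<Longrightarrow> compose (carrier (tensor Xs)) r (perm_op \<pi> Xs) (elem_tensor Xs xs) =
      r (elem_tensor (Ys @ Zs) (permute_list \<pi> xs))" if r: "r \<in> functionals (Ys @ Zs)" for r xs
    using compose_bounded_ops[OF r u(1) inner_product_tensor[OF fdX] inner_product_tensor[OF fd(3)]]
      u(2) elem_tensor_carrier[OF fdX] by (auto simp: compose_def)
  show 1: "interp (Atom R vs) \<Gamma> Xs = ?S"
    unfolding I
  proof (intro equalityI subsetI)
    fix f assume "f \<in> {compose (carrier (tensor Xs)) r (perm_op \<pi> Xs) | r. r \<in> ?P}"
    then obtain h where h: "h \<in> ?P" and f: "f = compose (carrier (tensor Xs)) h (perm_op \<pi> Xs)" by blast
    have hf: "h \<in> functionals (Ys @ Zs)" using h by blast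
    show "f \<in> ?S"
    proof (intro CollectI conjI ballI)
      show "f \<in> functionals Xs" using ru(1)[OF hf] f by simp
      fix zs assume "zs \<in> vec_lists Zs"
      then obtain r where r: "r \<in> R Ys"
        "\<And>ys. ys \<in> vec_lists Ys \<Longrightarrow> r (elem_tensor Ys ys) = h (elem_tensor (Ys @ Zs) (ys @ zs))"
        using h by blast
      show "\<exists>r\<in>R Ys. \<forall>ys\<in>vec_lists Ys. \<forall>xs\<in>vec_lists Xs. permute_list \<pi> xs = ys @ zs \<longrightarrow>
        r (elem_tensor Ys ys) = f (elem_tensor Xs xs)"
        by (rule bexI[OF _ r(1)]) (use r(2) ru(2)[OF hf] f in simp)
    qed
  next
    fix f assume f: "f \<in> ?S"
    have lenYZ: "length (Ys @ Zs) = length Xs" using YZ(1) by (metis length_permute_list)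
    have \<rho>YZ: "?\<rho> permutes {..<length (Ys @ Zs)}" using \<rho> lenYZ by simp
    have YZX: "permute_list ?\<rho> (Ys @ Zs) = Xs" using inv1[of Xs] YZ(1) by simp
    note v = perm_op[OF fd(3) \<rho>YZ, unfolded YZX]
    define h where "h = compose (carrier (tensor (Ys @ Zs))) f (perm_op ?\<rho> (Ys @ Zs))"
    have ff: "f \<in> functionals Xs" using f by blast
    have hf: "h \<in> functionals (Ys @ Zs)" unfolding h_def
      by (rule compose_bounded_ops[OF ff v(1) inner_product_tensor[OF fd(3)] inner_product_tensor[OF fdX]])
    have h: "h (elem_tensor (Ys @ Zs) ws) = f (elem_tensor Xs (permute_list ?\<rho> ws))"
      if "ws \<in> vec_lists (Ys @ Zs)" for ws
      using v(2)[OF that] elem_tensor_carrier[OF fd(3) that] by (simp add: h_def compose_def)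
    have "h \<in> ?P"
    proof (intro CollectI conjI ballI hf)
      fix zs assume zs: "zs \<in> vec_lists Zs"
      then obtain r where r: "r \<in> R Ys" "\<forall>ys\<in>vec_lists Ys. \<forall>xs\<in>vec_lists Xs. permute_list \<pi> xs = ys @ zs \<longrightarrow>
        r (elem_tensor Ys ys) = f (elem_tensor Xs xs)" using f by blast
      show "\<exists>r\<in>R Ys. \<forall>ys\<in>vec_lists Ys. r (elem_tensor Ys ys) = h (elem_tensor (Ys @ Zs) (ys @ zs))"
      proof (rule bexI[OF _ r(1)], intro ballI)
        fix ys assume ys: "ys \<in> vec_lists Ys"
        have yz: "ys @ zs \<in> vec_lists (Ys @ Zs)" using ys zs by (auto simp: listset_append_iff)
        have lyz: "length (ys @ zs) = length Xs" using yz lenYZ by (simp add: listset_iff)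
        have "permute_list ?\<rho> (ys @ zs) \<in> listset (permute_list ?\<rho> (map carrier (Ys @ Zs)))"
          by (rule permute_vec_lists[OF _ yz]) (use \<rho>YZ in simp)
        also have "permute_list ?\<rho> (map carrier (Ys @ Zs)) = map carrier Xs"
          using permute_list_map[OF \<rho>YZ, of carrier] YZX by simp
        finally have "permute_list ?\<rho> (ys @ zs) \<in> vec_lists Xs" .
        moreover have "permute_list \<pi> (permute_list ?\<rho> (ys @ zs)) = ys @ zs" by (rule inv2[OF lyz])
        ultimately have "r (elem_tensor Ys ys) = f (elem_tensor Xs (permute_list ?\<rho> (ys @ zs)))"
          using r(2) ys by blast
        then show "r (elem_tensor Ys ys) = h (elem_tensor (Ys @ Zs) (ys @ zs))" using h[OF yz] by simp
      qed
    qed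
    moreover have "f = compose (carrier (tensor Xs)) h (perm_op \<pi> Xs)"
    proof (rule functional_eqI[OF fdX ff ru(1)[OF hf]])
      fix xs assume xs: "xs \<in> vec_lists Xs"
      then have "length xs = length Xs" by (simp add: listset_iff)
      then show "f (elem_tensor Xs xs) = compose (carrier (tensor Xs)) h (perm_op \<pi> Xs) (elem_tensor Xs xs)"
        unfolding ru(2)[OF hf xs] h[OF perm[OF xs]] by (simp add: inv1)
    qed
    ultimately show "f \<in> {compose (carrier (tensor Xs)) r (perm_op \<pi> Xs) | r. r \<in> ?P}" by blast
  qed
  have P: "functional_subspace (Ys @ Zs) ?P" by (rule functional_subspace_slices[OF fd(1,2) RY])
  note PD = functional_subspaceD[OF P fd(3)]
  have uc: "perm_op \<pi> Xs t \<in> carrier (tensor (Ys @ Zs))" if "t \<in> carrier (tensor Xs)" for t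
    using bounded_opsD(1)[OF u(1) that] .
  show "functional_subspace Xs (interp (Atom R vs) \<Gamma> Xs)"
    unfolding functional_subspace_iff[OF fdX]
  proof (intro conjI ballI allI)
    show "interp (Atom R vs) \<Gamma> Xs \<subseteq> functionals Xs" unfolding 1 by blast
    show "(\<lambda>t\<in>carrier (tensor Xs). 0) \<in> interp (Atom R vs) \<Gamma> Xs"
      unfolding I using PD(2) uc
      by (intro CollectI exI[of _ "\<lambda>t\<in>carrier (tensor (Ys @ Zs)). 0"]) (auto simp: compose_def intro!: restrict_ext)
  next
    fix a b assume "a \<in> interp (Atom R vs) \<Gamma> Xs" "b \<in> interp (Atom R vs) \<Gamma> Xs"
    then obtain r s where "r \<in> ?P" "a = compose (carrier (tensor Xs)) r (perm_op \<pi> Xs)"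
      "s \<in> ?P" "b = compose (carrier (tensor Xs)) s (perm_op \<pi> Xs)" unfolding I by blast
    then show "(\<lambda>t\<in>carrier (tensor Xs). a t + b t) \<in> interp (Atom R vs) \<Gamma> Xs"
      unfolding I using PD(3)[of r s] uc
      by (intro CollectI exI[of _ "\<lambda>t\<in>carrier (tensor (Ys @ Zs)). r t + s t"])
        (auto simp: compose_def simp del: mem_Collect_eq intro!: restrict_ext)
  next
    fix c a assume "a \<in> interp (Atom R vs) \<Gamma> Xs"
    then obtain r where "r \<in> ?P" "a = compose (carrier (tensor Xs)) r (perm_op \<pi> Xs)" unfolding I by blast
    then show "(\<lambda>t\<in>carrier (tensor Xs). c * a t) \<in> interp (Atom R vs) \<Gamma> Xs"
      unfolding I using PD(4)[of r c] uc
      by (intro CollectI exI[of _ "\<lambda>t\<in>carrier (tensor (Ys @ Zs)). c * r t"])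
        (auto simp: compose_def simp del: mem_Collect_eq intro!: restrict_ext)
  qed
qed

subsection \<open>Connectives and quantifiers\<close>

lemma ball_listset_Cons: "(\<forall>xs\<in>listset (A # As). P xs) \<longleftrightarrow> (\<forall>a\<in>A. \<forall>as\<in>listset As. P (a # as))"
  unfolding Ball_def listset_Cons_iff by blast

lemma Cons_mem_listset: "a # as \<in> listset (A # As) \<longleftrightarrow> a \<in> A \<and> as \<in> listset As"
  unfolding listset_Cons_iff by blast

lemma relationsI: "(\<And>Xs. Xs \<in> listset As \<Longrightarrow> functional_subspace Xs (f Xs)) \<Longrightarrow> (\<lambda>Xs\<in>listset As. f Xs) \<in> relations As"
  by (auto simp: relations_def)

lemma functional_subspace_subset: "functional_subspace Xs W \<Longrightarrow> fd_list Xs \<Longrightarrow> W \<subseteq> functionals Xs"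
  using functional_subspaceD(1) by blast

lemma interp_Neg_relations:
  assumes "quantum_sets (map fst \<Gamma>)" "interp \<phi> \<Gamma> \<in> relations (map fst \<Gamma>)"
  shows "interp (Neg \<phi>) \<Gamma> \<in> relations (map fst \<Gamma>)"
  unfolding interp.simps rel_not_def
proof (rule relationsI)
  fix Xs assume Xs: "Xs \<in> listset (map fst \<Gamma>)"
  note fd = quantum_sets_fd_list[OF assms(1) Xs]
  show "functional_subspace Xs (ortho_compl (tensor Xs) complex_hilb (interp \<phi> \<Gamma> Xs))"
    by (rule op_subspace_ortho_compl[OF fd_tensor[OF fd] ip_complex_hilb
          functional_subspace_subset[OF relationsD[OF assms(2) Xs] fd]])
qed

lemma interp_Conj_relations:
  assumes "quantum_sets (map fst \<Gamma>)" "interp \<phi> \<Gamma> \<in> relations (map fst \<Gamma>)" "interp \<psi> \<Gamma> \<in> relations (map fst \<Gamma>)"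
  shows "interp (Conj \<phi> \<psi>) \<Gamma> \<in> relations (map fst \<Gamma>)"
  unfolding interp.simps rel_meet_def
proof (rule relationsI)
  fix Xs assume Xs: "Xs \<in> listset (map fst \<Gamma>)"
  note fd = quantum_sets_fd_list[OF assms(1) Xs]
  show "functional_subspace Xs (interp \<phi> \<Gamma> Xs \<inter> interp \<psi> \<Gamma> Xs)"
    by (rule op_subspace_Int[OF inner_product_tensor[OF fd] ip_complex_hilb
          relationsD[OF assms(2) Xs] relationsD[OF assms(3) Xs]])
qed

lemma interp_Imp_relations:
  assumes "quantum_sets (map fst \<Gamma>)" "interp \<phi> \<Gamma> \<in> relations (map fst \<Gamma>)" "interp \<psi> \<Gamma> \<in> relations (map fst \<Gamma>)"
  shows "interp (Imp \<phi> \<psi>) \<Gamma> \<in> relations (map fst \<Gamma>)"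
  unfolding Imp_def Disj_def
  by (intro interp_Neg_relations interp_Conj_relations assms)

lemma interp_Forall_relations:
  assumes "quantum_sets (map fst \<Gamma>)"
  shows "interp (Forall x \<phi>) \<Gamma> \<in> relations (map fst \<Gamma>)"
  unfolding interp.simps rel_Sup_def
proof (rule relationsI)
  fix Xs assume Xs: "Xs \<in> listset (map fst \<Gamma>)"
  note fd = quantum_sets_fd_list[OF assms(1) Xs]
  show "functional_subspace Xs (functional_span Xs (\<Union>R\<in>{R \<in> relations (map fst \<Gamma>). rel_le (map fst (x # \<Gamma>))
      (rel_prod [fst x] (map fst \<Gamma>) (rel_top [fst x]) R) (interp \<phi> (x # \<Gamma>))}. R Xs))"
    by (rule op_subspace_op_span[OF inner_product_tensor[OF fd] ip_complex_hilb])
      (use functional_subspaceD(1)[OF relationsD[OF _ Xs] fd] in blast)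
qed

abbreviation hs_functional :: "'v hilb list \<Rightarrow> (('v list \<Rightarrow> complex) \<Rightarrow> complex) \<Rightarrow> (('v list \<Rightarrow> complex) \<Rightarrow> complex) \<Rightarrow> complex" where
  "hs_functional Xs \<equiv> hs_ip (tensor Xs) complex_hilb"

lemma cnj_hs_functional:
  assumes "fd_list Xs" "a \<in> functionals Xs" "b \<in> functionals Xs"
  shows "cnj (hs_functional Xs a b) = hs_functional Xs b a"
  using inner_product_space.cnj_ip[OF inner_product_hs_space[OF fd_tensor[OF assms(1)] ip_complex_hilb]] assms by simp

text \<open>The Sasaki arrow \<open>A \<rightarrow> B\<close> is the orthogonal complement of \<open>A\<^sup>\<bottom>\<^sup>\<bottom> \<inter> (A \<inter> B)\<^sup>\<bottom>\<close>, and \<open>A\<^sup>\<bottom>\<^sup>\<bottom> = A\<close> in finite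
  dimension.\<close>

lemma interp_Imp_iff:
  assumes q: "quantum_sets (map fst \<Gamma>)" and Xs: "Xs \<in> listset (map fst \<Gamma>)"
    and \<phi>: "interp \<phi> \<Gamma> \<in> relations (map fst \<Gamma>)" and \<psi>: "interp \<psi> \<Gamma> \<in> relations (map fst \<Gamma>)"
  shows "h \<in> interp (Imp \<phi> \<psi>) \<Gamma> Xs \<longleftrightarrow> h \<in> functionals Xs \<and> (\<forall>a\<in>interp \<phi> \<Gamma> Xs.
     (\<forall>b\<in>interp \<phi> \<Gamma> Xs \<inter> interp \<psi> \<Gamma> Xs. hs_functional Xs b a = 0) \<longrightarrow> hs_functional Xs a h = 0)"
proof -
  note fd = quantum_sets_fd_list[OF q Xs]
  let ?A = "interp \<phi> \<Gamma> Xs" and ?B = "interp \<psi> \<Gamma> Xs"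
  have A: "?A \<subseteq> functionals Xs" by (rule functional_subspace_subset[OF relationsD[OF \<phi> Xs] fd])
  have "ortho_compl (tensor Xs) complex_hilb (ortho_compl (tensor Xs) complex_hilb ?A) = ?A"
  proof (intro equalityI subsetI)
    fix a assume a: "a \<in> ?A"
    then have "hs_functional Xs b a = 0" if "b \<in> functionals Xs" "\<forall>w\<in>?A. hs_functional Xs w b = 0" for b
      using cnj_hs_functional[OF fd _ that(1), of a] that(2) A by auto
    then show "a \<in> ortho_compl (tensor Xs) complex_hilb (ortho_compl (tensor Xs) complex_hilb ?A)"
      using a A by (auto simp: ortho_compl_def)
  next
    fix a assume "a \<in> ortho_compl (tensor Xs) complex_hilb (ortho_compl (tensor Xs) complex_hilb ?A)"
    then show "a \<in> ?A"
      by (intro hs_double_orthogonal[OF fd_tensor[OF fd] fd_complex_hilb relationsD[OF \<phi> Xs]])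
        (auto simp: ortho_compl_def)
  qed
  then show ?thesis
    using Xs A unfolding Imp_def Disj_def
    by (auto simp: rel_not_def rel_meet_def) (auto simp: ortho_compl_def subset_iff)
qed

lemma interp_Imp_modus_ponens:
  assumes q: "quantum_sets (map fst \<Gamma>)" and Xs: "Xs \<in> listset (map fst \<Gamma>)"
    and \<phi>: "interp \<phi> \<Gamma> \<in> relations (map fst \<Gamma>)" and \<psi>: "interp \<psi> \<Gamma> \<in> relations (map fst \<Gamma>)"
    and h: "h \<in> interp (Imp \<phi> \<psi>) \<Gamma> Xs" "h \<in> interp \<phi> \<Gamma> Xs"
  shows "h \<in> interp \<psi> \<Gamma> Xs"
proof -
  note fd = quantum_sets_fd_list[OF q Xs]
  note T = fd_tensor[OF fd]
  obtain S where S: "finite_spanning (hs_space (tensor Xs) complex_hilb) S"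
    using fd_hilbert_spaceD(2)[OF fd_hs_space[OF T fd_complex_hilb]] by blast
  note sub = submodule_hs_space[OF fd_hilbert_spaceD(1)[OF T] ip_complex_hilb]
  show ?thesis
    by (rule inner_product_space.sasaki_modus_ponens[OF inner_product_hs_space[OF T ip_complex_hilb] S _ _ h(2)])
      (use h(1) relationsD[OF \<phi> Xs] relationsD[OF \<psi> Xs] in
        \<open>auto simp: sub interp_Imp_iff[OF q Xs \<phi> \<psi>]\<close>)
qed

text \<open>The functionals on the right-hand side form a relation \<open>S\<close> such that \<open>\<top> \<times> S\<close> lies below the
  interpretation of \<open>\<phi>\<close>, and every relation with this property lies below \<open>S\<close>.\<close>

lemma interp_Forall_iff:
  assumes q: "quantum_set (fst x)" "quantum_sets (map fst \<Gamma>)" and Xs: "Xs \<in> listset (map fst \<Gamma>)"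
    and \<phi>: "interp \<phi> (x # \<Gamma>) \<in> relations (map fst (x # \<Gamma>))"
  shows "f \<in> interp (Forall x \<phi>) \<Gamma> Xs \<longleftrightarrow> f \<in> functionals Xs \<and>
    (\<forall>X\<in>fst x. \<forall>g\<in>functionals [X]. tensor_functional [X] Xs g f \<in> interp \<phi> (x # \<Gamma>) (X # Xs))"
proof -
  define S where "S = (\<lambda>Ys. {f \<in> functionals Ys. \<forall>X\<in>fst x. \<forall>g\<in>functionals [X].
      tensor_functional [X] Ys g f \<in> interp \<phi> (x # \<Gamma>) (X # Ys)})"
  have S_sub: "functional_subspace Ys (S Ys)" if Ys: "Ys \<in> listset (map fst \<Gamma>)" for Ys
  proof -
    note fd = quantum_sets_fd_list[OF q(2) Ys]
    note FD = functionals_closed[OF fd fd]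
    have W: "functional_subspace (X # Ys) (interp \<phi> (x # \<Gamma>) (X # Ys))" and fdX: "fd_list [X]" if "X \<in> fst x" for X
      using relationsD[OF \<phi>, of "X # Ys"] that Ys quantum_setD[OF q(1) that]
      by (auto simp: Cons_mem_listset simp del: listset.simps(2))
    have tf: "tensor_functional [X] Ys g a \<in> functionals (X # Ys)"
      "\<lbrakk>x' \<in> carrier X; ys \<in> vec_lists Ys\<rbrakk> \<Longrightarrow> tensor_functional [X] Ys g a (elem_tensor (X # Ys) (x' # ys)) =
        g (elem_tensor [X] [x']) * a (elem_tensor Ys ys)"
      if "X \<in> fst x" "g \<in> functionals [X]" "a \<in> functionals Ys" for X g a x' ys
      using tensor_functional[OF fdX[OF that(1)] fd that(2,3)] tensor_functional(2)[OF fdX[OF that(1)] fd that(2,3), of "[x']" ys]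
      by (auto simp: Cons_mem_listset simp del: listset.simps(2))
    have comb: "tensor_functional [X] Ys g h \<in> interp \<phi> (x # \<Gamma>) (X # Ys)"
      if X: "X \<in> fst x" and g: "g \<in> functionals [X]" and h: "h \<in> functionals Ys" and I: "finite I"
        and a: "\<And>i. i \<in> I \<Longrightarrow> a i \<in> S Ys"
        and eq: "\<And>ys. ys \<in> vec_lists Ys \<Longrightarrow> h (elem_tensor Ys ys) = (\<Sum>i\<in>I. c i * a i (elem_tensor Ys ys))"
      for X g h and I :: "nat set" and a c
    proof (rule functional_subspace_lincomb[OF W[OF X] _ I])
      show "fd_list (X # Ys)" using fd fdX[OF X] by simp
      show "tensor_functional [X] Ys g (a i) \<in> interp \<phi> (x # \<Gamma>) (X # Ys)" if "i \<in> I" for i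
        using a[OF that] X g by (simp add: S_def)
      fix zs assume "zs \<in> vec_lists (X # Ys)"
      then obtain x' ys where z: "zs = x' # ys" "x' \<in> carrier X" "ys \<in> vec_lists Ys"
        by (auto simp: set_Cons_def)
      have "a i \<in> functionals Ys" if "i \<in> I" for i using a[OF that] by (simp add: S_def)
      then show "tensor_functional [X] Ys g h (elem_tensor (X # Ys) zs) =
          (\<Sum>i\<in>I. c i * tensor_functional [X] Ys g (a i) (elem_tensor (X # Ys) zs))"
        using tf(2)[OF X g h z(2,3)] tf(2)[OF X g _ z(2,3)] eq[OF z(3)] z(1)
        by (simp add: sum_distrib_left mult_ac)
    qed (use tf(1)[OF X g h] in simp)
    show ?thesis unfolding functional_subspace_iff[OF fd]
    proof (intro conjI ballI allI)
      show "S Ys \<subseteq> functionals Ys" by (auto simp: S_def)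
      have "tensor_functional [X] Ys g (\<lambda>t\<in>carrier (tensor Ys). 0) \<in> interp \<phi> (x # \<Gamma>) (X # Ys)"
        if "X \<in> fst x" "g \<in> functionals [X]" for X g
        by (rule comb[OF that FD(2), of "{}"]) (use elem_tensor_carrier[OF fd] in auto)
      then show "(\<lambda>t\<in>carrier (tensor Ys). 0) \<in> S Ys" using FD(2) by (simp add: S_def)
    next
      fix a b assume ab: "a \<in> S Ys" "b \<in> S Ys"
      then have h: "(\<lambda>t\<in>carrier (tensor Ys). a t + b t) \<in> functionals Ys"
        by (intro FD(3)) (auto simp: S_def)
      have "tensor_functional [X] Ys g (\<lambda>t\<in>carrier (tensor Ys). a t + b t) \<in> interp \<phi> (x # \<Gamma>) (X # Ys)"
        if "X \<in> fst x" "g \<in> functionals [X]" for X g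
        by (rule comb[OF that h, of "{0, 1}" "\<lambda>i. if i = 0 then a else b" "\<lambda>_. 1"])
          (use ab elem_tensor_carrier[OF fd] in auto)
      then show "(\<lambda>t\<in>carrier (tensor Ys). a t + b t) \<in> S Ys" using h by (simp add: S_def)
    next
      fix c a assume a: "a \<in> S Ys"
      then have h: "(\<lambda>t\<in>carrier (tensor Ys). c * a t) \<in> functionals Ys"
        by (intro FD(4)) (auto simp: S_def)
      have "tensor_functional [X] Ys g (\<lambda>t\<in>carrier (tensor Ys). c * a t) \<in> interp \<phi> (x # \<Gamma>) (X # Ys)"
        if "X \<in> fst x" "g \<in> functionals [X]" for X g
        by (rule comb[OF that h, of "{0}" "\<lambda>_. a" "\<lambda>_. c"]) (use a elem_tensor_carrier[OF fd] in auto)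
      then show "(\<lambda>t\<in>carrier (tensor Ys). c * a t) \<in> S Ys" using h by (simp add: S_def)
    qed
  qed
  let ?\<R> = "{R \<in> relations (map fst \<Gamma>). rel_le (map fst (x # \<Gamma>))
      (rel_prod [fst x] (map fst \<Gamma>) (rel_top [fst x]) R) (interp \<phi> (x # \<Gamma>))}"
  have prod: "rel_prod [fst x] (map fst \<Gamma>) (rel_top [fst x]) R (X # Ys) =
      functional_span (X # Ys) {tensor_functional [X] Ys g s | g s. g \<in> functionals [X] \<and> s \<in> R Ys}"
    if "X \<in> fst x" "Ys \<in> listset (map fst \<Gamma>)" for X Ys R
    using that by (simp add: rel_prod_def rel_top_def Let_def Cons_mem_listset del: listset.simps(2))
  have I: "interp (Forall x \<phi>) \<Gamma> Xs = functional_span Xs (\<Union>R\<in>?\<R>. R Xs)"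
    using Xs by (simp add: rel_Sup_def)
  have "interp (Forall x \<phi>) \<Gamma> Xs = S Xs"
  proof
    show "interp (Forall x \<phi>) \<Gamma> Xs \<subseteq> S Xs"
      unfolding I
    proof (rule op_span_minimal[OF _ S_sub[OF Xs]], intro subsetI)
      fix f assume "f \<in> (\<Union>R\<in>?\<R>. R Xs)"
      then obtain R where R: "R \<in> relations (map fst \<Gamma>)" "f \<in> R Xs" and le: "rel_le (map fst (x # \<Gamma>))
        (rel_prod [fst x] (map fst \<Gamma>) (rel_top [fst x]) R) (interp \<phi> (x # \<Gamma>))" by blast
      have "tensor_functional [X] Xs g f \<in> interp \<phi> (x # \<Gamma>) (X # Xs)" if X: "X \<in> fst x" and g: "g \<in> functionals [X]" for X g
      proof -
        have "tensor_functional [X] Xs g f \<in> rel_prod [fst x] (map fst \<Gamma>) (rel_top [fst x]) R (X # Xs)"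
          unfolding prod[OF X Xs] by (rule op_span_inc) (use g R in blast)
        moreover have "X # Xs \<in> listset (map fst (x # \<Gamma>))"
          using X Xs by (simp add: Cons_mem_listset del: listset.simps(2))
        ultimately show ?thesis using le unfolding rel_le_def by blast
      qed
      then show "f \<in> S Xs"
        using functional_subspaceD(1)[OF relationsD[OF R(1) Xs] quantum_sets_fd_list[OF q(2) Xs] R(2)]
        by (simp add: S_def)
    qed
    show "S Xs \<subseteq> interp (Forall x \<phi>) \<Gamma> Xs"
    proof
      fix f assume f: "f \<in> S Xs"
      define R where "R = (\<lambda>Ys\<in>listset (map fst \<Gamma>). S Ys)"
      have "R \<in> relations (map fst \<Gamma>)" unfolding R_def by (rule relationsI[OF S_sub])
      moreover have "rel_le (map fst (x # \<Gamma>)) (rel_prod [fst x] (map fst \<Gamma>) (rel_top [fst x]) R) (interp \<phi> (x # \<Gamma>))"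
        unfolding rel_le_def
      proof
        fix Zs assume Zs: "Zs \<in> listset (map fst (x # \<Gamma>))"
        then obtain X Ys where Z: "Zs = X # Ys" "X \<in> fst x" "Ys \<in> listset (map fst \<Gamma>)"
          by (auto simp: set_Cons_def)
        show "rel_prod [fst x] (map fst \<Gamma>) (rel_top [fst x]) R Zs \<subseteq> interp \<phi> (x # \<Gamma>) Zs"
          unfolding Z(1) prod[OF Z(2,3)]
          by (rule op_span_minimal) (use relationsD[OF \<phi> Zs] Z in \<open>auto simp: R_def S_def\<close>)
      qed
      ultimately have "R \<in> ?\<R>" by blast
      then show "f \<in> interp (Forall x \<phi>) \<Gamma> Xs"
        unfolding I using f Xs by (intro op_span_inc UN_I[of R]) (auto simp: R_def)
    qed
  qed
  then show ?thesis by (simp add: S_def)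
qed

subsection \<open>Quantification over the equality relation\<close>

lemma evaluation:
  assumes X: "fd_hilbert_space X"
  shows "evaluation X \<in> functionals [X, hdual X]"
    and "\<lbrakk>x \<in> carrier X; y \<in> carrier X\<rbrakk> \<Longrightarrow> evaluation X (elem_tensor [X, hdual X] [x, y]) = ip X y x"
proof -
  note Xi = fd_hilbert_spaceD(1)[OF X]
  interpret X: inner_product_space X by fact
  have fd: "fd_list [X, hdual X]" using X fd_hdual by simp
  have m: "multilinear [X, hdual X] (\<lambda>xs. ip X (xs ! 1) (xs ! 0))"
    unfolding multilinear.simps ball_listset_Cons list.map
    by (auto intro!: linear_functionalI[OF Xi] linear_functionalI[OF inner_product_hdual[OF Xi], simplified]
        simp: X.ip_simps)
  show "evaluation X \<in> functionals [X, hdual X]"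
    unfolding evaluation_def by (rule functional_lift(1)[OF fd m])
  assume "x \<in> carrier X" "y \<in> carrier X"
  then show "evaluation X (elem_tensor [X, hdual X] [x, y]) = ip X y x"
    unfolding evaluation_def using functional_lift(2)[OF fd m, of "[x, y]"]
    by (simp add: Cons_mem_listset del: listset.simps(2))
qed

lemma equality_rel:
  assumes \<X>: "quantum_set \<X>"
  shows "equality_rel \<X> \<in> relations [\<X>, qdual \<X>]"
    and "\<lbrakk>X \<in> \<X>; Z \<in> qdual \<X>\<rbrakk> \<Longrightarrow> r \<in> equality_rel \<X> [X, Z] \<longleftrightarrow> r \<in> functionals [X, Z] \<and>
      (\<exists>c. \<forall>x\<in>carrier X. \<forall>z\<in>carrier Z. r (elem_tensor [X, Z] [x, z]) = c * (if Z = hdual X then ip X z x else 0))"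
proof -
  have gen: "(if Z = hdual X then {evaluation X} else {}) \<subseteq> functionals [X, Z]" if "X \<in> \<X>" for X Z
    using evaluation(1)[OF quantum_setD[OF \<X> that]] by auto
  have fd: "fd_list [X, Z]" if "X \<in> \<X>" "Z \<in> qdual \<X>" for X Z
    using that quantum_setD[OF \<X>] quantum_setD[OF quantum_set_qdual[OF \<X>]] by simp
  show "equality_rel \<X> \<in> relations [\<X>, qdual \<X>]"
    unfolding equality_rel_def
  proof (rule relationsI)
    fix Xs assume "Xs \<in> listset [\<X>, qdual \<X>]"
    then obtain X Z where XZ: "Xs = [X, Z]" "X \<in> \<X>" "Z \<in> qdual \<X>" by (auto simp: set_Cons_def)
    show "functional_subspace Xs (functional_span Xs (if Xs ! 1 = hdual (Xs ! 0) then {evaluation (Xs ! 0)} else {}))"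
      using op_subspace_op_span[OF inner_product_tensor[OF fd[OF XZ(2,3)]] ip_complex_hilb gen[OF XZ(2)]] XZ(1)
      by (cases "Z = hdual X") simp_all
  qed
  assume XZ: "X \<in> \<X>" "Z \<in> qdual \<X>"
  note fd' = fd[OF XZ]
  let ?G = "if Z = hdual X then {evaluation X} else {}"
  let ?S = "{r \<in> functionals [X, Z]. \<exists>c. \<forall>x\<in>carrier X. \<forall>z\<in>carrier Z.
     r (elem_tensor [X, Z] [x, z]) = c * (if Z = hdual X then ip X z x else 0)}"
  note FD = functionals_closed[OF fd' fd']
  have et: "elem_tensor [X, Z] [x, z] \<in> carrier (tensor [X, Z])" if "x \<in> carrier X" "z \<in> carrier Z" for x z
    by (rule elem_tensor_carrier[OF fd']) (use that in \<open>simp add: set_Cons_def\<close>)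
  have E: "equality_rel \<X> [X, Z] = functional_span [X, Z] ?G"
    using XZ by (simp add: equality_rel_def Cons_mem_listset del: listset.simps(2))
  have ev: "evaluation X (elem_tensor [X, Z] [x, z]) = ip X z x" if "Z = hdual X" "x \<in> carrier X" "z \<in> carrier Z" for x z
    using evaluation(2)[OF quantum_setD[OF \<X> XZ(1)]] that by simp
  have S: "functional_subspace [X, Z] ?S"
    unfolding functional_subspace_iff[OF fd']
  proof (intro conjI ballI allI)
    show "(\<lambda>t\<in>carrier (tensor [X, Z]). 0) \<in> ?S" using FD(2) et by (auto intro!: exI[of _ 0])
  next
    fix a b assume a: "a \<in> ?S" and b: "b \<in> ?S"
    then obtain c d where "\<forall>x\<in>carrier X. \<forall>z\<in>carrier Z. a (elem_tensor [X, Z] [x, z]) = c * (if Z = hdual X then ip X z x else 0)"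
      "\<forall>x\<in>carrier X. \<forall>z\<in>carrier Z. b (elem_tensor [X, Z] [x, z]) = d * (if Z = hdual X then ip X z x else 0)" by blast
    then show "(\<lambda>t\<in>carrier (tensor [X, Z]). a t + b t) \<in> ?S"
      using FD(3)[of a b] a b et by (auto intro!: exI[of _ "c + d"] simp: distrib_right)
  next
    fix k a assume a: "a \<in> ?S"
    then obtain c where "\<forall>x\<in>carrier X. \<forall>z\<in>carrier Z. a (elem_tensor [X, Z] [x, z]) = c * (if Z = hdual X then ip X z x else 0)" by blast
    then show "(\<lambda>t\<in>carrier (tensor [X, Z]). k * a t) \<in> ?S"
      using FD(4)[of a k] a et by (auto intro!: exI[of _ "k * c"])
  qed auto
  have "equality_rel \<X> [X, Z] = ?S"
  proof
    show "equality_rel \<X> [X, Z] \<subseteq> ?S"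
      unfolding E by (rule op_span_minimal[OF _ S]) (use gen[OF XZ(1), of Z] ev in \<open>auto intro!: exI[of _ 1]\<close>)
    show "?S \<subseteq> equality_rel \<X> [X, Z]"
    proof
      fix r assume r: "r \<in> ?S"
      then obtain c where c: "\<And>x z. x \<in> carrier X \<Longrightarrow> z \<in> carrier Z \<Longrightarrow>
         r (elem_tensor [X, Z] [x, z]) = c * (if Z = hdual X then ip X z x else 0)" by blast
      show "r \<in> equality_rel \<X> [X, Z]"
        unfolding E
      proof (rule functional_subspace_lincomb[OF
            op_subspace_op_span[OF inner_product_tensor[OF fd'] ip_complex_hilb gen[OF XZ(1)]] fd'])
        show "finite ?G" by simp
        show "g \<in> functional_span [X, Z] ?G" if "g \<in> ?G" for g by (rule op_span_inc[OF that])
        show "r \<in> functionals [X, Z]" using r by blast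
        fix xs assume "xs \<in> vec_lists [X, Z]"
        then obtain x z where "xs = [x, z]" "x \<in> carrier X" "z \<in> carrier Z" by (auto simp: set_Cons_def)
        then show "r (elem_tensor [X, Z] xs) = (\<Sum>g\<in>?G. c * g (elem_tensor [X, Z] xs))"
          using c ev by auto
      qed
    qed
  qed
  then show "r \<in> equality_rel \<X> [X, Z] \<longleftrightarrow> r \<in> functionals [X, Z] \<and>
      (\<exists>c. \<forall>x\<in>carrier X. \<forall>z\<in>carrier Z. r (elem_tensor [X, Z] [x, z]) = c * (if Z = hdual X then ip X z x else 0))"
    by blast
qed

lemma interp_Atom_relations:
  assumes \<Gamma>: "distinct \<Gamma>" "quantum_sets (map fst \<Gamma>)"
    and \<pi>: "\<pi> permutes {..<length \<Gamma>}" "permute_list \<pi> \<Gamma> = vs @ filter (\<lambda>v. v \<notin> set vs) \<Gamma>"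
    and R: "R \<in> relations (map fst vs)"
  shows "interp (Atom R vs) \<Gamma> \<in> relations (map fst \<Gamma>)"
proof -
  have "length (permute_list \<pi> \<Gamma>) = length vs + length (filter (\<lambda>v. v \<notin> set vs) \<Gamma>)" using \<pi>(2) by simp
  then have vs: "length vs \<le> length \<Gamma>" by simp
  have "functional_subspace Xs (interp (Atom R vs) \<Gamma> Xs)" if Xs: "Xs \<in> listset (map fst \<Gamma>)" for Xs
    by (rule interp_Atom(2)[OF \<Gamma> Xs \<pi> _ _ R, of "take (length vs) (permute_list \<pi> Xs)" "drop (length vs) (permute_list \<pi> Xs)"])
      (use vs Xs in \<open>auto simp: listset_iff\<close>)
  then show ?thesis by (auto simp: relations_def)
qed

lemma interp_Forall_eq_relations:
  "quantum_sets (map fst \<Gamma>) \<Longrightarrow> interp (Forall_eq \<X> i j \<phi>) \<Gamma> \<in> relations (map fst \<Gamma>)"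
  unfolding Forall_eq_def by (rule interp_Forall_relations)

text \<open>Let \<open>E\<close> be the interpretation of the equality atom. A product \<open>g\<^sub>1 \<otimes> g\<^sub>2\<close> of functionals on \<open>X\<close> and
  \<open>X\<^sup>*\<close> is a multiple of \<open>\<epsilon>\<^sub>X\<close> plus a functional orthogonal to \<open>\<epsilon>\<^sub>X\<close>. So \<open>g\<^sub>1 \<otimes> g\<^sub>2 \<otimes> f\<close> is a multiple of
  \<open>\<epsilon>\<^sub>X \<otimes> f\<close>, which lies in \<open>E\<close>, plus an element of \<open>E\<^sup>\<bottom>\<close>, which satisfies \<open>E \<rightarrow> \<phi>\<close> for every \<open>\<phi>\<close>. Hence all
  these products satisfy \<open>E \<rightarrow> \<phi>\<close> if \<open>\<epsilon>\<^sub>X \<otimes> f\<close> satisfies \<open>\<phi>\<close>. Conversely \<open>\<epsilon>\<^sub>X \<otimes> f\<close> is a sum of such products,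
  and modus ponens applies to it. On components \<open>X \<otimes> Z\<close> with \<open>Z \<noteq> X\<^sup>*\<close> the relation \<open>E\<close> vanishes and the
  implication holds trivially.\<close>

lemma interp_Forall_eq_iff:
  assumes \<X>: "quantum_set \<X>" and q: "quantum_sets (map fst \<Gamma>)"
    and dist: "distinct ((\<X>, i) # (qdual \<X>, j) # \<Gamma>)" and Xs: "Xs \<in> listset (map fst \<Gamma>)"
    and \<phi>: "interp \<phi> ((\<X>, i) # (qdual \<X>, j) # \<Gamma>) \<in> relations (map fst ((\<X>, i) # (qdual \<X>, j) # \<Gamma>))"
  shows "f \<in> interp (Forall_eq \<X> i j \<phi>) \<Gamma> Xs \<longleftrightarrow> f \<in> functionals Xs \<and>
    (\<forall>X\<in>\<X>. tensor_functional [X, hdual X] Xs (evaluation X) f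
       \<in> interp \<phi> ((\<X>, i) # (qdual \<X>, j) # \<Gamma>) (X # hdual X # Xs))"
proof -
  let ?\<Gamma>1 = "(qdual \<X>, j) # \<Gamma>" and ?\<Gamma> = "(\<X>, i) # (qdual \<X>, j) # \<Gamma>"
  let ?vs = "[(\<X>, i), (qdual \<X>, j)]"
  let ?E = "Atom (equality_rel \<X>) ?vs"
  let ?\<theta> = "Imp ?E \<phi>"
  have \<X>': "quantum_set (qdual \<X>)" by (rule quantum_set_qdual[OF \<X>])
  have q': "quantum_sets (map fst ?\<Gamma>)" "quantum_sets (map fst ?\<Gamma>1)" using q \<X> \<X>' by auto
  have filt: "filter (\<lambda>v. v \<notin> set ?vs) ?\<Gamma> = \<Gamma>"
    using dist by (auto simp: filter_id_conv)
  have \<pi>: "id permutes {..<length ?\<Gamma>}" "permute_list id ?\<Gamma> = ?vs @ filter (\<lambda>v. v \<notin> set ?vs) ?\<Gamma>"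
    unfolding filt by (auto simp: permutes_id)
  have R: "equality_rel \<X> \<in> relations (map fst ?vs)" using equality_rel(1)[OF \<X>] by simp
  have E: "interp ?E ?\<Gamma> \<in> relations (map fst ?\<Gamma>)"
    by (rule interp_Atom_relations[OF dist q'(1) \<pi> R])
  have \<theta>: "interp ?\<theta> ?\<Gamma> \<in> relations (map fst ?\<Gamma>)" by (rule interp_Imp_relations[OF q'(1) E \<phi>])
  have fdX: "fd_list Xs" by (rule quantum_sets_fd_list[OF q Xs])
  note mem = Cons_mem_listset
  have step: "f \<in> interp (Forall_eq \<X> i j \<phi>) \<Gamma> Xs \<longleftrightarrow> f \<in> functionals Xs \<and>
    (\<forall>Z\<in>qdual \<X>. \<forall>X\<in>\<X>. \<forall>g2\<in>functionals [Z]. \<forall>g1\<in>functionals [X].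
      tensor_functional [X] (Z # Xs) g1 (tensor_functional [Z] Xs g2 f) \<in> interp ?\<theta> ?\<Gamma> (X # Z # Xs))"
  proof -
    have 1: "g \<in> interp (Forall (\<X>, i) ?\<theta>) ?\<Gamma>1 (Z # Xs) \<longleftrightarrow> g \<in> functionals (Z # Xs) \<and>
      (\<forall>X\<in>\<X>. \<forall>g1\<in>functionals [X]. tensor_functional [X] (Z # Xs) g1 g \<in> interp ?\<theta> ?\<Gamma> (X # Z # Xs))"
      if Z: "Z \<in> qdual \<X>" for Z g
      using interp_Forall_iff[of "(\<X>, i)" ?\<Gamma>1 "Z # Xs" ?\<theta> g] \<X> q'(2) \<theta> Z Xs by (simp add: mem del: listset.simps(2) interp.simps)
    have 2: "tensor_functional [Z] Xs g2 f \<in> functionals (Z # Xs)"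
      if "Z \<in> qdual \<X>" "g2 \<in> functionals [Z]" "f \<in> functionals Xs" for Z g2
      using tensor_functional(1)[of "[Z]" Xs g2 f] that fdX quantum_setD[OF \<X>'] by simp
    show ?thesis unfolding Forall_eq_def
      using interp_Forall_iff[of "(qdual \<X>, j)" \<Gamma> Xs "Forall (\<X>, i) ?\<theta>" f] \<X>' q Xs
        interp_Forall_relations[OF q'(2), of "(\<X>, i)" ?\<theta>] 1 2 by (auto simp del: listset.simps(2) interp.simps)
  qed
  have main: "(\<forall>g2\<in>functionals [Z]. \<forall>g1\<in>functionals [X].
      tensor_functional [X] (Z # Xs) g1 (tensor_functional [Z] Xs g2 f) \<in> interp ?\<theta> ?\<Gamma> (X # Z # Xs)) \<longleftrightarrow>
    (Z = hdual X \<longrightarrow> tensor_functional [X, hdual X] Xs (evaluation X) f \<in> interp \<phi> ?\<Gamma> (X # hdual X # Xs))"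
    if X: "X \<in> \<X>" and Z: "Z \<in> qdual \<X>" and f: "f \<in> functionals Xs" for X Z
  proof -
    have XH: "fd_hilbert_space X" and ZH: "fd_hilbert_space Z"
      using X Z quantum_setD \<X> \<X>' by auto
    note Xi = fd_hilbert_spaceD(1)[OF XH] and Zi = fd_hilbert_spaceD(1)[OF ZH]
    interpret X: inner_product_space X by fact
    have fd: "fd_list [X]" "fd_list [Z]" "fd_list (Z # Xs)" "fd_list (X # Z # Xs)" "fd_list [X, Z]"
      using XH ZH fdX by auto
    have L: "X # Z # Xs \<in> listset (map fst ?\<Gamma>)" using X Z Xs by (simp add: mem del: listset.simps(2))
    let ?A = "interp ?E ?\<Gamma> (X # Z # Xs)" and ?B = "interp \<phi> ?\<Gamma> (X # Z # Xs)"
    note A_sub = relationsD[OF E L] and B_sub = relationsD[OF \<phi> L]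
    note Af = functional_subspaceD(1)[OF A_sub fd(4)]
    have A: "?A = {a \<in> functionals (X # Z # Xs). \<forall>zs\<in>vec_lists Xs. \<exists>r\<in>equality_rel \<X> [X, Z].
      \<forall>ys\<in>vec_lists [X, Z]. \<forall>xs\<in>vec_lists (X # Z # Xs). permute_list id xs = ys @ zs \<longrightarrow>
        r (elem_tensor [X, Z] ys) = a (elem_tensor (X # Z # Xs) xs)}"
      by (rule interp_Atom(1)[OF dist q'(1) L \<pi> _ _ R]) auto
    have A_D: "\<exists>c. \<forall>x\<in>carrier X. \<forall>z\<in>carrier Z.
        a (elem_tensor (X # Z # Xs) (x # z # zs)) = c * (if Z = hdual X then ip X z x else 0)"
      if a: "a \<in> ?A" and zs: "zs \<in> vec_lists Xs" for a zs
    proof -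
      obtain r where r: "r \<in> equality_rel \<X> [X, Z]" "\<forall>ys\<in>vec_lists [X, Z]. \<forall>xs\<in>vec_lists (X # Z # Xs).
         permute_list id xs = ys @ zs \<longrightarrow> r (elem_tensor [X, Z] ys) = a (elem_tensor (X # Z # Xs) xs)"
        using a zs unfolding A by blast
      obtain c where c: "\<forall>x\<in>carrier X. \<forall>z\<in>carrier Z. r (elem_tensor [X, Z] [x, z]) = c * (if Z = hdual X then ip X z x else 0)"
        using r(1) unfolding equality_rel(2)[OF \<X> X Z] by blast
      have "a (elem_tensor (X # Z # Xs) (x # z # zs)) = r (elem_tensor [X, Z] [x, z])"
        if "x \<in> carrier X" "z \<in> carrier Z" for x z
        using r(2)[rule_format, of "[x, z]" "x # z # zs"] that zs by (simp add: mem del: listset.simps(2))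
      then show ?thesis using c by auto
    qed
    have t: "tensor_functional [X] (Z # Xs) g1 (tensor_functional [Z] Xs g2 f) \<in> functionals (X # Z # Xs)"
      "\<lbrakk>x \<in> carrier X; z \<in> carrier Z; zs \<in> vec_lists Xs\<rbrakk> \<Longrightarrow>
        tensor_functional [X] (Z # Xs) g1 (tensor_functional [Z] Xs g2 f) (elem_tensor (X # Z # Xs) (x # z # zs)) =
        g1 (elem_tensor [X] [x]) * (g2 (elem_tensor [Z] [z]) * f (elem_tensor Xs zs))"
      if g: "g1 \<in> functionals [X]" "g2 \<in> functionals [Z]" for g1 g2 x z zs
    proof -
      note t2 = tensor_functional[OF fd(2) fdX g(2) f]
      have t2': "tensor_functional [Z] Xs g2 f \<in> functionals (Z # Xs)" using t2(1) by simp
      note t1 = tensor_functional[OF fd(1,3) g(1) t2']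
      show "tensor_functional [X] (Z # Xs) g1 (tensor_functional [Z] Xs g2 f) \<in> functionals (X # Z # Xs)"
        using t1(1) by simp
      assume "x \<in> carrier X" "z \<in> carrier Z" "zs \<in> vec_lists Xs"
      then show "tensor_functional [X] (Z # Xs) g1 (tensor_functional [Z] Xs g2 f) (elem_tensor (X # Z # Xs) (x # z # zs)) =
        g1 (elem_tensor [X] [x]) * (g2 (elem_tensor [Z] [z]) * f (elem_tensor Xs zs))"
        using t1(2)[of "[x]" "z # zs"] t2(2)[of "[z]" zs] by (simp add: mem del: listset.simps(2))
    qed
    show ?thesis
    proof (cases "Z = hdual X")
      case False
      have "tensor_functional [X] (Z # Xs) g1 (tensor_functional [Z] Xs g2 f) \<in> interp ?\<theta> ?\<Gamma> (X # Z # Xs)"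
        if g: "g1 \<in> functionals [X]" "g2 \<in> functionals [Z]" for g1 g2
        unfolding interp_Imp_iff[OF q'(1) L E \<phi>]
      proof (intro conjI ballI impI)
        fix a assume a: "a \<in> ?A"
        have "a (elem_tensor (X # Z # Xs) xs) = 0" if "xs \<in> vec_lists (X # Z # Xs)" for xs
          using that A_D[OF a] False by (auto simp: set_Cons_def)
        then show "hs_functional (X # Z # Xs) a (tensor_functional [X] (Z # Xs) g1 (tensor_functional [Z] Xs g2 f)) = 0"
          unfolding hs_ip_functionals[OF fd(4) onb_list_some[OF fd(4)] Af[OF a] t(1)[OF g]]
          using onb_list_subset[OF onb_list_some[OF fd(4)]] by (intro sum.neutral) auto
      qed (rule t(1)[OF g])
      then show ?thesis using False by blast
    next
      case True
      let ?e = "tensor_functional [X, hdual X] Xs (evaluation X) f"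
      note ev = evaluation[OF XH]
      have e: "?e \<in> functionals (X # Z # Xs)"
        "\<lbrakk>x \<in> carrier X; z \<in> carrier Z; zs \<in> vec_lists Xs\<rbrakk> \<Longrightarrow>
          ?e (elem_tensor (X # Z # Xs) (x # z # zs)) = ip X z x * f (elem_tensor Xs zs)" for x z zs
        using tensor_functional(1)[OF fd(5) fdX _ f, of "evaluation X"]
          tensor_functional(2)[OF fd(5) fdX _ f, of "evaluation X" "[x, z]" zs] ev True
        by (auto simp: mem simp del: listset.simps(2))
      have eA: "?e \<in> ?A"
        unfolding A
      proof (intro CollectI conjI ballI e(1))
        fix zs assume zs: "zs \<in> vec_lists Xs"
        let ?r = "\<lambda>t\<in>carrier (tensor [X, Z]). f (elem_tensor Xs zs) * evaluation X t"
        have r_eq: "?r (elem_tensor [X, Z] [x, z]) = f (elem_tensor Xs zs) * ip X z x"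
          if "x \<in> carrier X" "z \<in> carrier Z" for x z
          using elem_tensor_carrier[OF fd(5), of "[x, z]"] ev(2)[of x z] that True
          by (simp add: mem del: listset.simps(2))
        have "?r \<in> equality_rel \<X> [X, Z]"
          unfolding equality_rel(2)[OF \<X> X Z]
        proof
          show "?r \<in> functionals [X, Z]"
            by (rule functionals_closed(4)[OF fd(5) fd(5)]) (use ev(1) True in simp)
        qed (use r_eq True in auto)
        then show "\<exists>r\<in>equality_rel \<X> [X, Z]. \<forall>ys\<in>vec_lists [X, Z]. \<forall>xs\<in>vec_lists (X # Z # Xs).
          permute_list id xs = ys @ zs \<longrightarrow> r (elem_tensor [X, Z] ys) = ?e (elem_tensor (X # Z # Xs) xs)"
        proof (rule bexI[rotated], intro ballI impI)
          fix ys xs assume ys: "ys \<in> vec_lists [X, Z]" and xs: "permute_list id xs = ys @ zs"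
          obtain x z where xz: "ys = [x, z]" "x \<in> carrier X" "z \<in> carrier Z"
            using ys by (auto simp: set_Cons_def)
          then have "xs = x # z # zs" using xs by simp
          then show "?r (elem_tensor [X, Z] ys) = ?e (elem_tensor (X # Z # Xs) xs)"
            unfolding xz(1) using r_eq[OF xz(2,3)] e(2)[OF xz(2,3) zs] by simp
        qed
      qed
      let ?O = "some_onb X"
      note O = fd_hilbert_spaceD(3)[OF XH]
      note OD = orthonormal_basisD(1-3)[OF Xi O]
      note O' = orthonormal_basis_hdual[OF Xi O]
      let ?Fs = "listset (map some_onb Xs)"
      note Fs = onb_list_some[OF fdX]
      have onb: "onb_list (X # Z # Xs) (?O # ?O # map some_onb Xs)" using O O' Fs True by simp
      note hs = hs_ip_functionals[OF fd(4) onb]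
      have "?O \<noteq> {}"
      proof
        assume "?O = {}"
        then have "ip X x x = 0" if "x \<in> carrier X" for x
          using orthonormal_basisD(4)[OF Xi O that that] by simp
        then have "carrier X = {\<zero>\<^bsub>X\<^esub>}" using X.ip_self_eq_0 by auto
        then show False using \<X> X by (auto simp: quantum_set_def)
      qed
      then have card: "card ?O \<noteq> 0" using OD(1) by simp
      have delta: "(\<Sum>e\<in>?O. \<Sum>e'\<in>?O. (if e' = e then F e e' else 0)) = (\<Sum>e\<in>?O. F e e)" for F :: "_ \<Rightarrow> _ \<Rightarrow> complex"
        using OD(1) by simp
      show ?thesis
      proof
        assume R: "Z = hdual X \<longrightarrow> ?e \<in> interp \<phi> ?\<Gamma> (X # hdual X # Xs)"
        then have eB: "?e \<in> ?A \<inter> ?B" using eA True by simp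
        show "\<forall>g2\<in>functionals [Z]. \<forall>g1\<in>functionals [X].
          tensor_functional [X] (Z # Xs) g1 (tensor_functional [Z] Xs g2 f) \<in> interp ?\<theta> ?\<Gamma> (X # Z # Xs)"
          unfolding interp_Imp_iff[OF q'(1) L E \<phi>]
        proof (intro ballI conjI impI)
          fix g2 g1 a
          assume g2: "g2 \<in> functionals [Z]" and g1: "g1 \<in> functionals [X]" and a: "a \<in> ?A"
            and perp: "\<forall>b\<in>?A \<inter> ?B. hs_functional (X # Z # Xs) b a = 0"
          have "\<forall>zs\<in>vec_lists Xs. \<exists>c. \<forall>x\<in>carrier X. \<forall>z\<in>carrier Z.
              a (elem_tensor (X # Z # Xs) (x # z # zs)) = c * ip X z x"
            using A_D[OF a] True by simp
          from bchoice[OF this] obtain \<alpha> where \<alpha>: "\<And>zs x z. zs \<in> vec_lists Xs \<Longrightarrow> x \<in> carrier X \<Longrightarrow> z \<in> carrier Z \<Longrightarrow>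
              a (elem_tensor (X # Z # Xs) (x # z # zs)) = \<alpha> zs * ip X z x"
            by blast
          have Fv: "zs \<in> vec_lists Xs" if "zs \<in> ?Fs" for zs using onb_list_subset[OF Fs that] .
          have Ov: "e \<in> carrier X" "e \<in> carrier Z" if "e \<in> ?O" for e using OD(2)[OF that] True by auto
          \<comment> \<open>The inner product of \<open>\<epsilon>\<^sub>X \<otimes> f\<close> and \<open>a\<close> is the dimension of \<open>X\<close> times \<open>s\<close>, so \<open>s = 0\<close> as \<open>X \<noteq> 0\<close>.\<close>
          define s where "s = (\<Sum>zs\<in>?Fs. cnj (f (elem_tensor Xs zs)) * \<alpha> zs)"
          have "hs_functional (X # Z # Xs) ?e a =
            (\<Sum>e\<in>?O. \<Sum>e'\<in>?O. \<Sum>zs\<in>?Fs. cnj (?e (elem_tensor (X # Z # Xs) (e # e' # zs))) * a (elem_tensor (X # Z # Xs) (e # e' # zs)))"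
            unfolding hs[OF e(1) Af[OF a]] sum_listset_Cons ..
          also have "\<dots> = (\<Sum>e\<in>?O. \<Sum>e'\<in>?O. (if e' = e then s else 0))"
            using e(2) \<alpha> Fv Ov OD(3) by (intro sum.cong refl) (simp add: s_def)
          also have "\<dots> = of_nat (card ?O) * s" unfolding delta by simp
          finally have s: "s = 0" using perp eB card by simp
          have "hs_functional (X # Z # Xs) a (tensor_functional [X] (Z # Xs) g1 (tensor_functional [Z] Xs g2 f)) =
            (\<Sum>e\<in>?O. \<Sum>e'\<in>?O. \<Sum>zs\<in>?Fs. cnj (a (elem_tensor (X # Z # Xs) (e # e' # zs))) *
              tensor_functional [X] (Z # Xs) g1 (tensor_functional [Z] Xs g2 f) (elem_tensor (X # Z # Xs) (e # e' # zs)))"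
            unfolding hs[OF Af[OF a] t(1)[OF g1 g2]] sum_listset_Cons ..
          also have "\<dots> = (\<Sum>e\<in>?O. \<Sum>e'\<in>?O. (if e' = e then
              g1 (elem_tensor [X] [e]) * g2 (elem_tensor [Z] [e']) * cnj s else 0))"
            using t(2)[OF g1 g2] \<alpha> Fv Ov OD(3)
            by (intro sum.cong refl) (simp add: s_def sum_distrib_left mult_ac)
          also have "\<dots> = 0"
            by (simp only: s complex_cnj_zero mult_zero_right if_cancel sum.neutral_const)
          finally show "hs_functional (X # Z # Xs) a (tensor_functional [X] (Z # Xs) g1 (tensor_functional [Z] Xs g2 f)) = 0" .
        qed (rule t(1))
      next
        assume all: "\<forall>g2\<in>functionals [Z]. \<forall>g1\<in>functionals [X].
          tensor_functional [X] (Z # Xs) g1 (tensor_functional [Z] Xs g2 f) \<in> interp ?\<theta> ?\<Gamma> (X # Z # Xs)"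
        \<comment> \<open>The functionals \<open>\<langle>e|-\<rangle>\<close> on \<open>X\<close> and \<open>\<langle>-|e\<rangle>\<close> on \<open>X\<^sup>*\<close>; by Parseval \<open>\<epsilon>\<^sub>X\<close> is the sum of their products.\<close>
        define d1 where "d1 = (\<lambda>e. tensor_lift [X] complex_hilb (tensor_ip [X] [e]))"
        define d2 where "d2 = (\<lambda>e. tensor_lift [Z] complex_hilb (tensor_ip [Z] [e]))"
        have d1: "d1 e \<in> functionals [X]" "x \<in> carrier X \<Longrightarrow> d1 e (elem_tensor [X] [x]) = ip X e x"
          and d2: "d2 e \<in> functionals [Z]" "x \<in> carrier X \<Longrightarrow> d2 e (elem_tensor [Z] [x]) = ip X x e" if e: "e \<in> ?O" for e x
          using functional_lift[OF fd(1) multilinear_tensor_ip[OF fd(1)], of "[e]"]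
            functional_lift[OF fd(2) multilinear_tensor_ip[OF fd(2)], of "[e]"] OD(2)[OF e] True
          by (auto simp: mem d1_def d2_def simp del: listset.simps(2))
        have "?e \<in> interp ?\<theta> ?\<Gamma> (X # Z # Xs)"
        proof (rule functional_subspace_lincomb[OF relationsD[OF \<theta> L] fd(4) OD(1) _ e(1)])
          show "tensor_functional [X] (Z # Xs) (d1 e) (tensor_functional [Z] Xs (d2 e) f) \<in> interp ?\<theta> ?\<Gamma> (X # Z # Xs)"
            if "e \<in> ?O" for e using all d1(1)[OF that] d2(1)[OF that] by blast
          fix xs assume "xs \<in> vec_lists (X # Z # Xs)"
          then obtain x z zs where xs: "xs = x # z # zs" "x \<in> carrier X" "z \<in> carrier Z" "zs \<in> vec_lists Xs"
            by (auto simp: set_Cons_def)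
          have z: "z \<in> carrier X" using xs True by simp
          have "?e (elem_tensor (X # Z # Xs) xs) = (\<Sum>e\<in>?O. ip X z e * ip X e x) * f (elem_tensor Xs zs)"
            using e(2)[OF xs(2-4)] xs(1) orthonormal_basisD(4)[OF Xi O z xs(2)] by simp
          also have "\<dots> = (\<Sum>e\<in>?O. 1 * tensor_functional [X] (Z # Xs) (d1 e) (tensor_functional [Z] Xs (d2 e) f)
              (elem_tensor (X # Z # Xs) xs))"
            unfolding sum_distrib_right xs(1)
            by (rule sum.cong) (use t(2)[OF d1(1) d2(1) xs(2-4)] d1(2) d2(2) xs z in auto)
          finally show "?e (elem_tensor (X # Z # Xs) xs) = (\<Sum>e\<in>?O. 1 *
              tensor_functional [X] (Z # Xs) (d1 e) (tensor_functional [Z] Xs (d2 e) f) (elem_tensor (X # Z # Xs) xs))" .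
        qed
        then have "?e \<in> ?B" by (rule interp_Imp_modus_ponens[OF q'(1) L E \<phi> _ eA])
        then show "Z = hdual X \<longrightarrow> ?e \<in> interp \<phi> ?\<Gamma> (X # hdual X # Xs)" using True by simp
      qed
    qed
  qed
  show ?thesis
  proof (cases "f \<in> functionals Xs")
    case True
    show ?thesis unfolding step using True main[OF _ _ True] by (auto simp: qdual_def)
  qed (use step in blast)
qed

text \<open>The functionals on the empty tensor product are the scalars, so only \<open>f = 1\<close> has to be considered.\<close>

lemma interp_Forall_eq_sentence:
  assumes \<X>: "quantum_set \<X>"
    and \<phi>: "interp \<phi> [(\<X>, i), (qdual \<X>, j)] \<in> relations [\<X>, qdual \<X>]" and ij: "i \<noteq> j"
  shows "interp (Forall_eq \<X> i j \<phi>) [] = rel_top [] \<longleftrightarrow>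
    (\<forall>X\<in>\<X>. evaluation X \<in> interp \<phi> [(\<X>, i), (qdual \<X>, j)] [X, hdual X])"
proof -
  have fd: "fd_list [X, hdual X]" if "X \<in> \<X>" for X using quantum_setD[OF \<X> that] fd_hdual by simp
  have sub: "functional_subspace [X, hdual X] (interp \<phi> [(\<X>, i), (qdual \<X>, j)] [X, hdual X])" if "X \<in> \<X>" for X
    by (rule relationsD[OF \<phi>]) (use that in \<open>simp add: set_Cons_def qdual_def\<close>)
  have tf: "tensor_functional [X, hdual X] [] (evaluation X) f =
      (\<lambda>t\<in>carrier (tensor [X, hdual X]). f (elem_tensor [] []) * evaluation X t)"
    if X: "X \<in> \<X>" and f: "f \<in> functionals []" for X f
  proof (rule functional_eqI[OF fd[OF X]])
    note ev = evaluation(1)[OF quantum_setD[OF \<X> X]]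
    have e: "fd_list []" by simp
    show "tensor_functional [X, hdual X] [] (evaluation X) f \<in> functionals [X, hdual X]"
      using tensor_functional(1)[OF fd[OF X] e ev f] by simp
    show "(\<lambda>t\<in>carrier (tensor [X, hdual X]). f (elem_tensor [] []) * evaluation X t) \<in> functionals [X, hdual X]"
      by (rule functionals_closed(4)[OF fd[OF X] fd[OF X] ev])
    fix xs assume xs: "xs \<in> vec_lists [X, hdual X]"
    then show "tensor_functional [X, hdual X] [] (evaluation X) f (elem_tensor [X, hdual X] xs) =
      (\<lambda>t\<in>carrier (tensor [X, hdual X]). f (elem_tensor [] []) * evaluation X t) (elem_tensor [X, hdual X] xs)"
      using tensor_functional(2)[OF fd[OF X] e ev f xs, of "[]"] elem_tensor_carrier[OF fd[OF X] xs]
      by (simp add: mult.commute)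
  qed
  have iff: "f \<in> interp (Forall_eq \<X> i j \<phi>) [] [] \<longleftrightarrow> f \<in> functionals [] \<and>
    (\<forall>X\<in>\<X>. (\<lambda>t\<in>carrier (tensor [X, hdual X]). f (elem_tensor [] []) * evaluation X t)
       \<in> interp \<phi> [(\<X>, i), (qdual \<X>, j)] [X, hdual X])" for f
    using interp_Forall_eq_iff[OF \<X>, of "[]" i j "[]" \<phi> f] \<phi> ij tf by (auto simp del: interp.simps)
  have ext: "interp (Forall_eq \<X> i j \<phi>) [] = rel_top [] \<longleftrightarrow> interp (Forall_eq \<X> i j \<phi>) [] [] = functionals []"
  proof
    assume "interp (Forall_eq \<X> i j \<phi>) [] [] = functionals []"
    moreover have "interp (Forall_eq \<X> i j \<phi>) [] \<in> relations []"
      using interp_Forall_eq_relations[of "[]"] by simp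
    then have "interp (Forall_eq \<X> i j \<phi>) [] Xs = undefined" if "Xs \<noteq> []" for Xs
      using that by (auto simp: relations_def PiE_def extensional_def)
    ultimately show "interp (Forall_eq \<X> i j \<phi>) [] = rel_top []"
      by (auto simp: rel_top_def fun_eq_iff restrict_def)
  qed (simp add: rel_top_def)
  show ?thesis unfolding ext
  proof
    assume top: "interp (Forall_eq \<X> i j \<phi>) [] [] = functionals []"
    have m: "multilinear [] (\<lambda>_. 1)" by simp
    define u where "u = tensor_lift [] complex_hilb (\<lambda>_ :: 'a list. 1)"
    have u: "u \<in> functionals []" "u (elem_tensor [] []) = 1"
      using functional_lift[OF _ m] by (simp_all add: u_def)
    show "\<forall>X\<in>\<X>. evaluation X \<in> interp \<phi> [(\<X>, i), (qdual \<X>, j)] [X, hdual X]"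
    proof
      fix X assume X: "X \<in> \<X>"
      have "(\<lambda>t\<in>carrier (tensor [X, hdual X]). u (elem_tensor [] []) * evaluation X t) = evaluation X"
        using bounded_opsD(2)[OF evaluation(1)[OF quantum_setD[OF \<X> X]]] by (auto simp: u(2))
      then show "evaluation X \<in> interp \<phi> [(\<X>, i), (qdual \<X>, j)] [X, hdual X]"
        using iff[of u] u(1) top X by metis
    qed
  next
    assume ev: "\<forall>X\<in>\<X>. evaluation X \<in> interp \<phi> [(\<X>, i), (qdual \<X>, j)] [X, hdual X]"
    have "f \<in> interp (Forall_eq \<X> i j \<phi>) [] []" if "f \<in> functionals []" for f
      unfolding iff using that ev functional_subspaceD(4)[OF sub fd] by blast
    then show "interp (Forall_eq \<X> i j \<phi>) [] [] = functionals []" using iff by blast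
  qed
qed

section \<open>The functional of a binary relation\<close>

lemma tensor_op2:
  assumes fd: "fd_list [X, X']" "fd_list [Y, Y']" and a: "a \<in> bounded_ops X Y" and b: "b \<in> bounded_ops X' Y'"
  shows "tensor_op2 [X, X'] [Y, Y'] a b \<in> bounded_ops (tensor [X, X']) (tensor [Y, Y'])"
    and "\<lbrakk>x \<in> carrier X; x' \<in> carrier X'\<rbrakk> \<Longrightarrow>
      tensor_op2 [X, X'] [Y, Y'] a b (elem_tensor [X, X'] [x, x']) = elem_tensor [Y, Y'] [a x, b x']"
proof -
  have H: "inner_product_space X" "inner_product_space X'" "inner_product_space Y" "inner_product_space Y'"
    using fd fd_hilbert_spaceD(1) by auto
  interpret T: inner_product_space "tensor [Y, Y']" by (rule inner_product_tensor[OF fd(2)])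
  note aD = bounded_opsD[OF a] and bD = bounded_opsD[OF b]
  define F where "F = (\<lambda>xs. elem_tensor [Y, Y'] [a (xs ! 0), b (xs ! 1)])"
  have Fc: "F xs \<in> carrier (tensor [Y, Y'])" if "xs \<in> vec_lists [X, X']" for xs
    using that aD(1) bD(1) by (auto simp: F_def set_Cons_def intro!: elem_tensor_carrier[OF fd(2)])
  have exp: "ip (tensor [Y, Y']) k (F xs) = (\<Sum>es\<in>listset (map some_onb [X, X']). tensor_ip [X, X'] es xs * ip (tensor [Y, Y']) k (F es))"
    if xs: "xs \<in> vec_lists [X, X']" and k: "k \<in> carrier (tensor [Y, Y'])" for xs k
  proof -
    let ?r = "\<lambda>t\<in>carrier (tensor [Y, Y']). ip (tensor [Y, Y']) k t"
    have "linear_op (tensor [Y, Y']) complex_hilb ?r"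
      by (rule linear_functionalI[OF T.inner_product_space_axioms])
        (use k in \<open>auto simp: T.ip_simps simp del: tensor_simps\<close>)
    then have r: "?r \<in> functionals [Y, Y']" by (rule linear_op_bounded[OF _ fd_tensor[OF fd(2)] ip_complex_hilb])
    have m: "multilinear [Y, Y'] (\<lambda>ys. ?r (elem_tensor [Y, Y'] ys))" by (rule multilinear_functional[OF fd(2) r])
    have m1: "linear_op Y complex_hilb (\<lambda>y\<in>carrier Y. ?r (elem_tensor [Y, Y'] [y, y']))" if "y' \<in> carrier Y'" for y'
      using m that by (simp add: ball_listset_Cons del: listset.simps(2) tensor_simps)
    have m2: "linear_op Y' complex_hilb (\<lambda>y'\<in>carrier Y'. ?r (elem_tensor [Y, Y'] [y, y']))" if "y \<in> carrier Y" for y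
      using m that by (simp del: tensor_simps)
    have "multilinear [X, X'] (\<lambda>xs. ?r (F xs))"
      unfolding multilinear.simps ball_listset_Cons list.map listset.simps(1) F_def
      using linear_functionalD[OF H(3) m1] linear_functionalD[OF H(4) m2] aD bD
      by (auto intro!: linear_functionalI H simp del: tensor_simps restrict_apply)
    then have "?r (F xs) = (\<Sum>es\<in>listset (map some_onb [X, X']). tensor_ip [X, X'] es xs * ?r (F es))"
      by (rule multilinear_expand[OF fd(1) _ onb_list_some[OF fd(1)] xs])
    then show ?thesis
      using Fc xs onb_list_subset[OF onb_list_some[OF fd(1)]] by (simp del: tensor_simps listset.simps list.map cong: sum.cong)
  qed
  have eq: "tensor_op2 [X, X'] [Y, Y'] a b = tensor_lift [X, X'] (tensor [Y, Y']) F"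
    by (simp add: tensor_op2_def F_def)
  show "tensor_op2 [X, X'] [Y, Y'] a b \<in> bounded_ops (tensor [X, X']) (tensor [Y, Y'])"
    unfolding eq by (rule tensor_lift(1)[OF fd(1) T.inner_product_space_axioms Fc exp])
  assume "x \<in> carrier X" "x' \<in> carrier X'"
  then show "tensor_op2 [X, X'] [Y, Y'] a b (elem_tensor [X, X'] [x, x']) = elem_tensor [Y, Y'] [a x, b x']"
    unfolding eq using tensor_lift(2)[OF fd(1) T.inner_product_space_axioms Fc exp, of "[x, x']"]
    by (simp add: F_def Cons_mem_listset del: listset.simps(2))
qed

lemma binary_relationsD: "R \<in> binary_relations \<X> \<Y> \<Longrightarrow> X \<in> \<X> \<Longrightarrow> Y \<in> \<Y> \<Longrightarrow> op_subspace X Y (R X Y)"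
  by (auto simp: binary_relations_def PiE_iff)

lemma op_subspaceD:
  assumes "op_subspace H K W" "inner_product_space H" "inner_product_space K"
  shows "a \<in> W \<Longrightarrow> a \<in> bounded_ops H K" "(\<lambda>x\<in>carrier H. \<zero>\<^bsub>K\<^esub>) \<in> W"
    "a \<in> W \<Longrightarrow> b \<in> W \<Longrightarrow> (\<lambda>x\<in>carrier H. a x \<oplus>\<^bsub>K\<^esub> b x) \<in> W"
    "a \<in> W \<Longrightarrow> (\<lambda>x\<in>carrier H. c \<odot>\<^bsub>K\<^esub> a x) \<in> W"
  using assms by (auto simp: op_subspace_iff)

lemma id_relation:
  assumes \<X>: "quantum_set \<X>" and XY: "X \<in> \<X>" "Y \<in> \<X>" and b: "b \<in> id_relation \<X> X Y"
  shows "b \<in> bounded_ops X Y" "X \<noteq> Y \<Longrightarrow> x \<in> carrier X \<Longrightarrow> b x = \<zero>\<^bsub>Y\<^esub>"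
    "X = Y \<Longrightarrow> \<exists>d. \<forall>x\<in>carrier X. b x = d \<odot>\<^bsub>X\<^esub> x"
proof -
  have H: "inner_product_space X" "inner_product_space Y"
    using quantum_setD[OF \<X>] XY fd_hilbert_spaceD(1) by auto
  interpret X: inner_product_space X by (rule H)
  note BD = op_subspaceD[OF op_subspace_bounded_ops]
  have *: "b \<in> bounded_ops X X \<and> (\<exists>d. \<forall>x\<in>carrier X. b x = d \<odot>\<^bsub>X\<^esub> x)" if "X = Y"
  proof -
    let ?W = "{b \<in> bounded_ops X X. \<exists>d. \<forall>x\<in>carrier X. b x = d \<odot>\<^bsub>X\<^esub> x}"
    have "op_subspace X X ?W" unfolding op_subspace_iff[OF H(1) H(1)]
    proof (intro conjI ballI allI)
      show "(\<lambda>x\<in>carrier X. \<zero>\<^bsub>X\<^esub>) \<in> ?W"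
        using BD(2)[OF H(1,1) H(1,1)] by (auto intro!: exI[of _ 0])
    next
      fix a b assume "a \<in> ?W" "b \<in> ?W"
      then obtain c d where "a \<in> bounded_ops X X" "b \<in> bounded_ops X X"
        "\<forall>x\<in>carrier X. a x = c \<odot>\<^bsub>X\<^esub> x" "\<forall>x\<in>carrier X. b x = d \<odot>\<^bsub>X\<^esub> x" by blast
      then show "(\<lambda>x\<in>carrier X. a x \<oplus>\<^bsub>X\<^esub> b x) \<in> ?W"
        using BD(3)[OF H(1,1) H(1,1), of a b] X.smult_l_distr[of c d] by (auto intro!: exI[of _ "c + d"])
    next
      fix k a assume "a \<in> ?W"
      then obtain c where "a \<in> bounded_ops X X" "\<forall>x\<in>carrier X. a x = c \<odot>\<^bsub>X\<^esub> x" by blast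
      then show "(\<lambda>x\<in>carrier X. k \<odot>\<^bsub>X\<^esub> a x) \<in> ?W"
        using BD(4)[OF H(1,1) H(1,1), of a k] by (auto simp: X.smult_smult intro!: exI[of _ "k * c"])
    qed blast
    moreover have "{\<lambda>x\<in>carrier X. x} \<subseteq> ?W"
      using id_bounded_ops[OF H(1)] by (auto intro!: exI[of _ 1])
    ultimately have "op_span X X {\<lambda>x\<in>carrier X. x} \<subseteq> ?W" by (rule op_span_minimal[rotated])
    moreover have "b \<in> op_span X X {\<lambda>x\<in>carrier X. x}"
      using b XY unfolding id_relation_def that[symmetric] by (simp only: restrict_apply' if_True refl)
    ultimately show ?thesis by blast
  qed
  have **: "b = (\<lambda>x\<in>carrier X. \<zero>\<^bsub>Y\<^esub>)" if "X \<noteq> Y" using b XY that by (auto simp: id_relation_def)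
  show "b \<in> bounded_ops X Y"
  proof (cases "X = Y")
    case True
    then show ?thesis using * by simp
  next
    case False
    show ?thesis unfolding **[OF False] by (rule BD(2)[OF H H])
  qed
  show "X \<noteq> Y \<Longrightarrow> x \<in> carrier X \<Longrightarrow> b x = \<zero>\<^bsub>Y\<^esub>" using ** by simp
  show "X = Y \<Longrightarrow> \<exists>d. \<forall>x\<in>carrier X. b x = d \<odot>\<^bsub>X\<^esub> x" using * by simp
qed

lemma operator_functional:
  assumes X: "fd_hilbert_space X" and Y: "fd_hilbert_space Y" and b: "b \<in> bounded_ops X Y"
  obtains r where "r \<in> functionals [X, hdual Y]"
    "\<And>x y. x \<in> carrier X \<Longrightarrow> y \<in> carrier Y \<Longrightarrow> r (elem_tensor [X, hdual Y] [x, y]) = ip Y y (b x)"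
proof -
  note H = fd_hilbert_spaceD(1)[OF X] fd_hilbert_spaceD(1)[OF Y]
  interpret Y: inner_product_space Y by (rule H)
  note bD = bounded_opsD[OF b]
  have fd: "fd_list [X, hdual Y]" using X Y fd_hdual by simp
  have m: "multilinear [X, hdual Y] (\<lambda>xs. ip Y (xs ! 1) (b (xs ! 0)))"
    unfolding multilinear.simps ball_listset_Cons list.map
    using bD by (auto intro!: linear_functionalI[OF H(1)] linear_functionalI[OF inner_product_hdual[OF H(2)], simplified]
        simp: Y.ip_simps)
  show thesis
  proof (rule that)
    show "tensor_lift [X, hdual Y] complex_hilb (\<lambda>xs. ip Y (xs ! 1) (b (xs ! 0))) \<in> functionals [X, hdual Y]"
      by (rule functional_lift(1)[OF fd m])
    show "tensor_lift [X, hdual Y] complex_hilb (\<lambda>xs. ip Y (xs ! 1) (b (xs ! 0))) (elem_tensor [X, hdual Y] [x, y]) = ip Y y (b x)"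
      if "x \<in> carrier X" "y \<in> carrier Y" for x y
      using functional_lift(2)[OF fd m, of "[x, y]"] that by (simp add: Cons_mem_listset del: listset.simps(2))
  qed
qed

text \<open>In the composition of \<open>E\<close> with \<open>R \<times> I\<close> only the summand with intermediate atom \<open>Y \<otimes> Y\<^sup>*\<close> is nonzero, and
  there the identity relation contributes a scalar. What remains is \<open>\<epsilon>\<^sub>Y \<circ> (b \<otimes> 1)\<close> for \<open>b\<close> in \<open>R(X, Y)\<close>.\<close>

lemma rel_hat:
  assumes \<X>: "quantum_set \<X>" and \<Y>: "quantum_set \<Y>" and R: "R \<in> binary_relations \<X> \<Y>"
  shows "rel_hat \<X> \<Y> R \<in> relations [\<X>, qdual \<Y>]"
    and "\<lbrakk>X \<in> \<X>; Y \<in> \<Y>\<rbrakk> \<Longrightarrow> f \<in> rel_hat \<X> \<Y> R [X, hdual Y] \<longleftrightarrow> f \<in> functionals [X, hdual Y] \<and>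
      (\<exists>b\<in>R X Y. \<forall>x\<in>carrier X. \<forall>y\<in>carrier Y. f (elem_tensor [X, hdual Y] [x, y]) = ip Y y (b x))"
proof -
  note \<Y>' = quantum_set_qdual[OF \<Y>]
  define G where "G = (\<lambda>Xs. \<Union>Ys\<in>listset [\<Y>, qdual \<Y>]. {compose (carrier (tensor Xs)) e t | e t.
        e \<in> equality_rel \<Y> Ys \<and> t \<in> brel_prod R (id_relation (qdual \<Y>)) Xs Ys})"
  have hat: "rel_hat \<X> \<Y> R = (\<lambda>Xs\<in>listset [\<X>, qdual \<Y>]. functional_span Xs (G Xs))"
    by (simp add: rel_hat_def G_def)
  have t_gen: "{tensor_op2 [X, Z] [Y1, Z1] a b | a b. a \<in> R X Y1 \<and> b \<in> id_relation (qdual \<Y>) Z Z1}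
      \<subseteq> bounded_ops (tensor [X, Z]) (tensor [Y1, Z1])"
    and t_bd: "t \<in> brel_prod R (id_relation (qdual \<Y>)) [X, Z] [Y1, Z1] \<Longrightarrow> t \<in> bounded_ops (tensor [X, Z]) (tensor [Y1, Z1])"
    if m: "X \<in> \<X>" "Z \<in> qdual \<Y>" "Y1 \<in> \<Y>" "Z1 \<in> qdual \<Y>" for X Z Y1 Z1 t
  proof -
    have fd: "fd_list [X, Z]" "fd_list [Y1, Z1]" using m quantum_setD \<X> \<Y> \<Y>' by auto
    note i = fd_hilbert_spaceD(1)[OF quantum_setD[OF \<X> m(1)]] fd_hilbert_spaceD(1)[OF quantum_setD[OF \<Y> m(3)]]
    show g: "{tensor_op2 [X, Z] [Y1, Z1] a b | a b. a \<in> R X Y1 \<and> b \<in> id_relation (qdual \<Y>) Z Z1}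
      \<subseteq> bounded_ops (tensor [X, Z]) (tensor [Y1, Z1])"
      using tensor_op2(1)[OF fd op_subspaceD(1)[OF binary_relationsD[OF R m(1,3)] i] id_relation(1)[OF \<Y>' m(2,4)]] by blast
    have "brel_prod R (id_relation (qdual \<Y>)) [X, Z] [Y1, Z1] \<subseteq> bounded_ops (tensor [X, Z]) (tensor [Y1, Z1])"
      unfolding brel_prod_def using g
      by (intro op_span_minimal op_subspace_bounded_ops inner_product_tensor fd) simp
    then show "t \<in> brel_prod R (id_relation (qdual \<Y>)) [X, Z] [Y1, Z1] \<Longrightarrow> t \<in> bounded_ops (tensor [X, Z]) (tensor [Y1, Z1])"
      by blast
  qed
  have G_fun: "G [X, Z] \<subseteq> functionals [X, Z]" if m: "X \<in> \<X>" "Z \<in> qdual \<Y>" for X Z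
  proof
    fix f assume "f \<in> G [X, Z]"
    then obtain Y1 Z1 e t where Y1: "Y1 \<in> \<Y>" "Z1 \<in> qdual \<Y>" and e: "e \<in> equality_rel \<Y> [Y1, Z1]"
      and t: "t \<in> brel_prod R (id_relation (qdual \<Y>)) [X, Z] [Y1, Z1]" and f: "f = compose (carrier (tensor [X, Z])) e t"
      unfolding G_def by (auto simp: set_Cons_def)
    have fd: "fd_list [X, Z]" "fd_list [Y1, Z1]" using m Y1 quantum_setD \<X> \<Y> \<Y>' by auto
    have "e \<in> functionals [Y1, Z1]" using e equality_rel(2)[OF \<Y> Y1] by blast
    then show "f \<in> functionals [X, Z]"
      unfolding f by (rule compose_bounded_ops[OF _ t_bd[OF m Y1 t] inner_product_tensor[OF fd(1)] inner_product_tensor[OF fd(2)]])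
  qed
  show "rel_hat \<X> \<Y> R \<in> relations [\<X>, qdual \<Y>]"
    unfolding hat
  proof (rule relationsI)
    fix Xs assume "Xs \<in> listset [\<X>, qdual \<Y>]"
    then obtain X Z where XZ: "Xs = [X, Z]" "X \<in> \<X>" "Z \<in> qdual \<Y>" by (auto simp: set_Cons_def)
    have fd: "fd_list [X, Z]" using XZ quantum_setD \<X> \<Y>' by auto
    show "functional_subspace Xs (functional_span Xs (G Xs))"
      unfolding XZ(1) by (rule op_subspace_op_span[OF inner_product_tensor[OF fd] ip_complex_hilb G_fun[OF XZ(2,3)]])
  qed
  assume XY: "X \<in> \<X>" "Y \<in> \<Y>"
  have Z: "hdual Y \<in> qdual \<Y>" using XY by (simp add: qdual_def)
  have fX: "fd_hilbert_space X" and fY: "fd_hilbert_space Y" using XY quantum_setD \<X> \<Y> by auto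
  note H = fd_hilbert_spaceD(1)[OF fX] fd_hilbert_spaceD(1)[OF fY]
  interpret Y: inner_product_space Y by (rule H)
  have fd: "fd_list [X, hdual Y]" using fX fY fd_hdual by simp
  note RD = op_subspaceD[OF binary_relationsD[OF R XY] H]
  note FD = functionals_closed[OF fd fd]
  let ?S = "{f \<in> functionals [X, hdual Y].
     \<exists>b\<in>R X Y. \<forall>x\<in>carrier X. \<forall>y\<in>carrier Y. f (elem_tensor [X, hdual Y] [x, y]) = ip Y y (b x)}"
  have et: "elem_tensor [X, hdual Y] [x, y] \<in> carrier (tensor [X, hdual Y])" if "x \<in> carrier X" "y \<in> carrier Y" for x y
    by (rule elem_tensor_carrier[OF fd]) (use that in \<open>simp add: set_Cons_def\<close>)
  have S: "functional_subspace [X, hdual Y] ?S"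
    unfolding functional_subspace_iff[OF fd]
  proof (intro conjI ballI allI)
    show "(\<lambda>t\<in>carrier (tensor [X, hdual Y]). 0) \<in> ?S"
      using FD(2) et by (auto intro!: bexI[OF _ RD(2)])
  next
    fix a b assume a: "a \<in> ?S" and b: "b \<in> ?S"
    then obtain c d where c: "c \<in> R X Y" "\<forall>x\<in>carrier X. \<forall>y\<in>carrier Y. a (elem_tensor [X, hdual Y] [x, y]) = ip Y y (c x)"
      and d: "d \<in> R X Y" "\<forall>x\<in>carrier X. \<forall>y\<in>carrier Y. b (elem_tensor [X, hdual Y] [x, y]) = ip Y y (d x)" by blast
    show "(\<lambda>t\<in>carrier (tensor [X, hdual Y]). a t + b t) \<in> ?S"
      using FD(3)[of a b] a b et c d bounded_opsD(1)[OF RD(1)[OF c(1)]] bounded_opsD(1)[OF RD(1)[OF d(1)]]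
      by (auto intro!: bexI[OF _ RD(3)[OF c(1) d(1)]] simp: Y.ip_simps)
  next
    fix k a assume a: "a \<in> ?S"
    then obtain c where c: "c \<in> R X Y" "\<forall>x\<in>carrier X. \<forall>y\<in>carrier Y. a (elem_tensor [X, hdual Y] [x, y]) = ip Y y (c x)" by blast
    show "(\<lambda>t\<in>carrier (tensor [X, hdual Y]). k * a t) \<in> ?S"
      using FD(4)[of a k] a et c bounded_opsD(1)[OF RD(1)[OF c(1)]]
      by (auto intro!: bexI[OF _ RD(4)[OF c(1), of k]] simp: Y.ip_simps)
  qed auto
  have hatXY: "rel_hat \<X> \<Y> R [X, hdual Y] = functional_span [X, hdual Y] (G [X, hdual Y])"
    unfolding hat using XY Z by (simp add: Cons_mem_listset del: listset.simps(2))
  have "G [X, hdual Y] \<subseteq> ?S"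
  proof
    fix f assume "f \<in> G [X, hdual Y]"
    then obtain Y1 Z1 e t where m: "Y1 \<in> \<Y>" "Z1 \<in> qdual \<Y>" and e: "e \<in> equality_rel \<Y> [Y1, Z1]"
      and t: "t \<in> brel_prod R (id_relation (qdual \<Y>)) [X, hdual Y] [Y1, Z1]"
      and f: "f = compose (carrier (tensor [X, hdual Y])) e t"
      unfolding G_def by (auto simp: set_Cons_def)
    have fd1: "fd_list [Y1, Z1]" using m quantum_setD \<Y> \<Y>' by auto
    obtain c where ef: "e \<in> functionals [Y1, Z1]" and c: "\<And>y z. y \<in> carrier Y1 \<Longrightarrow> z \<in> carrier Z1 \<Longrightarrow>
       e (elem_tensor [Y1, Z1] [y, z]) = c * (if Z1 = hdual Y1 then ip Y1 z y else 0)"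
      using e unfolding equality_rel(2)[OF \<Y> m] by blast
    note eD = bounded_opsD[OF ef]
    note T = inner_product_tensor[OF fd] inner_product_tensor[OF fd1]
    let ?W = "{t \<in> bounded_ops (tensor [X, hdual Y]) (tensor [Y1, Z1]). compose (carrier (tensor [X, hdual Y])) e t \<in> ?S}"
    note SD = functional_subspaceD[OF S fd]
    note BD = op_subspaceD[OF op_subspace_bounded_ops[OF T] T]
    interpret T1: inner_product_space "tensor [Y1, Z1]" by (rule T)
    have "op_subspace (tensor [X, hdual Y]) (tensor [Y1, Z1]) ?W"
      unfolding op_subspace_iff[OF T]
    proof (intro conjI ballI allI)
      have "e \<zero>\<^bsub>tensor [Y1, Z1]\<^esub> = 0"
        using linear_op_zero[OF _ T(2) ip_complex_hilb, of e] ef by (simp add: bounded_ops_iff)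
      then have "compose (carrier (tensor [X, hdual Y])) e (\<lambda>x\<in>carrier (tensor [X, hdual Y]). \<zero>\<^bsub>tensor [Y1, Z1]\<^esub>) =
        (\<lambda>t\<in>carrier (tensor [X, hdual Y]). 0)" by (auto simp: compose_def)
      then show "(\<lambda>x\<in>carrier (tensor [X, hdual Y]). \<zero>\<^bsub>tensor [Y1, Z1]\<^esub>) \<in> ?W"
        using BD(2) SD(2) by (simp only: mem_Collect_eq simp_thms)
    next
      fix a b assume a: "a \<in> ?W" and b: "b \<in> ?W"
      then have ab: "a \<in> bounded_ops (tensor [X, hdual Y]) (tensor [Y1, Z1])" "b \<in> bounded_ops (tensor [X, hdual Y]) (tensor [Y1, Z1])" by auto
      have "compose (carrier (tensor [X, hdual Y])) e (\<lambda>x\<in>carrier (tensor [X, hdual Y]). a x \<oplus>\<^bsub>tensor [Y1, Z1]\<^esub> b x) =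
        (\<lambda>t\<in>carrier (tensor [X, hdual Y]). compose (carrier (tensor [X, hdual Y])) e a t + compose (carrier (tensor [X, hdual Y])) e b t)"
        using eD(3) bounded_opsD(1)[OF ab(1)] bounded_opsD(1)[OF ab(2)]
        by (auto simp: compose_def simp del: tensor_simps intro!: restrict_ext)
      then show "(\<lambda>x\<in>carrier (tensor [X, hdual Y]). a x \<oplus>\<^bsub>tensor [Y1, Z1]\<^esub> b x) \<in> ?W"
        using BD(3)[OF ab] SD(3)[of "compose (carrier (tensor [X, hdual Y])) e a" "compose (carrier (tensor [X, hdual Y])) e b"] a b
        by (simp only: mem_Collect_eq simp_thms)
    next
      fix k a assume a: "a \<in> ?W"
      then have ab: "a \<in> bounded_ops (tensor [X, hdual Y]) (tensor [Y1, Z1])" by auto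
      have "compose (carrier (tensor [X, hdual Y])) e (\<lambda>x\<in>carrier (tensor [X, hdual Y]). k \<odot>\<^bsub>tensor [Y1, Z1]\<^esub> a x) =
        (\<lambda>t\<in>carrier (tensor [X, hdual Y]). k * compose (carrier (tensor [X, hdual Y])) e a t)"
        using eD(4) bounded_opsD(1)[OF ab]
        by (auto simp: compose_def simp del: tensor_simps intro!: restrict_ext)
      then show "(\<lambda>x\<in>carrier (tensor [X, hdual Y]). k \<odot>\<^bsub>tensor [Y1, Z1]\<^esub> a x) \<in> ?W"
        using BD(4)[OF ab, of k] SD(4)[of "compose (carrier (tensor [X, hdual Y])) e a" k] a
        by (simp only: mem_Collect_eq simp_thms)
    qed blast
    moreover have "{tensor_op2 [X, hdual Y] [Y1, Z1] a b | a b. a \<in> R X Y1 \<and> b \<in> id_relation (qdual \<Y>) (hdual Y) Z1} \<subseteq> ?W"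
    proof
      fix t assume t: "t \<in> {tensor_op2 [X, hdual Y] [Y1, Z1] a b | a b. a \<in> R X Y1 \<and> b \<in> id_relation (qdual \<Y>) (hdual Y) Z1}"
      then obtain a b where t': "t = tensor_op2 [X, hdual Y] [Y1, Z1] a b" and a: "a \<in> R X Y1"
        and b: "b \<in> id_relation (qdual \<Y>) (hdual Y) Z1" by blast
      have H1: "inner_product_space Y1" using m quantum_setD[OF \<Y>] fd_hilbert_spaceD(1) by auto
      interpret Y1: inner_product_space Y1 by (rule H1)
      note ab = op_subspaceD(1)[OF binary_relationsD[OF R XY(1) m(1)] H(1) H1 a]
      note b' = id_relation[OF \<Y>' Z m(2) b]
      note t2 = tensor_op2[OF fd fd1 ab b'(1)]
      have tb: "t \<in> bounded_ops (tensor [X, hdual Y]) (tensor [Y1, Z1])" using t2(1) t' by simp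
      let ?f = "compose (carrier (tensor [X, hdual Y])) e t"
      have ff: "?f \<in> functionals [X, hdual Y]" by (rule compose_bounded_ops[OF ef tb T])
      have fv: "?f (elem_tensor [X, hdual Y] [x, y]) = c * (if Z1 = hdual Y1 then ip Y1 (b y) (a x) else 0)"
        if "x \<in> carrier X" "y \<in> carrier Y" for x y
        using t2(2)[of x y] that et[OF that] c[of "a x" "b y"] bounded_opsD(1)[OF ab] bounded_opsD(1)[OF b'(1)]
        by (simp add: compose_def t')
      have "\<exists>d\<in>R X Y. \<forall>x\<in>carrier X. \<forall>y\<in>carrier Y. ?f (elem_tensor [X, hdual Y] [x, y]) = ip Y y (d x)"
      proof (cases "Z1 = hdual Y1 \<and> Z1 = hdual Y")
        case True
        then have Y1: "Y1 = Y" by (metis hdual_inject)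
        obtain k where k: "\<And>y. y \<in> carrier Y \<Longrightarrow> b y = cnj k \<odot>\<^bsub>Y\<^esub> y" using b'(3) True by auto
        show ?thesis
        proof (rule bexI[of _ "\<lambda>x\<in>carrier X. (c * k) \<odot>\<^bsub>Y\<^esub> a x"])
          show "(\<lambda>x\<in>carrier X. (c * k) \<odot>\<^bsub>Y\<^esub> a x) \<in> R X Y" using RD(4) a Y1 by simp
        qed (use fv k True bounded_opsD(1)[OF ab] Y1 in \<open>auto simp: Y.ip_simps\<close>)
      next
        case False
        have "?f (elem_tensor [X, hdual Y] [x, y]) = 0" if "x \<in> carrier X" "y \<in> carrier Y" for x y
          using fv[OF that] False b'(2)[of y] that bounded_opsD(1)[OF ab] by auto
        then show ?thesis by (intro bexI[OF _ RD(2)]) auto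
      qed
      then show "t \<in> ?W" using tb ff by blast
    qed
    ultimately have "brel_prod R (id_relation (qdual \<Y>)) [X, hdual Y] [Y1, Z1] \<subseteq> ?W"
      unfolding brel_prod_def by (intro op_span_minimal) simp_all
    then show "f \<in> ?S" using t f by blast
  qed
  then have 1: "rel_hat \<X> \<Y> R [X, hdual Y] \<subseteq> ?S" unfolding hatXY using S by (rule op_span_minimal)
  have 2: "?S \<subseteq> rel_hat \<X> \<Y> R [X, hdual Y]"
  proof
    fix f assume f: "f \<in> ?S"
    then obtain b where b: "b \<in> R X Y" "\<And>x y. x \<in> carrier X \<Longrightarrow> y \<in> carrier Y \<Longrightarrow> f (elem_tensor [X, hdual Y] [x, y]) = ip Y y (b x)"
      by blast
    let ?i = "\<lambda>x\<in>carrier (hdual Y). x"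
    have fdY: "fd_list [Y, hdual Y]" using fY fd_hdual by simp
    note bb = RD(1)[OF b(1)]
    have ib: "?i \<in> bounded_ops (hdual Y) (hdual Y)" by (rule id_bounded_ops[OF inner_product_hdual[OF H(2)]])
    have i: "?i \<in> id_relation (qdual \<Y>) (hdual Y) (hdual Y)" using Z op_span_inc[of ?i "{?i}"] by (simp add: id_relation_def)
    note t = tensor_op2[OF fd fdY bb ib]
    note ev = evaluation[OF fY]
    have eE: "evaluation Y \<in> equality_rel \<Y> [Y, hdual Y]"
      unfolding equality_rel(2)[OF \<Y> XY(2) Z] using ev by (auto intro!: exI[of _ 1])
    have tB: "tensor_op2 [X, hdual Y] [Y, hdual Y] b ?i \<in> brel_prod R (id_relation (qdual \<Y>)) [X, hdual Y] [Y, hdual Y]"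
      unfolding brel_prod_def using b(1) i by (intro op_span_inc) auto
    let ?g = "compose (carrier (tensor [X, hdual Y])) (evaluation Y) (tensor_op2 [X, hdual Y] [Y, hdual Y] b ?i)"
    have "f = ?g"
    proof (rule functional_eqI[OF fd])
      show "f \<in> functionals [X, hdual Y]" using f by blast
      show "?g \<in> functionals [X, hdual Y]"
        by (rule compose_bounded_ops[OF ev(1) t(1) inner_product_tensor[OF fd] inner_product_tensor[OF fdY]])
      fix xs assume "xs \<in> vec_lists [X, hdual Y]"
      then obtain x y where xy: "xs = [x, y]" "x \<in> carrier X" "y \<in> carrier Y" by (auto simp: set_Cons_def)
      then show "f (elem_tensor [X, hdual Y] xs) = ?g (elem_tensor [X, hdual Y] xs)"
        using b(2) t(2)[of x y] ev(2)[of "b x" y] et bounded_opsD(1)[OF bb] by (simp add: compose_def)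
    qed
    moreover have "[Y, hdual Y] \<in> listset [\<Y>, qdual \<Y>]" using XY Z by (simp add: Cons_mem_listset del: listset.simps(2))
    ultimately have "f \<in> G [X, hdual Y]" unfolding G_def using eE tB by blast
    then show "f \<in> rel_hat \<X> \<Y> R [X, hdual Y]" unfolding hatXY by (rule op_span_inc)
  qed
  show "f \<in> rel_hat \<X> \<Y> R [X, hdual Y] \<longleftrightarrow> f \<in> functionals [X, hdual Y] \<and>
      (\<exists>b\<in>R X Y. \<forall>x\<in>carrier X. \<forall>y\<in>carrier Y. f (elem_tensor [X, hdual Y] [x, y]) = ip Y y (b x))"
    using 1 2 by blast
qed

text \<open>This eliminates the functional from the descriptions of atomic formulas provided by
  \<open>interp_Atom\<close>; the predicate \<open>P\<close> stands for the comparison with the values of another functional.\<close>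

lemma rel_hat_slice:
  assumes \<X>: "quantum_set \<X>" and \<Y>: "quantum_set \<Y>" and R: "R \<in> binary_relations \<X> \<Y>" and XY: "X \<in> \<X>" "Y \<in> \<Y>"
  shows "(\<exists>r\<in>rel_hat \<X> \<Y> R [X, hdual Y]. \<forall>ys\<in>vec_lists [X, hdual Y]. P ys (r (elem_tensor [X, hdual Y] ys))) \<longleftrightarrow>
    (\<exists>b\<in>R X Y. \<forall>x\<in>carrier X. \<forall>y\<in>carrier Y. P [x, y] (ip Y y (b x)))"
proof
  assume "\<exists>r\<in>rel_hat \<X> \<Y> R [X, hdual Y]. \<forall>ys\<in>vec_lists [X, hdual Y]. P ys (r (elem_tensor [X, hdual Y] ys))"
  then obtain r where r: "r \<in> rel_hat \<X> \<Y> R [X, hdual Y]" "\<forall>ys\<in>vec_lists [X, hdual Y]. P ys (r (elem_tensor [X, hdual Y] ys))" by blast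
  obtain b where b: "b \<in> R X Y" "\<forall>x\<in>carrier X. \<forall>y\<in>carrier Y. r (elem_tensor [X, hdual Y] [x, y]) = ip Y y (b x)"
    using r(1) unfolding rel_hat(2)[OF \<X> \<Y> R XY] by blast
  then show "\<exists>b\<in>R X Y. \<forall>x\<in>carrier X. \<forall>y\<in>carrier Y. P [x, y] (ip Y y (b x))"
    using r(2) unfolding ball_listset_Cons list.map listset.simps(1)
    by (intro bexI[OF _ b(1)]) auto
next
  assume "\<exists>b\<in>R X Y. \<forall>x\<in>carrier X. \<forall>y\<in>carrier Y. P [x, y] (ip Y y (b x))"
  then obtain b where b: "b \<in> R X Y" "\<forall>x\<in>carrier X. \<forall>y\<in>carrier Y. P [x, y] (ip Y y (b x))" by blast
  note fX = quantum_setD[OF \<X> XY(1)] and fY = quantum_setD[OF \<Y> XY(2)]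
  have "b \<in> bounded_ops X Y"
    by (rule op_subspaceD(1)[OF binary_relationsD[OF R XY] fd_hilbert_spaceD(1)[OF fX] fd_hilbert_spaceD(1)[OF fY] b(1)])
  then obtain r where r: "r \<in> functionals [X, hdual Y]"
    "\<And>x y. x \<in> carrier X \<Longrightarrow> y \<in> carrier Y \<Longrightarrow> r (elem_tensor [X, hdual Y] [x, y]) = ip Y y (b x)"
    using operator_functional[OF fX fY] by blast
  have "r \<in> rel_hat \<X> \<Y> R [X, hdual Y]" unfolding rel_hat(2)[OF \<X> \<Y> R XY] using r b(1) by blast
  then show "\<exists>r\<in>rel_hat \<X> \<Y> R [X, hdual Y]. \<forall>ys\<in>vec_lists [X, hdual Y]. P ys (r (elem_tensor [X, hdual Y] ys))"
    unfolding ball_listset_Cons list.map listset.simps(1)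
    using r(2) b(2) by (intro bexI[of _ r]) auto
qed

section \<open>Reflexivity and symmetry as formulas\<close>

text \<open>The formula says that \<open>\<epsilon>\<^sub>X\<close> is the functional of some \<open>b\<close> in \<open>R(X, X)\<close>, and \<open>\<langle>y|x\<rangle> = \<langle>y|b x\<rangle>\<close> means
  that \<open>b\<close> is the identity.\<close>

lemma interp_reflexive:
  assumes \<X>: "quantum_set \<X>" and R: "R \<in> binary_relations \<X> \<X>" and ij: "i \<noteq> j"
  shows "interp (Forall_eq \<X> i j (Atom (rel_hat \<X> \<X> R) [(\<X>, i), (qdual \<X>, j)])) [] = rel_top [] \<longleftrightarrow>
    (\<forall>X\<in>\<X>. (\<lambda>x\<in>carrier X. x) \<in> R X X)"
proof -
  let ?\<Gamma> = "[(\<X>, i), (qdual \<X>, j)]"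
  let ?A = "Atom (rel_hat \<X> \<X> R) ?\<Gamma>"
  note hat = rel_hat[OF \<X> \<X> R]
  have d: "distinct ?\<Gamma>" using ij by simp
  have q: "quantum_sets (map fst ?\<Gamma>)" using \<X> quantum_set_qdual by simp
  have \<pi>: "id permutes {..<length ?\<Gamma>}" "permute_list id ?\<Gamma> = ?\<Gamma> @ filter (\<lambda>v. v \<notin> set ?\<Gamma>) ?\<Gamma>"
    by (auto simp: permutes_id)
  have hat': "rel_hat \<X> \<X> R \<in> relations (map fst ?\<Gamma>)" using hat(1) by simp
  have A: "interp ?A ?\<Gamma> \<in> relations [\<X>, qdual \<X>]"
    using interp_Atom_relations[OF d q \<pi> hat'] by simp
  have "evaluation X \<in> interp ?A ?\<Gamma> [X, hdual X] \<longleftrightarrow> (\<lambda>x\<in>carrier X. x) \<in> R X X" if X: "X \<in> \<X>" for X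
  proof -
    note fX = quantum_setD[OF \<X> X]
    note Xi = fd_hilbert_spaceD(1)[OF fX]
    interpret X: inner_product_space X by fact
    note RD = op_subspaceD(1)[OF binary_relationsD[OF R X X] Xi Xi]
    have L: "[X, hdual X] \<in> listset (map fst ?\<Gamma>)"
      using X by (simp add: Cons_mem_listset qdual_def del: listset.simps(2))
    have "evaluation X \<in> interp ?A ?\<Gamma> [X, hdual X] \<longleftrightarrow>
      (\<exists>r\<in>rel_hat \<X> \<X> R [X, hdual X]. \<forall>ys\<in>vec_lists [X, hdual X]. \<forall>xs\<in>vec_lists [X, hdual X].
        xs = ys \<longrightarrow> r (elem_tensor [X, hdual X] ys) = evaluation X (elem_tensor [X, hdual X] xs))"
      using interp_Atom(1)[OF d q L \<pi> _ _ hat', of "[X, hdual X]" "[]"] evaluation(1)[OF fX] by simp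
    also have "\<dots> \<longleftrightarrow> (\<exists>b\<in>R X X. \<forall>x\<in>carrier X. \<forall>y\<in>carrier X. \<forall>xs\<in>vec_lists [X, hdual X].
        xs = [x, y] \<longrightarrow> ip X y (b x) = evaluation X (elem_tensor [X, hdual X] xs))"
      by (rule rel_hat_slice[OF \<X> \<X> R X X, where P = "\<lambda>ys c. \<forall>xs\<in>vec_lists [X, hdual X].
        xs = ys \<longrightarrow> c = evaluation X (elem_tensor [X, hdual X] xs)"])
    also have "\<dots> \<longleftrightarrow> (\<exists>b\<in>R X X. \<forall>x\<in>carrier X. \<forall>y\<in>carrier X. ip X y (b x) = ip X y x)"
      using evaluation(2)[OF fX] by (simp add: Cons_mem_listset del: listset.simps(2))
    also have "\<dots> \<longleftrightarrow> (\<lambda>x\<in>carrier X. x) \<in> R X X"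
    proof
      assume "\<exists>b\<in>R X X. \<forall>x\<in>carrier X. \<forall>y\<in>carrier X. ip X y (b x) = ip X y x"
      then obtain b where b: "b \<in> R X X" "\<And>x y. x \<in> carrier X \<Longrightarrow> y \<in> carrier X \<Longrightarrow> ip X y (b x) = ip X y x" by blast
      have "b = (\<lambda>x\<in>carrier X. x)"
        by (rule op_ext[OF RD[OF b(1)] id_bounded_ops[OF Xi]])
          (use b bounded_opsD(1)[OF RD[OF b(1)]] in \<open>auto intro!: X.ip_ext\<close>)
      then show "(\<lambda>x\<in>carrier X. x) \<in> R X X" using b(1) by simp
    qed (rule bexI[of _ "\<lambda>x\<in>carrier X. x"], simp_all)
    finally show ?thesis .
  qed
  then show ?thesis using interp_Forall_eq_sentence[OF \<X> A ij] by simp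
qed

text \<open>The heart of the symmetry condition. Identify functionals on \<open>X\<^sub>2 \<otimes> X\<^sub>2\<^sup>* \<otimes> X\<^sub>1 \<otimes> X\<^sub>1\<^sup>*\<close> with
  \<open>L(X\<^sub>1, X\<^sub>2) \<otimes> L(X\<^sub>2, X\<^sub>1)\<close>. Then \<open>A = R\<^sub>1\<^sub>2 \<otimes> L(X\<^sub>2, X\<^sub>1)\<close> and \<open>B = L(X\<^sub>1, X\<^sub>2) \<otimes> R\<^sub>2\<^sub>1\<close>, and \<open>h\<close> is
  \<open>\<Sum>\<^sub>i r\<^sub>i \<otimes> r\<^sub>i\<^sup>\<dagger>\<close> for every orthonormal basis \<open>(r\<^sub>i)\<close> of \<open>L(X\<^sub>1, X\<^sub>2)\<close>. Hence its component in \<open>A\<close> is the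
  same sum over an orthonormal basis of \<open>R\<^sub>1\<^sub>2\<close>, which lies in \<open>B\<close> exactly if \<open>R\<^sub>1\<^sub>2\<^sup>\<dagger> \<subseteq> R\<^sub>2\<^sub>1\<close>.\<close>

lemma symmetry_criterion:
  fixes X1 X2 :: "'v hilb"
  defines "Ts \<equiv> [X2, hdual X2, X1, hdual X1]"
  assumes X1: "fd_hilbert_space X1" and X2: "fd_hilbert_space X2"
    and R12: "op_subspace X1 X2 R12" and R21: "op_subspace X2 X1 R21"
    and A: "A = {f \<in> functionals Ts. \<forall>x2\<in>carrier X2. \<forall>y1\<in>carrier X1. \<exists>b\<in>R12. \<forall>x1\<in>carrier X1. \<forall>y2\<in>carrier X2.
      f (elem_tensor Ts [x2, y2, x1, y1]) = ip X2 y2 (b x1)}"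
    and B: "B = {f \<in> functionals Ts. \<forall>y2\<in>carrier X2. \<forall>x1\<in>carrier X1. \<exists>b\<in>R21. \<forall>x2\<in>carrier X2. \<forall>y1\<in>carrier X1.
      f (elem_tensor Ts [x2, y2, x1, y1]) = ip X1 y1 (b x2)}"
    and h: "h \<in> functionals Ts" "\<And>x2 y2 x1 y1. \<lbrakk>x2 \<in> carrier X2; y2 \<in> carrier X2; x1 \<in> carrier X1; y1 \<in> carrier X1\<rbrakk>
      \<Longrightarrow> h (elem_tensor Ts [x2, y2, x1, y1]) = ip X2 y2 x2 * ip X1 y1 x1"
  shows "(\<forall>a\<in>A. (\<forall>b\<in>A \<inter> B. hs_functional Ts b a = 0) \<longrightarrow> hs_functional Ts a h = 0) \<longleftrightarrow>
    (\<forall>r\<in>R12. adj X1 X2 r \<in> R21)"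
proof -
  note i1 = fd_hilbert_spaceD(1)[OF X1] and i2 = fd_hilbert_spaceD(1)[OF X2]
  interpret X1: inner_product_space X1 by fact
  interpret X2: inner_product_space X2 by fact
  note o1 = fd_hilbert_spaceD(3)[OF X1] and o2 = fd_hilbert_spaceD(3)[OF X2]
  let ?E1 = "some_onb X1" and ?E2 = "some_onb X2"
  note E1 = orthonormal_basisD(1-3)[OF i1 o1] and E2 = orthonormal_basisD(1-3)[OF i2 o2]
  note P1 = orthonormal_basisD(4)[OF i1 o1] and P2 = orthonormal_basisD(4)[OF i2 o2]
  have fd: "fd_list Ts" using X1 X2 fd_hdual[OF X1] fd_hdual[OF X2] by (simp add: Ts_def)
  have onb: "onb_list Ts [?E2, ?E2, ?E1, ?E1]"
    using o1 o2 orthonormal_basis_hdual[OF i1 o1] orthonormal_basis_hdual[OF i2 o2] by (simp add: Ts_def)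
  have mem: "[x2, y2, x1, y1] \<in> vec_lists Ts \<longleftrightarrow> x2 \<in> carrier X2 \<and> y2 \<in> carrier X2 \<and> x1 \<in> carrier X1 \<and> y1 \<in> carrier X1"
    for x2 y2 x1 y1 by (simp add: Ts_def Cons_mem_listset del: listset.simps(2))
  have hs: "hs_functional Ts f g = (\<Sum>e\<in>?E2. \<Sum>f'\<in>?E2. \<Sum>u\<in>?E1. \<Sum>k\<in>?E1.
      cnj (f (elem_tensor Ts [e, f', u, k])) * g (elem_tensor Ts [e, f', u, k]))"
    if "f \<in> functionals Ts" "g \<in> functionals Ts" for f g
    unfolding hs_ip_functionals[OF fd onb that] sum_listset_Cons by simp
  note r12 = op_subspaceD[OF R12 i1 i2] and r21 = op_subspaceD[OF R21 i2 i1]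
  define cross where "cross = (\<lambda>r s. tensor_lift Ts complex_hilb (\<lambda>xs. ip X2 (xs ! 1) (r (xs ! 2)) * ip X1 (xs ! 3) (s (xs ! 0))))"
  have cross: "cross r s \<in> functionals Ts"
    "\<lbrakk>x2 \<in> carrier X2; y2 \<in> carrier X2; x1 \<in> carrier X1; y1 \<in> carrier X1\<rbrakk> \<Longrightarrow>
      cross r s (elem_tensor Ts [x2, y2, x1, y1]) = ip X2 y2 (r x1) * ip X1 y1 (s x2)"
    if r: "r \<in> bounded_ops X1 X2" and s: "s \<in> bounded_ops X2 X1" for r s x2 y2 x1 y1
  proof -
    note rD = bounded_opsD[OF r] and sD = bounded_opsD[OF s]
    have m: "multilinear Ts (\<lambda>xs. ip X2 (xs ! 1) (r (xs ! 2)) * ip X1 (xs ! 3) (s (xs ! 0)))"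
      unfolding Ts_def multilinear.simps ball_listset_Cons list.map
      using rD sD by (auto intro!: linear_functionalI[OF i1] linear_functionalI[OF i2]
          linear_functionalI[OF inner_product_hdual[OF i1], simplified]
          linear_functionalI[OF inner_product_hdual[OF i2], simplified]
          simp: X1.ip_simps X2.ip_simps algebra_simps)
    show "cross r s \<in> functionals Ts" unfolding cross_def by (rule functional_lift(1)[OF fd m])
    show "\<lbrakk>x2 \<in> carrier X2; y2 \<in> carrier X2; x1 \<in> carrier X1; y1 \<in> carrier X1\<rbrakk> \<Longrightarrow>
      cross r s (elem_tensor Ts [x2, y2, x1, y1]) = ip X2 y2 (r x1) * ip X1 y1 (s x2)"
      unfolding cross_def using functional_lift(2)[OF fd m, of "[x2, y2, x1, y1]"] mem by simp
  qed
  have cross_A: "cross r s \<in> A" if r: "r \<in> R12" and s: "s \<in> bounded_ops X2 X1" for r s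
  proof -
    note rb = r12(1)[OF r]
    have "\<exists>b\<in>R12. \<forall>x1\<in>carrier X1. \<forall>y2\<in>carrier X2. cross r s (elem_tensor Ts [x2, y2, x1, y1]) = ip X2 y2 (b x1)"
      if "x2 \<in> carrier X2" "y1 \<in> carrier X1" for x2 y1
      using cross(2)[OF rb s] bounded_opsD(1)[OF rb] that
      by (intro bexI[OF _ r12(4)[OF r, of "ip X1 y1 (s x2)"]]) (auto simp: X2.ip_simps)
    then show ?thesis unfolding A using cross(1)[OF rb s] by blast
  qed
  have cross_B: "cross r s \<in> B" if r: "r \<in> bounded_ops X1 X2" and s: "s \<in> R21" for r s
  proof -
    note sb = r21(1)[OF s]
    have "\<exists>b\<in>R21. \<forall>x2\<in>carrier X2. \<forall>y1\<in>carrier X1. cross r s (elem_tensor Ts [x2, y2, x1, y1]) = ip X1 y1 (b x2)"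
      if "y2 \<in> carrier X2" "x1 \<in> carrier X1" for y2 x1
      using cross(2)[OF r sb] bounded_opsD(1)[OF sb] that
      by (intro bexI[OF _ r21(4)[OF s, of "ip X2 y2 (r x1)"]]) (auto simp: X1.ip_simps)
    then show ?thesis unfolding B using cross(1)[OF r sb] by blast
  qed
  have Af: "a \<in> functionals Ts" if "a \<in> A" for a using that A by blast
  have Bf: "a \<in> functionals Ts" if "a \<in> B" for a using that B by blast
  have hs_h: "hs_functional Ts h a = (\<Sum>e\<in>?E2. \<Sum>k\<in>?E1. a (elem_tensor Ts [e, e, k, k]))"
    if a: "a \<in> functionals Ts" for a
  proof -
    have "hs_functional Ts h a = (\<Sum>e\<in>?E2. \<Sum>f\<in>?E2. if f = e then
        (\<Sum>u\<in>?E1. \<Sum>k\<in>?E1. if k = u then a (elem_tensor Ts [e, f, u, k]) else 0) else 0)"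
      unfolding hs[OF h(1) a]
    proof (intro sum.cong refl)
      fix e f assume ef: "e \<in> ?E2" "f \<in> ?E2"
      show "(\<Sum>u\<in>?E1. \<Sum>k\<in>?E1. cnj (h (elem_tensor Ts [e, f, u, k])) * a (elem_tensor Ts [e, f, u, k])) =
        (if f = e then (\<Sum>u\<in>?E1. \<Sum>k\<in>?E1. if k = u then a (elem_tensor Ts [e, f, u, k]) else 0) else 0)"
        using ef E1(2,3) E2(2,3) h(2) by (auto intro!: sum.cong sum.neutral)
    qed
    also have "\<dots> = (\<Sum>e\<in>?E2. \<Sum>k\<in>?E1. a (elem_tensor Ts [e, e, k, k]))"
      using E1(1) E2(1) by simp
    finally show ?thesis .
  qed
  have adjb: "adj X1 X2 r \<in> bounded_ops X2 X1" if "r \<in> bounded_ops X1 X2" for r by (rule adj_fd(1)[OF X1 i2 that])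
  have adj_ip: "ip X1 k (adj X1 X2 r e) = cnj (ip X2 e (r k))"
    if "r \<in> bounded_ops X1 X2" "e \<in> carrier X2" "k \<in> carrier X1" for r e k
    using adj_fd(2)[OF X1 i2 that(1,3,2)] X1.ip_cnj[of "adj X1 X2 r e" k] bounded_opsD(1)[OF adjb[OF that(1)] that(2)] that by simp
  show ?thesis
  proof
    assume imp: "\<forall>a\<in>A. (\<forall>b\<in>A \<inter> B. hs_functional Ts b a = 0) \<longrightarrow> hs_functional Ts a h = 0"
    show "\<forall>r\<in>R12. adj X1 X2 r \<in> R21"
    proof
      fix r assume r: "r \<in> R12"
      note rb = r12(1)[OF r]
      \<comment> \<open>For \<open>s\<close> orthogonal to \<open>R\<^sub>2\<^sub>1\<close>, the functional \<open>r \<otimes> s\<close> lies in \<open>A\<close> and is orthogonal to \<open>B\<close>, hence to \<open>h\<close>;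
        its inner product with \<open>h\<close> is that of \<open>s\<close> and the adjoint of \<open>r\<close>.\<close>
      show "adj X1 X2 r \<in> R21"
      proof (rule hs_double_orthogonal[OF X2 X1 R21 adjb[OF rb]])
        fix s assume s: "s \<in> bounded_ops X2 X1" and perp: "\<And>w. w \<in> R21 \<Longrightarrow> hs_ip X2 X1 w s = 0"
        note sD = bounded_opsD(1)[OF s] and rD = bounded_opsD(1)[OF rb]
        have "hs_functional Ts b (cross r s) = 0" if b: "b \<in> B" for b
        proof -
          have bf: "b \<in> functionals Ts" by (rule Bf[OF b])
          have z: "(\<Sum>e\<in>?E2. \<Sum>k\<in>?E1. cnj (b (elem_tensor Ts [e, f, u, k])) * cross r s (elem_tensor Ts [e, f, u, k])) = 0"
            if f: "f \<in> ?E2" and u: "u \<in> ?E1" for f u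
          proof -
            obtain t where t: "t \<in> R21" "\<And>x2 y1. x2 \<in> carrier X2 \<Longrightarrow> y1 \<in> carrier X1 \<Longrightarrow> b (elem_tensor Ts [x2, f, u, y1]) = ip X1 y1 (t x2)"
              using b f u E1(2) E2(2) unfolding B by blast
            note tb = r21(1)[OF t(1)]
            note tD = bounded_opsD(1)[OF tb]
            have "(\<Sum>e\<in>?E2. \<Sum>k\<in>?E1. cnj (b (elem_tensor Ts [e, f, u, k])) * cross r s (elem_tensor Ts [e, f, u, k])) =
              (\<Sum>e\<in>?E2. ip X2 f (r u) * (\<Sum>k\<in>?E1. ip X1 (t e) k * ip X1 k (s e)))"
              unfolding sum_distrib_left
              by (intro sum.cong refl) (use t(2) cross(2)[OF rb s] E1(2) E2(2) f u tD in \<open>simp add: X1.cnj_ip\<close>)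
            also have "\<dots> = (\<Sum>e\<in>?E2. ip X2 f (r u) * ip X1 (t e) (s e))"
              by (intro sum.cong refl) (simp add: P1[OF tD sD, OF E2(2) E2(2), symmetric])
            also have "\<dots> = ip X2 f (r u) * hs_ip X2 X1 t s"
              by (simp add: hs_ip_some_onb[OF X2 i1 tb s] sum_distrib_left)
            finally show ?thesis using perp[OF t(1)] by simp
          qed
          have "hs_functional Ts b (cross r s) = (\<Sum>f\<in>?E2. \<Sum>u\<in>?E1. \<Sum>e\<in>?E2. \<Sum>k\<in>?E1.
              cnj (b (elem_tensor Ts [e, f, u, k])) * cross r s (elem_tensor Ts [e, f, u, k]))"
            unfolding hs[OF bf cross(1)[OF rb s]]
            by (subst sum.swap, rule sum.cong[OF refl], subst sum.swap) simp
          then show ?thesis using z by simp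
        qed
        then have "hs_functional Ts (cross r s) h = 0" using imp cross_A[OF r s] by blast
        then have "0 = hs_functional Ts h (cross r s)"
          using cnj_hs_functional[OF fd cross(1)[OF rb s] h(1)] by simp
        also have "\<dots> = (\<Sum>e\<in>?E2. \<Sum>k\<in>?E1. ip X2 e (r k) * ip X1 k (s e))"
          unfolding hs_h[OF cross(1)[OF rb s]] using cross(2)[OF rb s] E1(2) E2(2) by (intro sum.cong refl) auto
        also have "\<dots> = cnj (hs_ip X2 X1 s (adj X1 X2 r))"
          unfolding hs_ip_some_onb[OF X2 i1 s adjb[OF rb]] cnj_sum
        proof (rule sum.cong)
          fix e assume "e \<in> ?E2"
          then have e: "e \<in> carrier X2" by (rule E2(2))
          have "ip X1 (s e) (adj X1 X2 r e) = (\<Sum>k\<in>?E1. ip X1 (s e) k * ip X1 k (adj X1 X2 r e))"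
            by (rule P1) (use sD e bounded_opsD(1)[OF adjb[OF rb]] in auto)
          then show "(\<Sum>k\<in>?E1. ip X2 e (r k) * ip X1 k (s e)) = cnj (ip X1 (s e) (adj X1 X2 r e))"
            using adj_ip[OF rb e] E1(2) sD[OF e] by (auto simp: X1.cnj_ip mult.commute intro!: sum.cong)
        qed simp
        finally show "hs_ip X2 X1 s (adj X1 X2 r) = 0" by simp
      qed
    qed
  next
    assume sym: "\<forall>r\<in>R12. adj X1 X2 r \<in> R21"
    interpret HS: inner_product_space "hs_space X1 X2" by (rule inner_product_hs_space[OF X1 i2])
    obtain S where S: "finite_spanning (hs_space X1 X2) S"
      using fd_hilbert_spaceD(2)[OF fd_hs_space[OF X1 X2]] by blast
    have sub: "submodule R12 complex_ring (hs_space X1 X2)" using R12 submodule_hs_space[OF i1 i2] by blast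
    \<comment> \<open>The sum of \<open>r \<otimes> r\<^sup>\<dagger>\<close> over \<open>Q\<close> has the same inner product with the elements of \<open>A\<close> as \<open>h\<close>.\<close>
    obtain Q where Q: "orthonormal (hs_space X1 X2) Q" "Q \<subseteq> R12" "\<And>w. w \<in> R12 \<Longrightarrow> expands (hs_space X1 X2) Q w"
      using HS.subspace_basis[OF S sub] by metis
    have Qb: "r \<in> bounded_ops X1 X2" "r \<in> R12" if "r \<in> Q" for r using Q(2) r12(1) that by auto
    show "\<forall>a\<in>A. (\<forall>b\<in>A \<inter> B. hs_functional Ts b a = 0) \<longrightarrow> hs_functional Ts a h = 0"
    proof (intro ballI impI)
      fix a assume a: "a \<in> A" and perp: "\<forall>b\<in>A \<inter> B. hs_functional Ts b a = 0"
      note af = Af[OF a]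
      have "\<exists>b\<in>R12. \<forall>x1\<in>carrier X1. \<forall>y2\<in>carrier X2. a (elem_tensor Ts [fst p, y2, x1, snd p]) = ip X2 y2 (b x1)"
        if "p \<in> ?E2 \<times> ?E1" for p
        using a that E1(2) E2(2) unfolding A by auto
      then obtain s' where s': "\<And>p. p \<in> ?E2 \<times> ?E1 \<Longrightarrow> s' p \<in> R12 \<and> (\<forall>x1\<in>carrier X1. \<forall>y2\<in>carrier X2.
          a (elem_tensor Ts [fst p, y2, x1, snd p]) = ip X2 y2 (s' p x1))"
        by metis
      define s where "s = (\<lambda>e k. s' (e, k))"
      have s: "s e k \<in> R12" "x1 \<in> carrier X1 \<Longrightarrow> y2 \<in> carrier X2 \<Longrightarrow> a (elem_tensor Ts [e, y2, x1, k]) = ip X2 y2 (s e k x1)"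
        if "e \<in> ?E2" "k \<in> ?E1" for e k x1 y2
        using s'[of "(e, k)"] that by (auto simp: s_def)
      have p: "hs_functional Ts (cross r (adj X1 X2 r)) a = (\<Sum>e\<in>?E2. \<Sum>k\<in>?E1. ip X2 e (r k) * hs_ip X1 X2 r (s e k))"
        if r: "r \<in> Q" for r
      proof -
        note rb = Qb(1)[OF r] 
        note rD = bounded_opsD(1)[OF rb] and ab = adjb[OF rb]
        have "hs_functional Ts (cross r (adj X1 X2 r)) a = (\<Sum>e\<in>?E2. \<Sum>k\<in>?E1. \<Sum>f\<in>?E2. \<Sum>u\<in>?E1.
            cnj (cross r (adj X1 X2 r) (elem_tensor Ts [e, f, u, k])) * a (elem_tensor Ts [e, f, u, k]))"
          unfolding hs[OF cross(1)[OF rb ab] af]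
        proof (rule sum.cong[OF refl])
          fix e
          let ?t = "\<lambda>f u k. cnj (cross r (adj X1 X2 r) (elem_tensor Ts [e, f, u, k])) * a (elem_tensor Ts [e, f, u, k])"
          have "(\<Sum>f\<in>?E2. \<Sum>u\<in>?E1. \<Sum>k\<in>?E1. ?t f u k) = (\<Sum>f\<in>?E2. \<Sum>k\<in>?E1. \<Sum>u\<in>?E1. ?t f u k)"
            by (rule sum.cong[OF refl], rule sum.swap)
          also have "\<dots> = (\<Sum>k\<in>?E1. \<Sum>f\<in>?E2. \<Sum>u\<in>?E1. ?t f u k)" by (rule sum.swap)
          finally show "(\<Sum>f\<in>?E2. \<Sum>u\<in>?E1. \<Sum>k\<in>?E1. ?t f u k) = (\<Sum>k\<in>?E1. \<Sum>f\<in>?E2. \<Sum>u\<in>?E1. ?t f u k)" .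
        qed
        also have "\<dots> = (\<Sum>e\<in>?E2. \<Sum>k\<in>?E1. ip X2 e (r k) * hs_ip X1 X2 r (s e k))"
        proof (intro sum.cong refl)
          fix e k assume ek: "e \<in> ?E2" "k \<in> ?E1"
          then have ec: "e \<in> carrier X2" and kc: "k \<in> carrier X1" using E1(2) E2(2) by auto
          note sb = r12(1)[OF s(1)[OF ek]]
          note sD = bounded_opsD(1)[OF sb]
          have "(\<Sum>f\<in>?E2. \<Sum>u\<in>?E1. cnj (cross r (adj X1 X2 r) (elem_tensor Ts [e, f, u, k])) * a (elem_tensor Ts [e, f, u, k])) =
            (\<Sum>f\<in>?E2. \<Sum>u\<in>?E1. ip X2 e (r k) * (ip X2 (r u) f * ip X2 f (s e k u)))"
            by (intro sum.cong refl)
              (use cross(2)[OF rb ab] s(2)[OF ek] E1(2) E2(2) ec kc rD adj_ip[OF rb ec kc] in \<open>simp add: X2.cnj_ip\<close>)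
          also have "\<dots> = ip X2 e (r k) * (\<Sum>u\<in>?E1. \<Sum>f\<in>?E2. ip X2 (r u) f * ip X2 f (s e k u))"
            by (subst sum.swap) (simp add: sum_distrib_left)
          also have "(\<Sum>u\<in>?E1. \<Sum>f\<in>?E2. ip X2 (r u) f * ip X2 f (s e k u)) = hs_ip X1 X2 r (s e k)"
            unfolding hs_ip_some_onb[OF X1 i2 rb sb]
            by (rule sum.cong) (use P2 rD sD E1(2) in auto)
          finally show "(\<Sum>f\<in>?E2. \<Sum>u\<in>?E1. cnj (cross r (adj X1 X2 r) (elem_tensor Ts [e, f, u, k])) * a (elem_tensor Ts [e, f, u, k])) =
            ip X2 e (r k) * hs_ip X1 X2 r (s e k)" .
        qed
        finally show ?thesis .
      qed
      have "hs_functional Ts h a = (\<Sum>e\<in>?E2. \<Sum>k\<in>?E1. \<Sum>r\<in>Q. ip X2 e (r k) * hs_ip X1 X2 r (s e k))"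
        unfolding hs_h[OF af]
      proof (intro sum.cong refl)
        fix e k assume ek: "e \<in> ?E2" "k \<in> ?E1"
        then have ec: "e \<in> carrier X2" and kc: "k \<in> carrier X1" using E1(2) E2(2) by auto
        note kb = ketbra_bounded[OF i1 i2 ec kc]
        have ket: "hs_ip X1 X2 (ketbra X1 X2 e k) b = ip X2 e (b k)" if b: "b \<in> bounded_ops X1 X2" for b
        proof -
          have "hs_ip X1 X2 (ketbra X1 X2 e k) b = (\<Sum>u\<in>?E1. if k = u then ip X2 e (b u) else 0)"
            unfolding hs_ip_some_onb[OF X1 i2 kb b]
            by (rule sum.cong) (use ek E1(2,3) ec bounded_opsD(1)[OF b] in \<open>auto simp: ketbra_def X2.ip_simps\<close>)
          then show ?thesis using ek E1(1) by simp
        qed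
        have "ip X2 e (s e k k) = hs_ip X1 X2 (ketbra X1 X2 e k) (s e k)"
          using ket r12(1)[OF s(1)[OF ek]] by simp
        also have "\<dots> = (\<Sum>r\<in>Q. hs_ip X1 X2 (ketbra X1 X2 e k) r * hs_ip X1 X2 r (s e k))"
          using HS.expandsD[OF Q(3)[OF s(1)[OF ek]], of "ketbra X1 X2 e k"] kb by simp
        also have "\<dots> = (\<Sum>r\<in>Q. ip X2 e (r k) * hs_ip X1 X2 r (s e k))"
          by (rule sum.cong) (use ket Qb in auto)
        finally show "a (elem_tensor Ts [e, e, k, k]) = (\<Sum>r\<in>Q. ip X2 e (r k) * hs_ip X1 X2 r (s e k))"
          using s(2)[OF ek kc ec] by simp
      qed
      also have "\<dots> = (\<Sum>r\<in>Q. hs_functional Ts (cross r (adj X1 X2 r)) a)"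
      proof -
        have "(\<Sum>e\<in>?E2. \<Sum>k\<in>?E1. \<Sum>r\<in>Q. ip X2 e (r k) * hs_ip X1 X2 r (s e k)) =
          (\<Sum>e\<in>?E2. \<Sum>r\<in>Q. \<Sum>k\<in>?E1. ip X2 e (r k) * hs_ip X1 X2 r (s e k))"
          by (rule sum.cong[OF refl], rule sum.swap)
        also have "\<dots> = (\<Sum>r\<in>Q. \<Sum>e\<in>?E2. \<Sum>k\<in>?E1. ip X2 e (r k) * hs_ip X1 X2 r (s e k))" by (rule sum.swap)
        also have "\<dots> = (\<Sum>r\<in>Q. hs_functional Ts (cross r (adj X1 X2 r)) a)" using p by simp
        finally show ?thesis .
      qed
      also have "\<dots> = 0"
        by (rule sum.neutral) (use perp cross_A cross_B Qb adjb sym in blast)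
      finally show "hs_functional Ts a h = 0"
        using cnj_hs_functional[OF fd h(1) af] by simp
    qed
  qed
qed

text \<open>After both quantifiers have been replaced by evaluations, the formula says that \<open>\<epsilon>\<^sub>X\<^sub>2 \<otimes> \<epsilon>\<^sub>X\<^sub>1\<close> satisfies the
  implication between the two atomic formulas, in the context \<open>x\<^sub>2, x\<^sub>2\<^sub>*, x\<^sub>1, x\<^sub>1\<^sub>*\<close>; this is the situation of
  \<open>symmetry_criterion\<close>.\<close>

lemma interp_symmetric:
  assumes \<X>: "quantum_set \<X>" and R: "R \<in> binary_relations \<X> \<X>"
  shows "interp (Forall_eq \<X> 1 2 (Forall_eq \<X> 3 4
        (Imp (Atom (rel_hat \<X> \<X> R) [(\<X>, 1), (qdual \<X>, 4)])
             (Atom (rel_hat \<X> \<X> R) [(\<X>, 3), (qdual \<X>, 2)])))) [] = rel_top [] \<longleftrightarrow>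
    (\<forall>X1\<in>\<X>. \<forall>X2\<in>\<X>. \<forall>r\<in>R X1 X2. adj X1 X2 r \<in> R X2 X1)"
proof -
  let ?va = "[(\<X>, 1), (qdual \<X>, 4)] :: 'a var list" and ?vb = "[(\<X>, 3), (qdual \<X>, 2)] :: 'a var list"
  let ?A = "Atom (rel_hat \<X> \<X> R) ?va" and ?B = "Atom (rel_hat \<X> \<X> R) ?vb"
  let ?\<Gamma>2 = "[(\<X>, 1), (qdual \<X>, 2)] :: 'a var list"
  let ?\<Gamma> = "(\<X>, 3) # (qdual \<X>, 4) # ?\<Gamma>2"
  note \<X>' = quantum_set_qdual[OF \<X>]
  note hat = rel_hat[OF \<X> \<X> R]
  have d: "distinct ?\<Gamma>" by simp
  have q: "quantum_sets (map fst ?\<Gamma>)" "quantum_sets (map fst ?\<Gamma>2)" using \<X> \<X>' by auto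
  have hat': "rel_hat \<X> \<X> R \<in> relations (map fst ?va)" "rel_hat \<X> \<X> R \<in> relations (map fst ?vb)" using hat(1) by auto
  \<comment> \<open>These bring the variables of the two atomic formulas to the front of the context.\<close>
  define \<pi>a \<pi>b :: "nat \<Rightarrow> nat" where "\<pi>a = Transposition.transpose 0 2" and
    "\<pi>b = Transposition.transpose 1 3 \<circ> Transposition.transpose 2 3"
  have pa: "\<pi>a permutes {..<length ?\<Gamma>}" unfolding \<pi>a_def by (rule permutes_swap_id) auto
  have pb: "\<pi>b permutes {..<length ?\<Gamma>}" unfolding \<pi>b_def
    by (intro permutes_compose permutes_swap_id) auto
  have la: "permute_list \<pi>a [a, b, c, e] = [c, b, a, e]" for a b c e :: 'x
    by (simp add: permute_list_def \<pi>a_def Transposition.transpose_def numeral_2_eq_2)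
  have lb: "permute_list \<pi>b [a, b, c, e] = [a, e, b, c]" for a b c e :: 'x
    by (simp add: permute_list_def \<pi>b_def Transposition.transpose_def numeral_2_eq_2 numeral_3_eq_3)
  have pa': "permute_list \<pi>a ?\<Gamma> = ?va @ filter (\<lambda>v. v \<notin> set ?va) ?\<Gamma>" unfolding la by simp
  have pb': "permute_list \<pi>b ?\<Gamma> = ?vb @ filter (\<lambda>v. v \<notin> set ?vb) ?\<Gamma>" unfolding lb by simp
  note rA = interp_Atom_relations[OF d q(1) pa pa' hat'(1)] and rB = interp_Atom_relations[OF d q(1) pb pb' hat'(2)]
  let ?I = "Imp ?A ?B"
  note rI = interp_Imp_relations[OF q(1) rA rB]
  have L2: "[X1, hdual X1] \<in> listset (map fst ?\<Gamma>2)" if "X1 \<in> \<X>" for X1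
    using that by (simp add: Cons_mem_listset qdual_def del: listset.simps(2))
  have inner: "evaluation X1 \<in> interp (Forall_eq \<X> 3 4 ?I) ?\<Gamma>2 [X1, hdual X1] \<longleftrightarrow>
    (\<forall>X2\<in>\<X>. \<forall>r\<in>R X1 X2. adj X1 X2 r \<in> R X2 X1)" if m1: "X1 \<in> \<X>" for X1
  proof -
    note f1 = quantum_setD[OF \<X> m1]
    have "tensor_functional [X2, hdual X2] [X1, hdual X1] (evaluation X2) (evaluation X1)
        \<in> interp ?I ?\<Gamma> (X2 # hdual X2 # [X1, hdual X1]) \<longleftrightarrow> (\<forall>r\<in>R X1 X2. adj X1 X2 r \<in> R X2 X1)"
      if m2: "X2 \<in> \<X>" for X2
    proof -
      note f2 = quantum_setD[OF \<X> m2]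
      let ?Ts = "[X2, hdual X2, X1, hdual X1]"
      let ?h = "tensor_functional [X2, hdual X2] [X1, hdual X1] (evaluation X2) (evaluation X1)"
      have L: "?Ts \<in> listset (map fst ?\<Gamma>)"
        using m1 m2 by (simp add: Cons_mem_listset qdual_def del: listset.simps(2))
      have fd: "fd_list [X2, hdual X2]" "fd_list [X1, hdual X1]" using f1 f2 fd_hdual[OF f1] fd_hdual[OF f2] by auto
      note tf = tensor_functional[OF fd evaluation(1)[OF f2] evaluation(1)[OF f1]]
      have h: "?h \<in> functionals ?Ts" using tf(1) by simp
      have hv: "?h (elem_tensor ?Ts [x2, y2, x1, y1]) = ip X2 y2 x2 * ip X1 y1 x1"
        if "x2 \<in> carrier X2" "y2 \<in> carrier X2" "x1 \<in> carrier X1" "y1 \<in> carrier X1" for x2 y2 x1 y1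
        using tf(2)[of "[x2, y2]" "[x1, y1]"] that evaluation(2)[OF f1] evaluation(2)[OF f2]
        by (simp add: Cons_mem_listset del: listset.simps(2))
      have A: "interp ?A ?\<Gamma> ?Ts = {f \<in> functionals ?Ts. \<forall>x2\<in>carrier X2. \<forall>y1\<in>carrier X1. \<exists>b\<in>R X1 X2. \<forall>x1\<in>carrier X1. \<forall>y2\<in>carrier X2.
          f (elem_tensor ?Ts [x2, y2, x1, y1]) = ip X2 y2 (b x1)}"
      proof -
        have "interp ?A ?\<Gamma> ?Ts = {f \<in> functionals ?Ts. \<forall>zs\<in>vec_lists [X2, hdual X1]. \<exists>r\<in>rel_hat \<X> \<X> R [X1, hdual X2].
          \<forall>ys\<in>vec_lists [X1, hdual X2]. \<forall>xs\<in>vec_lists ?Ts. permute_list \<pi>a xs = ys @ zs \<longrightarrow>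
            r (elem_tensor [X1, hdual X2] ys) = f (elem_tensor ?Ts xs)}"
          by (rule interp_Atom(1)[OF d q(1) L pa pa' _ _ hat'(1)]) (simp_all add: la)
        also have "\<dots> = {f \<in> functionals ?Ts. \<forall>zs\<in>vec_lists [X2, hdual X1]. \<exists>b\<in>R X1 X2.
          \<forall>x\<in>carrier X1. \<forall>y\<in>carrier X2. \<forall>xs\<in>vec_lists ?Ts. permute_list \<pi>a xs = [x, y] @ zs \<longrightarrow>
            ip X2 y (b x) = f (elem_tensor ?Ts xs)}"
          by (simp only: rel_hat_slice[OF \<X> \<X> R m1 m2, where P = "\<lambda>ys c. \<forall>xs\<in>vec_lists ?Ts. permute_list \<pi>a xs = ys @ zs \<longrightarrow>
            c = f (elem_tensor ?Ts xs)" for zs f])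
        also have "\<dots> = {f \<in> functionals ?Ts. \<forall>x2\<in>carrier X2. \<forall>y1\<in>carrier X1. \<exists>b\<in>R X1 X2. \<forall>x1\<in>carrier X1. \<forall>y2\<in>carrier X2.
          f (elem_tensor ?Ts [x2, y2, x1, y1]) = ip X2 y2 (b x1)}"
          by (simp add: ball_listset_Cons la eq_commute cong: ball_cong del: listset.simps(2))
        finally show ?thesis .
      qed
      have B: "interp ?B ?\<Gamma> ?Ts = {f \<in> functionals ?Ts. \<forall>y2\<in>carrier X2. \<forall>x1\<in>carrier X1. \<exists>b\<in>R X2 X1. \<forall>x2\<in>carrier X2. \<forall>y1\<in>carrier X1.
          f (elem_tensor ?Ts [x2, y2, x1, y1]) = ip X1 y1 (b x2)}"
      proof -
        have "interp ?B ?\<Gamma> ?Ts = {f \<in> functionals ?Ts. \<forall>zs\<in>vec_lists [hdual X2, X1]. \<exists>r\<in>rel_hat \<X> \<X> R [X2, hdual X1].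
          \<forall>ys\<in>vec_lists [X2, hdual X1]. \<forall>xs\<in>vec_lists ?Ts. permute_list \<pi>b xs = ys @ zs \<longrightarrow>
            r (elem_tensor [X2, hdual X1] ys) = f (elem_tensor ?Ts xs)}"
          by (rule interp_Atom(1)[OF d q(1) L pb pb' _ _ hat'(2)]) (simp_all add: lb)
        also have "\<dots> = {f \<in> functionals ?Ts. \<forall>zs\<in>vec_lists [hdual X2, X1]. \<exists>b\<in>R X2 X1.
          \<forall>x\<in>carrier X2. \<forall>y\<in>carrier X1. \<forall>xs\<in>vec_lists ?Ts. permute_list \<pi>b xs = [x, y] @ zs \<longrightarrow>
            ip X1 y (b x) = f (elem_tensor ?Ts xs)}"
          by (simp only: rel_hat_slice[OF \<X> \<X> R m2 m1, where P = "\<lambda>ys c. \<forall>xs\<in>vec_lists ?Ts. permute_list \<pi>b xs = ys @ zs \<longrightarrow>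
            c = f (elem_tensor ?Ts xs)" for zs f])
        also have "\<dots> = {f \<in> functionals ?Ts. \<forall>y2\<in>carrier X2. \<forall>x1\<in>carrier X1. \<exists>b\<in>R X2 X1. \<forall>x2\<in>carrier X2. \<forall>y1\<in>carrier X1.
          f (elem_tensor ?Ts [x2, y2, x1, y1]) = ip X1 y1 (b x2)}"
          by (simp add: ball_listset_Cons lb eq_commute cong: ball_cong del: listset.simps(2))
        finally show ?thesis .
      qed
      have "?h \<in> interp ?I ?\<Gamma> ?Ts \<longleftrightarrow> (\<forall>a\<in>interp ?A ?\<Gamma> ?Ts.
        (\<forall>b\<in>interp ?A ?\<Gamma> ?Ts \<inter> interp ?B ?\<Gamma> ?Ts. hs_functional ?Ts b a = 0) \<longrightarrow> hs_functional ?Ts a ?h = 0)"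
        using interp_Imp_iff[OF q(1) L rA rB] h by blast
      also have "\<dots> \<longleftrightarrow> (\<forall>r\<in>R X1 X2. adj X1 X2 r \<in> R X2 X1)"
        by (rule symmetry_criterion[OF f1 f2 binary_relationsD[OF R m1 m2] binary_relationsD[OF R m2 m1] A B h hv])
      finally show ?thesis .
    qed
    then show ?thesis
      using interp_Forall_eq_iff[OF \<X> q(2) d L2[OF m1] rI, of "evaluation X1"] evaluation(1)[OF f1] by blast
  qed
  have rF: "interp (Forall_eq \<X> 3 4 ?I) ?\<Gamma>2 \<in> relations [\<X>, qdual \<X>]"
    using interp_Forall_eq_relations[OF q(2)] by simp
  show ?thesis
    using interp_Forall_eq_sentence[OF \<X> rF] inner by simp
qed
section \<open>Operators on the direct sum of the atoms\<close>

lemma hilbert_sum_simps [simp]: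
  "zero (hilbert_sum \<X>) = (\<lambda>X\<in>\<X>. \<zero>\<^bsub>X\<^esub>)"
  "add (hilbert_sum \<X>) = (\<lambda>f g. \<lambda>X\<in>\<X>. f X \<oplus>\<^bsub>X\<^esub> g X)"
  "smult (hilbert_sum \<X>) = (\<lambda>c f. \<lambda>X\<in>\<X>. c \<odot>\<^bsub>X\<^esub> f X)"
  "ip (hilbert_sum \<X>) = (\<lambda>f g. \<Sum>\<^sub>\<infinity>X\<in>\<X>. ip X (f X) (g X))"
  by (simp_all add: hilbert_sum_def)

lemma hilbert_sum_carrier:
  "f \<in> carrier (hilbert_sum \<X>) \<longleftrightarrow> f \<in> extensional \<X> \<and> (\<forall>X\<in>\<X>. f X \<in> carrier X) \<and> (\<lambda>X. (hnorm X (f X))\<^sup>2) summable_on \<X>"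
  by (auto simp: hilbert_sum_def PiE_def)

definition truncation :: "'v hilb set \<Rightarrow> 'v hilb set \<Rightarrow> ('v hilb \<Rightarrow> 'v) \<Rightarrow> 'v hilb \<Rightarrow> 'v" where
  "truncation \<X> F f = (\<lambda>X\<in>\<X>. if X \<in> F then f X else \<zero>\<^bsub>X\<^esub>)"

text \<open>The next two functions are \<open>inc\<^sub>Y\<^sup>\<dagger> v inc\<^sub>X\<close> and \<open>inc\<^sub>Y r inc\<^sub>X\<^sup>\<dagger>\<close>, in coordinates.\<close>

definition compression :: "'v hilb set \<Rightarrow> 'v hilb \<Rightarrow> 'v hilb \<Rightarrow> (('v hilb \<Rightarrow> 'v) \<Rightarrow> 'v hilb \<Rightarrow> 'v) \<Rightarrow> 'v \<Rightarrow> 'v" where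
  "compression \<X> X Y v = (\<lambda>x\<in>carrier X. v (inc \<X> X x) Y)"

definition block_op :: "'v hilb set \<Rightarrow> 'v hilb \<Rightarrow> 'v hilb \<Rightarrow> ('v \<Rightarrow> 'v) \<Rightarrow> ('v hilb \<Rightarrow> 'v) \<Rightarrow> 'v hilb \<Rightarrow> 'v" where
  "block_op \<X> X Y r = (\<lambda>f\<in>carrier (hilbert_sum \<X>). inc \<X> Y (r (f X)))"

definition truncation_op :: "'v hilb set \<Rightarrow> 'v hilb set \<Rightarrow> ('v hilb \<Rightarrow> 'v) \<Rightarrow> 'v hilb \<Rightarrow> 'v" where
  "truncation_op \<X> F = (\<lambda>f\<in>carrier (hilbert_sum \<X>). truncation \<X> F f)"

lemma quantum_graph_structureD:
  assumes "quantum_graph_structure H M V"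
  shows "op_subspace H H V" "closedin (ultraweak_topology H) V" "(\<lambda>x\<in>carrier H. x) \<in> V"
    "v \<in> V \<Longrightarrow> adj H H v \<in> V"
    "m \<in> commutant H M \<Longrightarrow> v \<in> V \<Longrightarrow> compose (carrier H) m v \<in> V"
    "m \<in> commutant H M \<Longrightarrow> v \<in> V \<Longrightarrow> compose (carrier H) v m \<in> V"
  using assms unfolding quantum_graph_structure_def by blast+

context
  fixes \<X> :: "'v hilb set"
  assumes \<X>: "quantum_set \<X>"
begin

private abbreviation (input) "H \<equiv> hilbert_sum \<X>"

lemma atom_ips: "X \<in> \<X> \<Longrightarrow> inner_product_space X"
  using quantum_setD[OF \<X>] fd_hilbert_spaceD(1) by blast

lemma atom_abelian_group: "X \<in> \<X> \<Longrightarrow> abelian_group X"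
  using atom_ips unfolding inner_product_space_def module_def by blast

lemma atom_zero: "X \<in> \<X> \<Longrightarrow> \<zero>\<^bsub>X\<^esub> \<in> carrier X"
  using abelian_monoid.zero_closed[OF abelian_group.axioms(1)[OF atom_abelian_group]] .

lemma hilbert_sum_ext:
  "\<lbrakk>f \<in> extensional \<X>; g \<in> extensional \<X>; \<And>X. X \<in> \<X> \<Longrightarrow> f X = g X\<rbrakk> \<Longrightarrow> f = g"
  by (rule extensionalityI)

lemma ip_summable:
  assumes "f \<in> carrier H" "g \<in> carrier H"
  shows "(\<lambda>X. ip X (f X) (g X)) summable_on \<X>"
proof (rule Infinite_Sum.abs_summable_summable, rule Infinite_Sum.abs_summable_on_comparison_test')
  show "(\<lambda>X. (hnorm X (f X))\<^sup>2 + (hnorm X (g X))\<^sup>2) summable_on \<X>"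
    using assms by (intro summable_on_add) (auto simp: hilbert_sum_carrier)
  fix X assume X: "X \<in> \<X>"
  interpret X: inner_product_space X by (rule atom_ips[OF X])
  have fg: "f X \<in> carrier X" "g X \<in> carrier X" using assms X by (auto simp: hilbert_sum_carrier)
  have "cmod (ip X (f X) (g X)) \<le> hnorm X (f X) * hnorm X (g X)" by (rule X.Cauchy_Schwarz[OF fg])
  also have "\<dots> \<le> (hnorm X (f X))\<^sup>2 + (hnorm X (g X))\<^sup>2"
    using sum_squares_bound[of "hnorm X (f X)" "hnorm X (g X)"] X.hnorm_ge_0[OF fg(1)] X.hnorm_ge_0[OF fg(2)]
      mult_nonneg_nonneg[of "hnorm X (f X)" "hnorm X (g X)"] by linarith
  finally show "norm (ip X (f X) (g X)) \<le> (hnorm X (f X))\<^sup>2 + (hnorm X (g X))\<^sup>2" .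
qed

lemma hilbert_sum_ip_self:
  assumes f: "f \<in> carrier H"
  shows "ip H f f = of_real (\<Sum>\<^sub>\<infinity>X\<in>\<X>. (hnorm X (f X))\<^sup>2)"
proof -
  have "ip H f f = (\<Sum>\<^sub>\<infinity>X\<in>\<X>. of_real ((hnorm X (f X))\<^sup>2))"
    unfolding hilbert_sum_simps
  proof (rule infsum_cong)
    fix X assume X: "X \<in> \<X>"
    interpret X: inner_product_space X by (rule atom_ips[OF X])
    show "ip X (f X) (f X) = of_real ((hnorm X (f X))\<^sup>2)"
      using f X by (intro X.ip_self) (auto simp: hilbert_sum_carrier)
  qed
  also have "\<dots> = of_real (\<Sum>\<^sub>\<infinity>X\<in>\<X>. (hnorm X (f X))\<^sup>2)"
    using f by (intro infsumI has_sum_of_real has_sum_infsum) (auto simp: hilbert_sum_carrier)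
  finally show ?thesis .
qed

lemma inner_product_hilbert_sum: "inner_product_space H"
proof -
  have add: "(\<lambda>X\<in>\<X>. f X \<oplus>\<^bsub>X\<^esub> g X) \<in> carrier H" if f: "f \<in> carrier H" and g: "g \<in> carrier H" for f g
    unfolding hilbert_sum_carrier
  proof (intro conjI ballI)
    have "(\<lambda>X. 2 * ((hnorm X (f X))\<^sup>2 + (hnorm X (g X))\<^sup>2)) summable_on \<X>"
      using f g by (intro summable_on_cmult_right summable_on_add) (auto simp: hilbert_sum_carrier)
    then show "(\<lambda>X. (hnorm X ((\<lambda>X\<in>\<X>. f X \<oplus>\<^bsub>X\<^esub> g X) X))\<^sup>2) summable_on \<X>"
    proof (rule summable_on_comparison_test)
      fix X assume X: "X \<in> \<X>"
      interpret X: inner_product_space X by (rule atom_ips[OF X])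
      have fg: "f X \<in> carrier X" "g X \<in> carrier X" using f g X by (auto simp: hilbert_sum_carrier)
      have "(hnorm X (f X \<oplus>\<^bsub>X\<^esub> g X))\<^sup>2 \<le> (hnorm X (f X) + hnorm X (g X))\<^sup>2"
        using X.hnorm_add_le[OF fg] fg by (intro power_mono) auto
      also have "\<dots> \<le> 2 * ((hnorm X (f X))\<^sup>2 + (hnorm X (g X))\<^sup>2)"
        using sum_squares_bound[of "hnorm X (f X)" "hnorm X (g X)"] by (simp add: power2_sum)
      finally show "(hnorm X ((\<lambda>X\<in>\<X>. f X \<oplus>\<^bsub>X\<^esub> g X) X))\<^sup>2 \<le> 2 * ((hnorm X (f X))\<^sup>2 + (hnorm X (g X))\<^sup>2)"
        using X by simp
    qed simp
    fix X assume X: "X \<in> \<X>"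
    then show "(\<lambda>X\<in>\<X>. f X \<oplus>\<^bsub>X\<^esub> g X) X \<in> carrier X"
      using f g abelian_monoid.a_closed[OF abelian_group.axioms(1)[OF atom_abelian_group[OF X]]]
      by (auto simp: hilbert_sum_carrier)
  qed auto
  have smult: "(\<lambda>X\<in>\<X>. c \<odot>\<^bsub>X\<^esub> f X) \<in> carrier H" if f: "f \<in> carrier H" for c f
    unfolding hilbert_sum_carrier
  proof (intro conjI ballI)
    have "(\<lambda>X. (cmod c)\<^sup>2 * (hnorm X (f X))\<^sup>2) summable_on \<X>"
      using f by (intro summable_on_cmult_right) (auto simp: hilbert_sum_carrier)
    then show "(\<lambda>X. (hnorm X ((\<lambda>X\<in>\<X>. c \<odot>\<^bsub>X\<^esub> f X) X))\<^sup>2) summable_on \<X>"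
    proof (rule summable_on_cong[THEN iffD1, rotated])
      fix X assume X: "X \<in> \<X>"
      interpret X: inner_product_space X by (rule atom_ips[OF X])
      show "(cmod c)\<^sup>2 * (hnorm X (f X))\<^sup>2 = (hnorm X ((\<lambda>X\<in>\<X>. c \<odot>\<^bsub>X\<^esub> f X) X))\<^sup>2"
        using f X by (simp add: X.hnorm_smult power_mult_distrib hilbert_sum_carrier)
    qed
    fix X assume X: "X \<in> \<X>"
    then show "(\<lambda>X\<in>\<X>. c \<odot>\<^bsub>X\<^esub> f X) X \<in> carrier X"
      using f inner_product_space.smult_in[OF atom_ips[OF X]] by (auto simp: hilbert_sum_carrier)
  qed auto
  have zero: "(\<lambda>X\<in>\<X>. \<zero>\<^bsub>X\<^esub>) \<in> carrier H"
    unfolding hilbert_sum_carrier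
  proof (intro conjI ballI)
    have "(\<lambda>X. (hnorm X ((\<lambda>X\<in>\<X>. \<zero>\<^bsub>X\<^esub>) X))\<^sup>2) summable_on \<X> \<longleftrightarrow> (\<lambda>X. 0 :: real) summable_on \<X>"
      by (rule summable_on_cong) (use inner_product_space.hnorm_zero[OF atom_ips] in simp)
    then show "(\<lambda>X. (hnorm X ((\<lambda>X\<in>\<X>. \<zero>\<^bsub>X\<^esub>) X))\<^sup>2) summable_on \<X>" by simp
    fix X assume X: "X \<in> \<X>"
    then show "(\<lambda>X\<in>\<X>. \<zero>\<^bsub>X\<^esub>) X \<in> carrier X"
      using atom_zero[OF X] by simp
  qed auto
  have ext: "f \<in> extensional \<X>" if "f \<in> carrier H" for f using that by (simp add: hilbert_sum_carrier)
  have val: "f X \<in> carrier X" if "f \<in> carrier H" "X \<in> \<X>" for f X using that by (simp add: hilbert_sum_carrier)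
  have mod: "module complex_ring X" if "X \<in> \<X>" for X
    using atom_ips[OF that] by (simp add: inner_product_space_def)
  have "module complex_ring H"
  proof (rule moduleI[OF cring_complex_ring])
    show "abelian_group H"
    proof (rule abelian_groupI)
      fix f g k assume f: "f \<in> carrier H" and g: "g \<in> carrier H" and k: "k \<in> carrier H"
      show "f \<oplus>\<^bsub>H\<^esub> g \<in> carrier H" using add[OF f g] by simp
      show "f \<oplus>\<^bsub>H\<^esub> g \<oplus>\<^bsub>H\<^esub> k = f \<oplus>\<^bsub>H\<^esub> (g \<oplus>\<^bsub>H\<^esub> k)"
        using abelian_monoid.a_assoc[OF abelian_group.axioms(1)[OF atom_abelian_group]] val f g k
        by (auto intro!: restrict_ext)
      show "f \<oplus>\<^bsub>H\<^esub> g = g \<oplus>\<^bsub>H\<^esub> f"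
        using abelian_monoid.a_comm[OF abelian_group.axioms(1)[OF atom_abelian_group]] val f g
        by (auto intro!: restrict_ext)
      show "\<zero>\<^bsub>H\<^esub> \<oplus>\<^bsub>H\<^esub> f = f"
        using abelian_monoid.l_zero[OF abelian_group.axioms(1)[OF atom_abelian_group]] val f ext[OF f]
        by (intro hilbert_sum_ext) auto
      show "\<exists>g\<in>carrier H. g \<oplus>\<^bsub>H\<^esub> f = \<zero>\<^bsub>H\<^esub>"
      proof (rule bexI[OF _ smult[OF f, of "-1"]])
        have "(-1) \<odot>\<^bsub>X\<^esub> f X \<oplus>\<^bsub>X\<^esub> f X = \<zero>\<^bsub>X\<^esub>" if X: "X \<in> \<X>" for X
        proof -
          interpret X: inner_product_space X by (rule atom_ips[OF X])
          show ?thesis using X.smult_l_distr[of "-1" 1 "f X"] val[OF f X] by simp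
        qed
        then show "(\<lambda>X\<in>\<X>. (-1) \<odot>\<^bsub>X\<^esub> f X) \<oplus>\<^bsub>H\<^esub> f = \<zero>\<^bsub>H\<^esub>" by (auto intro!: restrict_ext)
      qed
    qed (use zero in simp)
  next
    fix c d f g assume f: "f \<in> carrier H" and g: "g \<in> carrier H"
    show "c \<odot>\<^bsub>H\<^esub> f \<in> carrier H" using smult[OF f] by simp
    show "(c \<oplus>\<^bsub>complex_ring\<^esub> d) \<odot>\<^bsub>H\<^esub> f = c \<odot>\<^bsub>H\<^esub> f \<oplus>\<^bsub>H\<^esub> d \<odot>\<^bsub>H\<^esub> f"
      using module.smult_l_distr[OF mod, of _ c d] val f by (auto intro!: restrict_ext)
    show "c \<odot>\<^bsub>H\<^esub> (f \<oplus>\<^bsub>H\<^esub> g) = c \<odot>\<^bsub>H\<^esub> f \<oplus>\<^bsub>H\<^esub> c \<odot>\<^bsub>H\<^esub> g"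
      using module.smult_r_distr[OF mod, of _ c] val f g by (auto intro!: restrict_ext)
    show "(c \<otimes>\<^bsub>complex_ring\<^esub> d) \<odot>\<^bsub>H\<^esub> f = c \<odot>\<^bsub>H\<^esub> (d \<odot>\<^bsub>H\<^esub> f)"
      using inner_product_space.smult_smult[OF atom_ips] val f by (auto intro!: restrict_ext)
    show "\<one>\<^bsub>complex_ring\<^esub> \<odot>\<^bsub>H\<^esub> f = f"
      using inner_product_space.one_smult[OF atom_ips] val f ext[OF f] by (intro hilbert_sum_ext) auto
  qed
  then interpret module complex_ring H .
  show ?thesis
  proof
    fix f g k assume fgk: "f \<in> carrier H" "g \<in> carrier H" "k \<in> carrier H"
    have "ip H f (g \<oplus>\<^bsub>H\<^esub> k) = (\<Sum>\<^sub>\<infinity>X\<in>\<X>. ip X (f X) (g X) + ip X (f X) (k X))"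
      unfolding hilbert_sum_simps
      by (rule infsum_cong) (use inner_product_space.ip_add_right[OF atom_ips] val fgk in simp)
    also have "\<dots> = ip H f g + ip H f k"
      unfolding hilbert_sum_simps using fgk by (intro infsum_add ip_summable)
    finally show "ip H f (g \<oplus>\<^bsub>H\<^esub> k) = ip H f g + ip H f k" .
  next
    fix f g c assume fg: "f \<in> carrier H" "g \<in> carrier H"
    have "ip H f (c \<odot>\<^bsub>H\<^esub> g) = (\<Sum>\<^sub>\<infinity>X\<in>\<X>. c * ip X (f X) (g X))"
      unfolding hilbert_sum_simps
      by (rule infsum_cong) (use inner_product_space.ip_smult_right[OF atom_ips] val fg in simp)
    then show "ip H f (c \<odot>\<^bsub>H\<^esub> g) = c * ip H f g" by (simp add: infsum_cmult_right')
  next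
    fix f g assume fg: "f \<in> carrier H" "g \<in> carrier H"
    have "ip H g f = (\<Sum>\<^sub>\<infinity>X\<in>\<X>. cnj (ip X (f X) (g X)))"
      unfolding hilbert_sum_simps
      by (rule infsum_cong) (use inner_product_space.cnj_ip[OF atom_ips] val fg in simp)
    then show "ip H g f = cnj (ip H f g)" by simp
  next
    fix f assume f: "f \<in> carrier H" and nz: "f \<noteq> \<zero>\<^bsub>H\<^esub>"
    obtain X where X: "X \<in> \<X>" "f X \<noteq> \<zero>\<^bsub>X\<^esub>"
    proof (rule ccontr)
      assume "\<not> thesis"
      then have "f = \<zero>\<^bsub>H\<^esub>" using that ext[OF f] by (intro hilbert_sum_ext) auto
      then show False using nz by simp
    qed
    interpret X: inner_product_space X by (rule atom_ips[OF X(1)])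
    have "hnorm X (f X) \<noteq> 0" using X.hnorm_eq_0[OF val[OF f X(1)]] X(2) by blast
    then have "0 < (\<Sum>X\<in>{X}. (hnorm X (f X))\<^sup>2)" by simp
    also have "\<dots> \<le> (\<Sum>\<^sub>\<infinity>X\<in>\<X>. (hnorm X (f X))\<^sup>2)"
      by (rule finite_sum_le_infsum) (use f X in \<open>auto simp: hilbert_sum_carrier\<close>)
    finally show "Re (ip H f f) > 0" unfolding hilbert_sum_ip_self[OF f] by simp
  qed
qed

lemma component_carrier: "f \<in> carrier H \<Longrightarrow> X \<in> \<X> \<Longrightarrow> f X \<in> carrier X"
  by (simp add: hilbert_sum_carrier)

lemma hnorm_hilbert_sum_power2: "f \<in> carrier H \<Longrightarrow> (hnorm H f)\<^sup>2 = (\<Sum>\<^sub>\<infinity>X\<in>\<X>. (hnorm X (f X))\<^sup>2)"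
  using inner_product_space.hnorm_power2[OF inner_product_hilbert_sum, of f] hilbert_sum_ip_self[of f]
  by (simp del: hilbert_sum_simps)

text \<open>The family \<open>f\<close> is arbitrary, because the construction of adjoints applies this to the components of a
  vector whose square summability is still to be proved.\<close>

lemma truncation_carrier:
  assumes F: "finite F" "F \<subseteq> \<X>" and f: "\<And>X. X \<in> F \<Longrightarrow> f X \<in> carrier X"
  shows "truncation \<X> F f \<in> carrier H" "(hnorm H (truncation \<X> F f))\<^sup>2 = (\<Sum>X\<in>F. (hnorm X (f X))\<^sup>2)"
proof -
  have s: "((\<lambda>X. (hnorm X (truncation \<X> F f X))\<^sup>2) has_sum (\<Sum>X\<in>F. (hnorm X (f X))\<^sup>2)) \<X>"
    by (rule has_sum_finite_neutralI[OF F])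
      (use F inner_product_space.hnorm_zero[OF atom_ips] in \<open>auto simp: truncation_def intro!: sum.cong\<close>)
  then have sm: "(\<lambda>X. (hnorm X (truncation \<X> F f X))\<^sup>2) summable_on \<X>" by (auto simp: summable_on_def)
  show c: "truncation \<X> F f \<in> carrier H"
    unfolding hilbert_sum_carrier
  proof (intro conjI ballI sm)
    fix X assume X: "X \<in> \<X>"
    then show "truncation \<X> F f X \<in> carrier X"
      using f atom_zero[OF X] by (auto simp: truncation_def)
  qed (simp add: truncation_def)
  show "(hnorm H (truncation \<X> F f))\<^sup>2 = (\<Sum>X\<in>F. (hnorm X (f X))\<^sup>2)"
    unfolding hnorm_hilbert_sum_power2[OF c] by (rule infsumI[OF s])
qed

lemma inc_apply: "x \<in> carrier X \<Longrightarrow> inc \<X> X x = truncation \<X> {X} (\<lambda>_. x)"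
  by (auto simp: inc_def truncation_def fun_eq_iff restrict_def)

lemma inc_component: "\<lbrakk>x \<in> carrier X; Y \<in> \<X>\<rbrakk> \<Longrightarrow> inc \<X> X x Y = (if Y = X then x else \<zero>\<^bsub>Y\<^esub>)"
  by (simp add: inc_def)

lemma inc_carrier: "\<lbrakk>X \<in> \<X>; x \<in> carrier X\<rbrakk> \<Longrightarrow> inc \<X> X x \<in> carrier H"
  unfolding inc_apply by (rule truncation_carrier(1)) auto

lemma hnorm_inc: "\<lbrakk>X \<in> \<X>; x \<in> carrier X\<rbrakk> \<Longrightarrow> hnorm H (inc \<X> X x) = hnorm X x"
  using truncation_carrier(2)[of "{X}" "\<lambda>_. x"] inc_carrier[of X x]
    inner_product_space.hnorm_ge_0[OF inner_product_hilbert_sum, of "inc \<X> X x"]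
    inner_product_space.hnorm_ge_0[OF atom_ips, of X x]
  by (simp add: inc_apply)

lemma ip_inc_left:
  assumes X: "X \<in> \<X>" "x \<in> carrier X" and f: "f \<in> carrier H"
  shows "ip H (inc \<X> X x) f = ip X x (f X)"
  unfolding hilbert_sum_simps
  by (rule infsumI, rule has_sum_finite_neutralI[of "{X}"])
    (use X f inner_product_space.ip_zero_left[OF atom_ips] component_carrier in \<open>auto simp: inc_component\<close>)

lemma ip_inc_right:
  assumes X: "X \<in> \<X>" "x \<in> carrier X" and f: "f \<in> carrier H"
  shows "ip H f (inc \<X> X x) = ip X (f X) x"
  unfolding hilbert_sum_simps
  by (rule infsumI, rule has_sum_finite_neutralI[of "{X}"])
    (use X f inner_product_space.ip_zero_right[OF atom_ips] component_carrier in \<open>auto simp: inc_component\<close>)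

lemma inc_bounded: assumes X: "X \<in> \<X>" shows "inc \<X> X \<in> bounded_ops X H"
proof -
  interpret X: inner_product_space X by (rule atom_ips[OF X])
  have "linear_op X H (inc \<X> X)"
  proof (rule linear_opI)
    fix x y assume xy: "x \<in> carrier X" "y \<in> carrier X"
    show "inc \<X> X (x \<oplus>\<^bsub>X\<^esub> y) = inc \<X> X x \<oplus>\<^bsub>H\<^esub> inc \<X> X y"
    proof (rule hilbert_sum_ext)
      fix Y assume Y: "Y \<in> \<X>"
      interpret Y: inner_product_space Y by (rule atom_ips[OF Y])
      show "inc \<X> X (x \<oplus>\<^bsub>X\<^esub> y) Y = (inc \<X> X x \<oplus>\<^bsub>H\<^esub> inc \<X> X y) Y"
        using xy Y by (simp add: inc_component)
    qed (use xy in \<open>auto simp: inc_def\<close>)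
  next
    fix c x assume x: "x \<in> carrier X"
    show "inc \<X> X (c \<odot>\<^bsub>X\<^esub> x) = c \<odot>\<^bsub>H\<^esub> inc \<X> X x"
    proof (rule hilbert_sum_ext)
      fix Y assume Y: "Y \<in> \<X>"
      interpret Y: inner_product_space Y by (rule atom_ips[OF Y])
      show "inc \<X> X (c \<odot>\<^bsub>X\<^esub> x) Y = (c \<odot>\<^bsub>H\<^esub> inc \<X> X x) Y"
        using x Y by (simp add: inc_component)
    qed (use x in \<open>auto simp: inc_def\<close>)
  qed (use inc_carrier[OF X] in \<open>auto simp: inc_def\<close>)
  moreover have "\<forall>x\<in>carrier X. hnorm H (inc \<X> X x) \<le> 1 * hnorm X x" using hnorm_inc[OF X] by simp
  ultimately show ?thesis unfolding bounded_ops_iff by blast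
qed

lemma adj_inc:
  assumes X: "X \<in> \<X>"
  shows "adj X H (inc \<X> X) = (\<lambda>f\<in>carrier H. f X)" "(\<lambda>f\<in>carrier H. f X) \<in> bounded_ops H X"
proof -
  have ip: "ip H f (inc \<X> X x) = ip X ((\<lambda>f\<in>carrier H. f X) f) x" if "x \<in> carrier X" "f \<in> carrier H" for x f
    using ip_inc_right[OF X that] that(2) by (simp del: hilbert_sum_simps)
  show b: "(\<lambda>f\<in>carrier H. f X) \<in> bounded_ops H X"
    by (rule adjoint_bounded[OF atom_ips[OF X] inner_product_hilbert_sum inc_bounded[OF X] _ _ ip])
      (use component_carrier X in auto)
  show "adj X H (inc \<X> X) = (\<lambda>f\<in>carrier H. f X)" by (rule adj_eqI[OF atom_ips[OF X] b ip])
qed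

text \<open>Pythagoras, for the components of \<open>f\<close> at the atoms in \<open>F\<close> and at the other atoms.\<close>

lemma truncation_decomposition:
  assumes f: "f \<in> carrier H" and F: "finite F" "F \<subseteq> \<X>"
  shows "truncation \<X> (\<X> - F) f \<in> carrier H" "f = truncation \<X> F f \<oplus>\<^bsub>H\<^esub> truncation \<X> (\<X> - F) f"
    "(hnorm H (truncation \<X> (\<X> - F) f))\<^sup>2 = (hnorm H f)\<^sup>2 - (\<Sum>X\<in>F. (hnorm X (f X))\<^sup>2)"
proof -
  have sF: "((\<lambda>X. (hnorm X (truncation \<X> F f X))\<^sup>2) has_sum (\<Sum>X\<in>F. (hnorm X (f X))\<^sup>2)) \<X>"
    by (rule has_sum_finite_neutralI[OF F])
      (use F inner_product_space.hnorm_zero[OF atom_ips] in \<open>auto simp: truncation_def intro!: sum.cong\<close>)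
  have sf: "((\<lambda>X. (hnorm X (f X))\<^sup>2) has_sum (hnorm H f)\<^sup>2) \<X>"
    unfolding hnorm_hilbert_sum_power2[OF f] using f by (intro has_sum_infsum) (simp add: hilbert_sum_carrier)
  have "((\<lambda>X. (hnorm X (f X))\<^sup>2 - (hnorm X (truncation \<X> F f X))\<^sup>2) has_sum ((hnorm H f)\<^sup>2 - (\<Sum>X\<in>F. (hnorm X (f X))\<^sup>2))) \<X>"
    using has_sum_add[OF sf has_sum_uminusI[OF sF]] by simp
  then have s: "((\<lambda>X. (hnorm X (truncation \<X> (\<X> - F) f X))\<^sup>2) has_sum ((hnorm H f)\<^sup>2 - (\<Sum>X\<in>F. (hnorm X (f X))\<^sup>2))) \<X>"
    by (rule has_sum_cong[THEN iffD1, rotated])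
      (use inner_product_space.hnorm_zero[OF atom_ips] in \<open>auto simp: truncation_def\<close>)
  show c: "truncation \<X> (\<X> - F) f \<in> carrier H"
    unfolding hilbert_sum_carrier
  proof (intro conjI ballI)
    show "(\<lambda>X. (hnorm X (truncation \<X> (\<X> - F) f X))\<^sup>2) summable_on \<X>" using s by (auto simp: summable_on_def)
    fix X assume X: "X \<in> \<X>"
    then show "truncation \<X> (\<X> - F) f X \<in> carrier X"
      using component_carrier[OF f X] atom_zero[OF X]
      by (auto simp: truncation_def)
  qed (simp add: truncation_def)
  show "(hnorm H (truncation \<X> (\<X> - F) f))\<^sup>2 = (hnorm H f)\<^sup>2 - (\<Sum>X\<in>F. (hnorm X (f X))\<^sup>2)"
    unfolding hnorm_hilbert_sum_power2[OF c] by (rule infsumI[OF s])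
  show "f = truncation \<X> F f \<oplus>\<^bsub>H\<^esub> truncation \<X> (\<X> - F) f"
  proof (rule hilbert_sum_ext)
    fix X assume X: "X \<in> \<X>"
    interpret X: inner_product_space X by (rule atom_ips[OF X])
    show "f X = (truncation \<X> F f \<oplus>\<^bsub>H\<^esub> truncation \<X> (\<X> - F) f) X"
      using component_carrier[OF f X] X by (auto simp: truncation_def)
  qed (use f in \<open>auto simp: hilbert_sum_carrier\<close>)
qed

lemma hnorm_tail_tendsto:
  assumes f: "f \<in> carrier H"
  shows "((\<lambda>F. hnorm H (truncation \<X> (\<X> - F) f)) \<longlongrightarrow> 0) (finite_subsets_at_top \<X>)"
proof -
  have sf: "((\<lambda>X. (hnorm X (f X))\<^sup>2) has_sum (hnorm H f)\<^sup>2) \<X>"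
    unfolding hnorm_hilbert_sum_power2[OF f] using f by (intro has_sum_infsum) (simp add: hilbert_sum_carrier)
  have "((\<lambda>F. sqrt ((hnorm H f)\<^sup>2 - (\<Sum>X\<in>F. (hnorm X (f X))\<^sup>2))) \<longlongrightarrow> sqrt ((hnorm H f)\<^sup>2 - (hnorm H f)\<^sup>2)) (finite_subsets_at_top \<X>)"
    using sf unfolding has_sum_def by (intro tendsto_intros)
  then have "((\<lambda>F. sqrt ((hnorm H f)\<^sup>2 - (\<Sum>X\<in>F. (hnorm X (f X))\<^sup>2))) \<longlongrightarrow> 0) (finite_subsets_at_top \<X>)" by simp
  then show ?thesis
  proof (rule Lim_transform_eventually)
    show "\<forall>\<^sub>F F in finite_subsets_at_top \<X>. sqrt ((hnorm H f)\<^sup>2 - (\<Sum>X\<in>F. (hnorm X (f X))\<^sup>2)) = hnorm H (truncation \<X> (\<X> - F) f)"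
    proof (rule eventually_finite_subsets_at_top_weakI)
      fix F assume F: "finite F" "F \<subseteq> \<X>"
      show "sqrt ((hnorm H f)\<^sup>2 - (\<Sum>X\<in>F. (hnorm X (f X))\<^sup>2)) = hnorm H (truncation \<X> (\<X> - F) f)"
        unfolding truncation_decomposition(3)[OF f F, symmetric]
        using inner_product_space.hnorm_ge_0[OF inner_product_hilbert_sum truncation_decomposition(1)[OF f F]] by simp
    qed
  qed
qed

lemma hnorm_truncation_le:
  assumes f: "f \<in> carrier H" and F: "finite F" "F \<subseteq> \<X>"
  shows "truncation \<X> F f \<in> carrier H" "hnorm H (truncation \<X> F f) \<le> hnorm H f"
proof -
  have fc: "f X \<in> carrier X" if "X \<in> F" for X using component_carrier[OF f] F that by auto
  show "truncation \<X> F f \<in> carrier H" by (rule truncation_carrier(1)[OF F fc])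
  have "(hnorm H (truncation \<X> F f))\<^sup>2 \<le> (hnorm H f)\<^sup>2"
    using truncation_carrier(2)[OF F fc] truncation_decomposition(3)[OF f F] zero_le_power2[of "hnorm H (truncation \<X> (\<X> - F) f)"] by linarith
  then show "hnorm H (truncation \<X> F f) \<le> hnorm H f"
    using inner_product_space.hnorm_ge_0[OF inner_product_hilbert_sum f] by (rule power2_le_imp_le)
qed

lemma truncation_insert:
  assumes F: "finite F" "F \<subseteq> \<X>" "X \<in> \<X>" "X \<notin> F" and f: "\<And>Y. Y \<in> insert X F \<Longrightarrow> f Y \<in> carrier Y"
  shows "truncation \<X> (insert X F) f = inc \<X> X (f X) \<oplus>\<^bsub>H\<^esub> truncation \<X> F f"
proof (rule hilbert_sum_ext)
  fix Y assume Y: "Y \<in> \<X>"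
  interpret Y: inner_product_space Y by (rule atom_ips[OF Y])
  show "truncation \<X> (insert X F) f Y = (inc \<X> X (f X) \<oplus>\<^bsub>H\<^esub> truncation \<X> F f) Y"
  proof (cases "Y \<in> insert X F")
    case True
    then show ?thesis
      using Y F f[OF True] f[of X] Y.M.l_zero[of "f Y"] Y.M.r_zero[of "f Y"] by (auto simp: truncation_def inc_component)
  next
    case False
    then show ?thesis using Y F f[of X] by (auto simp: truncation_def inc_component)
  qed
qed (auto simp: truncation_def)

lemma truncation_empty: "truncation \<X> {} f = \<zero>\<^bsub>H\<^esub>"
  by (simp add: truncation_def)

lemma op_truncation:
  assumes K: "inner_product_space K" and a: "a \<in> bounded_ops H K" and k: "k \<in> carrier K"
    and F: "finite F" "F \<subseteq> \<X>" and f: "\<And>X. X \<in> F \<Longrightarrow> f X \<in> carrier X"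
  shows "ip K k (a (truncation \<X> F f)) = (\<Sum>X\<in>F. ip K k (a (inc \<X> X (f X))))"
  using F f
proof (induction F)
  case empty
  have "a \<zero>\<^bsub>H\<^esub> = \<zero>\<^bsub>K\<^esub>" using linear_op_zero[OF _ inner_product_hilbert_sum K] a by (simp add: bounded_ops_iff del: hilbert_sum_simps)
  then show ?case using inner_product_space.ip_zero_right[OF K k] by (simp add: truncation_empty del: hilbert_sum_simps)
next
  case (insert X F)
  have X: "X \<in> \<X>" "f X \<in> carrier X" and F: "F \<subseteq> \<X>" "\<And>Y. Y \<in> F \<Longrightarrow> f Y \<in> carrier Y" using insert by auto
  have c: "inc \<X> X (f X) \<in> carrier H" "truncation \<X> F f \<in> carrier H"
    using inc_carrier[OF X] truncation_carrier(1)[OF insert(1) F] by auto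
  have "truncation \<X> (insert X F) f = inc \<X> X (f X) \<oplus>\<^bsub>H\<^esub> truncation \<X> F f"
    by (rule truncation_insert) (use insert in auto)
  then have "a (truncation \<X> (insert X F) f) = a (inc \<X> X (f X)) \<oplus>\<^bsub>K\<^esub> a (truncation \<X> F f)"
    using bounded_opsD(3)[OF a c] by (simp del: hilbert_sum_simps)
  then show ?case
    using inner_product_space.ip_add_right[OF K k bounded_opsD(1)[OF a c(1)] bounded_opsD(1)[OF a c(2)]]
      insert.IH[OF F] insert(1,2) by simp
qed

text \<open>The difference between the value at \<open>f\<close> and a finite partial sum is the value at the tail of \<open>f\<close>, whose
  norm tends to zero.\<close>

lemma op_has_sum:
  assumes K: "inner_product_space K" and a: "a \<in> bounded_ops H K" and k: "k \<in> carrier K" and f: "f \<in> carrier H"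
  shows "((\<lambda>X. ip K k (a (inc \<X> X (f X)))) has_sum ip K k (a f)) \<X>"
proof -
  interpret K: inner_product_space K by fact
  obtain C where C: "C \<ge> 0" "\<And>x. x \<in> carrier H \<Longrightarrow> hnorm K (a x) \<le> C * hnorm H x"
    using bounded_ops_bound[OF a inner_product_hilbert_sum] by blast
  have "((\<lambda>F. hnorm K k * (C * hnorm H (truncation \<X> (\<X> - F) f))) \<longlongrightarrow> hnorm K k * (C * 0)) (finite_subsets_at_top \<X>)"
    by (intro tendsto_intros hnorm_tail_tendsto[OF f])
  then have lim: "((\<lambda>F. hnorm K k * (C * hnorm H (truncation \<X> (\<X> - F) f))) \<longlongrightarrow> 0) (finite_subsets_at_top \<X>)" by simp
  show ?thesis
    unfolding has_sum_def
  proof (rule Lim_transform[OF tendsto_const], rule Lim_null_comparison[OF _ lim], rule eventually_finite_subsets_at_top_weakI)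
    fix F assume F: "finite F" "F \<subseteq> \<X>"
    note cc = hnorm_truncation_le(1)[OF f F] and ct = truncation_decomposition(1)[OF f F]
    have fc: "f X \<in> carrier X" if "X \<in> F" for X using component_carrier[OF f] F that by auto
    have "a f = a (truncation \<X> F f) \<oplus>\<^bsub>K\<^esub> a (truncation \<X> (\<X> - F) f)"
      using bounded_opsD(3)[OF a cc ct] truncation_decomposition(2)[OF f F] by metis
    then have "ip K k (a f) = (\<Sum>X\<in>F. ip K k (a (inc \<X> X (f X)))) + ip K k (a (truncation \<X> (\<X> - F) f))"
      using K.ip_add_right[OF k bounded_opsD(1)[OF a cc] bounded_opsD(1)[OF a ct]] op_truncation[OF K a k F fc] by simp
    then have "norm ((\<Sum>X\<in>F. ip K k (a (inc \<X> X (f X)))) - ip K k (a f)) = cmod (ip K k (a (truncation \<X> (\<X> - F) f)))"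
      by simp
    also have "\<dots> \<le> hnorm K k * hnorm K (a (truncation \<X> (\<X> - F) f))"
      by (rule K.Cauchy_Schwarz[OF k bounded_opsD(1)[OF a ct]])
    also have "\<dots> \<le> hnorm K k * (C * hnorm H (truncation \<X> (\<X> - F) f))"
      by (rule mult_left_mono[OF C(2)[OF ct] K.hnorm_ge_0[OF k]])
    finally show "norm ((\<Sum>X\<in>F. ip K k (a (inc \<X> X (f X)))) - ip K k (a f)) \<le>
      hnorm K k * (C * hnorm H (truncation \<X> (\<X> - F) f))" .
  qed
qed

text \<open>The adjoint is found componentwise, by finite-dimensional duality; its components are square
  summable because their partial sums are values of the functional \<open>\<langle>g | a -\<rangle>\<close>.\<close>

lemma adj_hilbert_sum:
  assumes a: "a \<in> bounded_ops H H"
  shows "adj H H a \<in> bounded_ops H H"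
    "\<lbrakk>f \<in> carrier H; g \<in> carrier H\<rbrakk> \<Longrightarrow> ip H g (a f) = ip H (adj H H a g) f"
proof -
  note Hi = inner_product_hilbert_sum
  interpret H: inner_product_space H by (rule Hi)
  note aD = bounded_opsD[OF a]
  obtain C where C: "C \<ge> 0" "\<And>x. x \<in> carrier H \<Longrightarrow> hnorm H (a x) \<le> C * hnorm H x"
    using bounded_ops_bound[OF a Hi] by blast
  define w where "w = (\<lambda>g X. adj X H (compose (carrier X) a (inc \<X> X)) g)"
  have w: "w g X \<in> carrier X" "x \<in> carrier X \<Longrightarrow> ip H g (a (inc \<X> X x)) = ip X (w g X) x"
    if X: "X \<in> \<X>" and g: "g \<in> carrier H" for g X x
  proof -
    have c: "compose (carrier X) a (inc \<X> X) \<in> bounded_ops X H"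
      by (rule compose_bounded_ops[OF a inc_bounded[OF X] atom_ips[OF X] Hi])
    note A = adj_fd[OF quantum_setD[OF \<X> X] Hi c]
    show "w g X \<in> carrier X" unfolding w_def by (rule bounded_opsD(1)[OF A(1) g])
    show "x \<in> carrier X \<Longrightarrow> ip H g (a (inc \<X> X x)) = ip X (w g X) x"
      using A(2)[of x g] g by (simp add: w_def compose_def del: hilbert_sum_simps)
  qed
  define b where "b = (\<lambda>g\<in>carrier H. \<lambda>X\<in>\<X>. w g X)"
  have bc: "b g \<in> carrier H" if g: "g \<in> carrier H" for g
    unfolding hilbert_sum_carrier
  proof (intro conjI ballI)
    have wn: "(hnorm X (w g X))\<^sup>2 = Re (ip X (w g X) (w g X))" if "X \<in> \<X>" for X
      by (rule inner_product_space.hnorm_power2[OF atom_ips[OF that] w(1)[OF that g]])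
    have bd: "(\<Sum>X\<in>F. (hnorm X (w g X))\<^sup>2) \<le> (hnorm H g * C)\<^sup>2" if F: "F \<subseteq> \<X>" "finite F" for F
    proof -
      let ?u = "truncation \<X> F (w g)" and ?N = "\<Sum>X\<in>F. (hnorm X (w g X))\<^sup>2"
      have wF: "w g X \<in> carrier X" if "X \<in> F" for X using w(1)[OF _ g] F that by auto
      note u = truncation_carrier[OF F(2,1) wF]
      have N: "?N = (hnorm H ?u)\<^sup>2" using u(2) by simp
      have u0: "hnorm H ?u \<ge> 0" by (rule H.hnorm_ge_0[OF u(1)])
      have "?N = Re (\<Sum>X\<in>F. ip H g (a (inc \<X> X (w g X))))"
        unfolding Re_sum by (rule sum.cong) (use wn w(2)[OF _ g wF] F in \<open>auto simp del: hilbert_sum_simps\<close>)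
      also have "\<dots> = Re (ip H g (a ?u))" using op_truncation[OF Hi a g F(2,1) wF] by simp
      also have "\<dots> \<le> cmod (ip H g (a ?u))" by (rule complex_Re_le_cmod)
      also have "\<dots> \<le> hnorm H g * hnorm H (a ?u)" by (rule H.Cauchy_Schwarz[OF g aD(1)[OF u(1)]])
      also have "\<dots> \<le> hnorm H g * (C * hnorm H ?u)"
        by (rule mult_left_mono[OF C(2)[OF u(1)] H.hnorm_ge_0[OF g]])
      finally have "hnorm H ?u * hnorm H ?u \<le> hnorm H g * C * hnorm H ?u"
        unfolding N by (simp add: power2_eq_square mult_ac)
      then have "hnorm H ?u \<le> hnorm H g * C"
        using u0 C(1) H.hnorm_ge_0[OF g] by (cases "hnorm H ?u = 0") auto
      then show ?thesis unfolding N using u0 by (rule power_mono)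
    qed
    have "(\<lambda>X. (hnorm X (w g X))\<^sup>2) summable_on \<X>"
      by (rule nonneg_bdd_above_summable_on) (use bd in \<open>auto intro!: bdd_aboveI\<close>)
    then show "(\<lambda>X. (hnorm X (b g X))\<^sup>2) summable_on \<X>"
      by (rule summable_on_cong[THEN iffD1, rotated]) (use g in \<open>simp add: b_def\<close>)
    show "b g X \<in> carrier X" if "X \<in> \<X>" for X using w(1)[OF that g] that g by (simp add: b_def)
  qed (use g in \<open>simp add: b_def\<close>)
  have ab: "ip H g (a f) = ip H (b g) f" if f: "f \<in> carrier H" and g: "g \<in> carrier H" for f g
  proof -
    have "((\<lambda>X. ip H g (a (inc \<X> X (f X)))) has_sum ip H g (a f)) \<X>" by (rule op_has_sum[OF Hi a g f])
    then have "((\<lambda>X. ip X (b g X) (f X)) has_sum ip H g (a f)) \<X>"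
      by (rule has_sum_cong[THEN iffD1, rotated])
        (use w(2)[OF _ g component_carrier[OF f]] g in \<open>simp add: b_def del: hilbert_sum_simps\<close>)
    then show ?thesis unfolding hilbert_sum_simps(4)[of \<X>] by (rule infsumI[symmetric])
  qed
  have bb: "b \<in> bounded_ops H H" by (rule adjoint_bounded[OF Hi Hi a bc _ ab]) (auto simp: b_def)
  have "adj H H a = b" by (rule adj_eqI[OF Hi bb ab])
  then show "adj H H a \<in> bounded_ops H H"
    "\<lbrakk>f \<in> carrier H; g \<in> carrier H\<rbrakk> \<Longrightarrow> ip H g (a f) = ip H (adj H H a g) f"
    using bb ab by auto
qed

lemmas sum_ips = inner_product_hilbert_sum

lemmas atom_fd = quantum_setD[OF \<X>]

lemma compression_eq:
  assumes X: "X \<in> \<X>" and Y: "Y \<in> \<X>" and v: "v \<in> bounded_ops H H"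
  shows "compose (carrier X) (adj Y H (inc \<X> Y)) (compose (carrier X) v (inc \<X> X)) = compression \<X> X Y v"
    "compression \<X> X Y v \<in> bounded_ops X Y"
proof -
  have b: "compose (carrier X) v (inc \<X> X) \<in> bounded_ops X H"
    by (rule compose_bounded_ops[OF v inc_bounded[OF X] atom_ips[OF X] sum_ips])
  show 1: "compose (carrier X) (adj Y H (inc \<X> Y)) (compose (carrier X) v (inc \<X> X)) = compression \<X> X Y v"
    unfolding adj_inc(1)[OF Y] compression_def
    using bounded_opsD(1)[OF v inc_carrier[OF X]] by (auto simp: compose_def intro!: restrict_ext)
  show "compression \<X> X Y v \<in> bounded_ops X Y"
    unfolding 1[symmetric] adj_inc(1)[OF Y]
    by (rule compose_bounded_ops[OF adj_inc(2)[OF Y] b atom_ips[OF X] sum_ips])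
qed

lemma adj_compression:
  assumes X: "X \<in> \<X>" and Y: "Y \<in> \<X>" and v: "v \<in> bounded_ops H H"
  shows "adj X Y (compression \<X> X Y v) = compression \<X> Y X (adj H H v)"
proof (rule adj_eqI[OF atom_ips[OF X]])
  note A = adj_hilbert_sum[OF v]
  show "compression \<X> Y X (adj H H v) \<in> bounded_ops Y X" by (rule compression_eq(2)[OF Y X A(1)])
  fix x y assume xy: "x \<in> carrier X" "y \<in> carrier Y"
  note ix = inc_carrier[OF X xy(1)] and iy = inc_carrier[OF Y xy(2)]
  show "ip Y y (compression \<X> X Y v x) = ip X (compression \<X> Y X (adj H H v) y) x"
    using A(2)[OF ix iy] ip_inc_left[OF Y xy(2) bounded_opsD(1)[OF v ix]]
      ip_inc_right[OF X xy(1) bounded_opsD(1)[OF A(1) iy]] xy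
    by (simp add: compression_def del: hilbert_sum_simps)
qed

lemma adj_adj_hilbert_sum:
  assumes v: "v \<in> bounded_ops H H" shows "adj H H (adj H H v) = v"
proof (rule adj_eqI[OF sum_ips v])
  note A = adj_hilbert_sum[OF v]
  fix f g assume fg: "f \<in> carrier H" "g \<in> carrier H"
  show "ip H g (adj H H v f) = ip H (v g) f"
    using A(2)[OF fg(2,1)] inner_product_space.ip_cnj[OF sum_ips bounded_opsD(1)[OF A(1) fg(1)] fg(2)]
      inner_product_space.ip_cnj[OF sum_ips fg(1) bounded_opsD(1)[OF v fg(2)]] by simp
qed

lemma block_op_bounded:
  assumes X: "X \<in> \<X>" and Y: "Y \<in> \<X>" and r: "r \<in> bounded_ops X Y"
  shows "block_op \<X> X Y r \<in> bounded_ops H H"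
proof -
  have "block_op \<X> X Y r = compose (carrier H) (inc \<X> Y) (compose (carrier H) r (\<lambda>f\<in>carrier H. f X))"
    by (auto simp: block_op_def compose_def intro!: restrict_ext)
  then show ?thesis
    using compose_bounded_ops[OF inc_bounded[OF Y]
        compose_bounded_ops[OF r adj_inc(2)[OF X] sum_ips atom_ips[OF X]] sum_ips atom_ips[OF Y]] by simp
qed

lemma compression_block_op:
  assumes X: "X \<in> \<X>" and Y: "Y \<in> \<X>" and r: "r \<in> bounded_ops X Y" and X': "X' \<in> \<X>" and Y': "Y' \<in> \<X>"
  shows "compression \<X> X' Y' (block_op \<X> X Y r) = (if X' = X \<and> Y' = Y then r else (\<lambda>x\<in>carrier X'. \<zero>\<^bsub>Y'\<^esub>))"
proof -
  note rD = bounded_opsD[OF r]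
  interpret X: inner_product_space X by (rule atom_ips[OF X])
  interpret Y: inner_product_space Y by (rule atom_ips[OF Y])
  have r0: "r \<zero>\<^bsub>X\<^esub> = \<zero>\<^bsub>Y\<^esub>"
    using linear_op_zero[OF _ atom_ips[OF X] atom_ips[OF Y]] r by (simp add: bounded_ops_iff)
  have v: "block_op \<X> X Y r (inc \<X> X' x) Y' = (if X' = X \<and> Y' = Y then r x else \<zero>\<^bsub>Y'\<^esub>)" if x: "x \<in> carrier X'" for x
  proof (cases "X' = X")
    case True
    then show ?thesis using x inc_carrier[OF X' x] X Y' rD(1) by (simp add: block_op_def inc_component)
  next
    case False
    then have "inc \<X> X' x X = \<zero>\<^bsub>X\<^esub>" using x X by (simp add: inc_component)
    then show ?thesis using False inc_carrier[OF X' x] Y' r0 by (simp add: block_op_def inc_component)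
  qed
  show ?thesis
    using v rD(2) by (auto simp: compression_def fun_eq_iff restrict_def)
qed

lemma truncation_op_bounded:
  assumes F: "finite F" "F \<subseteq> \<X>" shows "truncation_op \<X> F \<in> bounded_ops H H"
proof -
  have "linear_op H H (truncation_op \<X> F)"
  proof (rule linear_opI)
    interpret H: inner_product_space H by (rule sum_ips)
    fix f g assume fg: "f \<in> carrier H" "g \<in> carrier H"
    have fgc: "f \<oplus>\<^bsub>H\<^esub> g \<in> carrier H" using fg by (rule H.M.a_closed)
    have "truncation \<X> F (f \<oplus>\<^bsub>H\<^esub> g) = truncation \<X> F f \<oplus>\<^bsub>H\<^esub> truncation \<X> F g"
    proof (rule hilbert_sum_ext)
      fix X assume X: "X \<in> \<X>"
      interpret X: inner_product_space X by (rule atom_ips[OF X])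
      show "truncation \<X> F (f \<oplus>\<^bsub>H\<^esub> g) X = (truncation \<X> F f \<oplus>\<^bsub>H\<^esub> truncation \<X> F g) X"
        using X by (simp add: truncation_def)
    qed (auto simp: truncation_def)
    then show "truncation_op \<X> F (f \<oplus>\<^bsub>H\<^esub> g) = truncation_op \<X> F f \<oplus>\<^bsub>H\<^esub> truncation_op \<X> F g"
      using fg fgc by (simp add: truncation_op_def del: hilbert_sum_simps)
  next
    interpret H: inner_product_space H by (rule sum_ips)
    fix c f assume f: "f \<in> carrier H"
    have cf: "c \<odot>\<^bsub>H\<^esub> f \<in> carrier H" using f by (rule H.smult_in)
    have "truncation \<X> F (c \<odot>\<^bsub>H\<^esub> f) = c \<odot>\<^bsub>H\<^esub> truncation \<X> F f"
    proof (rule hilbert_sum_ext)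
      fix X assume X: "X \<in> \<X>"
      interpret X: inner_product_space X by (rule atom_ips[OF X])
      show "truncation \<X> F (c \<odot>\<^bsub>H\<^esub> f) X = (c \<odot>\<^bsub>H\<^esub> truncation \<X> F f) X"
        using X by (simp add: truncation_def)
    qed (auto simp: truncation_def)
    then show "truncation_op \<X> F (c \<odot>\<^bsub>H\<^esub> f) = c \<odot>\<^bsub>H\<^esub> truncation_op \<X> F f"
      using f cf by (simp add: truncation_op_def del: hilbert_sum_simps)
  qed (use hnorm_truncation_le(1)[OF _ F] in \<open>auto simp: truncation_op_def\<close>)
  moreover have "\<forall>f\<in>carrier H. hnorm H (truncation_op \<X> F f) \<le> 1 * hnorm H f"
    using hnorm_truncation_le(2)[OF _ F] by (simp add: truncation_op_def)
  ultimately show ?thesis unfolding bounded_ops_iff by blast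
qed

lemma truncation_singleton: "X \<in> \<X> \<Longrightarrow> f \<in> carrier H \<Longrightarrow> truncation \<X> {X} f = inc \<X> X (f X)"
  using component_carrier[of f X] by (auto simp: truncation_def inc_def fun_eq_iff restrict_def)

subsection \<open>The commutant\<close>

text \<open>The operators \<open>a \<oplus> 0\<close>, concentrated on one atom, suffice below to compute the commutant.\<close>

lemma block_op_ell_infinity:
  assumes X: "X \<in> \<X>" and a: "a \<in> bounded_ops X X"
  shows "block_op \<X> X X a \<in> ell_infinity \<X>"
proof -
  define m where "m = (\<lambda>Y. if Y = X then a else (\<lambda>y\<in>carrier Y. \<zero>\<^bsub>Y\<^esub>))"
  obtain C where C: "C \<ge> 0" "\<And>x. x \<in> carrier X \<Longrightarrow> hnorm X (a x) \<le> C * hnorm X x"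
    using bounded_ops_bound[OF a atom_ips[OF X]] by blast
  have "m Y \<in> bounded_ops Y Y" if Y: "Y \<in> \<X>" for Y
    using a op_subspaceD(2)[OF op_subspace_bounded_ops[OF atom_ips[OF Y] atom_ips[OF Y]] atom_ips[OF Y] atom_ips[OF Y]]
    by (simp add: m_def)
  moreover have "\<forall>Y\<in>\<X>. \<forall>y\<in>carrier Y. hnorm Y (m Y y) \<le> C * hnorm Y y"
  proof (intro ballI)
    fix Y y assume Y: "Y \<in> \<X>" "y \<in> carrier Y"
    interpret Y: inner_product_space Y by (rule atom_ips[OF Y(1)])
    show "hnorm Y (m Y y) \<le> C * hnorm Y y" using C Y by (auto simp: m_def)
  qed
  moreover have "block_op \<X> X X a = (\<lambda>f\<in>carrier H. \<lambda>Y\<in>\<X>. m Y (f Y))"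
    using component_carrier bounded_opsD(1)[OF a] X
    by (auto simp: block_op_def m_def inc_def intro!: restrict_ext)
  ultimately show ?thesis unfolding ell_infinity_def by blast
qed

text \<open>An element \<open>m\<close> of the commutant commutes with the rank-one operators \<open>|x\<rangle>\<langle>e|\<close> on the atom \<open>X\<close>. Applied to a
  unit vector \<open>e\<close>, this expresses the value of \<open>m\<close> at every \<open>x\<close> by the single number \<open>\<langle>e|m e\<rangle>\<close>.\<close>

lemma commutant_scalar:
  assumes m: "m \<in> commutant H (ell_infinity \<X>)" and X: "X \<in> \<X>"
  shows "\<exists>c. (\<forall>f\<in>carrier H. m f X = c \<odot>\<^bsub>X\<^esub> f X) \<and>
    (\<forall>x\<in>carrier X. m (inc \<X> X x) = inc \<X> X (c \<odot>\<^bsub>X\<^esub> x))"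
proof -
  interpret X: inner_product_space X by (rule atom_ips[OF X])
  have mb: "m \<in> bounded_ops H H" using m by (simp add: commutant_def)
  note mD = bounded_opsD(1)[OF mb]
  have comm: "inc \<X> X (a (m f X)) = m (inc \<X> X (a (f X)))" if a: "a \<in> bounded_ops X X" and f: "f \<in> carrier H" for a f
  proof -
    have "compose (carrier H) (block_op \<X> X X a) m = compose (carrier H) m (block_op \<X> X X a)"
      using m block_op_ell_infinity[OF X a] by (simp add: commutant_def)
    then have "compose (carrier H) (block_op \<X> X X a) m f = compose (carrier H) m (block_op \<X> X X a) f" by simp
    then show ?thesis using f mD[OF f] by (simp add: compose_def block_op_def)
  qed
  let ?O = "some_onb X"
  note OD = orthonormal_basisD(1-3)[OF atom_ips[OF X] fd_hilbert_spaceD(3)[OF atom_fd[OF X]]]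
  have "?O \<noteq> {}"
  proof
    assume "?O = {}"
    then have "ip X x x = 0" if "x \<in> carrier X" for x
      using orthonormal_basisD(4)[OF atom_ips[OF X] fd_hilbert_spaceD(3)[OF atom_fd[OF X]] that that] by simp
    then have "carrier X = {\<zero>\<^bsub>X\<^esub>}" using X.ip_self_eq_0 by auto
    then show False using \<X> X by (auto simp: quantum_set_def)
  qed
  then obtain e where e: "e \<in> ?O" by blast
  then have ec: "e \<in> carrier X" and ee: "ip X e e = 1" using OD by auto
  define c where "c = ip X e (m (inc \<X> X e) X)"
  have inc: "m (inc \<X> X x) = inc \<X> X (c \<odot>\<^bsub>X\<^esub> x)" if x: "x \<in> carrier X" for x
  proof -
    have kb: "ketbra X X x e \<in> bounded_ops X X" by (rule ketbra_bounded[OF atom_ips[OF X] atom_ips[OF X] x ec])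
    note ie = inc_carrier[OF X ec]
    have "ketbra X X x e e = x" using ec ee x by (simp add: ketbra_def)
    moreover have "ketbra X X x e (m (inc \<X> X e) X) = c \<odot>\<^bsub>X\<^esub> x"
      using component_carrier[OF mD[OF ie] X] by (simp add: ketbra_def c_def)
    moreover have "inc \<X> X e X = e" using ec X by (simp add: inc_component)
    ultimately show ?thesis using comm[OF kb ie] by simp
  qed
  have "m f X = c \<odot>\<^bsub>X\<^esub> f X" if f: "f \<in> carrier H" for f
  proof -
    have fX: "f X \<in> carrier X" and mX: "m f X \<in> carrier X"
      using component_carrier[OF f X] component_carrier[OF mD[OF f] X] by auto
    have "inc \<X> X (m f X) = m (inc \<X> X (f X))"
      using comm[OF id_bounded_ops[OF atom_ips[OF X]] f] fX mX by simp
    also have "\<dots> = inc \<X> X (c \<odot>\<^bsub>X\<^esub> f X)" by (rule inc[OF fX])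
    finally have "inc \<X> X (m f X) X = inc \<X> X (c \<odot>\<^bsub>X\<^esub> f X) X" by simp
    then show ?thesis using fX mX X by (simp add: inc_component)
  qed
  with inc show ?thesis by blast
qed

lemma truncation_op_commutant:
  assumes F: "finite F" "F \<subseteq> \<X>" shows "truncation_op \<X> F \<in> commutant H (ell_infinity \<X>)"
  unfolding commutant_def
proof (intro CollectI conjI ballI truncation_op_bounded[OF F])
  fix a assume "a \<in> ell_infinity \<X>"
  then obtain m C where a: "a = (\<lambda>f\<in>carrier H. \<lambda>X\<in>\<X>. m X (f X))" and m: "\<And>X. X \<in> \<X> \<Longrightarrow> m X \<in> bounded_ops X X"
    and C: "\<And>X x. X \<in> \<X> \<Longrightarrow> x \<in> carrier X \<Longrightarrow> hnorm X (m X x) \<le> C * hnorm X x"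
    unfolding ell_infinity_def by blast
  have m0: "m X \<zero>\<^bsub>X\<^esub> = \<zero>\<^bsub>X\<^esub>" if X: "X \<in> \<X>" for X
    using linear_op_zero[OF _ atom_ips[OF X] atom_ips[OF X]] m[OF X] by (simp add: bounded_ops_iff)
  have ac: "(\<lambda>X\<in>\<X>. m X (f X)) \<in> carrier H" if f: "f \<in> carrier H" for f
    unfolding hilbert_sum_carrier
  proof (intro conjI ballI)
    have "(\<lambda>X. C\<^sup>2 * (hnorm X (f X))\<^sup>2) summable_on \<X>"
      using f by (intro summable_on_cmult_right) (auto simp: hilbert_sum_carrier)
    then show "(\<lambda>X. (hnorm X ((\<lambda>X\<in>\<X>. m X (f X)) X))\<^sup>2) summable_on \<X>"
    proof (rule summable_on_comparison_test)
      fix X assume X: "X \<in> \<X>"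
      note fX = component_carrier[OF f X]
      have "(hnorm X (m X (f X)))\<^sup>2 \<le> (C * hnorm X (f X))\<^sup>2"
        by (rule power_mono[OF C[OF X fX] inner_product_space.hnorm_ge_0[OF atom_ips[OF X] bounded_opsD(1)[OF m[OF X] fX]]])
      then show "(hnorm X ((\<lambda>X\<in>\<X>. m X (f X)) X))\<^sup>2 \<le> C\<^sup>2 * (hnorm X (f X))\<^sup>2"
        using X by (simp add: power_mult_distrib)
    qed simp
    show "(\<lambda>X\<in>\<X>. m X (f X)) X \<in> carrier X" if "X \<in> \<X>" for X
      using bounded_opsD(1)[OF m[OF that] component_carrier[OF f that]] that by simp
  qed simp
  show "compose (carrier H) a (truncation_op \<X> F) = compose (carrier H) (truncation_op \<X> F) a"
    unfolding compose_def
  proof (rule restrict_ext)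
    fix f assume f: "f \<in> carrier H"
    have "a (truncation_op \<X> F f) = (\<lambda>X\<in>\<X>. m X (truncation \<X> F f X))"
      using f hnorm_truncation_le(1)[OF f F] by (simp add: a truncation_op_def)
    also have "\<dots> = truncation \<X> F (\<lambda>X\<in>\<X>. m X (f X))"
      unfolding truncation_def by (rule restrict_ext) (use m0 F in auto)
    also have "\<dots> = truncation_op \<X> F (a f)"
      using f ac[OF f] by (simp add: a truncation_op_def)
    finally show "a (truncation_op \<X> F f) = truncation_op \<X> F (a f)" .
  qed
qed

subsection \<open>The ultraweak topology\<close>

lemma topspace_ultraweak: "topspace (ultraweak_topology H) = bounded_ops H H"
proof -
  interpret H: inner_product_space H by (rule sum_ips)
  have "square_summable H (\<lambda>_. \<zero>\<^bsub>H\<^esub>)"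
    using H.hnorm_zero H.M.zero_closed by (auto simp: square_summable_def simp del: hilbert_sum_simps)
  then have "{a \<in> bounded_ops H H. (\<Sum>n. ip H \<zero>\<^bsub>H\<^esub> (a \<zero>\<^bsub>H\<^esub>)) \<in> UNIV} \<subseteq> topspace (ultraweak_topology H)"
    unfolding ultraweak_topology_def topology_generated_by_topspace
    by (intro Union_upper CollectI exI[of _ "\<lambda>_. \<zero>\<^bsub>H\<^esub>"] exI[of _ UNIV] conjI) simp_all
  moreover have "topspace (ultraweak_topology H) \<subseteq> bounded_ops H H"
    unfolding ultraweak_topology_def topology_generated_by_topspace by blast
  ultimately show ?thesis by auto
qed

text \<open>Membership of a compression in a subspace is a family of linear equations, each of which involves
  a finite sum of matrix coefficients and is thus ultraweakly continuous.\<close>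

lemma closedin_compressions:
  assumes R: "R \<in> binary_relations \<X> \<X>"
  shows "closedin (ultraweak_topology H) {v \<in> bounded_ops H H. \<forall>X\<in>\<X>. \<forall>Y\<in>\<X>. compression \<X> X Y v \<in> R X Y}" (is "closedin _ ?V")
  unfolding closedin_def topspace_ultraweak
proof (intro conjI)
  interpret H: inner_product_space H by (rule sum_ips)
  show "openin (ultraweak_topology H) (bounded_ops H H - ?V)"
  proof (subst openin_subopen, intro ballI)
    fix v assume "v \<in> bounded_ops H H - ?V"
    then obtain X Y where v: "v \<in> bounded_ops H H" and X: "X \<in> \<X>" and Y: "Y \<in> \<X>" and nR: "compression \<X> X Y v \<notin> R X Y"
      by blast
    obtain s where s: "s \<in> bounded_ops X Y" "\<And>w. w \<in> R X Y \<Longrightarrow> hs_ip X Y w s = 0" "hs_ip X Y s (compression \<X> X Y v) \<noteq> 0"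
      using hs_double_orthogonal[OF atom_fd[OF X] atom_fd[OF Y] binary_relationsD[OF R X Y] compression_eq(2)[OF X Y v]] nR by blast
    note OD = orthonormal_basisD(1,2)[OF atom_ips[OF X] fd_hilbert_spaceD(3)[OF atom_fd[OF X]]]
    obtain es where es: "set es = some_onb X" "distinct es" using finite_distinct_list[OF OD(1)] by blast
    have esc: "es ! n \<in> carrier X" if "n < length es" for n using es(1) OD(2) that nth_mem by metis
    \<comment> \<open>The Hilbert-Schmidt inner product of \<open>s\<close> with a compression, as one of the functionals that define the
      topology: the sequences list the vectors \<open>inc e\<close> and \<open>inc (s e)\<close> and continue with zeros.\<close>
    define \<xi> where "\<xi> = (\<lambda>n. if n < length es then inc \<X> X (es ! n) else \<zero>\<^bsub>H\<^esub>)"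
    define \<eta> where "\<eta> = (\<lambda>n. if n < length es then inc \<X> Y (s (es ! n)) else \<zero>\<^bsub>H\<^esub>)"
    have c: "\<xi> n \<in> carrier H" "\<eta> n \<in> carrier H" for n
      using inc_carrier[OF X esc] inc_carrier[OF Y bounded_opsD(1)[OF s(1) esc]] H.M.zero_closed
      by (auto simp: \<xi>_def \<eta>_def simp del: hilbert_sum_simps)
    have z: "\<xi> n = \<zero>\<^bsub>H\<^esub>" "\<eta> n = \<zero>\<^bsub>H\<^esub>" if "n \<notin> {..<length es}" for n using that by (auto simp: \<xi>_def \<eta>_def)
    have sq: "square_summable H \<xi>" "square_summable H \<eta>"
    proof -
      have "summable (\<lambda>n. (hnorm H (\<xi> n))\<^sup>2)" "summable (\<lambda>n. (hnorm H (\<eta> n))\<^sup>2)"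
        by (rule summable_finite[of "{..<length es}"]; use z H.hnorm_zero in \<open>simp del: hilbert_sum_simps\<close>)+
      then show "square_summable H \<xi>" "square_summable H \<eta>"
        unfolding square_summable_def using c by auto
    qed
    have val: "(\<Sum>n. ip H (\<eta> n) (a (\<xi> n))) = hs_ip X Y s (compression \<X> X Y a)" if a: "a \<in> bounded_ops H H" for a
    proof -
      have "(\<Sum>n. ip H (\<eta> n) (a (\<xi> n))) = (\<Sum>n\<in>{..<length es}. ip H (\<eta> n) (a (\<xi> n)))"
      proof (rule suminf_finite)
        fix n assume "n \<notin> {..<length es}"
        then show "ip H (\<eta> n) (a (\<xi> n)) = 0"
          using z(2) H.ip_zero_left[OF bounded_opsD(1)[OF a c(1)]] by simp
      qed simp
      also have "\<dots> = (\<Sum>n\<in>{..<length es}. ip Y (s (es ! n)) (compression \<X> X Y a (es ! n)))"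
      proof (rule sum.cong)
        fix n assume "n \<in> {..<length es}"
        then have n: "n < length es" by simp
        show "ip H (\<eta> n) (a (\<xi> n)) = ip Y (s (es ! n)) (compression \<X> X Y a (es ! n))"
          using ip_inc_left[OF Y bounded_opsD(1)[OF s(1) esc[OF n]] bounded_opsD(1)[OF a inc_carrier[OF X esc[OF n]]]] n esc[OF n]
          by (simp add: \<xi>_def \<eta>_def compression_def del: hilbert_sum_simps)
      qed simp
      also have "\<dots> = (\<Sum>e\<in>some_onb X. ip Y (s e) (compression \<X> X Y a e))"
        unfolding es(1)[symmetric]
        by (rule sum.reindex_bij_betw[OF bij_betw_nth[OF es(2)]]) auto
      finally show ?thesis
        using hs_ip_some_onb[OF atom_fd[OF X] atom_ips[OF Y] s(1) compression_eq(2)[OF X Y a]] by simp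
    qed
    let ?T = "{a \<in> bounded_ops H H. (\<Sum>n. ip H (\<eta> n) (a (\<xi> n))) \<in> - {0}}"
    have "openin (ultraweak_topology H) ?T"
      unfolding ultraweak_topology_def
      by (rule topology_generated_by_Basis) (use sq in \<open>blast intro: open_Compl closed_singleton\<close>)
    moreover have "v \<in> ?T" using v val[OF v] s(3) by (simp del: hilbert_sum_simps)
    moreover have "?T \<subseteq> bounded_ops H H - ?V"
    proof
      fix a assume a: "a \<in> ?T"
      then have ab: "a \<in> bounded_ops H H" by blast
      have "compression \<X> X Y a \<notin> R X Y"
      proof
        assume "compression \<X> X Y a \<in> R X Y"
        then have "hs_ip X Y (compression \<X> X Y a) s = 0" by (rule s(2))
        then have "hs_ip X Y s (compression \<X> X Y a) = 0"
          using inner_product_space.ip_cnj[OF inner_product_hs_space[OF atom_fd[OF X] atom_ips[OF Y]], of "compression \<X> X Y a" s]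
            compression_eq(2)[OF X Y ab] s(1) by simp
        then show False using a val[OF ab] by (simp del: hilbert_sum_simps)
      qed
      then show "a \<in> bounded_ops H H - ?V" using ab X Y by blast
    qed
    ultimately show "\<exists>T. openin (ultraweak_topology H) T \<and> v \<in> T \<and> T \<subseteq> bounded_ops H H - ?V" by blast
  qed
qed blast

text \<open>The matrix coefficients of the truncated operators converge for each pair of vectors. As truncation does
  not increase norms, they are dominated, along two square summable sequences, by a summable sequence
  that does not depend on the truncation. So the functionals that define the topology converge by Tannery's
  theorem, and convergence for a subbase is enough.\<close>

lemma limitin_truncation:
  assumes v: "v \<in> bounded_ops H H"
  shows "limitin (ultraweak_topology H)
    (\<lambda>F. compose (carrier H) (truncation_op \<X> F) (compose (carrier H) v (truncation_op \<X> F))) v (finite_subsets_at_top \<X>)"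
proof -
  interpret H: inner_product_space H by (rule sum_ips)
  let ?a = "\<lambda>F. compose (carrier H) (truncation_op \<X> F) (compose (carrier H) v (truncation_op \<X> F))"
  let ?L = "finite_subsets_at_top \<X>"
  note vD = bounded_opsD[OF v]
  obtain C where C: "C \<ge> 0" "\<And>x. x \<in> carrier H \<Longrightarrow> hnorm H (v x) \<le> C * hnorm H x"
    using bounded_ops_bound[OF v sum_ips] by blast
  have ab: "?a F \<in> bounded_ops H H" if "finite F" "F \<subseteq> \<X>" for F
    by (rule compose_bounded_ops[OF truncation_op_bounded[OF that]
          compose_bounded_ops[OF v truncation_op_bounded[OF that] sum_ips sum_ips] sum_ips sum_ips])
  have val: "ip H g (?a F f) = ip H (truncation \<X> F g) (v (truncation \<X> F f))"
    if F: "finite F" "F \<subseteq> \<X>" and f: "f \<in> carrier H" and g: "g \<in> carrier H" for F f g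
  proof -
    note tf = hnorm_truncation_le(1)[OF f F]
    note w = vD(1)[OF tf]
    have fc: "g X \<in> carrier X" "v (truncation \<X> F f) X \<in> carrier X" if "X \<in> \<X>" for X
      using component_carrier[OF _ that] g w by auto
    have "ip H g (truncation \<X> F (v (truncation \<X> F f))) = ip H (truncation \<X> F g) (v (truncation \<X> F f))"
      unfolding hilbert_sum_simps
      by (rule infsum_cong) (use fc inner_product_space.ip_zero_left[OF atom_ips]
          inner_product_space.ip_zero_right[OF atom_ips] in \<open>simp add: truncation_def\<close>)
    then show ?thesis using f tf w by (simp add: compose_def truncation_op_def del: hilbert_sum_simps)
  qed
  have bound: "cmod (ip H g (?a F f)) \<le> C * ((hnorm H g)\<^sup>2 + (hnorm H f)\<^sup>2)"
    if F: "finite F" "F \<subseteq> \<X>" and f: "f \<in> carrier H" and g: "g \<in> carrier H" for F f g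
  proof -
    note tf = hnorm_truncation_le[OF f F] and tg = hnorm_truncation_le[OF g F]
    have "cmod (ip H g (?a F f)) \<le> hnorm H (truncation \<X> F g) * hnorm H (v (truncation \<X> F f))"
      unfolding val[OF F f g] by (rule H.Cauchy_Schwarz[OF tg(1) vD(1)[OF tf(1)]])
    also have "\<dots> \<le> hnorm H g * (C * hnorm H f)"
    proof (rule mult_mono[OF tg(2)])
      show "hnorm H (v (truncation \<X> F f)) \<le> C * hnorm H f"
        using C(2)[OF tf(1)] mult_left_mono[OF tf(2) C(1)] by linarith
    qed (use H.hnorm_ge_0 g vD(1)[OF tf(1)] in auto)
    also have "\<dots> = C * (hnorm H g * hnorm H f)" by simp
    also have "\<dots> \<le> C * ((hnorm H g)\<^sup>2 + (hnorm H f)\<^sup>2)"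
    proof (rule mult_left_mono[OF _ C(1)])
      show "hnorm H g * hnorm H f \<le> (hnorm H g)\<^sup>2 + (hnorm H f)\<^sup>2"
        using sum_squares_bound[of "hnorm H g" "hnorm H f"] mult_nonneg_nonneg[OF H.hnorm_ge_0[OF g] H.hnorm_ge_0[OF f]]
        by linarith
    qed
    finally show ?thesis .
  qed
  have lim: "((\<lambda>F. ip H g (?a F f)) \<longlongrightarrow> ip H g (v f)) ?L" if f: "f \<in> carrier H" and g: "g \<in> carrier H" for f g
  proof -
    let ?tl = "\<lambda>F f. truncation \<X> (\<X> - F) f"
    have "((\<lambda>F. hnorm H (?tl F g) * (C * hnorm H f) + hnorm H g * (C * hnorm H (?tl F f))) \<longlongrightarrow>
        0 * (C * hnorm H f) + hnorm H g * (C * 0)) ?L"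
      by (intro tendsto_intros hnorm_tail_tendsto f g)
    then have l0: "((\<lambda>F. hnorm H (?tl F g) * (C * hnorm H f) + hnorm H g * (C * hnorm H (?tl F f))) \<longlongrightarrow> 0) ?L" by simp
    show ?thesis
    proof (rule Lim_transform[OF tendsto_const], rule Lim_null_comparison[OF _ l0], rule eventually_finite_subsets_at_top_weakI)
      fix F assume F: "finite F" "F \<subseteq> \<X>"
      note tf = hnorm_truncation_le[OF f F] and tg = hnorm_truncation_le[OF g F]
      note df = truncation_decomposition(1,2)[OF f F] and dg = truncation_decomposition(1,2)[OF g F]
      have "v f = v (truncation \<X> F f) \<oplus>\<^bsub>H\<^esub> v (?tl F f)" using vD(3)[OF tf(1) df(1)] df(2) by metis
      then have 1: "ip H (truncation \<X> F g) (v f) = ip H (truncation \<X> F g) (v (truncation \<X> F f)) + ip H (truncation \<X> F g) (v (?tl F f))"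
        using H.ip_add_right[OF tg(1) vD(1)[OF tf(1)] vD(1)[OF df(1)]] by simp
      have 2: "ip H g (v f) = ip H (truncation \<X> F g) (v f) + ip H (?tl F g) (v f)"
        using H.ip_add_left[OF vD(1)[OF f] tg(1) dg(1)] dg(2) by metis
      have "norm (ip H g (?a F f) - ip H g (v f)) = norm (ip H (?tl F g) (v f) + ip H (truncation \<X> F g) (v (?tl F f)))"
        unfolding val[OF F f g] 2 1
        by (subst norm_minus_commute) (simp add: algebra_simps del: hilbert_sum_simps)
      also have "\<dots> \<le> norm (ip H (?tl F g) (v f)) + norm (ip H (truncation \<X> F g) (v (?tl F f)))" by (rule norm_triangle_ineq)
      also have "\<dots> \<le> hnorm H (?tl F g) * (C * hnorm H f) + hnorm H g * (C * hnorm H (?tl F f))"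
      proof (rule add_mono)
        show "norm (ip H (?tl F g) (v f)) \<le> hnorm H (?tl F g) * (C * hnorm H f)"
          using H.Cauchy_Schwarz[OF dg(1) vD(1)[OF f]] mult_left_mono[OF C(2)[OF f] H.hnorm_ge_0[OF dg(1)]] by linarith
        have "hnorm H (truncation \<X> F g) * hnorm H (v (?tl F f)) \<le> hnorm H g * (C * hnorm H (?tl F f))"
          by (rule mult_mono[OF tg(2) C(2)[OF df(1)] H.hnorm_ge_0[OF g] H.hnorm_ge_0[OF vD(1)[OF df(1)]]])
        then show "norm (ip H (truncation \<X> F g) (v (?tl F f))) \<le> hnorm H g * (C * hnorm H (?tl F f))"
          using H.Cauchy_Schwarz[OF tg(1) vD(1)[OF df(1)]] by linarith
      qed
      finally show "norm (ip H g (?a F f) - ip H g (v f)) \<le> hnorm H (?tl F g) * (C * hnorm H f) + hnorm H g * (C * hnorm H (?tl F f))" .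
    qed
  qed
  let ?S = "{{a \<in> bounded_ops H H. (\<Sum>n. ip H (\<eta> n) (a (\<xi> n))) \<in> U} | \<xi> \<eta> U.
        square_summable H \<xi> \<and> square_summable H \<eta> \<and> open U}"
  have ev: "v \<in> T \<longrightarrow> eventually (\<lambda>F. ?a F \<in> T) ?L" if "generate_topology_on ?S T" for T
    using that
  proof (induction)
    case (Int a b)
    then show ?case by (auto intro: eventually_conj)
  next
    case (UN K)
    show ?case
    proof
      assume "v \<in> \<Union>K"
      then obtain k where k: "k \<in> K" "v \<in> k" by blast
      then have "eventually (\<lambda>F. ?a F \<in> k) ?L" using UN by blast
      then show "eventually (\<lambda>F. ?a F \<in> \<Union>K) ?L" by (rule eventually_mono) (use k in blast)
    qed
  next
    case (Basis T)
    then obtain \<xi> \<eta> U where T: "T = {a \<in> bounded_ops H H. (\<Sum>n. ip H (\<eta> n) (a (\<xi> n))) \<in> U}"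
      and sq: "square_summable H \<xi>" "square_summable H \<eta>" and U: "open U" by blast
    have c: "\<xi> n \<in> carrier H" "\<eta> n \<in> carrier H" for n using sq by (auto simp: square_summable_def)
    have fin: "eventually (\<lambda>F. finite F \<and> F \<subseteq> \<X>) ?L"
      by (rule eventually_finite_subsets_at_top_weakI) simp
    show ?case
    proof
      assume "v \<in> T"
      have "((\<lambda>F. \<Sum>n. ip H (\<eta> n) (?a F (\<xi> n))) \<longlongrightarrow> (\<Sum>n. ip H (\<eta> n) (v (\<xi> n)))) ?L"
      proof (rule tannerys_theorem[THEN conjunct2, THEN conjunct2])
        show "((\<lambda>F. ip H (\<eta> n) (?a F (\<xi> n))) \<longlongrightarrow> ip H (\<eta> n) (v (\<xi> n))) ?L" for n by (rule lim[OF c])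
        show "summable (\<lambda>n. C * ((hnorm H (\<eta> n))\<^sup>2 + (hnorm H (\<xi> n))\<^sup>2))"
          using sq by (intro summable_mult summable_add) (auto simp: square_summable_def)
        show "eventually (\<lambda>(n, F). norm (ip H (\<eta> n) (?a F (\<xi> n))) \<le> C * ((hnorm H (\<eta> n))\<^sup>2 + (hnorm H (\<xi> n))\<^sup>2)) (at_top \<times>\<^sub>F ?L)"
          unfolding eventually_prod_filter
        proof (intro exI conjI allI impI)
          show "eventually (\<lambda>_. True) at_top" by simp
          show "eventually (\<lambda>F. finite F \<and> F \<subseteq> \<X>) ?L" by (rule fin)
        qed (use bound[OF _ _ c] in auto)
      qed simp
      then have "eventually (\<lambda>F. (\<Sum>n. ip H (\<eta> n) (?a F (\<xi> n))) \<in> U) ?L"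
        by (rule topological_tendstoD) (use U T \<open>v \<in> T\<close> in auto)
      with fin show "eventually (\<lambda>F. ?a F \<in> T) ?L"
        unfolding T by eventually_elim (use ab in blast)
    qed
  qed simp
  show ?thesis
    unfolding limitin_def topspace_ultraweak
    using v ev unfolding ultraweak_topology_def openin_topology_generated_by_iff by blast
qed
section \<open>Quantum graph structures and their compressions\<close>

text \<open>The projections to the atoms belong to the commutant. Hence \<open>p\<^sub>Y v p\<^sub>X\<close>, which depends only on a
  compression of \<open>v\<close>, lies in \<open>V\<close>, and so do the finite sums \<open>p\<^sub>G v p\<^sub>F\<close> of such operators, where \<open>p\<^sub>F\<close> is
  the projection to the atoms in \<open>F\<close>. The operators \<open>p\<^sub>F v p\<^sub>F\<close> converge ultraweakly to \<open>v\<close>.\<close>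

lemma quantum_graph_structure_contains:
  assumes V: "quantum_graph_structure H (ell_infinity \<X>) V" and v: "v \<in> bounded_ops H H"
    and comp: "\<And>X Y. \<lbrakk>X \<in> \<X>; Y \<in> \<X>\<rbrakk> \<Longrightarrow> compression \<X> X Y v \<in> compression \<X> X Y ` V"
  shows "v \<in> V"
proof -
  interpret H: inner_product_space H by (rule sum_ips)
  note VD = quantum_graph_structureD[OF V]
  note VS = op_subspaceD[OF VD(1) sum_ips sum_ips]
  note vD = bounded_opsD[OF v]
  define T where "T = (\<lambda>G F. \<lambda>f\<in>carrier H. truncation \<X> G (v (truncation \<X> F f)))"
  have single: "T {Y} {X} \<in> V" if X: "X \<in> \<X>" and Y: "Y \<in> \<X>" for X Y
  proof -
    obtain v' where v': "v' \<in> V" "compression \<X> X Y v = compression \<X> X Y v'" using comp[OF X Y] by blast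
    note vb' = VS(1)[OF v'(1)]
    have mX: "truncation_op \<X> {X} \<in> commutant H (ell_infinity \<X>)" and mY: "truncation_op \<X> {Y} \<in> commutant H (ell_infinity \<X>)"
      using truncation_op_commutant X Y by auto
    have "T {Y} {X} = compose (carrier H) (truncation_op \<X> {Y}) (compose (carrier H) v' (truncation_op \<X> {X}))"
      unfolding T_def compose_def
    proof (rule restrict_ext)
      fix f assume f: "f \<in> carrier H"
      note fX = component_carrier[OF f X]
      note ix = inc_carrier[OF X fX]
      have "v (inc \<X> X (f X)) Y = v' (inc \<X> X (f X)) Y"
        using v'(2) fX by (metis compression_def restrict_apply')
      then show "truncation \<X> {Y} (v (truncation \<X> {X} f)) =
        truncation_op \<X> {Y} ((\<lambda>f\<in>carrier H. v' (truncation_op \<X> {X} f)) f)"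
        using f truncation_singleton[OF X f] truncation_singleton[OF Y vD(1)[OF ix]]
          truncation_singleton[OF Y bounded_opsD(1)[OF vb' ix]] bounded_opsD(1)[OF vb' ix]
        by (simp add: truncation_op_def)
    qed
    then show ?thesis using VD(5)[OF mY VD(6)[OF mX v'(1)]] by simp
  qed
  have zero: "truncation \<X> {} f = \<zero>\<^bsub>H\<^esub>" for f by (rule truncation_empty)
  have v0: "v \<zero>\<^bsub>H\<^esub> = \<zero>\<^bsub>H\<^esub>" using linear_op_zero[OF _ sum_ips sum_ips] v by (simp add: bounded_ops_iff del: hilbert_sum_simps)
  have tr0: "truncation \<X> G \<zero>\<^bsub>H\<^esub> = \<zero>\<^bsub>H\<^esub>" for G by (auto simp: truncation_def)
  have tr_bd: "truncation \<X> F f \<in> carrier H" if "finite F" "F \<subseteq> \<X>" "f \<in> carrier H" for F f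
    by (rule hnorm_truncation_le(1)[OF that(3,1,2)])
  have left: "T G {X} \<in> V" if G: "finite G" "G \<subseteq> \<X>" and X: "X \<in> \<X>" for G X
    using G
  proof (induction G)
    case empty
    show ?case unfolding T_def zero by (rule VS(2))
  next
    case (insert Y G)
    then have Y: "Y \<in> \<X>" and G: "G \<subseteq> \<X>" by auto
    have eq: "T (insert Y G) {X} = (\<lambda>f\<in>carrier H. T {Y} {X} f \<oplus>\<^bsub>H\<^esub> T G {X} f)"
    proof (rule ext)
      fix f
      show "T (insert Y G) {X} f = (\<lambda>f\<in>carrier H. T {Y} {X} f \<oplus>\<^bsub>H\<^esub> T G {X} f) f"
      proof (cases "f \<in> carrier H")
        case True
        have w: "v (truncation \<X> {X} f) \<in> carrier H" using vD(1) tr_bd[of "{X}" f] X True by simp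
        have "truncation \<X> (insert Y G) (v (truncation \<X> {X} f)) =
            inc \<X> Y (v (truncation \<X> {X} f) Y) \<oplus>\<^bsub>H\<^esub> truncation \<X> G (v (truncation \<X> {X} f))"
          by (rule truncation_insert[OF insert(1) G Y insert(2)]) (use component_carrier[OF w] Y G in blast)
        then show ?thesis
          using truncation_singleton[OF Y w] True by (simp add: T_def del: hilbert_sum_simps)
      qed (simp add: T_def)
    qed
    show ?case unfolding eq by (rule VS(3)[OF single[OF X Y] insert.IH[OF G]])
  qed
  have trunc: "T G F \<in> V" if G: "finite G" "G \<subseteq> \<X>" and F: "finite F" "F \<subseteq> \<X>" for G F
    using F
  proof (induction F)
    case empty
    show ?case unfolding T_def zero v0 tr0 by (rule VS(2))
  next
    case (insert X F)
    then have X: "X \<in> \<X>" and F: "F \<subseteq> \<X>" by auto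
    note tG = bounded_opsD(3)[OF truncation_op_bounded[OF G]]
    have eq: "T G (insert X F) = (\<lambda>f\<in>carrier H. T G {X} f \<oplus>\<^bsub>H\<^esub> T G F f)"
    proof (rule ext)
      fix f
      show "T G (insert X F) f = (\<lambda>f\<in>carrier H. T G {X} f \<oplus>\<^bsub>H\<^esub> T G F f) f"
      proof (cases "f \<in> carrier H")
        case True
        have c: "truncation \<X> {X} f \<in> carrier H" "truncation \<X> F f \<in> carrier H"
          using tr_bd True X F insert(1) by auto
        have "truncation \<X> (insert X F) f = truncation \<X> {X} f \<oplus>\<^bsub>H\<^esub> truncation \<X> F f"
          unfolding truncation_singleton[OF X True]
          by (rule truncation_insert[OF insert(1) F X insert(2)]) (use component_carrier[OF True] X F in blast)
        then have "v (truncation \<X> (insert X F) f) = v (truncation \<X> {X} f) \<oplus>\<^bsub>H\<^esub> v (truncation \<X> F f)"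
          using vD(3)[OF c] by simp
        then have "truncation \<X> G (v (truncation \<X> (insert X F) f)) =
            truncation \<X> G (v (truncation \<X> {X} f)) \<oplus>\<^bsub>H\<^esub> truncation \<X> G (v (truncation \<X> F f))"
          using tG[OF vD(1)[OF c(1)] vD(1)[OF c(2)]] vD(1)[OF c(1)] vD(1)[OF c(2)]
            H.M.a_closed[OF vD(1)[OF c(1)] vD(1)[OF c(2)]]
          by (simp add: truncation_op_def del: hilbert_sum_simps)
        then show ?thesis using True by (simp add: T_def del: hilbert_sum_simps)
      qed (simp add: T_def)
    qed
    show ?case unfolding eq by (rule VS(3)[OF left[OF G X] insert.IH[OF F]])
  qed
  have "compose (carrier H) (truncation_op \<X> F) (compose (carrier H) v (truncation_op \<X> F)) \<in> V"
    if F: "finite F" "F \<subseteq> \<X>" for F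
  proof -
    have "compose (carrier H) (truncation_op \<X> F) (compose (carrier H) v (truncation_op \<X> F)) = T F F"
      unfolding T_def compose_def
      by (rule restrict_ext) (use tr_bd[OF F] vD(1) in \<open>simp add: truncation_op_def\<close>)
    then show ?thesis using trunc[OF F F] by simp
  qed
  then have "eventually (\<lambda>F. compose (carrier H) (truncation_op \<X> F) (compose (carrier H) v (truncation_op \<X> F)) \<in> V)
      (finite_subsets_at_top \<X>)"
    by (rule eventually_finite_subsets_at_top_weakI)
  then show ?thesis
    by (rule limitin_closedin[OF limitin_truncation[OF v] VD(2)]) simp
qed

lemma compression_image_subspace:
  assumes V: "op_subspace H H V" and X: "X \<in> \<X>" and Y: "Y \<in> \<X>"
  shows "op_subspace X Y (compression \<X> X Y ` V)"
proof -
  note VS = op_subspaceD[OF V sum_ips sum_ips]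
  note i = atom_ips[OF X] atom_ips[OF Y]
  have ic: "inc \<X> X x \<in> carrier H" if "x \<in> carrier X" for x by (rule inc_carrier[OF X that])
  show ?thesis
    unfolding op_subspace_iff[OF i]
  proof (intro conjI ballI allI)
    show "compression \<X> X Y ` V \<subseteq> bounded_ops X Y" using compression_eq(2)[OF X Y VS(1)] by blast
    have eq: "compression \<X> X Y (\<lambda>f\<in>carrier H. \<zero>\<^bsub>H\<^esub>) = (\<lambda>x\<in>carrier X. \<zero>\<^bsub>Y\<^esub>)"
      unfolding compression_def by (rule restrict_ext) (use ic Y in simp)
    show "(\<lambda>x\<in>carrier X. \<zero>\<^bsub>Y\<^esub>) \<in> compression \<X> X Y ` V"
      unfolding eq[symmetric] by (rule imageI[OF VS(2)])
  next
    fix a b assume "a \<in> compression \<X> X Y ` V" "b \<in> compression \<X> X Y ` V"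
    then obtain v w where vw: "v \<in> V" "a = compression \<X> X Y v" "w \<in> V" "b = compression \<X> X Y w" by blast
    have eq: "compression \<X> X Y (\<lambda>f\<in>carrier H. v f \<oplus>\<^bsub>H\<^esub> w f) = (\<lambda>x\<in>carrier X. a x \<oplus>\<^bsub>Y\<^esub> b x)"
      unfolding compression_def vw by (rule restrict_ext) (use ic Y in simp)
    show "(\<lambda>x\<in>carrier X. a x \<oplus>\<^bsub>Y\<^esub> b x) \<in> compression \<X> X Y ` V"
      unfolding eq[symmetric] by (rule imageI[OF VS(3)[OF vw(1,3)]])
  next
    fix c a assume "a \<in> compression \<X> X Y ` V"
    then obtain v where v: "v \<in> V" "a = compression \<X> X Y v" by blast
    have eq: "compression \<X> X Y (\<lambda>f\<in>carrier H. c \<odot>\<^bsub>H\<^esub> v f) = (\<lambda>x\<in>carrier X. c \<odot>\<^bsub>Y\<^esub> a x)"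
      unfolding compression_def v by (rule restrict_ext) (use ic Y in simp)
    show "(\<lambda>x\<in>carrier X. c \<odot>\<^bsub>Y\<^esub> a x) \<in> compression \<X> X Y ` V"
      unfolding eq[symmetric] by (rule imageI[OF VS(4)[OF v(1)]])
  qed
qed

text \<open>Multiplication with an element of the commutant multiplies each compression by a scalar, and the adjoint
  of an operator has the adjoint compressions. Closedness is \<open>closedin_compressions\<close>.\<close>

lemma quantum_graph_structure_of_relation:
  assumes R: "R \<in> binary_relations \<X> \<X>" and refl: "\<And>X. X \<in> \<X> \<Longrightarrow> (\<lambda>x\<in>carrier X. x) \<in> R X X"
    and sym: "\<And>X Y r. \<lbrakk>X \<in> \<X>; Y \<in> \<X>; r \<in> R X Y\<rbrakk> \<Longrightarrow> adj X Y r \<in> R Y X"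
  shows "quantum_graph_structure H (ell_infinity \<X>)
    {v \<in> bounded_ops H H. \<forall>X\<in>\<X>. \<forall>Y\<in>\<X>. compression \<X> X Y v \<in> R X Y}" (is "quantum_graph_structure _ _ ?V")
  unfolding quantum_graph_structure_def
proof (intro conjI ballI)
  interpret H: inner_product_space H by (rule sum_ips)
  have RD: "op_subspace X Y (R X Y)" if "X \<in> \<X>" "Y \<in> \<X>" for X Y by (rule binary_relationsD[OF R that])
  note RS = op_subspaceD[OF RD atom_ips atom_ips]
  have ic: "inc \<X> X x \<in> carrier H" if "X \<in> \<X>" "x \<in> carrier X" for X x by (rule inc_carrier[OF that])
  note BD = op_subspaceD[OF op_subspace_bounded_ops[OF sum_ips sum_ips] sum_ips sum_ips]
  show "op_subspace H H ?V"
    unfolding op_subspace_iff[OF sum_ips sum_ips]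
  proof (intro conjI ballI allI)
    have "compression \<X> X Y (\<lambda>f\<in>carrier H. \<zero>\<^bsub>H\<^esub>) = (\<lambda>x\<in>carrier X. \<zero>\<^bsub>Y\<^esub>)" if "X \<in> \<X>" "Y \<in> \<X>" for X Y
      unfolding compression_def by (rule restrict_ext) (use ic that in simp)
    then show "(\<lambda>f\<in>carrier H. \<zero>\<^bsub>H\<^esub>) \<in> ?V" using BD(2) RS(2) by (auto simp del: hilbert_sum_simps)
  next
    fix v w assume vw: "v \<in> ?V" "w \<in> ?V"
    have "compression \<X> X Y (\<lambda>f\<in>carrier H. v f \<oplus>\<^bsub>H\<^esub> w f) =
        (\<lambda>x\<in>carrier X. compression \<X> X Y v x \<oplus>\<^bsub>Y\<^esub> compression \<X> X Y w x)" if "X \<in> \<X>" "Y \<in> \<X>" for X Y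
      unfolding compression_def by (rule restrict_ext) (use ic that in simp)
    then show "(\<lambda>f\<in>carrier H. v f \<oplus>\<^bsub>H\<^esub> w f) \<in> ?V"
      using BD(3)[of v w] RS(3) vw by (auto simp del: hilbert_sum_simps)
  next
    fix c v assume v: "v \<in> ?V"
    have "compression \<X> X Y (\<lambda>f\<in>carrier H. c \<odot>\<^bsub>H\<^esub> v f) = (\<lambda>x\<in>carrier X. c \<odot>\<^bsub>Y\<^esub> compression \<X> X Y v x)"
      if "X \<in> \<X>" "Y \<in> \<X>" for X Y
      unfolding compression_def by (rule restrict_ext) (use ic that in simp)
    then show "(\<lambda>f\<in>carrier H. c \<odot>\<^bsub>H\<^esub> v f) \<in> ?V"
      using BD(4)[of v c] RS(4) v by (auto simp del: hilbert_sum_simps)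
  qed blast
  show "closedin (ultraweak_topology H) ?V" by (rule closedin_compressions[OF R])
  show "(\<lambda>f\<in>carrier H. f) \<in> ?V"
  proof (intro CollectI conjI ballI id_bounded_ops[OF sum_ips])
    fix X Y assume XY: "X \<in> \<X>" "Y \<in> \<X>"
    have "compression \<X> X Y (\<lambda>f\<in>carrier H. f) = (if Y = X then (\<lambda>x\<in>carrier X. x) else (\<lambda>x\<in>carrier X. \<zero>\<^bsub>Y\<^esub>))"
      using ic[OF XY(1)] XY by (auto simp: compression_def inc_component intro!: restrict_ext)
    then show "compression \<X> X Y (\<lambda>f\<in>carrier H. f) \<in> R X Y" using refl XY RS(2)[OF XY XY] by auto
  qed
  have adjV: "adj H H v \<in> ?V" if v: "v \<in> ?V" for v
  proof (intro CollectI conjI ballI)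
    have vb: "v \<in> bounded_ops H H" using v by blast
    show "adj H H v \<in> bounded_ops H H" by (rule adj_hilbert_sum(1)[OF vb])
    fix X Y assume XY: "X \<in> \<X>" "Y \<in> \<X>"
    have "adj Y X (compression \<X> Y X v) \<in> R X Y" using sym[OF XY(2,1)] v XY by blast
    then show "compression \<X> X Y (adj H H v) \<in> R X Y" using adj_compression[OF XY(2,1) vb] by simp
  qed
  show "adj H H ` ?V = ?V"
  proof (intro equalityI subsetI)
    fix v assume v: "v \<in> ?V"
    then have "v = adj H H (adj H H v)" using adj_adj_hilbert_sum[of v] by simp
    then show "v \<in> adj H H ` ?V" using adjV[OF v] by (rule image_eqI)
  qed (use adjV in blast)
next
  have RD: "op_subspace X Y (R X Y)" if "X \<in> \<X>" "Y \<in> \<X>" for X Y by (rule binary_relationsD[OF R that])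
  note RS = op_subspaceD[OF RD atom_ips atom_ips]
  fix m v assume m: "m \<in> commutant H (ell_infinity \<X>)" and v: "v \<in> ?V"
  have mb: "m \<in> bounded_ops H H" and vb: "v \<in> bounded_ops H H" using m v by (auto simp: commutant_def)
  have ic: "inc \<X> X x \<in> carrier H" if "X \<in> \<X>" "x \<in> carrier X" for X x by (rule inc_carrier[OF that])
  show "compose (carrier H) m v \<in> ?V"
  proof (intro CollectI conjI ballI compose_bounded_ops[OF mb vb sum_ips sum_ips])
    fix X Y assume XY: "X \<in> \<X>" "Y \<in> \<X>"
    obtain c where c: "\<forall>f\<in>carrier H. m f Y = c \<odot>\<^bsub>Y\<^esub> f Y"
      using commutant_scalar[OF m XY(2)] by blast
    have "compression \<X> X Y (compose (carrier H) m v) = (\<lambda>x\<in>carrier X. c \<odot>\<^bsub>Y\<^esub> compression \<X> X Y v x)"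
      unfolding compression_def
      by (rule restrict_ext) (use ic[OF XY(1)] c bounded_opsD(1)[OF vb] in \<open>simp add: compose_def\<close>)
    then show "compression \<X> X Y (compose (carrier H) m v) \<in> R X Y" using RS(4)[OF XY XY] v XY by auto
  qed
  show "compose (carrier H) v m \<in> ?V"
  proof (intro CollectI conjI ballI compose_bounded_ops[OF vb mb sum_ips sum_ips])
    fix X Y assume XY: "X \<in> \<X>" "Y \<in> \<X>"
    obtain c where c: "\<forall>x\<in>carrier X. m (inc \<X> X x) = inc \<X> X (c \<odot>\<^bsub>X\<^esub> x)"
      using commutant_scalar[OF m XY(1)] by blast
    have "compression \<X> X Y (compose (carrier H) v m) = (\<lambda>x\<in>carrier X. c \<odot>\<^bsub>Y\<^esub> compression \<X> X Y v x)"
      unfolding compression_def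
    proof (rule restrict_ext)
      fix x assume x: "x \<in> carrier X"
      have "inc \<X> X (c \<odot>\<^bsub>X\<^esub> x) = c \<odot>\<^bsub>H\<^esub> inc \<X> X x"
        by (rule bounded_opsD(4)[OF inc_bounded[OF XY(1)] x])
      then have "v (m (inc \<X> X x)) = c \<odot>\<^bsub>H\<^esub> v (inc \<X> X x)"
        using c x bounded_opsD(4)[OF vb ic[OF XY(1) x]] by simp
      then show "compose (carrier H) v m (inc \<X> X x) Y = c \<odot>\<^bsub>Y\<^esub> (\<lambda>x\<in>carrier X. v (inc \<X> X x) Y) x"
        using ic[OF XY(1) x] x XY(2) by (simp add: compose_def)
    qed
    then show "compression \<X> X Y (compose (carrier H) v m) \<in> R X Y" using RS(4)[OF XY XY] v XY by auto
  qed
qed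

end

theorem theorem4p1p5:
  fixes \<X> :: "'v hilb set"
  assumes "quantum_set \<X>"
  shows "bij_betw
    (\<lambda>V. \<lambda>X1\<in>\<X>. \<lambda>X2\<in>\<X>.
      {compose (carrier X1) (adj X2 (hilbert_sum \<X>) (inc \<X> X2))
         (compose (carrier X1) v (inc \<X> X1)) | v. v \<in> V})
    {V. quantum_graph_structure (hilbert_sum \<X>) (ell_infinity \<X>) V}
    {R \<in> binary_relations \<X> \<X>.
      interp (Forall_eq \<X> 1 2 (Atom (rel_hat \<X> \<X> R) [(\<X>, 1), (qdual \<X>, 2)])) [] = rel_top [] \<and>
      interp (Forall_eq \<X> 1 2 (Forall_eq \<X> 3 4
        (Imp (Atom (rel_hat \<X> \<X> R) [(\<X>, 1), (qdual \<X>, 4)])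
             (Atom (rel_hat \<X> \<X> R) [(\<X>, 3), (qdual \<X>, 2)])))) [] = rel_top []}"
    (is "bij_betw ?\<Phi> ?QGS ?Rel")
proof -
  note \<X> = assms
  let ?H = "hilbert_sum \<X>"
  note Hi = inner_product_hilbert_sum[OF \<X>]
  define \<Psi> where "\<Psi> = (\<lambda>R. {v \<in> bounded_ops ?H ?H. \<forall>X\<in>\<X>. \<forall>Y\<in>\<X>. compression \<X> X Y v \<in> R X Y})"
  have Rel: "R \<in> ?Rel \<longleftrightarrow> R \<in> binary_relations \<X> \<X> \<and> (\<forall>X\<in>\<X>. (\<lambda>x\<in>carrier X. x) \<in> R X X) \<and>
      (\<forall>X\<in>\<X>. \<forall>Y\<in>\<X>. \<forall>r\<in>R X Y. adj X Y r \<in> R Y X)" for R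
    using interp_reflexive[OF \<X>, of R 1 2] interp_symmetric[OF \<X>, of R] by auto
  have \<Phi>: "?\<Phi> V = (\<lambda>X\<in>\<X>. \<lambda>Y\<in>\<X>. compression \<X> X Y ` V)" if V: "V \<in> ?QGS" for V
  proof (intro restrict_ext)
    fix X Y assume XY: "X \<in> \<X>" "Y \<in> \<X>"
    have "v \<in> bounded_ops ?H ?H" if "v \<in> V" for v
      using V op_subspaceD(1)[OF quantum_graph_structureD(1) Hi Hi] that by blast
    then have "(\<lambda>v. compose (carrier X) (adj Y ?H (inc \<X> Y)) (compose (carrier X) v (inc \<X> X))) ` V = compression \<X> X Y ` V"
      by (intro image_cong compression_eq(1)[OF \<X> XY]) auto
    then show "{compose (carrier X) (adj Y ?H (inc \<X> Y)) (compose (carrier X) v (inc \<X> X)) | v. v \<in> V} = compression \<X> X Y ` V"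
      by blast
  qed
  show ?thesis
  proof (rule bij_betw_byWitness[where f' = \<Psi>])
    show "\<forall>V\<in>?QGS. \<Psi> (?\<Phi> V) = V"
    proof
      fix V assume V: "V \<in> ?QGS"
      then have V': "quantum_graph_structure ?H (ell_infinity \<X>) V" by simp
      note VS = op_subspaceD[OF quantum_graph_structureD(1)[OF V'] Hi Hi]
      have "v \<in> V" if "v \<in> \<Psi> (\<lambda>X\<in>\<X>. \<lambda>Y\<in>\<X>. compression \<X> X Y ` V)" for v
        by (rule quantum_graph_structure_contains[OF \<X> V']) (use that in \<open>auto simp: \<Psi>_def\<close>)
      moreover have "v \<in> \<Psi> (\<lambda>X\<in>\<X>. \<lambda>Y\<in>\<X>. compression \<X> X Y ` V)" if "v \<in> V" for v
        using that VS(1) by (simp add: \<Psi>_def)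
      ultimately show "\<Psi> (?\<Phi> V) = V" unfolding \<Phi>[OF V] by blast
    qed
    show "\<forall>R\<in>?Rel. ?\<Phi> (\<Psi> R) = R"
    proof
      fix R assume R: "R \<in> ?Rel"
      then have Rb: "R \<in> binary_relations \<X> \<X>" using Rel by blast
      have Q: "\<Psi> R \<in> ?QGS" unfolding \<Psi>_def using quantum_graph_structure_of_relation[OF \<X> Rb] R Rel by blast
      have *: "compression \<X> X Y ` \<Psi> R = R X Y" if XY: "X \<in> \<X>" "Y \<in> \<X>" for X Y
      proof
        show "compression \<X> X Y ` \<Psi> R \<subseteq> R X Y" using XY by (auto simp: \<Psi>_def)
        show "R X Y \<subseteq> compression \<X> X Y ` \<Psi> R"
        proof
          fix r assume r: "r \<in> R X Y"
          note RS = op_subspaceD[OF binary_relationsD[OF Rb] atom_ips[OF \<X>] atom_ips[OF \<X>]]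
          have rb: "r \<in> bounded_ops X Y" by (rule RS(1)[OF XY XY r])
          note cb = compression_block_op[OF \<X> XY rb]
          have "block_op \<X> X Y r \<in> \<Psi> R"
            unfolding \<Psi>_def using block_op_bounded[OF \<X> XY rb] cb r RS(2) by auto
          moreover have "r = compression \<X> X Y (block_op \<X> X Y r)" using cb[OF XY] by simp
          ultimately show "r \<in> compression \<X> X Y ` \<Psi> R" by blast
        qed
      qed
      have Re: "R \<in> extensional \<X>" "\<And>X. X \<in> \<X> \<Longrightarrow> R X \<in> extensional \<X>"
        using Rb by (auto simp: binary_relations_def PiE_def Pi_def)
      show "?\<Phi> (\<Psi> R) = R"
        unfolding \<Phi>[OF Q]
      proof (rule extensionalityI[of _ \<X>])
        fix X assume X: "X \<in> \<X>"
        have "(\<lambda>Y\<in>\<X>. compression \<X> X Y ` \<Psi> R) = R X"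
          by (rule extensionalityI[of _ \<X>]) (use * X Re(2)[OF X] in auto)
        then show "(\<lambda>X\<in>\<X>. \<lambda>Y\<in>\<X>. compression \<X> X Y ` \<Psi> R) X = R X" using X by simp
      qed (use Re in auto)
    qed
    show "?\<Phi> ` ?QGS \<subseteq> ?Rel"
    proof
      fix R assume "R \<in> ?\<Phi> ` ?QGS"
      then obtain V where V: "V \<in> ?QGS" and R: "R = ?\<Phi> V" by blast
      then have V': "quantum_graph_structure ?H (ell_infinity \<X>) V" by simp
      note VD = quantum_graph_structureD[OF V']
      note VS = op_subspaceD[OF VD(1) Hi Hi]
      have RXY: "R X Y = compression \<X> X Y ` V" if "X \<in> \<X>" "Y \<in> \<X>" for X Y unfolding R \<Phi>[OF V] using that by simp
      have "R \<in> binary_relations \<X> \<X>"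
        unfolding R \<Phi>[OF V] binary_relations_def using compression_image_subspace[OF \<X> VD(1)] by auto
      moreover have "(\<lambda>x\<in>carrier X. x) \<in> R X X" if X: "X \<in> \<X>" for X
      proof -
        have "compression \<X> X X (\<lambda>f\<in>carrier ?H. f) = (\<lambda>x\<in>carrier X. x)"
          using inc_carrier[OF \<X> X] X by (auto simp: compression_def inc_component[OF \<X>] intro!: restrict_ext)
        then show ?thesis unfolding RXY[OF X X] using VD(3) by (metis imageI)
      qed
      moreover have "adj X Y r \<in> R Y X" if XY: "X \<in> \<X>" "Y \<in> \<X>" and r: "r \<in> R X Y" for X Y r
      proof -
        obtain v where v: "v \<in> V" "r = compression \<X> X Y v" using r unfolding RXY[OF XY] by blast
        show ?thesis
          unfolding RXY[OF XY(2,1)] v(2) adj_compression[OF \<X> XY VS(1)[OF v(1)]] using VD(4)[OF v(1)] by blast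
      qed
      ultimately show "R \<in> ?Rel" unfolding Rel by blast
    qed
    show "\<Psi> ` ?Rel \<subseteq> ?QGS"
    proof
      fix V assume "V \<in> \<Psi> ` ?Rel"
      then obtain R where R: "R \<in> ?Rel" "V = \<Psi> R" by blast
      then show "V \<in> ?QGS"
        unfolding \<Psi>_def using quantum_graph_structure_of_relation[OF \<X>, of R] Rel[of R] by auto
    qed
  qed
qed

end
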